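(* Let $\mu$ be the uniform law on $[-1,1]$ and $\nu$ the uniform law on $[-2,2]$. For $k>0$, the set $\mathcal M_k(\mu,\nu)$ is nonempty if and only if $k\ge 1$. For every $k\ge1$ there is a coupling $\pi_k\in\mathcal M_k(\mu,\nu)$ of two-graph form $$\pi_k(\mathrm dx,\mathrm dy)=\mu(\mathrm dx)\big[(1-q(x))\delta_{D(x)}(\mathrm dy)+q(x)\delta_{U(x)}(\mathrm dy)\big]$$ such that $$V_k(h)=\int h(y-x)\,\pi_k(\mathrm dx,\mathrm dy)\quad\text{for every } h\in C^1([-3,3]) \text{ with convex derivative.}$$ At $k=1$ it is given by $D(x)=x-1$, $U(x)=x+1$, $q(x)=\tfrac12$, and $V_1(h)=\tfrac12[h(-1)+h(1)]$ for all such $h$. For $k>1$ it is given as follows (all objects are defined in the context). (i) For $1<k<2$, $D$ and $U$ are the maps of Construction I, and the scalar equations there each have a unique admissible solution: $z(\delta_b)=b$ has a unique solution $\delta_b\in(0,1)$; $T(\delta_0)=0$ has a unique solution $\delta_0\in(\delta_b,1)$; and for each $x\in(-1,x_0]$ the pair of equations $R-L=2(x+1)$, $A(R)-A(L)=x^2-1$ has a unique solution $(L,R)$ with $\delta_b\le L<R\le1$. (ii) For $2\le k<3$, $D$ and $U$ are the maps of Construction II; in particular they agree with the ordinary left-curtain maps $D_{\mathrm{lc}},U_{\mathrm{lc}}$ on $[-1,2k-5]$. (iii) For $k\ge3$, $\pi_k$ is the ordinary left-curtain coupling, given by $D=D_{\mathrm{lc}}$, $U=U_{\mathrm{lc}}$,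 $q=\tfrac34$. For $1<k<3$, with $b=k-2$, the lower map $D$ is decreasing on $[-1,b]$ and satisfies $D(x)=x-k$ on $[b,1]$, and the upper map $U$ is increasing on $[-1,1]$.
   Context: Problem. For $k>0$ let $\Gamma_k=\{(x,y)\in\mathbb R^2: y\ge x-k\}$. $\mathcal M_k(\mu,\nu)$ is the set of Borel probability measures $\pi$ on $\mathbb R^2$ with first marginal $\mu$, second marginal $\nu$, $\pi(\Gamma_k)=1$, and, for a disintegration $\pi(\mathrm dx,\mathrm dy)=\mu(\mathrm dx)\pi_x(\mathrm dy)$, $\int y\,\pi_x(\mathrm dy)=x$ for $\mu$-a.e. $x$. For $h\in C^1([-3,3])$, $V_k(h)=\inf_{\pi\in\mathcal M_k(\mu,\nu)}\int h(y-x)\,\pi(\mathrm dx,\mathrm dy)$, with $V_k(h)=+\infty$ if $\mathcal M_k(\mu,\nu)=\varnothing$. Ordinary left-curtain maps: $D_{\mathrm{lc}}(x)=-\frac x2-\frac32$, $U_{\mathrm{lc}}(x)=\frac{3x}2+\frac12$. For $1<k<3$ put $b=k-2$, and use the weights $q(x)=\frac{x-D(x)}{U(x)-D(x)}$ for $x>-1$, $q(-1)=\frac12$. Construction I ($1<k<2$). For $0\le\delta\le1$ let $z(\delta)=2-\delta+2k\log\frac{k-1}{k-\delta}$, $y(\delta)=z(\delta)-k$, $A(\delta)=(2-k)\delta-\frac{\delta^2}2+2k\big[\delta\log(k-1)+(k-\delta)\log(k-\delta)-(k-\delta)\big]$, $T(\delta)=A(1)-A(\delta)-\big(\frac{(1+\delta)^2}4-1\big)$,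 $\mathcal W(\delta)=b^2-2b(\delta-1)+2k\big[(k-\delta)\log\frac{k-\delta}{k-1}+\delta-1\big]$. The function $z$ is strictly increasing with $z(1)=1$. Let $\delta_b\in(0,1)$ solve $z(\delta_b)=b$, let $\delta_0\in(\delta_b,1)$ solve $T(\delta_0)=0$, and put $x_0=-\frac{1+\delta_0}2$. Then: - $D(-1)=U(-1)=-1$; for $-1<x\le x_0$, $D(x)=y(L(x))$ and $U(x)=y(R(x))$, where $(L,R)=(L(x),R(x))$ solves $R-L=2(x+1)$, $A(R)-A(L)=x^2-1$, $\delta_b\le L<R\le 1$; - for $x_0\le x\le b$, $D,U$ are given parametrically by $x=b-\delta+W(\delta)$, $D=z(\delta)-k$, $U=b-\delta+2W(\delta)$, $\delta\in[\delta_b,\delta_0]$, $W=\sqrt{\mathcal W}$ (here $\mathcal W>0$ on $[\delta_b,\delta_0]$ and $\delta\mapsto x$ is a decreasing bijection onto $[x_0,b]$); - for $b\le x\le1$: $x=z(\delta)$, $D=x-k$, $U=x+\delta$, $\delta\in[\delta_b,1]$. Construction II ($2\le k<3$). Put $a=2k-5$, $E(\eta)=(k-1)\exp\big(\frac{2-\eta}{2k}\big)$, $\rho(\eta)=E(\eta)+\eta-k$, let $\eta_b$ be the unique solution in $(b,2)$ of $\rho(\eta_b)=b$, and $R(\eta)=\sqrt{k^2-(\eta+2)E(\eta)}$ on $[\eta_b,2]$. Then: - for $-1\le x\le a$: $D=D_{\mathrm{lc}}$, $U=U_{\mathrm{lc}}$; - for $a\le x\le b$: parametrically $x=E(\eta)-2+R(\eta)$,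 $D=E(\eta)+\eta-2k$, $U=E(\eta)-2+2R(\eta)$, $\eta\in[\eta_b,2]$ (the map $\eta\mapsto x$ is a decreasing bijection of $[\eta_b,2]$ onto $[a,b]$); - for $b\le x\le1$: parametrically $x=\rho(\eta)$, $U=\eta$, $D=x-k$, $\eta\in[\eta_b,2]$ ($\rho$ is an increasing bijection of $[\eta_b,2]$ onto $[b,1]$). *)

theory Defs
  imports "HOL-Probability.Probability"
begin

section \<open>The transport problem\<close>

definition mu :: "real measure" where
  "mu = uniform_measure lborel {-1..1}"

definition nu :: "real measure" where
  "nu = uniform_measure lborel {-2..2}"

definition Gamma :: "real \<Rightarrow> (real \<times> real) set" where
  "Gamma k = {(x, y). y \<ge> x - k}"

text \<open>\<open>disintegration \<pi> \<kappa>\<close> says that \<open>\<pi>(dx,dy) = mu(dx) \<kappa>\<^sub>x(dy)\<close> for a probability kernel \<open>\<kappa>\<close>.\<close>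

definition disintegration :: "(real \<times> real) measure \<Rightarrow> (real \<Rightarrow> real measure) \<Rightarrow> bool" where
  "disintegration \<pi> \<kappa> \<longleftrightarrow>
     \<kappa> \<in> borel \<rightarrow>\<^sub>M prob_algebra borel \<and>
     (\<forall>S\<in>sets borel. emeasure \<pi> S = (\<integral>\<^sup>+x. emeasure (\<kappa> x) {y. (x, y) \<in> S} \<partial>mu))"

text \<open>Disintegrations exist and are \<open>mu\<close>-a.e. unique, so asking for the barycentre condition along
  some disintegration is the same as asking for it along every one.\<close>

definition couplings :: "real \<Rightarrow> (real \<times> real) measure set" where
  "couplings k = {\<pi>. sets \<pi> = sets borel \<and> prob_space \<pi> \<and>
     distr \<pi> borel fst = mu \<and> distr \<pi> borel snd = nu \<and>
     emeasure \<pi> (Gamma k) = 1 \<and>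
     (\<exists>\<kappa>. disintegration \<pi> \<kappa> \<and> (AE x in mu. has_bochner_integral (\<kappa> x) (\<lambda>y. y) x))}"

text \<open>The cost function \<open>h\<close> is only given on \<open>[-3,3]\<close>; its values elsewhere are junk (and \<open>h\<close> need not
  be measurable there), hence the set integral. Every member of \<open>couplings k\<close> has marginals
  \<open>mu\<close> and \<open>nu\<close>, so it is carried by \<open>{(x, y). y - x \<in> {-3..3}}\<close> and nothing is cut off.\<close>

definition cost :: "(real \<Rightarrow> real) \<Rightarrow> (real \<times> real) measure \<Rightarrow> real" where
  "cost h \<pi> = (LINT p:{p. snd p - fst p \<in> {-3..3}}|\<pi>. h (snd p - fst p))"

text \<open>The infimum over the empty set is \<open>\<infinity>\<close> in \<^typ>\<open>ereal\<close>.\<close>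

definition V :: "real \<Rightarrow> (real \<Rightarrow> real) \<Rightarrow> ereal" where
  "V k h = (INF \<pi>\<in>couplings k. ereal (cost h \<pi>))"

definition C1_convex_derivative :: "(real \<Rightarrow> real) \<Rightarrow> bool" where
  "C1_convex_derivative h \<longleftrightarrow>
     (\<exists>h'. (\<forall>t\<in>{-3..3}. (h has_real_derivative h' t) (at t within {-3..3})) \<and>
           continuous_on {-3..3} h' \<and> convex_on {-3..3} h')"

text \<open>\<open>\<pi>(dx,dy) = mu(dx) [(1 - q(x)) \<delta>\<^bsub>D(x)\<^esub>(dy) + q(x) \<delta>\<^bsub>U(x)\<^esub>(dy)]\<close>. Only the restrictions of
  \<open>D\<close>, \<open>U\<close>, \<open>q\<close> to \<open>[-1,1]\<close> matter.\<close>

definition two_graph ::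
  "(real \<Rightarrow> real) \<Rightarrow> (real \<Rightarrow> real) \<Rightarrow> (real \<Rightarrow> real) \<Rightarrow> (real \<times> real) measure \<Rightarrow> bool" where
  "two_graph D U q \<pi> \<longleftrightarrow>
     D \<in> borel_measurable borel \<and> U \<in> borel_measurable borel \<and> q \<in> borel_measurable borel \<and>
     (\<forall>x\<in>{-1..1}. 0 \<le> q x \<and> q x \<le> 1) \<and>
     sets \<pi> = sets borel \<and>
     (\<forall>S\<in>sets borel. emeasure \<pi> S =
        (\<integral>\<^sup>+x. ennreal (1 - q x) * indicator S (x, D x) + ennreal (q x) * indicator S (x, U x) \<partial>mu))"

definition curtain_weights :: "(real \<Rightarrow> real) \<Rightarrow> (real \<Rightarrow> real) \<Rightarrow> (real \<Rightarrow> real) \<Rightarrow> bool" where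
  "curtain_weights D U q \<longleftrightarrow>
     (\<forall>x\<in>{-1<..1}. q x = (x - D x) / (U x - D x)) \<and> q (-1) = 1/2"

definition D_lc :: "real \<Rightarrow> real" where "D_lc x = - x/2 - 3/2"
definition U_lc :: "real \<Rightarrow> real" where "U_lc x = 3*x/2 + 1/2"

definition increasing_bijection :: "(real \<Rightarrow> real) \<Rightarrow> real set \<Rightarrow> real set \<Rightarrow> bool" where
  "increasing_bijection f P X \<longleftrightarrow> strict_mono_on P f \<and> bij_betw f P X"

definition decreasing_bijection :: "(real \<Rightarrow> real) \<Rightarrow> real set \<Rightarrow> real set \<Rightarrow> bool" where
  "decreasing_bijection f P X \<longleftrightarrow> monotone_on P (<) (>) f \<and> bij_betw f P X"

section \<open>Construction I (\<open>1 < k < 2\<close>)\<close>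

definition z1 :: "real \<Rightarrow> real \<Rightarrow> real" where
  "z1 k \<delta> = 2 - \<delta> + 2*k * ln ((k - 1) / (k - \<delta>))"

definition y1 :: "real \<Rightarrow> real \<Rightarrow> real" where
  "y1 k \<delta> = z1 k \<delta> - k"

definition A1 :: "real \<Rightarrow> real \<Rightarrow> real" where
  "A1 k \<delta> = (2 - k)*\<delta> - \<delta>\<^sup>2/2 + 2*k * (\<delta> * ln (k - 1) + (k - \<delta>) * ln (k - \<delta>) - (k - \<delta>))"

definition T1 :: "real \<Rightarrow> real \<Rightarrow> real" where
  "T1 k \<delta> = A1 k 1 - A1 k \<delta> - ((1 + \<delta>)\<^sup>2/4 - 1)"

definition WW1 :: "real \<Rightarrow> real \<Rightarrow> real" where
  "WW1 k \<delta> = (let b = k - 2 in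
     b\<^sup>2 - 2*b*(\<delta> - 1) + 2*k * ((k - \<delta>) * ln ((k - \<delta>) / (k - 1)) + \<delta> - 1))"

definition W1 :: "real \<Rightarrow> real \<Rightarrow> real" where
  "W1 k \<delta> = sqrt (WW1 k \<delta>)"

definition is_delta_b :: "real \<Rightarrow> real \<Rightarrow> bool" where
  "is_delta_b k \<delta> \<longleftrightarrow> \<delta> \<in> {0<..<1} \<and> z1 k \<delta> = k - 2"

definition delta_b :: "real \<Rightarrow> real" where
  "delta_b k = (THE \<delta>. is_delta_b k \<delta>)"

definition is_delta_0 :: "real \<Rightarrow> real \<Rightarrow> bool" where
  "is_delta_0 k \<delta> \<longleftrightarrow> \<delta> \<in> {delta_b k<..<1} \<and> T1 k \<delta> = 0"

definition delta_0 :: "real \<Rightarrow> real" where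
  "delta_0 k = (THE \<delta>. is_delta_0 k \<delta>)"

definition x_0 :: "real \<Rightarrow> real" where
  "x_0 k = - (1 + delta_0 k) / 2"

definition is_LR :: "real \<Rightarrow> real \<Rightarrow> real \<Rightarrow> real \<Rightarrow> bool" where
  "is_LR k x L R \<longleftrightarrow> R - L = 2*(x + 1) \<and> A1 k R - A1 k L = x\<^sup>2 - 1 \<and>
     delta_b k \<le> L \<and> L < R \<and> R \<le> 1"

definition xpar1 :: "real \<Rightarrow> real \<Rightarrow> real" where
  "xpar1 k \<delta> = (k - 2) - \<delta> + W1 k \<delta>"

text \<open>The side facts, besides unique solvability of the scalar equations, that make the defining
  formulas meaningful: positivity under the root and bijectivity of the parametrisations.\<close>

definition well_posed_I :: "real \<Rightarrow> bool" where
  "well_posed_I k \<longleftrightarrow>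
     strict_mono_on {0..1} (z1 k) \<and> z1 k 1 = 1 \<and>
     (\<forall>\<delta>\<in>{delta_b k..delta_0 k}. WW1 k \<delta> > 0) \<and>
     decreasing_bijection (xpar1 k) {delta_b k..delta_0 k} {x_0 k..k - 2} \<and>
     increasing_bijection (z1 k) {delta_b k..1} {k - 2..1}"

definition construction_I :: "real \<Rightarrow> (real \<Rightarrow> real) \<Rightarrow> (real \<Rightarrow> real) \<Rightarrow> bool" where
  "construction_I k D U \<longleftrightarrow>
     D (-1) = -1 \<and> U (-1) = -1 \<and>
     (\<forall>x\<in>{-1<..x_0 k}. \<forall>L R. is_LR k x L R \<longrightarrow> D x = y1 k L \<and> U x = y1 k R) \<and>
     (\<forall>\<delta>\<in>{delta_b k..delta_0 k}.
        D (xpar1 k \<delta>) = z1 k \<delta> - k \<and> U (xpar1 k \<delta>) = (k - 2) - \<delta> + 2 * W1 k \<delta>) \<and>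
     (\<forall>\<delta>\<in>{delta_b k..1}.
        D (z1 k \<delta>) = z1 k \<delta> - k \<and> U (z1 k \<delta>) = z1 k \<delta> + \<delta>)"

section \<open>Construction II (\<open>2 \<le> k < 3\<close>)\<close>

definition E2 :: "real \<Rightarrow> real \<Rightarrow> real" where
  "E2 k \<eta> = (k - 1) * exp ((2 - \<eta>) / (2*k))"

definition rho2 :: "real \<Rightarrow> real \<Rightarrow> real" where
  "rho2 k \<eta> = E2 k \<eta> + \<eta> - k"

definition is_eta_b :: "real \<Rightarrow> real \<Rightarrow> bool" where
  "is_eta_b k \<eta> \<longleftrightarrow> \<eta> \<in> {k - 2<..<2} \<and> rho2 k \<eta> = k - 2"

definition eta_b :: "real \<Rightarrow> real" where
  "eta_b k = (THE \<eta>. is_eta_b k \<eta>)"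

definition R2 :: "real \<Rightarrow> real \<Rightarrow> real" where
  "R2 k \<eta> = sqrt (k\<^sup>2 - (\<eta> + 2) * E2 k \<eta>)"

definition xpar2 :: "real \<Rightarrow> real \<Rightarrow> real" where
  "xpar2 k \<eta> = E2 k \<eta> - 2 + R2 k \<eta>"

definition well_posed_II :: "real \<Rightarrow> bool" where
  "well_posed_II k \<longleftrightarrow>
     (\<exists>!\<eta>. is_eta_b k \<eta>) \<and>
     (\<forall>\<eta>\<in>{eta_b k..2}. k\<^sup>2 - (\<eta> + 2) * E2 k \<eta> \<ge> 0) \<and>
     decreasing_bijection (xpar2 k) {eta_b k..2} {2*k - 5..k - 2} \<and>
     increasing_bijection (rho2 k) {eta_b k..2} {k - 2..1}"

definition construction_II :: "real \<Rightarrow> (real \<Rightarrow> real) \<Rightarrow> (real \<Rightarrow> real) \<Rightarrow> bool" where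
  "construction_II k D U \<longleftrightarrow>
     (\<forall>x\<in>{-1..2*k - 5}. D x = D_lc x \<and> U x = U_lc x) \<and>
     (\<forall>\<eta>\<in>{eta_b k..2}.
        D (xpar2 k \<eta>) = E2 k \<eta> + \<eta> - 2*k \<and> U (xpar2 k \<eta>) = E2 k \<eta> - 2 + 2 * R2 k \<eta>) \<and>
     (\<forall>\<eta>\<in>{eta_b k..2}.
        D (rho2 k \<eta>) = rho2 k \<eta> - k \<and> U (rho2 k \<eta>) = \<eta>)"

end

theory Submission
  imports Defs
begin

text \<open>
Costs whose derivative is convex are mixtures of affine and quadratic functions, which have the same
integral under all competitors, and of the hinge costs \<open>h(t) = ((t - s)\<^sup>+)\<^sup>2 / 2\<close>; so it suffices to
find, for every \<open>s \<noteq> 0\<close>, dual potentials with nonnegative slack that vanishes on the two graphs. Use \<open>b = k - 2\<close> and the mass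
coordinate \<open>e\<close> in which the free part of \<open>nu\<close> is parametrised by \<open>y = z1 k e - k\<close>. For \<open>x \<le> b\<close> the two graphs
are \<open>Y (L x)\<close> and \<open>Y (R x)\<close>, where \<open>[L, R]\<close> carries the mass and the barycentre of \<open>[-1, x]\<close>; the intervals
\<open>[D x, U x]\<close> are nested, and the potentials are those of the ordinary left-curtain coupling:
\<open>\<theta>' = - \<beta>\<close> with \<open>\<beta>\<close> the slope of the chord of the positive part over \<open>[D x - x, U x - x]\<close>. For \<open>x \<ge> b\<close>
the lower graph is the boundary of the constraint and the multiplier solves a linear first-order equation in
the mass coordinate. The dual inequality between \<open>x \<ge> b\<close> and targets \<open>y \<le> U b\<close> is verified at a
minimum of the dual slack over \<open>y\<close>: the slack vanishes at the lower graph and is nonnegative at the other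
end, and monotonicity of its derivative excludes a negative minimum, except for \<open>1 < k < 1.36\<close>, where
one explicit numerical estimate in two parameters remains.
\<close>

text \<open>The right part determines the rest. Its lower target is \<open>x - k\<close>; with upper
  displacement \<open>d\<close> the barycentre gives the upper weight \<open>k / (k + d)\<close>,
  and matching density 1/2 of \<open>mu\<close> with density 1/4 of \<open>nu\<close> along the
  upper graph gives \<open>d' = (k - d) / (k + d)\<close>, with \<open>d = 1\<close> at
  \<open>x = 1\<close>. The inverse of this solution is \<open>z1\<close>. What the lower graph
  leaves of \<open>nu\<close> at \<open>z1 k e - k\<close> is exactly \<open>de / 4\<close>, so the
  same \<open>e\<close> is the mass coordinate of the free part. Constructions I and II differ only
  in where \<open>L x\<close> and \<open>R x\<close> lie relative to \<open>1\<close>, the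
  coordinate at which the thinning of \<open>nu\<close> ends; one locale treats both, with
  \<open>k = 3\<close> as its degenerate end. The obstacle is the order of the targets: the left
  intervals are nested, but the lower ends on the right part move upwards with the boundary, so no
  nestedness relates right sources to left targets. The case \<open>k = 1\<close> stands apart
  because \<open>ln (k - 1)\<close> degenerates. The value \<open>s = 0\<close> is avoided because
  for other \<open>s\<close> the hinge derivative is affine on the short intervals near
  \<open>x = -1\<close>.\<close>

section \<open>Couplings, martingale test functions and weak duality\<close>

lemma mu_space [simp]: "space mu = UNIV" and mu_sets [simp, measurable_cong]: "sets mu = sets borel"
  by (simp_all add: mu_def)

lemma nu_space [simp]: "space nu = UNIV" and nu_sets [simp, measurable_cong]: "sets nu = sets borel"
  by (simp_all add: nu_def)

lemma prob_space_mu: "prob_space mu" and prob_space_nu: "prob_space nu"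
  unfolding mu_def nu_def by (intro prob_space_uniform_measure; simp)+

lemma AE_mu: "AE x in mu. x \<in> {-1..1}"
  unfolding mu_def by (rule AE_uniform_measureI) auto

lemma AE_nu: "AE x in nu. x \<in> {-2..2}"
  unfolding nu_def by (rule AE_uniform_measureI) auto

lemma mu_density: "mu = density lborel (\<lambda>x. ennreal (indicator {-1..1} x / 2))"
  unfolding mu_def uniform_measure_def
  by (rule arg_cong[where f = "density lborel"])
     (auto simp: fun_eq_iff indicator_def ennreal_divide_numeral[symmetric] simp flip: ennreal_1 split: if_splits)

lemma integral_mu:
  fixes f :: "real \<Rightarrow> real"
  assumes [measurable]: "f \<in> borel_measurable borel"
  shows "(\<integral>x. f x \<partial>mu) = (LINT x:{-1..1}|lborel. f x) / 2"
  unfolding mu_density set_lebesgue_integral_def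
  by (subst integral_density) auto

lemma coupling_facts:
  assumes "\<pi> \<in> couplings k"
  shows "prob_space \<pi>" "sets \<pi> = sets borel" "space \<pi> = UNIV"
    "distr \<pi> borel fst = mu" "distr \<pi> borel snd = nu"
    "AE p in \<pi>. fst p \<in> {-1..1}" "AE p in \<pi>. snd p \<in> {-2..2}" "AE p in \<pi>. snd p \<ge> fst p - k"
proof -
  have ps: "prob_space \<pi>" and s: "sets \<pi> = sets borel" and f: "distr \<pi> borel fst = mu"
    and g: "distr \<pi> borel snd = nu" and G: "emeasure \<pi> (Gamma k) = 1"
    using assms by (auto simp: couplings_def)
  note [measurable_cong] = s
  have sp: "space \<pi> = UNIV" using sets_eq_imp_space_eq[OF s] by simp
  show "prob_space \<pi>" "sets \<pi> = sets borel" "space \<pi> = UNIV"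
    "distr \<pi> borel fst = mu" "distr \<pi> borel snd = nu" by fact+
  have [measurable]: "fst \<in> \<pi> \<rightarrow>\<^sub>M borel" "snd \<in> \<pi> \<rightarrow>\<^sub>M borel"
    by (simp_all add: measurable_cong_sets[OF s refl] borel_measurable_continuous_onI continuous_on_fst continuous_on_snd)
  have "AE x in distr \<pi> borel fst. x \<in> {-1..1}" unfolding f by (rule AE_mu)
  then show "AE p in \<pi>. fst p \<in> {-1..1}" by (subst (asm) AE_distr_iff) auto
  have "AE x in distr \<pi> borel snd. x \<in> {-2..2}" unfolding g by (rule AE_nu)
  then show "AE p in \<pi>. snd p \<in> {-2..2}" by (subst (asm) AE_distr_iff) auto
  interpret prob_space \<pi> by fact
  have m: "Gamma k \<in> sets \<pi>"
  proof -
    have "closed (Gamma k)" unfolding Gamma_def case_prod_unfold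
      by (intro closed_Collect_le continuous_intros)
    then show ?thesis using s by simp
  qed
  have "prob (Gamma k) = 1" using G by (simp add: emeasure_eq_measure)
  then have "AE p in \<pi>. p \<in> Gamma k" by (subst AE_in_set_eq_1[OF m])
  then show "AE p in \<pi>. snd p \<ge> fst p - k" by (auto simp: Gamma_def elim!: eventually_mono)
qed

lemma fst_snd_borel:
  assumes "sets (\<pi> :: (real \<times> real) measure) = sets borel"
  shows "fst \<in> \<pi> \<rightarrow>\<^sub>M borel" "snd \<in> \<pi> \<rightarrow>\<^sub>M borel"
  by (simp_all add: measurable_cong_sets[OF assms refl] borel_measurable_continuous_onI continuous_on_fst continuous_on_snd)

lemma coupling_integrals:
  fixes f :: "real \<Rightarrow> real"
  assumes p: "\<pi> \<in> couplings k" and f[measurable]: "f \<in> borel_measurable borel" and b: "\<And>x. \<bar>f x\<bar> \<le> C"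
  shows "integrable \<pi> (\<lambda>p. f (fst p))" "(\<integral>p. f (fst p) \<partial>\<pi>) = (\<integral>x. f x \<partial>mu)"
    "integrable \<pi> (\<lambda>p. f (snd p))" "(\<integral>p. f (snd p) \<partial>\<pi>) = (\<integral>x. f x \<partial>nu)"
proof -
  note c = coupling_facts[OF p]
  note [measurable] = fst_snd_borel[OF c(2)]
  interpret prob_space \<pi> by fact
  show "integrable \<pi> (\<lambda>p. f (fst p))" "integrable \<pi> (\<lambda>p. f (snd p))"
    by (rule integrable_const_bound[where B = C]; use b in auto)+
  show "(\<integral>p. f (fst p) \<partial>\<pi>) = (\<integral>x. f x \<partial>mu)"
    unfolding c(4)[symmetric] by (subst integral_distr) auto
  show "(\<integral>p. f (snd p) \<partial>\<pi>) = (\<integral>x. f x \<partial>nu)"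
    unfolding c(5)[symmetric] by (subst integral_distr) auto
qed

text \<open>Written as a bind over \<open>mu\<close>, the coupling is open to the library rules that
  split almost-everywhere statements and nonnegative integrals along the kernel.\<close>

lemma disintegration_bind:
  assumes s: "sets \<pi> = sets borel" and d: "disintegration \<pi> \<kappa>"
  shows "\<pi> = mu \<bind> (\<lambda>x. distr (\<kappa> x) borel (Pair x))"
    and "(\<lambda>x. distr (\<kappa> x) borel (Pair x)) \<in> mu \<rightarrow>\<^sub>M subprob_algebra (borel :: (real \<times> real) measure)"
proof -
  have k: "\<kappa> \<in> borel \<rightarrow>\<^sub>M prob_algebra borel"
    and e: "\<And>S. S \<in> sets borel \<Longrightarrow> emeasure \<pi> S = (\<integral>\<^sup>+x. emeasure (\<kappa> x) {y. (x, y) \<in> S} \<partial>mu)"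
    using d by (auto simp: disintegration_def)
  have k1[measurable]: "\<kappa> \<in> borel \<rightarrow>\<^sub>M subprob_algebra borel"
    using k by (rule measurable_prob_algebraD)
  have ks: "sets (\<kappa> x) = sets borel" for x
    using measurable_space[OF k, of x] by (auto simp: space_prob_algebra)
  have m: "(\<lambda>x. distr (\<kappa> x) borel (Pair x)) \<in> borel \<rightarrow>\<^sub>M subprob_algebra (borel :: (real \<times> real) measure)"
    by (rule measurable_distr2[where M = borel]) (simp_all add: borel_prod)
  then show m': "(\<lambda>x. distr (\<kappa> x) borel (Pair x)) \<in> mu \<rightarrow>\<^sub>M subprob_algebra (borel :: (real \<times> real) measure)"
    by (simp cong: measurable_cong_sets)
  show "\<pi> = mu \<bind> (\<lambda>x. distr (\<kappa> x) borel (Pair x))"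
  proof (rule measure_eqI)
    show "sets \<pi> = sets (mu \<bind> (\<lambda>x. distr (\<kappa> x) borel (Pair x)))"
      using s by (subst sets_bind[where N = borel]) auto
    fix A assume "A \<in> sets \<pi>"
    then have A: "A \<in> sets borel" using s by simp
    have "emeasure (distr (\<kappa> x) borel (Pair x)) A = emeasure (\<kappa> x) {y. (x, y) \<in> A}" for x
      using A ks[of x] sets_eq_imp_space_eq[OF ks[of x]]
      by (subst emeasure_distr)
        (auto simp: vimage_def measurable_cong_sets[OF ks refl]
           intro!: borel_measurable_continuous_onI continuous_intros)
    then show "emeasure \<pi> A = emeasure (mu \<bind> (\<lambda>x. distr (\<kappa> x) borel (Pair x))) A"
      using e[OF A] by (subst emeasure_bind[OF _ m' A]) auto
  qed
qed

text \<open>Integration along the kernels is done for nonnegative integrands only: \<open>y\<close>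
  is shifted by \<open>2\<close> and the test function by \<open>C\<close>, and both shifts are
  removed by subtraction.\<close>

lemma martingale_test:
  fixes f :: "real \<Rightarrow> real"
  assumes p: "\<pi> \<in> couplings k" and f[measurable]: "f \<in> borel_measurable borel" and b: "\<And>x. \<bar>f x\<bar> \<le> C"
  shows "integrable \<pi> (\<lambda>p. f (fst p) * (snd p - fst p))" "(\<integral>p. f (fst p) * (snd p - fst p) \<partial>\<pi>) = 0"
proof -
  note c = coupling_facts[OF p]
  note [measurable] = fst_snd_borel[OF c(2)]
  note [measurable_cong] = c(2)
  interpret prob_space \<pi> by fact
  have bd: "AE p in \<pi>. \<bar>g (fst p) * (snd p - fst p)\<bar> \<le> K * 3"
    if "\<And>x. \<bar>g x\<bar> \<le> K" for g :: "real \<Rightarrow> real" and K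
    using c(6,7)
  proof eventually_elim
    case (elim p)
    have "\<bar>g (fst p) * (snd p - fst p)\<bar> = \<bar>g (fst p)\<bar> * \<bar>snd p - fst p\<bar>" by (rule abs_mult)
    also have "\<dots> \<le> K * 3" using elim that[of "fst p"] by (intro mult_mono) auto
    finally show ?case .
  qed
  have int: "integrable \<pi> (\<lambda>p. g (fst p) * (snd p - fst p))"
    if "\<And>x. \<bar>g x\<bar> \<le> K" and [measurable]: "g \<in> borel_measurable borel" for g :: "real \<Rightarrow> real" and K
    using bd[OF that(1)] by (intro integrable_const_bound[where B = "K * 3"]) auto
  show "integrable \<pi> (\<lambda>p. f (fst p) * (snd p - fst p))" using int[OF b f] .
  obtain \<kappa> where d: "disintegration \<pi> \<kappa>" and mean: "AE x in mu. has_bochner_integral (\<kappa> x) (\<lambda>y. y) x"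
    using p by (auto simp: couplings_def)
  note bind = disintegration_bind[OF c(2) d]
  have k: "\<kappa> \<in> borel \<rightarrow>\<^sub>M prob_algebra borel" using d by (auto simp: disintegration_def)
  have ks[measurable_cong]: "sets (\<kappa> x) = sets borel" and kp: "prob_space (\<kappa> x)" for x
    using measurable_space[OF k, of x] by (auto simp: space_prob_algebra)
  have pairm: "Pair x \<in> \<kappa> x \<rightarrow>\<^sub>M (borel :: (real \<times> real) measure)" for x
    by (simp add: measurable_cong_sets[OF ks refl] borel_measurable_continuous_onI continuous_intros)
  \<comment> \<open>Nonnegativity of \<open>g x * (y + 2)\<close> under \<open>\<kappa> x\<close> is
    inherited from the second marginal, for almost every \<open>x\<close>.\<close>
  have supp: "AE x in mu. AE y in \<kappa> x. y \<ge> -2"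
  proof -
    have pm: "Measurable.pred borel (\<lambda>p :: real \<times> real. snd p \<ge> -2)"
      by (auto simp: pred_def intro!: closed_Collect_le continuous_intros)
    have "AE p in \<pi>. snd p \<ge> -2" using c(7) by eventually_elim auto
    then have "AE p in mu \<bind> (\<lambda>x. distr (\<kappa> x) borel (Pair x)). snd p \<ge> -2"
      unfolding bind(1)[symmetric] .
    then have "AE x in mu. AE p in distr (\<kappa> x) borel (Pair x). snd p \<ge> -2"
      by (subst (asm) AE_bind[OF bind(2) pm])
    then show ?thesis
    proof eventually_elim
      case (elim x)
      then show ?case
        by (subst (asm) AE_distr_iff[OF pairm]) (use pm in \<open>auto simp: pred_def\<close>)
    qed
  qed
  have pos: "(\<integral>p. g (fst p) * (snd p - fst p) \<partial>\<pi>) = 0"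
    if g0: "\<And>x. 0 \<le> g x" and gK: "\<And>x. g x \<le> K" and [measurable]: "g \<in> borel_measurable borel"
    for g :: "real \<Rightarrow> real" and K
  proof -
    have ga: "\<And>x. \<bar>g x\<bar> \<le> K" using g0 gK by simp
    have ig: "integrable \<pi> (\<lambda>p. g (fst p) * (fst p + 2))" "integrable \<pi> (\<lambda>p. g (fst p) * (snd p + 2))"
    proof -
      have "AE p in \<pi>. norm (g (fst p) * (fst p + 2)) \<le> K * 4" "AE p in \<pi>. norm (g (fst p) * (snd p + 2)) \<le> K * 4"
        using c(6,7) by (eventually_elim, use g0 gK in \<open>auto simp: abs_mult intro!: mult_mono order_trans[OF g0 gK]\<close>)+
      then show "integrable \<pi> (\<lambda>p. g (fst p) * (fst p + 2))" "integrable \<pi> (\<lambda>p. g (fst p) * (snd p + 2))"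
        by (auto intro!: integrable_const_bound[where B = "K * 4"])
    qed
    have "(\<integral>\<^sup>+p. ennreal (g (fst p) * (snd p + 2)) \<partial>\<pi>)
        = (\<integral>\<^sup>+x. \<integral>\<^sup>+p. ennreal (g (fst p) * (snd p + 2)) \<partial>distr (\<kappa> x) borel (Pair x) \<partial>mu)"
      by (subst bind(1)) (rule nn_integral_bind[OF _ bind(2)], simp add: borel_prod[symmetric])
    also have "\<dots> = (\<integral>\<^sup>+x. \<integral>\<^sup>+y. ennreal (g x * (y + 2)) \<partial>\<kappa> x \<partial>mu)"
      by (intro nn_integral_cong, subst nn_integral_distr[OF pairm]) (simp_all add: borel_prod[symmetric])
    also have "\<dots> = (\<integral>\<^sup>+x. ennreal (g x * (x + 2)) \<partial>mu)"
    proof (rule nn_integral_cong_AE)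
      show "AE x in mu. (\<integral>\<^sup>+y. ennreal (g x * (y + 2)) \<partial>\<kappa> x) = ennreal (g x * (x + 2))"
        using mean supp
      proof eventually_elim
        case (elim x)
        interpret K: prob_space "\<kappa> x" by (rule kp)
        have "has_bochner_integral (\<kappa> x) (\<lambda>y. g x * (y + 2)) (g x * (x + 2))"
          using has_bochner_integral_mult_right[OF has_bochner_integral_add[OF elim(1), of "\<lambda>_. 2" 2], of "g x"]
          by (simp add: has_bochner_integral_iff K.prob_space)
        moreover have "AE y in \<kappa> x. 0 \<le> g x * (y + 2)" using elim(2) by eventually_elim (use g0 in auto)
        ultimately show ?case
          by (metis has_bochner_integral_integral_eq has_bochner_integral_iff nn_integral_eq_integral)
      qed
    qed
    also have "\<dots> = (\<integral>\<^sup>+p. ennreal (g (fst p) * (fst p + 2)) \<partial>\<pi>)"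
      unfolding c(4)[symmetric] by (subst nn_integral_distr) auto
    finally have eq: "(\<integral>\<^sup>+p. ennreal (g (fst p) * (snd p + 2)) \<partial>\<pi>) = (\<integral>\<^sup>+p. ennreal (g (fst p) * (fst p + 2)) \<partial>\<pi>)" .
    have nn: "AE p in \<pi>. 0 \<le> g (fst p) * (snd p + 2)"
      using c(7) by eventually_elim (use g0 in auto)
    have nn': "AE p in \<pi>. 0 \<le> g (fst p) * (fst p + 2)"
      using c(6) by eventually_elim (use g0 in auto)
    have "(\<integral>p. g (fst p) * (snd p + 2) \<partial>\<pi>) = (\<integral>p. g (fst p) * (fst p + 2) \<partial>\<pi>)"
    proof -
      have "ennreal (\<integral>p. g (fst p) * (snd p + 2) \<partial>\<pi>) = ennreal (\<integral>p. g (fst p) * (fst p + 2) \<partial>\<pi>)"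
        using eq unfolding nn_integral_eq_integral[OF ig(2) nn] nn_integral_eq_integral[OF ig(1) nn'] .
      then show ?thesis
        using integral_nonneg_AE[OF nn] integral_nonneg_AE[OF nn'] by (subst (asm) ennreal_inj)
    qed
    moreover have "(\<integral>p. g (fst p) * (snd p - fst p) \<partial>\<pi>)
        = (\<integral>p. g (fst p) * (snd p + 2) \<partial>\<pi>) - (\<integral>p. g (fst p) * (fst p + 2) \<partial>\<pi>)"
      by (subst Bochner_Integration.integral_diff[symmetric, OF ig(2,1)]) (simp add: algebra_simps)
    ultimately show ?thesis by simp
  qed
  have fC: "\<And>x. f x + C \<ge> 0" "\<And>x. f x + C \<le> 2 * C" "0 \<le> C" using b by (smt (verit))+
  have "(\<integral>p. f (fst p) * (snd p - fst p) \<partial>\<pi>)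
     = (\<integral>p. (f (fst p) + C) * (snd p - fst p) \<partial>\<pi>) - (\<integral>p. C * (snd p - fst p) \<partial>\<pi>)"
    by (subst Bochner_Integration.integral_diff[symmetric, OF int[of "\<lambda>x. f x + C" "2 * C"] int[of "\<lambda>_. C" C]])
       (use fC in \<open>auto simp: algebra_simps\<close>)
  also have "\<dots> = 0" using pos[of "\<lambda>x. f x + C" "2 * C"] pos[of "\<lambda>_. C" C] fC by simp
  finally show "(\<integral>p. f (fst p) * (snd p - fst p) \<partial>\<pi>) = 0" .
qed

lemma cost_integrable:
  assumes p: "\<pi> \<in> couplings k" and h: "continuous_on {-3..3} h"
  shows "integrable \<pi> (\<lambda>p. indicator {-3..3} (snd p - fst p) * h (snd p - fst p))"
    and "cost h \<pi> = (\<integral>p. indicator {-3..3} (snd p - fst p) * h (snd p - fst p) \<partial>\<pi>)"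
proof -
  note c = coupling_facts[OF p]
  note [measurable] = fst_snd_borel[OF c(2)]
  interpret prob_space \<pi> by fact
  have [measurable]: "(\<lambda>t. indicator {-3..3} t * h t) \<in> borel_measurable borel"
    using borel_measurable_continuous_on_indicator[OF _ h] by simp
  have "compact (h ` {-3..3})" by (rule compact_continuous_image[OF h]) simp
  then have "bounded (h ` {-3..3})" by (rule compact_imp_bounded)
  then obtain K where K': "\<forall>x\<in>h ` {-3..3}. norm x \<le> K" unfolding bounded_iff by blast
  have K: "\<bar>h t\<bar> \<le> K" if "t \<in> {-3..3}" for t using K' that by auto
  show "integrable \<pi> (\<lambda>p. indicator {-3..3} (snd p - fst p) * h (snd p - fst p))"
  proof (rule integrable_const_bound[where B = "\<bar>K\<bar>"])
    have "norm (indicator {-3..3} t * h t :: real) \<le> \<bar>K\<bar>" for t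
      using K[of t] by (auto simp: indicator_def)
    then show "AE x in \<pi>. norm (indicator {- 3..3} (snd x - fst x) * h (snd x - fst x)) \<le> \<bar>K\<bar>" by simp
    have "(\<lambda>t. indicator {-3..3} t * h t) \<circ> (\<lambda>p. snd p - fst p) \<in> borel_measurable \<pi>" by (rule measurable_comp[where N = borel]) auto
    then show "(\<lambda>x. indicator {- 3..3} (snd x - fst x) * h (snd x - fst x)) \<in> borel_measurable \<pi>" by (simp add: o_def)
  qed
  show "cost h \<pi> = (\<integral>p. indicator {-3..3} (snd p - fst p) * h (snd p - fst p) \<partial>\<pi>)"
    unfolding cost_def set_lebesgue_integral_def by (intro Bochner_Integration.integral_cong) (auto simp: indicator_def)
qed

text \<open>The marginals and the barycentre condition leave a right-hand side without
  \<open>\<pi>\<close>, so the dual integrand has one value for all couplings.\<close>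

lemma dual_value:
  fixes \<phi> \<psi> \<theta> :: "real \<Rightarrow> real"
  assumes p: "\<pi> \<in> couplings k"
    and [measurable]: "\<phi> \<in> borel_measurable borel" "\<psi> \<in> borel_measurable borel" "\<theta> \<in> borel_measurable borel"
    and b: "\<And>x. \<bar>\<phi> x\<bar> \<le> C" "\<And>x. \<bar>\<psi> x\<bar> \<le> C" "\<And>x. \<bar>\<theta> x\<bar> \<le> C"
  shows "integrable \<pi> (\<lambda>p. \<phi> (fst p) + \<psi> (snd p) + \<theta> (fst p) * (snd p - fst p))"
    and "(\<integral>p. \<phi> (fst p) + \<psi> (snd p) + \<theta> (fst p) * (snd p - fst p) \<partial>\<pi>) = (\<integral>x. \<phi> x \<partial>mu) + (\<integral>y. \<psi> y \<partial>nu)"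
  using coupling_integrals[OF p, of \<phi> C] coupling_integrals[OF p, of \<psi> C] martingale_test[OF p, of \<theta> C] b
  by auto

text \<open>Complementary slackness. The inequality is asked only where couplings live, the equality
  only along \<open>\<pi>0\<close>; the bound \<open>C\<close> on the whole line provides
  integrability.\<close>

lemma weak_duality:
  fixes \<phi> \<psi> \<theta> :: "real \<Rightarrow> real"
  assumes p: "\<pi> \<in> couplings k" and p0: "\<pi>0 \<in> couplings k" and h: "continuous_on {-3..3} h"
    and m: "\<phi> \<in> borel_measurable borel" "\<psi> \<in> borel_measurable borel" "\<theta> \<in> borel_measurable borel"
    and b: "\<And>x. \<bar>\<phi> x\<bar> \<le> C" "\<And>x. \<bar>\<psi> x\<bar> \<le> C" "\<And>x. \<bar>\<theta> x\<bar> \<le> C"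
    and le: "\<And>x y. x \<in> {-1..1} \<Longrightarrow> y \<in> {-2..2} \<Longrightarrow> y \<ge> x - k \<Longrightarrow> \<phi> x + \<psi> y + \<theta> x * (y - x) \<le> h (y - x)"
    and eq: "AE p in \<pi>0. \<phi> (fst p) + \<psi> (snd p) + \<theta> (fst p) * (snd p - fst p) = h (snd p - fst p)"
  shows "cost h \<pi>0 \<le> cost h \<pi>"
proof -
  note c = coupling_facts[OF p] and c0 = coupling_facts[OF p0]
  note d = dual_value[OF p m b] and d0 = dual_value[OF p0 m b]
  have "cost h \<pi>0 = (\<integral>p. \<phi> (fst p) + \<psi> (snd p) + \<theta> (fst p) * (snd p - fst p) \<partial>\<pi>0)"
    unfolding cost_integrable(2)[OF p0 h]
    using borel_measurable_integrable[OF cost_integrable(1)[OF p0 h]] borel_measurable_integrable[OF d0(1)]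
  proof (rule integral_cong_AE)
    show "AE p in \<pi>0. indicator {-3..3} (snd p - fst p) * h (snd p - fst p)
       = \<phi> (fst p) + \<psi> (snd p) + \<theta> (fst p) * (snd p - fst p)"
      using eq c0(6,7) by eventually_elim (auto simp: indicator_def)
  qed
  also have "\<dots> = (\<integral>p. \<phi> (fst p) + \<psi> (snd p) + \<theta> (fst p) * (snd p - fst p) \<partial>\<pi>)"
    using d(2) d0(2) by simp
  also have "\<dots> \<le> cost h \<pi>"
    unfolding cost_integrable(2)[OF p h]
  proof (rule integral_mono_AE[OF d(1) cost_integrable(1)[OF p h]])
    show "AE p in \<pi>. \<phi> (fst p) + \<psi> (snd p) + \<theta> (fst p) * (snd p - fst p)
       \<le> indicator {-3..3} (snd p - fst p) * h (snd p - fst p)"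
      using c(6,7,8) by eventually_elim (auto simp: indicator_def intro!: le)
  qed
  finally show ?thesis .
qed

text \<open>All targets lie above \<open>-1 - k\<close>, so the mass of \<open>nu\<close> between
  \<open>-2\<close> and \<open>-1 - k\<close> would have no source.\<close>

lemma couplings_empty:
  assumes "0 < k" "k < 1"
  shows "couplings k = {}"
proof (rule ccontr)
  assume "couplings k \<noteq> {}"
  then obtain \<pi> where p: "\<pi> \<in> couplings k" by blast
  note c = coupling_facts[OF p]
  note [measurable] = fst_snd_borel[OF c(2)]
  have "AE p in \<pi>. snd p \<ge> -1 - k" using c(6,8) by eventually_elim auto
  then have "AE y in distr \<pi> borel snd. y \<ge> -1 - k" by (subst AE_distr_iff) auto
  then have "AE y in nu. y \<ge> -1 - k" using c(5) by metis
  then have "emeasure nu {y. \<not> y \<ge> -1 - k} = 0" by (subst (asm) AE_iff_measurable[OF _ refl]) auto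
  moreover have "emeasure nu {y. \<not> y \<ge> -1 - k} = emeasure lborel ({-2..2} \<inter> {..<-1 - k}) / emeasure lborel {-2..2::real}"
    unfolding nu_def by (subst emeasure_uniform_measure) (auto simp: not_le lessThan_def)
  moreover have "{-2..2} \<inter> {..<-1 - k} = {-2..<-1 - k}" using assms by auto
  ultimately show False using assms
    by (auto simp: ennreal_divide_eq_0_iff)
qed

section \<open>Measures carried by two graphs\<close>

definition tg :: "(real \<Rightarrow> real) \<Rightarrow> (real \<Rightarrow> real) \<Rightarrow> (real \<Rightarrow> real) \<Rightarrow> (real \<times> real) measure" where
  "tg D U q = mu \<bind> (\<lambda>x. distr (measure_pmf (bernoulli_pmf (q x))) borel (\<lambda>c. (x, if c then U x else D x)))"

lemma emeasure_distr_bernoulli: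
  assumes "0 \<le> p" "p \<le> 1" "A \<in> sets N" "f \<in> UNIV \<rightarrow> space N"
  shows "emeasure (distr (measure_pmf (bernoulli_pmf p)) N f) A
    = ennreal (1 - p) * indicator A (f False) + ennreal p * indicator A (f True)"
proof -
  have "emeasure (distr (measure_pmf (bernoulli_pmf p)) N f) A
    = (\<integral>\<^sup>+c. indicator A (f c) \<partial>measure_pmf (bernoulli_pmf p))"
    using assms by (subst emeasure_distr)
      (auto simp: nn_integral_indicator[symmetric] simp del: nn_integral_indicator intro!: nn_integral_cong split: split_indicator)
  also have "\<dots> = ennreal (1 - p) * indicator A (f False) + ennreal p * indicator A (f True)"
    using assms by (subst nn_integral_bernoulli_pmf) (auto simp: mult.commute add.commute)
  finally show ?thesis .
qed

lemma tg_measurable: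
  assumes [measurable]: "D \<in> borel_measurable borel" "U \<in> borel_measurable borel" "q \<in> borel_measurable borel"
    and q: "\<And>x. 0 \<le> q x" "\<And>x. q x \<le> 1"
  shows "(\<lambda>x. distr (measure_pmf (bernoulli_pmf (q x))) borel (\<lambda>c. (x, if c then U x else D x)))
           \<in> mu \<rightarrow>\<^sub>M subprob_algebra (borel :: (real \<times> real) measure)"
    and "(\<lambda>x. distr (measure_pmf (bernoulli_pmf (q x))) borel (\<lambda>c. if c then U x else D x))
           \<in> borel \<rightarrow>\<^sub>M prob_algebra borel"
proof -
  show "(\<lambda>x. distr (measure_pmf (bernoulli_pmf (q x))) borel (\<lambda>c. (x, if c then U x else D x)))
           \<in> mu \<rightarrow>\<^sub>M subprob_algebra (borel :: (real \<times> real) measure)"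
  proof (rule measurable_subprob_algebra)
    fix A :: "(real \<times> real) set" assume [measurable]: "A \<in> sets borel"
    have "(\<lambda>x. ennreal (1 - q x) * indicator A (x, D x) + ennreal (q x) * indicator A (x, U x)) \<in> borel_measurable borel"
      by measurable
    then show "(\<lambda>x. emeasure (distr (measure_pmf (bernoulli_pmf (q x))) borel (\<lambda>c. (x, if c then U x else D x))) A) \<in> borel_measurable mu"
      using q by (simp add: emeasure_distr_bernoulli)
  qed (auto intro!: prob_space_imp_subprob_space prob_space.prob_space_distr measure_pmf.prob_space_axioms)
  show "(\<lambda>x. distr (measure_pmf (bernoulli_pmf (q x))) borel (\<lambda>c. if c then U x else D x))
           \<in> borel \<rightarrow>\<^sub>M prob_algebra borel"
  proof (intro measurable_prob_algebraI measurable_subprob_algebra)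
    fix A :: "real set" assume [measurable]: "A \<in> sets borel"
    show "(\<lambda>x. emeasure (distr (measure_pmf (bernoulli_pmf (q x))) borel (\<lambda>c. if c then U x else D x)) A) \<in> borel_measurable borel"
      using q by (simp add: emeasure_distr_bernoulli)
  qed (auto intro!: prob_space_imp_subprob_space prob_space.prob_space_distr measure_pmf.prob_space_axioms)
qed

text \<open>The second marginal is identified by its distribution function. The last hypothesis
  integrates over Lebesgue measure instead of \<open>mu\<close>, hence twice
  \<open>(c + 2) / 4\<close> on its right-hand side.\<close>

lemma tg_coupling:
  assumes m[measurable]: "D \<in> borel_measurable borel" "U \<in> borel_measurable borel" "q \<in> borel_measurable borel"
    and q: "\<And>x. 0 \<le> q x" "\<And>x. q x \<le> 1"
    and mean: "\<And>x. x \<in> {-1..1} \<Longrightarrow> (1 - q x) * D x + q x * U x = x"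
    and con: "\<And>x. x \<in> {-1..1} \<Longrightarrow> D x \<ge> x - k" "\<And>x. x \<in> {-1..1} \<Longrightarrow> U x \<ge> x - k"
    and cdf: "\<And>c. c \<in> {-2..2} \<Longrightarrow>
       (LINT x:{-1..1}|lborel. (1 - q x) * indicator {..c} (D x) + q x * indicator {..c} (U x)) = (c + 2) / 2"
  shows "tg D U q \<in> couplings k" "two_graph D U q (tg D U q)"
    "AE p in tg D U q. fst p \<in> {-1..1} \<and> (snd p = D (fst p) \<or> snd p = U (fst p))"
proof -
  note km = tg_measurable[OF m q]
  let ?N = "\<lambda>x. distr (measure_pmf (bernoulli_pmf (q x))) borel (\<lambda>c. (x, if c then U x else D x))"
  let ?\<kappa> = "\<lambda>x. distr (measure_pmf (bernoulli_pmf (q x))) borel (\<lambda>c. if c then U x else D x)"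
  let ?\<pi> = "tg D U q"
  interpret mu: prob_space mu by (rule prob_space_mu)
  have s: "sets ?\<pi> = sets borel" unfolding tg_def by (subst sets_bind[where N = borel]) auto
  note [measurable_cong] = s
  note [measurable] = fst_snd_borel[OF s]
  have em: "emeasure ?\<pi> S = (\<integral>\<^sup>+x. ennreal (1 - q x) * indicator S (x, D x) + ennreal (q x) * indicator S (x, U x) \<partial>mu)"
    if "S \<in> sets borel" for S
    unfolding tg_def using that q by (subst emeasure_bind[OF _ km(1) that]) (auto simp: emeasure_distr_bernoulli)
  show tw: "two_graph D U q ?\<pi>"
    unfolding two_graph_def using m q s em by auto
  have sp: "space ?\<pi> = UNIV" using sets_eq_imp_space_eq[OF s] by simp
  have prob: "prob_space ?\<pi>"
  proof
    have "emeasure ?\<pi> UNIV = (\<integral>\<^sup>+x. 1 \<partial>mu)"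
      unfolding em[OF sets.top[of borel, unfolded space_borel]]
      by (intro nn_integral_cong) (use q in \<open>auto simp flip: ennreal_plus\<close>)
    then show "emeasure ?\<pi> (space ?\<pi>) = 1" using mu.emeasure_space_1 sp by simp
  qed
  interpret \<pi>: prob_space ?\<pi> by fact
  have d1: "distr ?\<pi> borel fst = mu"
  proof (rule measure_eqI)
    fix A assume "A \<in> sets (distr ?\<pi> borel fst)"
    then have A: "A \<in> sets borel" by simp
    have "emeasure (distr ?\<pi> borel fst) A = emeasure ?\<pi> (fst -` A)"
      using A by (subst emeasure_distr) (auto simp: sp)
    also have "\<dots> = (\<integral>\<^sup>+x. indicator A x \<partial>mu)"
    proof (subst em)
      have "(fst -` A :: (real \<times> real) set) \<in> sets ?\<pi>" using measurable_sets[OF fst_snd_borel(1)[OF s] A] sp by simp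
      then show "(fst -` A :: (real \<times> real) set) \<in> sets borel" using s by simp
      show "(\<integral>\<^sup>+x. ennreal (1 - q x) * indicator (fst -` A) (x, D x) + ennreal (q x) * indicator (fst -` A) (x, U x) \<partial>mu) = (\<integral>\<^sup>+x. indicator A x \<partial>mu)"
        by (intro nn_integral_cong) (use q in \<open>auto simp: indicator_def simp flip: ennreal_plus\<close>)
    qed
    finally show "emeasure (distr ?\<pi> borel fst) A = emeasure mu A" using A by simp
  qed simp
  have ind: "AE p in ?\<pi>. fst p \<in> {-1..1} \<and> (snd p = D (fst p) \<or> snd p = U (fst p))"
  proof -
    let ?S = "{p :: real \<times> real. \<not> (snd p = D (fst p) \<or> snd p = U (fst p))}"
    have S: "?S \<in> sets borel"
    proof -
      have "{p \<in> space (borel \<Otimes>\<^sub>M borel). \<not> (snd p = D (fst p) \<or> snd p = U (fst p))} \<in> sets (borel \<Otimes>\<^sub>M borel)"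
        by measurable
      then show ?thesis by (simp add: borel_prod)
    qed
    have "emeasure ?\<pi> ?S = 0" unfolding em[OF S] by simp
    then have "AE p in ?\<pi>. p \<notin> ?S" using S s by (intro AE_not_in) (auto simp: null_sets_def)
    moreover have "AE p in ?\<pi>. fst p \<in> {-1..1}"
    proof -
      have "AE x in distr ?\<pi> borel fst. x \<in> {-1..1}" unfolding d1 by (rule AE_mu)
      then show ?thesis by (subst (asm) AE_distr_iff) auto
    qed
    ultimately show ?thesis by eventually_elim auto
  qed
  then show "AE p in tg D U q. fst p \<in> {-1..1} \<and> (snd p = D (fst p) \<or> snd p = U (fst p))" .
  have cd: "measure (distr ?\<pi> borel snd) {..c} = (c + 2) / 4" if c: "c \<in> {-2..2}" for c
  proof -
    have "emeasure (distr ?\<pi> borel snd) {..c} = emeasure ?\<pi> (snd -` {..c})"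
      by (subst emeasure_distr) (auto simp: sp)
    also have "\<dots> = (\<integral>\<^sup>+x. ennreal ((1 - q x) * indicator {..c} (D x) + q x * indicator {..c} (U x)) \<partial>mu)"
    proof (subst em)
      have "(snd -` {..c} :: (real \<times> real) set) \<in> sets ?\<pi>" using measurable_sets[OF fst_snd_borel(2)[OF s], of "{..c}"] sp by simp
      then show "(snd -` {..c} :: (real \<times> real) set) \<in> sets borel" using s by simp
      show "(\<integral>\<^sup>+x. ennreal (1 - q x) * indicator (snd -` {..c}) (x, D x) + ennreal (q x) * indicator (snd -` {..c}) (x, U x) \<partial>mu)
        = (\<integral>\<^sup>+x. ennreal ((1 - q x) * indicator {..c} (D x) + q x * indicator {..c} (U x)) \<partial>mu)"
        by (intro nn_integral_cong) (use q in \<open>auto simp: indicator_def simp flip: ennreal_plus\<close>)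
    qed
    also have "\<dots> = ennreal (\<integral>x. (1 - q x) * indicator {..c} (D x) + q x * indicator {..c} (U x) \<partial>mu)"
    proof (rule nn_integral_eq_integral)
      show "integrable mu (\<lambda>x. (1 - q x) * indicator {..c} (D x) + q x * indicator {..c} (U x))"
      proof (rule mu.integrable_const_bound[where B = 2])
        have "norm ((1 - q x) * indicator {..c} (D x) + q x * indicator {..c} (U x)) \<le> 2" for x
          using q[of x] by (auto simp: indicator_def)
        then show "AE x in mu. norm ((1 - q x) * indicator {..c} (D x) + q x * indicator {..c} (U x)) \<le> 2" by simp
      qed simp
    qed (use q in auto)
    also have "\<dots> = ennreal ((c + 2) / 4)" by (subst integral_mu) (auto simp: cdf[OF c])
    finally show ?thesis using c by (simp add: measure_def)
  qed
  have d2: "distr ?\<pi> borel snd = nu"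
  proof (rule cdf_unique)
    have p2: "prob_space (distr ?\<pi> borel snd)" by (rule \<pi>.prob_space_distr) simp
    interpret S: prob_space "distr ?\<pi> borel snd" by (rule p2)
    interpret nu: prob_space nu by (rule prob_space_nu)
    show r1: "real_distribution (distr ?\<pi> borel snd)"
      using p2 by (auto simp: real_distribution_def real_distribution_axioms_def)
    show r2: "real_distribution nu"
      using prob_space_nu by (auto simp: real_distribution_def real_distribution_axioms_def)
    have n: "measure nu {..c} = (c + 2) / 4" if c: "c \<in> {-2..2}" for c
    proof -
      have "{-2..2} \<inter> {..c} = {-2..c}" using c by auto
      then show ?thesis using c unfolding nu_def by (subst measure_uniform_measure) auto
    qed
    \<comment> \<open>By monotonicity, the values 0 at \<open>-2\<close> and 1 at \<open>2\<close>
      settle all \<open>c\<close> outside the interval.\<close>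
    have out: "measure M {..c} = (if c < -2 then 0 else if c > 2 then 1 else (c + 2) / 4)"
      if M: "real_distribution M" and f: "\<And>c. c \<in> {-2..2} \<Longrightarrow> measure M {..c} = (c + 2) / 4" for M c
    proof -
      interpret real_distribution M by (rule M)
      have "measure M {..c} \<le> measure M {..-2}" if "c < -2" using that by (intro finite_measure_mono) auto
      moreover have "measure M {..2} \<le> measure M {..c}" if "c > 2" using that by (intro finite_measure_mono) auto
      moreover have "measure M {..c} \<ge> 0" "measure M {..c} \<le> 1" by simp_all
      moreover have "measure M {..-2} = 0" "measure M {..2} = 1" using f[of "-2"] f[of 2] by simp_all
      ultimately show ?thesis using f[of c] by (cases "c < -2"; cases "c > 2"; simp)
    qed
    show "Distribution_Functions.cdf (distr ?\<pi> borel snd) = Distribution_Functions.cdf nu"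
      by (rule ext) (simp only: cdf_def out[OF r1 cd] out[OF r2 n])
  qed
  have G: "emeasure ?\<pi> (Gamma k) = 1"
  proof -
    have cl: "closed (Gamma k)" unfolding Gamma_def case_prod_unfold
      by (intro closed_Collect_le continuous_intros)
    have "AE p in ?\<pi>. p \<in> Gamma k" using ind by eventually_elim (use con in \<open>auto simp: Gamma_def\<close>)
    then have "\<pi>.prob (Gamma k) = 1" using cl s by (subst \<pi>.AE_in_set_eq_1[symmetric]) auto
    then show ?thesis by (simp add: \<pi>.emeasure_eq_measure)
  qed
  have dis: "disintegration ?\<pi> ?\<kappa>"
    unfolding disintegration_def
  proof (intro conjI ballI)
    show "?\<kappa> \<in> borel \<rightarrow>\<^sub>M prob_algebra borel" by (rule km(2))
    fix S :: "(real \<times> real) set" assume S[measurable]: "S \<in> sets borel"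
    have "Pair x -` S \<in> sets borel" for x
    proof -
      have "Pair x \<in> borel \<rightarrow>\<^sub>M (borel :: (real \<times> real) measure)"
        by (intro borel_measurable_continuous_onI continuous_intros)
      from measurable_sets[OF this S] show ?thesis by simp
    qed
    then have S': "{y. (x, y) \<in> S} \<in> sets borel" for x by (simp add: vimage_def)
    show "emeasure ?\<pi> S = (\<integral>\<^sup>+x. emeasure (?\<kappa> x) {y. (x, y) \<in> S} \<partial>mu)"
      unfolding em[OF S] by (intro nn_integral_cong, subst emeasure_distr_bernoulli)
        (use q S' in \<open>auto simp: indicator_def\<close>)
  qed
  have bar: "AE x in mu. has_bochner_integral (?\<kappa> x) (\<lambda>y. y) x"
    using AE_mu
  proof eventually_elim
    case (elim x)
    have "integrable (measure_pmf (bernoulli_pmf (q x))) (\<lambda>c. if c then U x else D x)"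
      by (rule integrable_measure_pmf_finite) simp
    moreover have "(\<integral>c. (if c then U x else D x) \<partial>measure_pmf (bernoulli_pmf (q x))) = x"
      using mean[OF elim] q[of x] by (subst integral_bernoulli_pmf) (auto simp: algebra_simps)
    ultimately have "has_bochner_integral (measure_pmf (bernoulli_pmf (q x))) (\<lambda>c. if c then U x else D x) x"
      by (simp add: has_bochner_integral_iff)
    then show ?case by (intro has_bochner_integral_distr) auto
  qed
  show "?\<pi> \<in> couplings k"
    unfolding couplings_def using s prob d1 d2 G dis bar by auto
qed

lemma mono_couplings: "k \<le> k' \<Longrightarrow> \<pi> \<in> couplings k \<Longrightarrow> \<pi> \<in> couplings k'"
proof -
  assume k: "k \<le> k'" and p: "\<pi> \<in> couplings k"
  note c = coupling_facts[OF p]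
  interpret prob_space \<pi> by fact
  have m: "Gamma k' \<in> sets \<pi>"
  proof -
    have "closed (Gamma k')" unfolding Gamma_def case_prod_unfold
      by (intro closed_Collect_le continuous_intros)
    then show ?thesis using c(2) by simp
  qed
  have "AE p in \<pi>. p \<in> Gamma k'" using c(8) by eventually_elim (use k in \<open>auto simp: Gamma_def\<close>)
  then have "prob (Gamma k') = 1" by (subst AE_in_set_eq_1[OF m, symmetric])
  then have "emeasure \<pi> (Gamma k') = 1" by (simp add: emeasure_eq_measure)
  then show "\<pi> \<in> couplings k'" using p by (auto simp: couplings_def)
qed

text \<open>The marginals alone force \<open>snd p - fst p \<ge> -3\<close>, so from
  \<open>k = 3\<close> on the constraint is void.\<close>

lemma couplings_ge3:
  assumes "k \<ge> 3" shows "couplings k = couplings 3"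
proof -
  have "\<pi> \<in> couplings 3" if p: "\<pi> \<in> couplings k" for \<pi>
  proof -
    note c = coupling_facts[OF p]
    interpret prob_space \<pi> by fact
    have m: "Gamma 3 \<in> sets \<pi>"
    proof -
      have "closed (Gamma 3)" unfolding Gamma_def case_prod_unfold
        by (intro closed_Collect_le continuous_intros)
      then show ?thesis using c(2) by simp
    qed
    have "AE p in \<pi>. p \<in> Gamma 3" using c(6,7) by eventually_elim (auto simp: Gamma_def)
    then have "prob (Gamma 3) = 1" by (subst AE_in_set_eq_1[OF m, symmetric])
    then have "emeasure \<pi> (Gamma 3) = 1" by (simp add: emeasure_eq_measure)
    then show ?thesis using p by (auto simp: couplings_def)
  qed
  then show ?thesis using mono_couplings[OF assms] by blast
qed


section \<open>Reduction to hinge costs\<close>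

definition hinge :: "real \<Rightarrow> real \<Rightarrow> real" where
  "hinge s t = (max (t - s) 0)\<^sup>2 / 2"

lemma hinge_deriv: "(hinge s has_real_derivative max (t - s) 0) (at t within S)"
proof -
  consider "t < s" | "t = s" | "t > s" by linarith
  then have "(hinge s has_real_derivative max (t - s) 0) (at t)"
  proof cases
    case 1
    have "((\<lambda>_. 0) has_real_derivative 0) (at t)" by simp
    then have "(hinge s has_real_derivative 0) (at t)"
      by (rule DERIV_cong_ev[THEN iffD1, rotated -1, OF _ refl _ refl])
         (use 1 eventually_nhds_in_open[of "{..<s}" t] in \<open>auto simp: hinge_def elim!: eventually_mono\<close>)
    then show ?thesis using 1 by simp
  next
    case 3
    have "((\<lambda>t. (t - s)\<^sup>2 / 2) has_real_derivative (t - s)) (at t)"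
      by (auto intro!: derivative_eq_intros)
    then have "(hinge s has_real_derivative (t - s)) (at t)"
      by (rule DERIV_cong_ev[THEN iffD1, rotated -1, OF _ refl _ refl])
         (use 3 eventually_nhds_in_open[of "{s<..}" t] in \<open>auto simp: hinge_def elim!: eventually_mono\<close>)
    then show ?thesis using 3 by simp
  next
    case 2
    have "((\<lambda>y. (hinge s y - hinge s s) / (y - s)) \<longlongrightarrow> 0) (at s)"
    proof (rule Lim_null_comparison)
      show "\<forall>\<^sub>F y in at s. norm ((hinge s y - hinge s s) / (y - s)) \<le> \<bar>y - s\<bar>"
      proof (intro always_eventually allI)
        fix y :: real
        have "\<bar>hinge s y - hinge s s\<bar> \<le> \<bar>y - s\<bar> * \<bar>y - s\<bar>"
          by (auto simp: hinge_def power2_eq_square max_def abs_mult)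
        then show "norm ((hinge s y - hinge s s) / (y - s)) \<le> \<bar>y - s\<bar>"
          by (cases "y = s") (auto simp: divide_simps)
      qed
      show "((\<lambda>y. \<bar>y - s\<bar>) \<longlongrightarrow> 0) (at s)"
        by (rule tendsto_rabs_zero, rule LIM_zero, simp)
    qed
    then show ?thesis using 2 by (simp add: has_field_derivative_iff)
  qed
  then show ?thesis by (rule has_field_derivative_at_within)
qed

lemma hinge_continuous [continuous_intros]: "continuous_on S (hinge s)"
  by (rule DERIV_continuous_on[OF hinge_deriv])

lemma cost_affine:
  assumes p: "\<pi> \<in> couplings k" and f: "continuous_on {-3..3} f" and g: "continuous_on {-3..3} g"
  shows "cost (\<lambda>t. f t + c * g t) \<pi> = cost f \<pi> + c * cost g \<pi>"
proof -
  have fg: "continuous_on {-3..3} (\<lambda>t. f t + c * g t)" using f g by (intro continuous_intros)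
  show ?thesis
    unfolding cost_integrable(2)[OF p fg] cost_integrable(2)[OF p f] cost_integrable(2)[OF p g]
    using cost_integrable(1)[OF p f] cost_integrable(1)[OF p g]
    by (subst integral_mult_right_zero[symmetric], subst Bochner_Integration.integral_add[symmetric])
       (auto intro!: Bochner_Integration.integral_cong simp: algebra_simps)
qed

lemma cost_diff_le:
  assumes p: "\<pi> \<in> couplings k" and f: "continuous_on {-3..3} f" and g: "continuous_on {-3..3} g"
    and le: "\<And>t. t \<in> {-3..3} \<Longrightarrow> f t \<le> g t + e" and e: "e \<ge> 0"
  shows "cost f \<pi> \<le> cost g \<pi> + e"
proof -
  interpret prob_space \<pi> using coupling_facts(1)[OF p] .
  have "cost f \<pi> \<le> (\<integral>p. indicator {-3..3} (snd p - fst p) * g (snd p - fst p) + e \<partial>\<pi>)"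
    unfolding cost_integrable(2)[OF p f]
    by (rule integral_mono) (use cost_integrable(1)[OF p f] cost_integrable(1)[OF p g] le e in \<open>auto simp: indicator_def\<close>)
  also have "\<dots> = cost g \<pi> + e"
    unfolding cost_integrable(2)[OF p g]
    using cost_integrable(1)[OF p g] by (subst Bochner_Integration.integral_add) (auto simp: prob_space)
  finally show ?thesis .
qed

text \<open>For \<open>t = y - x\<close>,
  \<open>t\<^sup>2 = y\<^sup>2 - x\<^sup>2 - 2 * x * (y - x)\<close> is a sum of functions of one
  marginal and a martingale term. Duality then holds with equality everywhere and applies in both
  directions.\<close>

lemma cost_quadratic:
  assumes p: "\<pi> \<in> couplings k" and p0: "\<pi>0 \<in> couplings k"
  shows "cost (\<lambda>t. a + b * t + c * t\<^sup>2) \<pi> = cost (\<lambda>t. a + b * t + c * t\<^sup>2) \<pi>0"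
proof -
  \<comment> \<open>Clamping bounds the potentials on the whole line and changes nothing on the
    supports.\<close>
  define cl where "cl r x = max (-r) (min r x)" for r x :: real
  have cl: "cl r x = x" if "x \<in> {-r..r}" for r x using that by (auto simp: cl_def)
  have clb: "\<bar>cl r x\<bar> \<le> r" if "r \<ge> 0" for r x using that by (auto simp: cl_def)
  have sq: "(cl r x)\<^sup>2 \<le> r\<^sup>2" if "r \<ge> 0" for r x
    using power_mono[OF clb[OF that, of x] abs_ge_zero, of 2] by simp
  have le: "cost (\<lambda>t. a + b * t + c * t\<^sup>2) \<pi>1 \<le> cost (\<lambda>t. a + b * t + c * t\<^sup>2) \<pi>2"
    if p1: "\<pi>1 \<in> couplings k" and p2: "\<pi>2 \<in> couplings k" for \<pi>1 \<pi>2
  proof (rule weak_duality[OF p2 p1, where \<phi> = "\<lambda>x. a - c * (cl 1 x)\<^sup>2" and \<psi> = "\<lambda>y. c * (cl 2 y)\<^sup>2"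
        and \<theta> = "\<lambda>x. b - 2 * c * cl 1 x" and C = "\<bar>a\<bar> + \<bar>b\<bar> + 4 * \<bar>c\<bar>"])
    show "continuous_on {-3..3} (\<lambda>t. a + b * t + c * t\<^sup>2)" by (intro continuous_intros)
    show "(\<lambda>x. a - c * (cl 1 x)\<^sup>2) \<in> borel_measurable borel" "(\<lambda>y. c * (cl 2 y)\<^sup>2) \<in> borel_measurable borel"
      "(\<lambda>x. b - 2 * c * cl 1 x) \<in> borel_measurable borel"
      unfolding cl_def by measurable
    fix x :: real
    have "\<bar>c * (cl 1 x)\<^sup>2\<bar> \<le> \<bar>c\<bar> * 1" unfolding abs_mult using sq[of 1 x] by (intro mult_left_mono) auto
    then show "\<bar>a - c * (cl 1 x)\<^sup>2\<bar> \<le> \<bar>a\<bar> + \<bar>b\<bar> + 4 * \<bar>c\<bar>" by linarith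
    have "\<bar>c * (cl 2 x)\<^sup>2\<bar> \<le> \<bar>c\<bar> * 4" unfolding abs_mult using sq[of 2 x] by (intro mult_left_mono) auto
    then show "\<bar>c * (cl 2 x)\<^sup>2\<bar> \<le> \<bar>a\<bar> + \<bar>b\<bar> + 4 * \<bar>c\<bar>" by linarith
    have "\<bar>2 * c * cl 1 x\<bar> \<le> 2 * \<bar>c\<bar> * 1" unfolding abs_mult using clb[of 1 x] by (intro mult_mono) auto
    then show "\<bar>b - 2 * c * cl 1 x\<bar> \<le> \<bar>a\<bar> + \<bar>b\<bar> + 4 * \<bar>c\<bar>" by linarith
  next
    have eq: "a - c * (cl 1 x)\<^sup>2 + c * (cl 2 y)\<^sup>2 + (b - 2 * c * cl 1 x) * (y - x) = a + b * (y - x) + c * (y - x)\<^sup>2"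
      if "x \<in> {-1..1}" "y \<in> {-2..2}" for x y
      using cl[of x 1] cl[of y 2] that by (simp add: algebra_simps power2_eq_square)
    show "a - c * (cl 1 x)\<^sup>2 + c * (cl 2 y)\<^sup>2 + (b - 2 * c * cl 1 x) * (y - x) \<le> a + b * (y - x) + c * (y - x)\<^sup>2"
      if "x \<in> {-1..1}" "y \<in> {-2..2}" for x y using eq[OF that] by simp
    show "AE p in \<pi>1. a - c * (cl 1 (fst p))\<^sup>2 + c * (cl 2 (snd p))\<^sup>2 + (b - 2 * c * cl 1 (fst p)) * (snd p - fst p)
       = a + b * (snd p - fst p) + c * (snd p - fst p)\<^sup>2"
      using coupling_facts(6,7)[OF p1] by eventually_elim (rule eq)
  qed
  show ?thesis using le[OF p p0] le[OF p0 p] by simp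
qed

lemma cost_sum_hinges:
  assumes p: "\<pi> \<in> couplings k" and f: "continuous_on {-3..3} f"
  shows "cost (\<lambda>t. f t + (\<Sum>i\<in>{1..j::nat}. c i * hinge (s i) t)) \<pi> = cost f \<pi> + (\<Sum>i\<in>{1..j}. c i * cost (hinge (s i)) \<pi>)"
proof (induction j)
  case (Suc j)
  have c: "continuous_on {-3..3} (\<lambda>t. f t + (\<Sum>i\<in>{1..j}. c i * hinge (s i) t))"
    using f by (intro continuous_intros)
  have "cost (\<lambda>t. f t + (\<Sum>i\<in>{1..Suc j}. c i * hinge (s i) t)) \<pi>
    = cost (\<lambda>t. (f t + (\<Sum>i\<in>{1..j}. c i * hinge (s i) t)) + c (Suc j) * hinge (s (Suc j)) t) \<pi>"
    by (simp add: add.assoc)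
  also have "\<dots> = cost (\<lambda>t. f t + (\<Sum>i\<in>{1..j}. c i * hinge (s i) t)) \<pi> + c (Suc j) * cost (hinge (s (Suc j))) \<pi>"
    by (rule cost_affine[OF p c hinge_continuous])
  finally show ?case using Suc by simp
qed simp

text \<open>\<open>g j\<close> is the piecewise linear interpolant up to the knot
  \<open>s (Suc j)\<close>, continued linearly. Its ramp coefficients are increments of chord
  slopes, nonnegative by convexity; the error on a cell is a convex combination of two oscillations
  of \<open>f\<close>.\<close>

lemma convex_interpolation:
  fixes f :: "real \<Rightarrow> real" and n :: nat
  assumes cv: "convex_on {-3..3} f" and n: "n \<ge> 1"
    and e: "\<And>x y. x \<in> {-3..3} \<Longrightarrow> y \<in> {-3..3} \<Longrightarrow> \<bar>x - y\<bar> \<le> 6 / n \<Longrightarrow> \<bar>f x - f y\<bar> \<le> e"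
  defines "s \<equiv> \<lambda>i. -3 + 6 * real i / n"
  defines "m \<equiv> \<lambda>i. (f (s (Suc i)) - f (s i)) * n / 6"
  defines "g \<equiv> \<lambda>j t. f (-3) + m 0 * (t + 3) + (\<Sum>i\<in>{1..j}. (m i - m (i - 1)) * max (t - s i) 0)"
  shows "\<And>i. i \<ge> 1 \<Longrightarrow> i < n \<Longrightarrow> m i - m (i - 1) \<ge> 0"
    and "\<And>t. t \<in> {-3..3} \<Longrightarrow> \<bar>g (n - 1) t - f t\<bar> \<le> e"
proof -
  have s: "s i \<in> {-3..3}" if "i \<le> n" for i
    using that n by (auto simp: s_def divide_simps)
  have step: "s (Suc i) = s i + 6 / n" for i by (simp add: s_def add_divide_distrib algebra_simps)
  show inc: "m i - m (i - 1) \<ge> 0" if i: "i \<ge> 1" "i < n" for i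
  proof -
    obtain j where j: "i = Suc j" using i by (cases i) auto
    have "f ((1 - 1/2) *\<^sub>R s j + (1/2) *\<^sub>R s (Suc (Suc j))) \<le> (1 - 1/2) * f (s j) + (1/2) * f (s (Suc (Suc j)))"
      by (rule convex_onD[OF cv]) (use s[of j] s[of "Suc (Suc j)"] i j in auto)
    moreover have "(1 - 1/2) *\<^sub>R s j + (1/2) *\<^sub>R s (Suc (Suc j)) = s (Suc j)"
      by (simp add: step algebra_simps)
    ultimately have "0 \<le> f (s (Suc (Suc j))) - 2 * f (s (Suc j)) + f (s j)" by simp
    then have "0 \<le> (f (s (Suc (Suc j))) - 2 * f (s (Suc j)) + f (s j)) * n / 6" using n by simp
    then show ?thesis unfolding m_def j by (simp add: algebra_simps diff_divide_distrib add_divide_distrib)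
  qed
  have lin: "t \<ge> s j \<Longrightarrow> g j t = f (s j) + m j * (t - s j)" if "j < n" for j t
    using that
  proof (induction j arbitrary: t)
    case 0 then show ?case by (simp add: g_def s_def)
  next
    case (Suc j)
    have "g (Suc j) t = g j t + (m (Suc j) - m j) * (t - s (Suc j))"
      using Suc.prems by (simp add: g_def)
    also have "g j t = f (s j) + m j * (t - s j)"
    proof (rule Suc.IH)
      have "s j \<le> s (Suc j)" using step[of j] n by simp
      then show "t \<ge> s j" using Suc.prems by linarith
    qed (use Suc.prems in auto)
    finally have "g (Suc j) t = f (s j) + m j * (s (Suc j) - s j) + m (Suc j) * (t - s (Suc j))"
      by (simp add: algebra_simps)
    also have "f (s j) + m j * (s (Suc j) - s j) = f (s (Suc j))" using n by (simp add: step m_def)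
    finally show ?case .
  qed
  have cell: "\<bar>g j t - f t\<bar> \<le> e" if j: "j < n" and t: "s j \<le> t" "t \<le> s (Suc j)" for j t
  proof -
    define \<tau> where "\<tau> = (t - s j) * n / 6"
    have \<tau>: "0 \<le> \<tau>" "\<tau> \<le> 1" using t n step[of j] by (auto simp: \<tau>_def divide_simps mult.commute algebra_simps)
    have tt: "t \<in> {-3..3}" using s[of j] s[of "Suc j"] j t by auto
    have "\<bar>f (s j) - f t\<bar> \<le> e" "\<bar>f (s (Suc j)) - f t\<bar> \<le> e"
      using t step[of j] s[of j] s[of "Suc j"] j tt by (auto intro!: e)
    then have a: "\<bar>(1 - \<tau>) * (f (s j) - f t)\<bar> \<le> (1 - \<tau>) * e" "\<bar>\<tau> * (f (s (Suc j)) - f t)\<bar> \<le> \<tau> * e"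
      using \<tau> by (auto simp: abs_mult intro!: mult_left_mono)
    have "g j t - f t = (1 - \<tau>) * (f (s j) - f t) + \<tau> * (f (s (Suc j)) - f t)"
      unfolding lin[OF j t(1)] by (simp add: m_def \<tau>_def field_simps)
    also have "\<bar>\<dots>\<bar> \<le> (1 - \<tau>) * e + \<tau> * e" using a by linarith
    finally show ?thesis by (simp add: algebra_simps)
  qed
  have app: "t \<in> {-3..s (Suc j)} \<Longrightarrow> \<bar>g j t - f t\<bar> \<le> e" if "j < n" for j t
    using that
  proof (induction j arbitrary: t)
    case 0
    then show ?case using cell[of 0 t] by (simp add: s_def)
  next
    case (Suc j)
    show ?case
    proof (cases "t \<le> s (Suc j)")
      case True
      then have "g (Suc j) t = g j t" by (simp add: g_def)
      then show ?thesis using Suc True by auto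
    next
      case False
      then show ?thesis using cell[of "Suc j" t] Suc.prems by auto
    qed
  qed
  fix t :: real assume t: "t \<in> {-3..3}"
  have "s n = 3" using n by (simp add: s_def)
  then show "\<bar>g (n - 1) t - f t\<bar> \<le> e" using app[of "n - 1" t] t n by simp
qed


text \<open>The interpolant of \<open>h'\<close> is integrated: the affine part becomes a quadratic,
  whose cost both couplings share, and the ramps become hinges with nonnegative
  coefficients.\<close>

lemma hinge_reduction:
  assumes p: "\<pi> \<in> couplings k" and p0: "\<pi>0 \<in> couplings k"
    and hs: "\<And>s. s \<in> {-3..3} \<Longrightarrow> s \<noteq> 0 \<Longrightarrow> cost (hinge s) \<pi>0 \<le> cost (hinge s) \<pi>"
    and h: "C1_convex_derivative h"
  shows "cost h \<pi>0 \<le> cost h \<pi>"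
proof (rule field_le_epsilon)
  fix e0 :: real assume "e0 > 0"
  \<comment> \<open>The approximation of \<open>h\<close> errs by at most \<open>6 * e\<close> on an
    interval of length 6, and this is paid once for each coupling.\<close>
  define e where "e = e0 / 12"
  have e: "e > 0" using \<open>e0 > 0\<close> by (simp add: e_def)
  from h obtain h' where hd: "\<And>t. t \<in> {-3..3} \<Longrightarrow> (h has_real_derivative h' t) (at t within {-3..3})"
    and hc: "continuous_on {-3..3} h'" and cv: "convex_on {-3..3} h'"
    unfolding C1_convex_derivative_def by blast
  have h0: "continuous_on {-3..3} h" using hd by (rule DERIV_continuous_on)
  have "uniformly_continuous_on {-3..3} h'" by (rule compact_uniformly_continuous[OF hc]) simp
  then obtain d where d: "d > 0" "\<And>x y. x \<in> {-3..3} \<Longrightarrow> y \<in> {-3..3} \<Longrightarrow> dist y x < d \<Longrightarrow> dist (h' y) (h' x) < e"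
    using e unfolding uniformly_continuous_on_def by metis
  obtain n0 :: nat where n0: "6 / d < n0" using reals_Archimedean2 by blast
  \<comment> \<open>An odd number of cells keeps \<open>0\<close> from being a knot.\<close>
  define n where "n = 2 * n0 + 1"
  have n: "n \<ge> 1" "odd n" by (auto simp: n_def)
  have nd: "6 / n < d"
  proof -
    have "6 / d < n" using n0 by (simp add: n_def)
    then show ?thesis using d(1) n(1) by (simp add: field_simps)
  qed
  have u: "\<bar>h' x - h' y\<bar> \<le> e" if "x \<in> {-3..3}" "y \<in> {-3..3}" "\<bar>x - y\<bar> \<le> 6 / n" for x y
    using d(2)[of y x] that nd by (auto simp: dist_real_def)
  define s where "s = (\<lambda>i. -3 + 6 * real i / n)"
  define m where "m = (\<lambda>i. (h' (s (Suc i)) - h' (s i)) * n / 6)"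
  define c where "c = (\<lambda>i. m i - m (i - 1))"
  define g where "g = (\<lambda>t. h' (-3) + m 0 * (t + 3) + (\<Sum>i\<in>{1..n - 1}. c i * max (t - s i) 0))"
  have cpos: "c i \<ge> 0" if "i \<in> {1..n - 1}" for i
    unfolding c_def m_def s_def
    by (rule convex_interpolation(1)[OF cv n(1) u]) (use that n in auto)
  have ci: "\<bar>g t - h' t\<bar> \<le> e" if "t \<in> {-3..3}" for t
    unfolding g_def c_def m_def s_def
    by (rule convex_interpolation(2)[OF cv n(1) u that])
  \<comment> \<open>This is \<open>h (-3) + h' (-3) * (t + 3) + m 0 * (t + 3)\<^sup>2 / 2\<close>
    expanded, so the approximation agrees with \<open>h\<close> at \<open>-3\<close>.\<close>
  define q where "q = (\<lambda>t::real. (h (-3) + h' (-3) * 3 + m 0 * 9 / 2) + (h' (-3) + 3 * m 0) * t + m 0 / 2 * t\<^sup>2)"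
  define h0 where "h0 = (\<lambda>t. q t + (\<Sum>i\<in>{1..n - 1}. c i * hinge (s i) t))"
  have qc: "continuous_on {-3..3} q" unfolding q_def by (intro continuous_intros)
  have hc0: "continuous_on {-3..3} h0" unfolding h0_def by (intro continuous_intros qc)
  have sm: "s i \<in> {-3..3}" "s i \<noteq> 0" if "i \<in> {1..n - 1}" for i
  proof -
    have "i < n" using that n by auto
    then have "6 * real i \<le> 6 * real n" by simp
    then show "s i \<in> {-3..3}" using n(1) by (auto simp: s_def divide_simps)
    show "s i \<noteq> 0"
    proof
      assume "s i = 0"
      then have "2 * real i = real n" using n(1) by (simp add: s_def field_simps)
      then have "real (2 * i) = real n" by simp
      then have "2 * i = n" by (simp only: of_nat_eq_iff)
      then show False using n(2) by auto
    qed
  qed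
  have h0_3: "h0 (-3) = h (-3)"
  proof -
    have "hinge (s i) (-3) = 0" if "i \<in> {1..n - 1}" for i using sm[OF that] by (auto simp: hinge_def)
    then show ?thesis by (simp add: h0_def q_def algebra_simps)
  qed
  have h0d: "(h0 has_real_derivative g t) (at t within {-3..3})" for t
    unfolding h0_def q_def g_def
    by (auto intro!: derivative_eq_intros hinge_deriv DERIV_sum simp: algebra_simps)
  have close: "\<bar>h t - h0 t\<bar> \<le> 6 * e" if t: "t \<in> {-3..3}" for t
  proof -
    have "norm ((h t - h0 t) - (h (-3) - h0 (-3))) \<le> e * norm (t - (-3))"
    proof (rule field_differentiable_bound[where S = "{-3..3}" and f' = "\<lambda>t. h' t - g t"])
      show "((\<lambda>t. h t - h0 t) has_real_derivative h' z - g z) (at z within {-3..3})" if "z \<in> {-3..3}" for z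
        by (intro DERIV_diff hd h0d that)
      show "norm (h' z - g z) \<le> e" if "z \<in> {-3..3}" for z using ci[OF that] by (simp add: abs_minus_commute)
    qed (use t in auto)
    also have "\<dots> \<le> e * 6" using t e by (intro mult_left_mono) auto
    finally show ?thesis using h0_3 by simp
  qed
  have "cost h \<pi>0 \<le> cost h0 \<pi>0 + 6 * e"
    by (rule cost_diff_le[OF p0 h0 hc0]) (use close e in \<open>auto simp: abs_le_iff algebra_simps\<close>)
  also have "cost h0 \<pi>0 = cost q \<pi>0 + (\<Sum>i\<in>{1..n - 1}. c i * cost (hinge (s i)) \<pi>0)"
    unfolding h0_def by (rule cost_sum_hinges[OF p0 qc])
  also have "\<dots> \<le> cost q \<pi> + (\<Sum>i\<in>{1..n - 1}. c i * cost (hinge (s i)) \<pi>)"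
    unfolding q_def cost_quadratic[OF p p0]
    by (intro add_mono order_refl sum_mono mult_left_mono cpos hs sm)
  also have "\<dots> = cost h0 \<pi>"
    unfolding h0_def by (rule cost_sum_hinges[OF p qc, symmetric])
  also have "cost h0 \<pi> \<le> cost h \<pi> + 6 * e"
    by (rule cost_diff_le[OF p hc0 h0]) (use close e in \<open>auto simp: abs_le_iff algebra_simps\<close>)
  finally show "cost h \<pi>0 \<le> cost h \<pi> + e0" by (simp add: e_def)
qed

lemma V_eq:
  assumes p0: "\<pi>0 \<in> couplings k"
    and hs: "\<And>s \<pi>. s \<in> {-3..3} \<Longrightarrow> s \<noteq> 0 \<Longrightarrow> \<pi> \<in> couplings k \<Longrightarrow> cost (hinge s) \<pi>0 \<le> cost (hinge s) \<pi>"
    and h: "C1_convex_derivative h"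
  shows "V k h = ereal (cost h \<pi>0)"
  unfolding V_def
proof (rule INF_eqI)
  show "ereal (cost h \<pi>0) \<le> ereal (cost h \<pi>)" if "\<pi> \<in> couplings k" for \<pi>
    using hinge_reduction[OF that p0 hs h] that by simp
qed (use p0 in auto)

section \<open>The case \<open>k = 1\<close>\<close>

lemma coupling_1:
  defines "\<pi>1 \<equiv> tg (\<lambda>x. x - 1) (\<lambda>x. x + 1) (\<lambda>_. 1/2)"
  shows "\<pi>1 \<in> couplings 1" "two_graph (\<lambda>x. x - 1) (\<lambda>x. x + 1) (\<lambda>_. 1/2) \<pi>1"
    "AE p in \<pi>1. fst p \<in> {-1..1} \<and> (snd p = fst p - 1 \<or> snd p = fst p + 1)"
proof -
  have cdf: "(LINT x:{-1..1}|lborel. (1 - 1/2 :: real) * indicator {..c} (x - 1) + 1/2 * indicator {..c} (x + 1)) = (c + 2) / 2"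
    if c: "c \<in> {-2..2}" for c :: real
  proof -
    have "(LINT x:{-1..1}|lborel. (1 - 1/2 :: real) * indicator {..c} (x - 1) + 1/2 * indicator {..c} (x + 1))
      = (\<integral>x. (1/2 :: real) * indicator ({-1..1} \<inter> {..c + 1}) x + 1/2 * indicator ({-1..1} \<inter> {..c - 1}) x \<partial>lborel)"
      unfolding set_lebesgue_integral_def by (intro Bochner_Integration.integral_cong) (auto simp: indicator_def)
    also have "\<dots> = 1/2 * measure lborel ({-1..1} \<inter> {..c + 1}) + 1/2 * measure lborel ({-1..1} \<inter> {..c - 1})"
      by (subst Bochner_Integration.integral_add)
        (auto intro!: integrable_mult_right integrable_real_indicator emeasure_bounded_finite bounded_Int)
    also have "\<dots> = (c + 2) / 2"
    proof (cases "c \<le> 0")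
      case True
      then have "{-1..1} \<inter> {..c + 1} = {-1..c + 1}" using c by auto
      moreover have "measure lborel ({-1..1} \<inter> {..c - 1}) = 0"
      proof -
        have "{-1..1} \<inter> {..c - 1} = (if c = 0 then {-1} else {})" using True c by (auto simp: min_def)
        then show ?thesis by auto
      qed
      ultimately show ?thesis using c True by simp
    next
      case False
      then have "{-1..1} \<inter> {..c + 1} = {-1..1}" "{-1..1} \<inter> {..c - 1} = {-1..c - 1}" using c by auto
      then show ?thesis using c False by simp
    qed
    finally show ?thesis .
  qed
  have m: "(\<lambda>x::real. x - 1) \<in> borel_measurable borel" "(\<lambda>x::real. x + 1) \<in> borel_measurable borel"
    "(\<lambda>_. 1/2) \<in> borel_measurable (borel :: real measure)" by simp_all
  show "\<pi>1 \<in> couplings 1" "two_graph (\<lambda>x. x - 1) (\<lambda>x. x + 1) (\<lambda>_. 1/2) \<pi>1"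
    "AE p in \<pi>1. fst p \<in> {-1..1} \<and> (snd p = fst p - 1 \<or> snd p = fst p + 1)"
    unfolding \<pi>1_def
    by (rule tg_coupling[OF m _ _ _ _ _ cdf, where k = 1]; simp add: field_simps)+
qed

text \<open>The displacement has mean zero under every coupling, so the linear term contributes
  nothing.\<close>

lemma affine_cost:
  assumes p: "\<pi> \<in> couplings k" and h: "continuous_on {-3..3} h"
    and ae: "AE p in \<pi>. h (snd p - fst p) = a + b * (snd p - fst p)"
  shows "cost h \<pi> = a"
proof -
  note d = dual_value[OF p, of "\<lambda>_. a" "\<lambda>_. 0" "\<lambda>_. b" "\<bar>a\<bar> + \<bar>b\<bar>"]
  interpret mu: prob_space mu by (rule prob_space_mu)
  have "cost h \<pi> = (\<integral>p. a + 0 + b * (snd p - fst p) \<partial>\<pi>)"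
    unfolding cost_integrable(2)[OF p h]
  proof (rule integral_cong_AE)
    show "AE p in \<pi>. indicator {-3..3} (snd p - fst p) * h (snd p - fst p) = a + 0 + b * (snd p - fst p)"
      using ae coupling_facts(6,7)[OF p] by eventually_elim (auto simp: indicator_def)
    show "(\<lambda>p. indicator {-3..3} (snd p - fst p) * h (snd p - fst p)) \<in> borel_measurable \<pi>"
      using cost_integrable(1)[OF p h] by (rule borel_measurable_integrable)
    show "(\<lambda>p. a + 0 + b * (snd p - fst p)) \<in> borel_measurable \<pi>"
      using d(1) by (auto dest: borel_measurable_integrable)
  qed
  also have "\<dots> = a" using d(2) mu.prob_space by simp
  finally show ?thesis .
qed

text \<open>This parabola is tangent to the hinge at \<open>1\<close> and meets it again at
  \<open>-1\<close>, the two displacements that occur for \<open>k = 1\<close>. To the right of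
  \<open>s\<close> the difference is a multiple of a square; to the left the parabola is
  nonpositive.\<close>

lemma hinge_parabola:
  assumes "-1 < s" "s < 1" "t \<ge> -1"
  shows "(1 - s) * (3 + s) / 8 * (t - 1)\<^sup>2 + (1 - s) * (t - 1) + (1 - s)\<^sup>2 / 2 \<le> hinge s t"
proof (cases "t \<ge> s")
  case True
  have "hinge s t - ((1 - s) * (3 + s) / 8 * (t - 1)\<^sup>2 + (1 - s) * (t - 1) + (1 - s)\<^sup>2 / 2) = (1 + s)\<^sup>2 * (t - 1)\<^sup>2 / 8"
    using True by (simp add: hinge_def power2_eq_square field_simps)
  moreover have "\<dots> \<ge> 0" by simp
  ultimately show ?thesis by linarith
next
  case False
  have eq: "(1 - s) * (3 + s) / 8 * (t - 1)\<^sup>2 + (1 - s) * (t - 1) + (1 - s)\<^sup>2 / 2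
      = (1 - s) / 8 * ((t + 1) * ((3 + s) * (t - 1) + 2 * (1 - s)))"
    by (simp add: power2_eq_square field_simps)
  have "(3 + s) * (t - 1) + 2 * (1 - s) \<le> (3 + s) * (s - 1) + 2 * (1 - s)"
    using False assms by (simp add: mult_left_mono)
  also have "\<dots> = - ((1 - s) * (1 + s))" by (simp add: algebra_simps)
  also have "\<dots> \<le> 0" using assms by simp
  finally have f: "(t + 1) * ((3 + s) * (t - 1) + 2 * (1 - s)) \<le> 0"
    by (intro mult_nonneg_nonpos) (use assms in auto)
  have "(1 - s) / 8 * ((t + 1) * ((3 + s) * (t - 1) + 2 * (1 - s))) \<le> 0"
    by (rule mult_nonneg_nonpos[OF _ f]) (use assms in auto)
  moreover have "hinge s t \<ge> 0" by (simp add: hinge_def)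
  ultimately show ?thesis unfolding eq by linarith
qed

lemma V_1:
  defines "\<pi>1 \<equiv> tg (\<lambda>x. x - 1) (\<lambda>x. x + 1) (\<lambda>_. 1/2)"
  assumes h: "C1_convex_derivative h"
  shows "V 1 h = ereal (cost h \<pi>1)" "cost h \<pi>1 = (h (-1) + h 1) / 2"
proof -
  note c = coupling_1[folded \<pi>1_def]
  have aff: "cost f \<pi>1 = (f (-1) + f 1) / 2" if f: "continuous_on {-3..3} f" for f
  proof (rule affine_cost[OF c(1) f, where b = "(f 1 - f (-1)) / 2"])
    show "AE p in \<pi>1. f (snd p - fst p) = (f (- 1) + f 1) / 2 + (f 1 - f (- 1)) / 2 * (snd p - fst p)"
      using c(3) by eventually_elim (auto simp: field_simps)
  qed
  have hc: "continuous_on {-3..3} h"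
    using h unfolding C1_convex_derivative_def by (blast intro: DERIV_continuous_on)
  show "cost h \<pi>1 = (h (-1) + h 1) / 2" by (rule aff[OF hc])
  \<comment> \<open>A quadratic minorant with contact at \<open>-1\<close> and \<open>1\<close>
    certifies optimality, because its cost is common to all couplings.\<close>
  have par: "cost (hinge s) \<pi>1 \<le> cost (hinge s) \<pi>"
    if p: "\<pi> \<in> couplings 1" and le: "\<And>t. t \<ge> -1 \<Longrightarrow> t \<le> 3 \<Longrightarrow> a + b * t + d * t\<^sup>2 \<le> hinge s t"
      and e: "a + b + d = hinge s 1" "a - b + d = hinge s (-1)" for \<pi> s a b d
  proof -
    let ?q = "\<lambda>t. a + b * t + d * t\<^sup>2"
    have qc: "continuous_on {-3..3} ?q" by (intro continuous_intros)
    have "cost (hinge s) \<pi>1 = cost ?q \<pi>1" using e by (simp add: aff[OF hinge_continuous] aff[OF qc])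
    also have "\<dots> = cost ?q \<pi>" by (rule cost_quadratic[OF c(1) p])
    also have "\<dots> \<le> cost (hinge s) \<pi>"
      unfolding cost_integrable(2)[OF p qc] cost_integrable(2)[OF p hinge_continuous]
    proof (rule integral_mono_AE[OF cost_integrable(1)[OF p qc] cost_integrable(1)[OF p hinge_continuous]])
      show "AE x in \<pi>. indicat_real {- 3..3} (snd x - fst x) * (a + b * (snd x - fst x) + d * (snd x - fst x)\<^sup>2)
         \<le> indicat_real {- 3..3} (snd x - fst x) * hinge s (snd x - fst x)"
        using coupling_facts(6-8)[OF p] by eventually_elim (auto intro!: mult_left_mono le)
    qed
    finally show ?thesis .
  qed
  show "V 1 h = ereal (cost h \<pi>1)"
  proof (rule V_eq[OF c(1) _ h])
    fix s :: real and \<pi> assume p: "\<pi> \<in> couplings 1"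
    consider "s \<le> -1" | "-1 < s" "s < 1" | "s \<ge> 1" by linarith
    then show "cost (hinge s) \<pi>1 \<le> cost (hinge s) \<pi>"
    proof cases
      case 1
      show ?thesis by (rule par[OF p, of "s\<^sup>2 / 2" "-s" "1/2"])
        (use 1 in \<open>auto simp: hinge_def power2_eq_square field_simps\<close>)
    next
      case 3
      show ?thesis by (rule par[OF p, of 0 0 0]) (use 3 in \<open>auto simp: hinge_def\<close>)
    next
      case 2
      define d where "d = (1 - s) * (3 + s) / 8"
      show ?thesis
      proof (rule par[OF p, of "d - (1 - s) + (1 - s)\<^sup>2 / 2" "(1 - s) - 2 * d" d])
        fix t :: real assume "t \<ge> -1"
        from hinge_parabola[OF 2 this]
        show "d - (1 - s) + (1 - s)\<^sup>2 / 2 + (1 - s - 2 * d) * t + d * t\<^sup>2 \<le> hinge s t"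
          unfolding d_def[symmetric] by (simp add: power2_eq_square algebra_simps)
      qed (use 2 in \<open>auto simp: hinge_def d_def power2_eq_square field_simps\<close>)
    qed
  qed
qed

section \<open>The mass coordinate\<close>

lemma DERIV_z1:
  assumes "k > 1" "e < k"
  shows "(z1 k has_real_derivative (k + e) / (k - e)) (at e)"
proof -
  have l: "((\<lambda>e. ln (k - e)) has_real_derivative (-1) / (k - e)) (at e)"
    using assms by (auto intro!: derivative_eq_intros)
  have "((\<lambda>e. 2 - e + 2 * k * (ln (k - 1) - ln (k - e))) has_real_derivative (0 - 1 + 2 * k * (0 - (-1) / (k - e)))) (at e)"
    by (intro DERIV_add DERIV_diff DERIV_const DERIV_ident DERIV_cmult l)
  moreover have "0 - 1 + 2 * k * (0 - (-1) / (k - e)) = (k + e) / (k - e)"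
    using assms by (simp add: field_simps)
  ultimately have "((\<lambda>e. 2 - e + 2 * k * (ln (k - 1) - ln (k - e))) has_real_derivative (k + e) / (k - e)) (at e)"
    by simp
  then show ?thesis
    by (rule DERIV_cong_ev[THEN iffD1, rotated -1, OF _ refl _ refl])
       (use assms eventually_nhds_in_open[of "{..<k}" e] in \<open>auto simp: z1_def ln_div elim!: eventually_mono\<close>)
qed

lemma DERIV_A1:
  assumes "k > 1" "e < k"
  shows "(A1 k has_real_derivative y1 k e) (at e)"
proof -
  have l: "((\<lambda>e. ln (k - e)) has_real_derivative (-1) / (k - e)) (at e)"
    using assms by (auto intro!: derivative_eq_intros)
  have s: "((\<lambda>e. k - e) has_real_derivative 0 - 1) (at e)"
    by (intro DERIV_diff DERIV_const DERIV_ident)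
  have q: "((\<lambda>e. e\<^sup>2 / 2) has_real_derivative e) (at e)"
    by (auto intro!: derivative_eq_intros)
  have "(A1 k has_real_derivative
      ((2 - k) * 1 - e + 2 * k * (1 * ln (k - 1) + ((0 - 1) * ln (k - e) + (-1) / (k - e) * (k - e)) - (0 - 1)))) (at e)"
    unfolding A1_def
    by (intro DERIV_add DERIV_diff DERIV_cmult DERIV_cmult_right DERIV_ident DERIV_mult s l q)
  moreover have "(2 - k) * 1 - e + 2 * k * (1 * ln (k - 1) + ((0 - 1) * ln (k - e) + (-1) / (k - e) * (k - e)) - (0 - 1)) = y1 k e"
    using assms by (simp add: y1_def z1_def ln_div algebra_simps)
  ultimately show ?thesis by simp
qed

text \<open>\<open>yc\<close> continues \<open>y1\<close> beyond \<open>1\<close>: it pushes \<open>de/4\<close> onto the part of \<open>nu\<close> that is not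
  filled by the points \<open>x - k\<close> with \<open>k - 2 \<le> x \<le> 1\<close>.\<close>

definition yc :: "real \<Rightarrow> real \<Rightarrow> real" where
  "yc k e = (if e \<le> 1 then y1 k e else e - k)"

text \<open>An antiderivative of \<open>yc\<close>: \<open>ac k e' - ac k e\<close> is four times
  the first moment of the free mass between the coordinates \<open>e\<close> and
  \<open>e'\<close>.\<close>

definition ac :: "real \<Rightarrow> real \<Rightarrow> real" where
  "ac k e = (if e \<le> 1 then A1 k e else A1 k 1 + ((e - k)\<^sup>2 - (1 - k)\<^sup>2) / 2)"

lemma z1_1: "k > 1 \<Longrightarrow> z1 k 1 = 1"
  by (simp add: z1_def)

lemma DERIV_ac:
  assumes k: "k > 1"
  shows "(ac k has_real_derivative yc k e) (at e)"
proof -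
  have p: "((\<lambda>e. A1 k 1 + ((e - k)\<^sup>2 - (1 - k)\<^sup>2) / 2) has_real_derivative (e - k)) (at e)" for e
    by (auto intro!: derivative_eq_intros)
  consider "e < 1" | "e > 1" | "e = 1" by linarith
  then show ?thesis
  proof cases
    case 1
    have "(ac k has_real_derivative y1 k e) (at e)"
      by (rule DERIV_cong_ev[THEN iffD1, OF refl _ refl DERIV_A1])
         (use 1 k eventually_nhds_in_open[of "{..<1}" e] in \<open>auto simp: ac_def elim!: eventually_mono\<close>)
    then show ?thesis using 1 by (simp add: yc_def)
  next
    case 2
    have "(ac k has_real_derivative e - k) (at e)"
      by (rule DERIV_cong_ev[THEN iffD1, OF refl _ refl p])
         (use 2 k eventually_nhds_in_open[of "{1<..}" e] in \<open>auto simp: ac_def elim!: eventually_mono\<close>)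
    then show ?thesis using 2 by (simp add: yc_def)
  next
    case 3
    have y: "y1 k 1 = 1 - k" using k by (simp add: y1_def z1_1)
    have "((\<lambda>y. (ac k y - ac k 1) / (y - 1)) \<longlongrightarrow> 1 - k) (at 1)"
      unfolding filterlim_at_split
    proof
      have "((\<lambda>y. (A1 k y - A1 k 1) / (y - 1)) \<longlongrightarrow> 1 - k) (at_left 1)"
        using DERIV_A1[of k 1] k y by (auto simp: has_field_derivative_iff filterlim_at_split)
      then show "((\<lambda>y. (ac k y - ac k 1) / (y - 1)) \<longlongrightarrow> 1 - k) (at_left 1)"
        by (rule Lim_transform_eventually) (auto simp: ac_def eventually_at_filter)
      have "((\<lambda>y. (A1 k 1 + ((y - k)\<^sup>2 - (1 - k)\<^sup>2) / 2 - (A1 k 1 + ((1 - k)\<^sup>2 - (1 - k)\<^sup>2) / 2)) / (y - 1)) \<longlongrightarrow> 1 - k) (at_right 1)"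
        using p[of 1] unfolding has_field_derivative_iff filterlim_at_split by blast
      then show "((\<lambda>y. (ac k y - ac k 1) / (y - 1)) \<longlongrightarrow> 1 - k) (at_right 1)"
        by (rule Lim_transform_eventually) (auto simp: ac_def eventually_at_filter)
    qed
    then show ?thesis using 3 y by (simp add: has_field_derivative_iff yc_def)
  qed
qed

lemma z1_slope:
  assumes k: "k > 1" and e: "0 \<le> e" "e \<le> e'" "e' < k"
  shows "z1 k e' - z1 k e \<ge> e' - e"
proof -
  have "z1 k e - e \<le> z1 k e' - e'"
  proof (rule DERIV_nonneg_imp_nondecreasing[OF e(2)])
    fix x assume x: "e \<le> x" "x \<le> e'"
    have "((\<lambda>x. z1 k x - x) has_real_derivative (k + x) / (k - x) - 1) (at x)"
      by (rule derivative_eq_intros DERIV_z1 refl | use x k e in auto)+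
    moreover have "(k + x) / (k - x) - 1 \<ge> 0" using x k e by (simp add: field_simps)
    ultimately show "\<exists>y. ((\<lambda>x. z1 k x - x) has_real_derivative y) (at x) \<and> 0 \<le> y" by blast
  qed
  then show ?thesis by linarith
qed

lemma z1_slope_strict:
  assumes k: "k > 1" and e: "0 \<le> e" "e < e'" "e' < k"
  shows "z1 k e < z1 k e'"
  using z1_slope[OF k e(1) less_imp_le[OF e(2)] e(3)] e by linarith

text \<open>The free part has density at most 1/4, the density of \<open>nu\<close>. This is the
  quantitative fact behind the monotonicity of \<open>L\<close> and \<open>R\<close>.\<close>

lemma yc_slope:
  assumes k: "k > 1" and e: "0 \<le> e" "e \<le> e'"
  shows "yc k e' - yc k e \<ge> e' - e"
proof -
  have y1: "y1 k 1 = 1 - k" using k by (simp add: y1_def z1_1)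
  consider "e' \<le> 1" | "e > 1" | "e \<le> 1" "e' > 1" by linarith
  then show ?thesis
  proof cases
    case 1
    then show ?thesis using z1_slope[OF k e] k e by (simp add: yc_def y1_def)
  next
    case 2 then show ?thesis using e by (simp add: yc_def)
  next
    case 3 then show ?thesis using z1_slope[OF k e(1) 3(1)] k y1 by (simp add: yc_def y1_def)
  qed
qed

lemma yc_less: "k > 1 \<Longrightarrow> 0 \<le> e \<Longrightarrow> e < e' \<Longrightarrow> yc k e < yc k e'"
  using yc_slope[of k e e'] by linarith

lemma yc_le: "k > 1 \<Longrightarrow> 0 \<le> e \<Longrightarrow> e \<le> e' \<Longrightarrow> yc k e \<le> yc k e'"
  using yc_slope[of k e e'] by linarith

lemma yc_le_diff: "k > 1 \<Longrightarrow> 0 \<le> e \<Longrightarrow> yc k e \<le> e - k"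
  using yc_slope[of k e 1] by (cases "e \<le> 1") (auto simp: yc_def y1_def z1_1)

lemma continuous_yc: assumes k: "k > 1" shows "continuous_on S (yc k)"
proof -
  have z: "continuous_on {..1} (y1 k)"
    unfolding y1_def using k
    by (intro continuous_intros DERIV_continuous_on[where f = "z1 k" and D = "\<lambda>e. (k + e) / (k - e)"])
       (auto intro!: has_field_derivative_at_within[OF DERIV_z1])
  have "continuous_on ({..1} \<union> {1..}) (yc k)"
    unfolding yc_def
    by (rule continuous_on_cases) (use z k in \<open>auto intro!: continuous_intros simp: y1_def z1_1\<close>)
  moreover have "({..1} \<union> {1..}) = (UNIV :: real set)" by auto
  ultimately show ?thesis using continuous_on_subset[of UNIV "yc k" S] by auto
qed

text \<open>The slope bound makes \<open>ac k\<close> strongly convex with modulus 1 on nonnegative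
  coordinates.\<close>

lemma ac_lower:
  assumes k: "k > 1" and e: "0 \<le> e" "e \<le> e'"
  shows "ac k e' - ac k e \<ge> yc k e * (e' - e) + (e' - e)\<^sup>2 / 2"
proof -
  let ?f = "\<lambda>x. ac k x - yc k e * (x - e) - (x - e)\<^sup>2 / 2"
  have "?f e \<le> ?f e'"
  proof (rule DERIV_nonneg_imp_nondecreasing[OF e(2)])
    fix x assume x: "e \<le> x" "x \<le> e'"
    have "(?f has_real_derivative yc k x - yc k e - (x - e)) (at x)"
      by (auto intro!: derivative_eq_intros DERIV_ac[OF k] simp: field_simps)
    then show "\<exists>y. (?f has_real_derivative y) (at x) \<and> 0 \<le> y"
      using yc_slope[OF k e(1) x(1)] by force
  qed
  then show ?thesis by simp
qed

lemma ac_upper: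
  assumes k: "k > 1" and e: "0 \<le> e" "e \<le> e'"
  shows "ac k e' - ac k e \<le> yc k e' * (e' - e) - (e' - e)\<^sup>2 / 2"
proof -
  let ?f = "\<lambda>x. (e' - x)\<^sup>2 / 2 - ac k x - yc k e' * (e' - x)"
  have "?f e \<le> ?f e'"
  proof (rule DERIV_nonneg_imp_nondecreasing[OF e(2)])
    fix x assume x: "e \<le> x" "x \<le> e'"
    have "(?f has_real_derivative yc k e' - yc k x - (e' - x)) (at x)"
      by (auto intro!: derivative_eq_intros DERIV_ac[OF k] simp: field_simps)
    then show "\<exists>y. (?f has_real_derivative y) (at x) \<and> 0 \<le> y"
      using yc_slope[OF k _ x(2)] x e by force
  qed
  then show ?thesis by simp
qed

section \<open>The left part: sources in \<open>[-1, b]\<close>\<close>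

locale curtain =
  fixes k db :: real
  assumes k1: "1 < k" and k3: "k \<le> 3" and db0: "0 < db" and db1: "db \<le> 1"
    and zdb: "z1 k db = k - 2" and Rb1: "1 < db + 2 * (k - 1)"
begin

abbreviation b where "b \<equiv> k - 2"
abbreviation Y where "Y \<equiv> yc k"
abbreviation A where "A \<equiv> ac k"

lemma Ydb: "Y db = -2"
  using db1 zdb by (simp add: yc_def y1_def)

definition es :: real where "es = (SOME e. db < e \<and> e \<le> 2 \<and> Y e = -1)"

lemma es: "db < es" "es \<le> 2" "Y es = -1"
proof -
  have "\<exists>e. db \<le> e \<and> e \<le> 2 \<and> Y e = -1"
    using k1 k3 db1 by (intro IVT') (auto simp: Ydb continuous_yc[OF k1], simp add: yc_def)
  then obtain e where e: "db \<le> e" "e \<le> 2" "Y e = -1" by blast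
  moreover have "e \<noteq> db" using e Ydb by auto
  ultimately have "\<exists>e. db < e \<and> e \<le> 2 \<and> Y e = -1" by (intro exI[of _ e]) auto
  from someI_ex[OF this] show "db < es" "es \<le> 2" "Y es = -1" by (auto simp: es_def)
qed

text \<open>The mass \<open>(x + 1) / 2\<close> needs a coordinate interval of length
  \<open>2 * (x + 1)\<close>. Four times the first moment of \<open>mu\<close> on
  \<open>[-1, x]\<close> is \<open>x\<^sup>2 - 1\<close>, so \<open>F x l = x\<^sup>2 - 1\<close> is
  the barycentre condition.\<close>

definition F where "F x l = A (l + 2 * (x + 1)) - A l"

lemma F_strict:
  assumes "-1 < x" "db \<le> l" "l < l'"
  shows "F x l < F x l'"
proof (rule DERIV_pos_imp_increasing[OF assms(3)])
  fix y assume y: "l \<le> y" "y \<le> l'"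
  have "(F x has_real_derivative Y (y + 2 * (x + 1)) - Y y) (at y)"
    unfolding F_def by (rule derivative_eq_intros DERIV_ac refl k1 DERIV_chain2[where f = A] | simp)+
  moreover have "Y (y + 2 * (x + 1)) - Y y > 0" using yc_less[OF k1, of y "y + 2 * (x + 1)"] assms y db0 by simp
  ultimately show "\<exists>z. (F x has_real_derivative z) (at y) \<and> 0 < z" by blast
qed

lemma A1_diff:
  assumes "e < k"
  shows "A1 k 1 - A1 k e = (2 - k) * (1 - e) - (1 - e\<^sup>2) / 2 + 2 * k * (k - e) * ln ((k - 1) / (k - e)) + 2 * k * (1 - e)"
proof -
  have l: "ln ((k - 1) / (k - e)) = ln (k - 1) - ln (k - e)" using assms k1 by (simp add: ln_div)
  show ?thesis unfolding l A1_def by (simp add: algebra_simps power2_eq_square add_divide_distrib diff_divide_distrib)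
qed

text \<open>The two parts fit together: what \<open>[-1, b]\<close> fills begins exactly at the
  lower end \<open>db\<close> of the free part. The equation \<open>zdb\<close> removes the
  logarithm from the moment.\<close>

lemma F_b: "F b db = b\<^sup>2 - 1"
proof -
  have l: "2 * k * ln ((k - 1) / (k - db)) = k - 4 + db" using zdb by (simp add: z1_def)
  have "2 * k * (k - db) * ln ((k - 1) / (k - db)) = (k - db) * (k - 4 + db)"
    using arg_cong[OF l, of "\<lambda>t. (k - db) * t"] by (simp add: algebra_simps)
  then have d: "A1 k 1 - A1 k db = (2 - k) * (1 - db) - (1 - db\<^sup>2) / 2 + (k - db) * (k - 4 + db) + 2 * k * (1 - db)"
    using A1_diff[of db] db1 k1 by simp
  have "F b db = (A1 k 1 - A1 k db) + ((db + 2 * (k - 1) - k)\<^sup>2 - (1 - k)\<^sup>2) / 2"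
    using Rb1 db1 by (simp add: F_def ac_def algebra_simps)
  then show ?thesis unfolding d by (simp add: field_simps power2_eq_square)
qed

text \<open>In \<open>\<xi> = x + 1\<close> the difference of the two sides is convex, by the slope
  bound on \<open>yc\<close>, and vanishes at \<open>0\<close> and, by \<open>F_b\<close>, at
  \<open>k - 1\<close>.\<close>

lemma F_db:
  assumes x: "-1 \<le> x" "x \<le> b"
  shows "F x db \<le> x\<^sup>2 - 1"
proof -
  define H where "H = (\<lambda>\<xi>. A (db + 2 * \<xi>) - A db - \<xi>\<^sup>2 + 2 * \<xi>)"
  have cv: "convex_on {0..k - 1} H"
  proof (rule convex_on_realI)
    fix \<xi> assume "\<xi> \<in> {0..k - 1}"
    show "(H has_real_derivative 2 * Y (db + 2 * \<xi>) - 2 * \<xi> + 2) (at \<xi>)"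
      unfolding H_def by (rule derivative_eq_intros DERIV_ac refl k1 DERIV_chain2[where f = A] | simp)+
  next
    fix \<xi> \<xi>' assume "\<xi> \<in> {0..k - 1}" "\<xi>' \<in> {0..k - 1}" "\<xi> \<le> \<xi>'"
    then show "2 * Y (db + 2 * \<xi>) - 2 * \<xi> + 2 \<le> 2 * Y (db + 2 * \<xi>') - 2 * \<xi>' + 2"
      using yc_slope[OF k1, of "db + 2 * \<xi>" "db + 2 * \<xi>'"] db0 by simp
  qed simp
  have H0: "H 0 = 0" by (simp add: H_def)
  have "A (db + 2 * (k - 1)) - A db = b\<^sup>2 - 1" using F_b by (simp add: F_def)
  then have H1: "H (k - 1) = 0" by (simp add: H_def power2_eq_square algebra_simps)
  define t where "t = (x + 1) / (k - 1)"
  have t: "0 \<le> t" "t \<le> 1" using x k1 by (auto simp: t_def field_simps)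
  have "H ((1 - t) *\<^sub>R 0 + t *\<^sub>R (k - 1)) \<le> (1 - t) * H 0 + t * H (k - 1)"
    by (rule convex_onD[OF cv t]) (use k1 in auto)
  then have "H (x + 1) \<le> 0" using H0 H1 k1 by (simp add: t_def)
  then show ?thesis by (simp add: H_def F_def power2_eq_square algebra_simps)
qed

lemma F_es:
  assumes "-1 < x"
  shows "x\<^sup>2 - 1 < F x es"
proof -
  have "F x es \<ge> - (2 * (x + 1)) + (2 * (x + 1))\<^sup>2 / 2"
    using ac_lower[OF k1, of es "es + 2 * (x + 1)"] assms es db0 by (simp add: F_def)
  moreover have "(x + 1)\<^sup>2 > 0" using assms by simp
  ultimately show ?thesis by (simp add: power2_eq_square algebra_simps)
qed

text \<open>At \<open>x = -1\<close> the interval has length zero and every \<open>l\<close> solves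
  the moment equation; the value is set to \<open>es\<close>, the coordinate of the target
  \<open>-1\<close>, which makes \<open>L\<close> continuous.\<close>

definition L where "L x = (if x = -1 then es else SOME l. db \<le> l \<and> F x l = x\<^sup>2 - 1)"
definition R where "R x = L x + 2 * (x + 1)"

lemma L_eq:
  assumes x: "-1 \<le> x" "x \<le> b"
  shows "db \<le> L x" "F x (L x) = x\<^sup>2 - 1"
proof -
  have "\<exists>l. db \<le> l \<and> F x l = x\<^sup>2 - 1"
  proof (cases "x = -1")
    case True then show ?thesis by (intro exI[of _ db]) (simp add: F_def)
  next
    case False
    have c: "continuous_on {db..es} (F x)"
    proof -
      have "(F x has_real_derivative Y (y + 2 * (x + 1)) - Y y) (at y)" for y
        unfolding F_def by (rule derivative_eq_intros DERIV_ac refl k1 DERIV_chain2[where f = A] | simp)+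
      then show ?thesis by (intro DERIV_continuous_on) (auto intro: has_field_derivative_at_within)
    qed
    have "\<exists>l. db \<le> l \<and> l \<le> es \<and> F x l = x\<^sup>2 - 1"
      by (rule IVT') (use F_db[OF x] F_es[of x] False x es c in auto)
    then show ?thesis by blast
  qed
  from someI_ex[OF this] show "db \<le> L x" "F x (L x) = x\<^sup>2 - 1"
    using es by (auto simp: L_def F_def)
qed

lemma L_unique:
  assumes "-1 < x" "x \<le> b" "db \<le> l" "F x l = x\<^sup>2 - 1"
  shows "l = L x"
  using F_strict[of x l "L x"] F_strict[of x "L x" l] L_eq[of x] assms
  by (cases l "L x" rule: linorder_cases) auto

lemma L_m1: "L (-1) = es" "R (-1) = es" by (simp_all add: L_def R_def)

lemma L_b: "L b = db"
  using L_unique[of b db] F_b k1 by simp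

lemma L_less_es:
  assumes "-1 < x" "x \<le> b" shows "L x < es"
  using F_strict[of x es "L x"] F_es[of x] L_eq[of x] assms es
  by (cases es "L x" rule: linorder_cases) auto

lemma L_le_es: "-1 \<le> x \<Longrightarrow> x \<le> b \<Longrightarrow> L x \<le> es"
  using L_less_es[of x] L_m1 by (cases "x = -1") auto

definition D where "D x = Y (L x)"
definition U where "U x = Y (R x)"

lemma AR: "-1 \<le> x \<Longrightarrow> x \<le> b \<Longrightarrow> A (R x) - A (L x) = x\<^sup>2 - 1"
  using L_eq by (simp add: F_def R_def)

lemma DU_m1: "D (-1) = -1" "U (-1) = -1"
  by (simp_all add: D_def U_def L_m1 es)

lemma D_b: "D b = -2" by (simp add: D_def L_b Ydb)

lemma LR: "-1 \<le> x \<Longrightarrow> L x \<le> R x" "-1 < x \<Longrightarrow> L x < R x"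
  by (auto simp: R_def)

lemma D_le: "-1 \<le> x \<Longrightarrow> x \<le> b \<Longrightarrow> D x \<le> -1"
  using yc_le[OF k1, of "L x" es] L_le_es[of x] L_eq[of x] es db0 by (simp add: D_def)

lemma D_less: "-1 < x \<Longrightarrow> x \<le> b \<Longrightarrow> D x < -1"
  using yc_less[OF k1, of "L x" es] L_less_es[of x] L_eq[of x] es db0 by (simp add: D_def)

text \<open>If \<open>U x \<le> x\<close>, the filled interval has too small a moment: the upper
  bound on \<open>ac\<close> leaves a deficit of \<open>(x + 1)\<^sup>2\<close>.\<close>

lemma U_gt: assumes "-1 < x" "x \<le> b" shows "x < U x"
proof (rule ccontr)
  assume n: "\<not> x < U x"
  have "x\<^sup>2 - 1 \<le> U x * (2 * (x + 1)) - (2 * (x + 1))\<^sup>2 / 2"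
    using ac_upper[OF k1, of "L x" "R x"] AR[of x] L_eq[of x] LR[of x] assms db0
    by (simp add: U_def R_def)
  also have "\<dots> \<le> x * (2 * (x + 1)) - (2 * (x + 1))\<^sup>2 / 2"
    using n assms by (intro diff_right_mono mult_right_mono) auto
  finally have "(x + 1)\<^sup>2 \<le> 0" by (simp add: power2_eq_square algebra_simps)
  then show False using assms by simp
qed

lemma U_ge: "-1 \<le> x \<Longrightarrow> x \<le> b \<Longrightarrow> x \<le> U x"
  using U_gt[of x] DU_m1 by (cases "x = -1") auto

text \<open>Placing the mass of \<open>[x, x']\<close> entirely above \<open>R x\<close> gives too
  large a moment, because \<open>U x \<ge> x\<close> and the free density is at most 1/4. So the
  interval for \<open>x'\<close> must also extend below \<open>L x\<close>.\<close>

lemma L_dec: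
  assumes "-1 \<le> x" "x < x'" "x' \<le> b" shows "L x' < L x"
proof -
  define h where "h = x' - x"
  have x': "x' = x + h" by (simp add: h_def)
  have h0: "h > 0" using assms by (simp add: h_def)
  have "A (R x + 2 * h) - A (R x) \<ge> U x * (2 * h) + 2 * h\<^sup>2"
    using ac_lower[OF k1, of "R x" "R x + 2 * h"] L_eq[of x] LR[of x] assms db0 h0
    by (simp add: U_def power_mult_distrib)
  moreover have "F x' (L x) = A (R x + 2 * h) - A (R x) + (x\<^sup>2 - 1)"
    using AR[of x] assms by (simp add: F_def R_def h_def algebra_simps)
  moreover have "x * (2 * h) \<le> U x * (2 * h)"
    using U_ge[of x] assms by (intro mult_right_mono) (auto simp: h_def)
  moreover have "h\<^sup>2 > 0" using assms by (simp add: h_def)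
  moreover have "x'\<^sup>2 = x\<^sup>2 + x * (2 * h) + h\<^sup>2" by (simp add: x' power2_eq_square algebra_simps)
  ultimately have "F x' (L x) > x'\<^sup>2 - 1" by linarith
  then show ?thesis
    using F_strict[of x' "L x" "L x'"] L_eq[of x'] L_eq[of x] assms by (cases "L x" "L x'" rule: linorder_cases) auto
qed

text \<open>The mirror image: placing the new mass entirely below \<open>L x\<close> gives too small
  a moment. If \<open>db\<close> leaves no room for that, the claim is immediate.\<close>

lemma R_inc:
  assumes "-1 \<le> x" "x < x'" "x' \<le> b" shows "R x < R x'"
proof -
  define h where "h = x' - x"
  have x': "x' = x + h" by (simp add: h_def)
  have h0: "h > 0" using assms by (simp add: h_def)
  let ?l = "L x - 2 * h"
  have "?l < L x'"
  proof (cases "?l < db")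
    case True then show ?thesis using L_eq[of x'] assms by linarith
  next
    case False
    have "A (L x) - A ?l \<le> D x * (2 * h) - 2 * h\<^sup>2"
      using ac_upper[OF k1, of ?l "L x"] False assms db0 h0 by (simp add: D_def power_mult_distrib)
    moreover have "F x' ?l = A (L x) - A ?l + (x\<^sup>2 - 1)"
      using AR[of x] assms by (simp add: F_def R_def h_def algebra_simps)
    moreover have "D x * (2 * h) \<le> x * (2 * h)"
      using D_le[of x] assms by (intro mult_right_mono) (auto simp: h_def)
    moreover have "h\<^sup>2 > 0" using assms by (simp add: h_def)
    moreover have "x'\<^sup>2 = x\<^sup>2 + x * (2 * h) + h\<^sup>2" by (simp add: x' power2_eq_square algebra_simps)
    ultimately have "F x' ?l < x'\<^sup>2 - 1" by linarith
    then show ?thesis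
      using F_strict[of x' "L x'" ?l] L_eq[of x'] False assms by (cases ?l "L x'" rule: linorder_cases) auto
  qed
  then show ?thesis by (simp add: R_def h_def)
qed

lemma L_lipschitz:
  assumes "x \<in> {-1..b}" "x' \<in> {-1..b}" shows "\<bar>L x' - L x\<bar> \<le> 2 * \<bar>x' - x\<bar>"
  using L_dec[of x x'] L_dec[of x' x] R_inc[of x x'] R_inc[of x' x] assms
  by (cases x x' rule: linorder_cases) (auto simp: R_def)

lemma L_continuous: "continuous_on {-1..b} L"
  unfolding continuous_on_iff
proof (intro ballI allI impI)
  fix x and e :: real assume x: "x \<in> {-1..b}" and e: "e > 0"
  show "\<exists>d>0. \<forall>x'\<in>{-1..b}. dist x' x < d \<longrightarrow> dist (L x') (L x) < e"
    using L_lipschitz[OF x] e by (intro exI[of _ "e / 2"]) (force simp: dist_real_def)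
qed

lemma R_continuous: "continuous_on {-1..b} R"
  unfolding R_def by (intro continuous_intros L_continuous)

lemma D_continuous: "continuous_on {-1..b} D"
  unfolding D_def by (rule continuous_on_compose2[OF continuous_yc[OF k1, of UNIV] L_continuous]) simp

lemma U_continuous: "continuous_on {-1..b} U"
  unfolding U_def by (rule continuous_on_compose2[OF continuous_yc[OF k1, of UNIV] R_continuous]) simp

lemma U_inc: "-1 \<le> x \<Longrightarrow> x < x' \<Longrightarrow> x' \<le> b \<Longrightarrow> U x < U x'"
  using R_inc[of x x'] yc_less[OF k1, of "R x" "R x'"] L_eq[of x] LR[of x] db0 by (simp add: U_def)

lemma D_dec: "-1 \<le> x \<Longrightarrow> x < x' \<Longrightarrow> x' \<le> b \<Longrightarrow> D x' < D x"
  using L_dec[of x x'] yc_less[OF k1, of "L x'" "L x"] L_eq[of x'] db0 by (simp add: D_def)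

abbreviation u where "u x \<equiv> U x - x"
abbreviation v where "v x \<equiv> x - D x"

lemma uv_pos: "-1 < x \<Longrightarrow> x \<le> b \<Longrightarrow> u x > 0" "-1 < x \<Longrightarrow> x \<le> b \<Longrightarrow> v x > 0"
  using U_gt[of x] D_less[of x] by auto

text \<open>Implicit differentiation of \<open>AR\<close> with \<open>R = L + 2 * (x + 1)\<close>,
  carried out on difference quotients, where continuity and strict monotonicity of \<open>L\<close>
  and \<open>R\<close> suffice. The weights of the lower and the upper graph are
  \<open>- L' / 2\<close> and \<open>R' / 2\<close>.\<close>

lemma L_deriv:
  assumes x: "-1 < x" "x \<le> b"
  shows "(L has_real_derivative - 2 * u x / (u x + v x)) (at x within {-1..b})"
proof -
  have xm: "x \<in> {-1..b}" using x by simp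
  let ?F = "at x within {-1..b}"
  have ev: "eventually (\<lambda>y. y \<in> {-1..b} \<and> y \<noteq> x) ?F" by (simp add: eventually_at_filter)
  define qR where "qR y = (A (R y) - A (R x)) / (R y - R x)" for y
  define qL where "qL y = (A (L y) - A (L x)) / (L y - L x)" for y
  have ne: "R y \<noteq> R x" "L y \<noteq> L x" if "y \<in> {-1..b}" "y \<noteq> x" for y
    using R_inc[of x y] R_inc[of y x] L_dec[of x y] L_dec[of y x] that xm
    by (cases x y rule: linorder_cases; force)+
  have tR: "(qR \<longlongrightarrow> U x) ?F"
  proof -
    have "((\<lambda>e. (A e - A (R x)) / (e - R x)) \<longlongrightarrow> Y (R x)) (at (R x))"
      using DERIV_ac[OF k1, of "R x"] by (simp add: has_field_derivative_iff)
    moreover have "filterlim R (at (R x)) ?F"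
      using R_continuous xm ne(1) by (auto simp: filterlim_at continuous_on_def eventually_at_filter)
    ultimately show ?thesis unfolding qR_def U_def by (rule filterlim_compose)
  qed
  have tL: "(qL \<longlongrightarrow> D x) ?F"
  proof -
    have "((\<lambda>e. (A e - A (L x)) / (e - L x)) \<longlongrightarrow> Y (L x)) (at (L x))"
      using DERIV_ac[OF k1, of "L x"] by (simp add: has_field_derivative_iff)
    moreover have "filterlim L (at (L x)) ?F"
      using L_continuous xm ne(2) by (auto simp: filterlim_at continuous_on_def eventually_at_filter)
    ultimately show ?thesis unfolding qL_def D_def by (rule filterlim_compose)
  qed
  have UD: "U x - D x > 0" using uv_pos[OF x] by simp
  have "((\<lambda>y. (y + x - 2 * qR y) / (qR y - qL y)) \<longlongrightarrow> (x + x - 2 * U x) / (U x - D x)) ?F"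
    by (intro tendsto_intros tR tL) (use UD in auto)
  then have "((\<lambda>y. (L y - L x) / (y - x)) \<longlongrightarrow> (x + x - 2 * U x) / (U x - D x)) ?F"
  proof (rule Lim_transform_eventually)
    have "eventually (\<lambda>y. qR y - qL y > 0) ?F"
      using order_tendstoD(1)[OF tendsto_diff[OF tR tL], of 0] UD by simp
    then show "eventually (\<lambda>y. (y + x - 2 * qR y) / (qR y - qL y) = (L y - L x) / (y - x)) ?F"
      using ev
    proof eventually_elim
      case (elim y)
      then have y: "y \<in> {-1..b}" "y \<noteq> x" and p: "qR y - qL y > 0" by auto
      have "A (R y) - A (R x) = qR y * (R y - R x)" "A (L y) - A (L x) = qL y * (L y - L x)"
        using ne[OF y] by (simp_all add: qR_def qL_def)
      moreover have "(A (R y) - A (R x)) - (A (L y) - A (L x)) = y\<^sup>2 - x\<^sup>2"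
        using AR[of x] AR[of y] y xm by simp
      moreover have "R y - R x = L y - L x + 2 * (y - x)" by (simp add: R_def)
      ultimately have "(qR y - qL y) * (L y - L x) = (y - x) * (y + x - 2 * qR y)"
        by (simp add: power2_eq_square algebra_simps)
      then show ?case using y p by (simp add: field_simps)
    qed
  qed
  moreover have "(x + x - 2 * U x) / (U x - D x) = - 2 * u x / (u x + v x)" by (simp add: algebra_simps)
  ultimately show ?thesis by (simp add: has_field_derivative_iff)
qed

lemma R_deriv:
  assumes x: "-1 < x" "x \<le> b"
  shows "(R has_real_derivative 2 * v x / (u x + v x)) (at x within {-1..b})"
proof -
  have "(R has_real_derivative - 2 * u x / (u x + v x) + 2) (at x within {-1..b})"
    unfolding R_def by (rule derivative_eq_intros L_deriv[OF x] refl | simp)+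
  moreover have "- 2 * u x / (u x + v x) + 2 = 2 * v x / (u x + v x)"
    using uv_pos[OF x] by (simp add: field_simps)
  ultimately show ?thesis by simp
qed

lemma u_le: "-1 \<le> x \<Longrightarrow> x \<le> b \<Longrightarrow> u x \<le> L x - (b - x)"
  using yc_le_diff[OF k1, of "R x"] L_eq[of x] LR[of x] db0 by (simp add: U_def R_def)

lemma Y_ge1: "1 \<le> e \<Longrightarrow> Y e = e - k"
  using k1 by (cases "e = 1") (auto simp: yc_def y1_def z1_1)

lemma u_eq: "1 \<le> R x \<Longrightarrow> u x = L x - (b - x)"
  using Y_ge1[of "R x"] by (simp add: U_def R_def)

lemma R_b: "R b = db + 2 * (k - 1)" "1 < R b"
  using Rb1 by (simp_all add: R_def L_b)

lemma U_b: "U b = b + db"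
  using u_eq[of b] R_b by (simp add: L_b)

end

section \<open>The right part and the second marginal\<close>

lemma borel_measurable_if_continuous_on:
  fixes f g :: "real \<Rightarrow> real"
  assumes "A \<in> sets borel" "continuous_on A f" "g \<in> borel_measurable borel"
  shows "(\<lambda>x. if x \<in> A then f x else g x) \<in> borel_measurable borel"
proof -
  note [measurable] = assms(1,3)
  have [measurable]: "(\<lambda>x. indicator A x * f x) \<in> borel_measurable borel"
    using borel_measurable_continuous_on_indicator[OF assms(1,2)] by simp
  have eq: "(\<lambda>x. if x \<in> A then f x else g x) = (\<lambda>x. indicator A x * f x + indicator (- A) x * g x)"
    by (auto simp: fun_eq_iff indicator_def)
  show ?thesis unfolding eq by measurable
qed

context curtain
begin

text \<open>For a right source \<open>x\<close> this is the upper displacement and at the same time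
  the mass coordinate of the lower target \<open>x - k\<close>.\<close>

definition dl where "dl = the_inv_into {db..1} (z1 k)"

lemma z1_inj: "inj_on (z1 k) {db..1}"
  by (rule inj_onI) (metis atLeastAtMost_iff db0 k1 less_imp_le linorder_neqE_linordered_idom order.trans order_le_less_trans order_less_irrefl z1_slope_strict)

lemma z1_cont: "continuous_on {db..1} (z1 k)"
  using k1 by (intro DERIV_continuous_on[where D = "\<lambda>e. (k + e) / (k - e)"])
    (auto intro!: has_field_derivative_at_within[OF DERIV_z1])

lemma z1_image: "z1 k ` {db..1} = {b..1}"
proof
  show "z1 k ` {db..1} \<subseteq> {b..1}"
  proof
    fix y assume "y \<in> z1 k ` {db..1}"
    then obtain e where e: "e \<in> {db..1}" "y = z1 k e" by auto
    have "z1 k db \<le> z1 k e" using z1_slope[OF k1, of db e] e db0 k1 by simp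
    moreover have "z1 k e \<le> z1 k 1" using z1_slope[OF k1, of e 1] e db0 k1 by simp
    ultimately show "y \<in> {b..1}" using e zdb z1_1[OF k1] by simp
  qed
  show "{b..1} \<subseteq> z1 k ` {db..1}"
  proof
    fix y assume y: "y \<in> {b..1}"
    have "\<exists>e\<ge>db. e \<le> 1 \<and> z1 k e = y"
      by (rule IVT') (use y zdb z1_1[OF k1] db1 z1_cont in auto)
    then show "y \<in> z1 k ` {db..1}" by auto
  qed
qed

lemma dl_z1: "e \<in> {db..1} \<Longrightarrow> dl (z1 k e) = e"
  unfolding dl_def by (rule the_inv_into_f_f[OF z1_inj])

lemma dl:
  assumes "x \<in> {b..1}" shows "dl x \<in> {db..1}" "z1 k (dl x) = x"
proof -
  obtain e where "e \<in> {db..1}" "x = z1 k e" using z1_image assms by (metis imageE)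
  then show "dl x \<in> {db..1}" "z1 k (dl x) = x" using dl_z1 by auto
qed

lemma dl_pos: assumes "x \<in> {b..1}" shows "0 < dl x" "dl x < k" "0 < k + dl x" "k + dl x \<noteq> 0" "k \<noteq> dl x"
  using dl[OF assms] db0 k1 by auto

lemma b1: "b \<le> 1" "-1 < b" using k1 k3 by auto

lemma dl_b: "dl b = db" using dl_z1[of db] zdb db1 by simp
lemma dl_1: "dl 1 = 1" using dl_z1[of 1] z1_1[OF k1] db1 by simp

lemma dl_cont: "continuous_on {b..1} dl"
  using continuous_on_inv_into[OF z1_cont _ z1_inj] z1_image by (simp add: dl_def)

lemma dl_less: "x \<in> {b..1} \<Longrightarrow> x' \<in> {b..1} \<Longrightarrow> x < x' \<Longrightarrow> dl x < dl x'"
  using z1_slope[OF k1, of "dl x'" "dl x"] dl[of x] dl[of x'] db0 k1 by (cases "dl x < dl x'") auto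

lemma dl_deriv:
  assumes x: "b < x" "x < 1"
  shows "(dl has_real_derivative (k - dl x) / (k + dl x)) (at x)"
proof -
  have d: "dl x \<in> {db..1}" using dl[of x] x by auto
  have "(dl has_real_derivative inverse ((k + dl x) / (k - dl x))) (at x)"
  proof (rule DERIV_inverse_function[where f = "z1 k" and a = b and b = 1])
    show "(z1 k has_real_derivative (k + dl x) / (k - dl x)) (at (dl x))"
      by (rule DERIV_z1) (use k1 d in auto)
    show "isCont dl x" using dl_cont x by (auto intro: continuous_on_interior)
  qed (use d x dl dl_pos[of x] in auto)
  then show ?thesis by simp
qed

definition Dc where "Dc x = (if x \<in> {-1..b} then D x else if x \<in> {b..1} then x - k else 0)"
definition Uc where "Uc x = (if x \<in> {-1..b} then U x else if x \<in> {b..1} then x + dl x else 0)"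
text \<open>At \<open>-1\<close> the two graphs meet and the weight formula reads 0/0;
  \<open>q0\<close> is the value chosen there and outside the two ranges.\<close>

definition qc where "qc q0 x = (if x \<in> {-1<..b} then v x / (u x + v x) else if x \<in> {b<..1} then k / (k + dl x) else q0)"

lemma Dc_le: "x \<in> {-1..b} \<Longrightarrow> Dc x = D x" by (simp add: Dc_def)
lemma Uc_le: "x \<in> {-1..b} \<Longrightarrow> Uc x = U x" by (simp add: Uc_def)
lemma Dc_ge: "x \<in> {b..1} \<Longrightarrow> Dc x = x - k" using D_b by (auto simp: Dc_def)
lemma Uc_ge: "x \<in> {b..1} \<Longrightarrow> Uc x = x + dl x" using U_b dl_b by (auto simp: Uc_def)

lemma Dc_borel: "Dc \<in> borel_measurable borel"
  unfolding Dc_def by (intro borel_measurable_if_continuous_on D_continuous continuous_intros) auto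

lemma Uc_borel: "Uc \<in> borel_measurable borel"
  unfolding Uc_def by (intro borel_measurable_if_continuous_on U_continuous continuous_intros dl_cont) auto

lemma qc_borel: "qc q0 \<in> borel_measurable borel"
  unfolding qc_def
proof (intro borel_measurable_if_continuous_on)
  show "continuous_on {-1<..b} (\<lambda>x. v x / (u x + v x))"
    by (intro continuous_intros continuous_on_subset[OF U_continuous] continuous_on_subset[OF D_continuous])
       (use uv_pos in force)+
  show "continuous_on {b<..1} (\<lambda>x. k / (k + dl x))"
    by (intro continuous_intros continuous_on_subset[OF dl_cont]) (use dl_pos in auto)
qed auto

lemma qc_bounds: assumes "0 \<le> q0" "q0 \<le> 1" shows "0 \<le> qc q0 x" "qc q0 x \<le> 1"
  using assms uv_pos[of x] dl[of x] k1 db0 by (auto simp: qc_def divide_simps)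

lemma Dc_m1: "Dc (-1) = -1" and Uc_m1: "Uc (-1) = -1"
  using DU_m1 b1 by (auto simp: Dc_def Uc_def)

lemma Dc_less_Uc: "x \<in> {-1<..1} \<Longrightarrow> Dc x < x \<and> x < Uc x"
  using uv_pos[of x] dl[of x] k1 db0 by (cases "x \<le> b") (auto simp: Dc_def Uc_def)

lemma qc_eq: "x \<in> {-1<..1} \<Longrightarrow> qc q0 x = (x - Dc x) / (Uc x - Dc x)"
  using dl[of x] by (cases "x \<le> b") (auto simp: qc_def Dc_def Uc_def add.commute)

lemma mean_c: "x \<in> {-1..1} \<Longrightarrow> (1 - qc q0 x) * Dc x + qc q0 x * Uc x = x"
proof (cases "x = -1")
  case False
  assume "x \<in> {-1..1}"
  then have x: "x \<in> {-1<..1}" using False by auto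
  have "Uc x - Dc x \<noteq> 0" using Dc_less_Uc[OF x] by auto
  then have a: "(x - Dc x) / (Uc x - Dc x) * (Uc x - Dc x) = x - Dc x" by simp
  have l: "(1 - t) * d + t * w = d + t * (w - d)" for t d w :: real by (simp add: algebra_simps)
  show ?thesis unfolding qc_eq[OF x] l a by simp
qed (simp add: Dc_m1 Uc_m1 algebra_simps)

lemma D_ge: "-1 \<le> x \<Longrightarrow> x \<le> b \<Longrightarrow> D x \<ge> -2"
  using D_dec[of x b] D_b by (cases "x = b") auto

lemma constraint_c: "x \<in> {-1..1} \<Longrightarrow> Dc x \<ge> x - k" "x \<in> {-1..1} \<Longrightarrow> Uc x \<ge> x - k"
proof -
  show D: "Dc x \<ge> x - k" if "x \<in> {-1..1}" for x
    using D_ge[of x] that by (cases "x \<le> b") (auto simp: Dc_def)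
  show "x \<in> {-1..1} \<Longrightarrow> Uc x \<ge> x - k"
    using Dc_less_Uc[of x] D[of x] Dc_m1 Uc_m1 k1 by (cases "x = -1") force+
qed

lemma half_frac: "0 < a \<Longrightarrow> 0 < c \<Longrightarrow> - (- 2 * a / (a + c)) / 2 = 1 - c / (a + c)" for a c :: real
  by (simp add: field_simps)

text \<open>The weights are derivatives of \<open>- L / 2\<close> and \<open>R / 2\<close>, so the
  mass sent below \<open>c\<close> telescopes. \<open>xc\<close> and \<open>xu\<close> are the
  sources at which the lower and the upper graph cross \<open>c\<close>.\<close>

lemma left_integral:
  assumes xc: "xc \<in> {-1..b}" and xu: "xu \<in> {-1..b}"
    and c1: "\<And>x. x \<in> {-1<..<b} \<Longrightarrow> x \<noteq> xc \<Longrightarrow> D x \<le> c \<longleftrightarrow> xc \<le> x"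
    and c2: "\<And>x. x \<in> {-1<..<b} \<Longrightarrow> x \<noteq> xu \<Longrightarrow> U x \<le> c \<longleftrightarrow> x \<le> xu"
  shows "((\<lambda>x. (1 - qc q0 x) * indicator {..c} (Dc x) + qc q0 x * indicator {..c} (Uc x)) has_integral
     (L xc - db) / 2 + (R xu - es) / 2) {-1..b}"
proof -
  have at: "at x within {-1..b} = at x" if "-1 < x" "x < b" for x
    using that by (intro at_within_interior) auto
  have 1: "((\<lambda>x. 1 - qc q0 x) has_integral (- L b / 2 - (- L xc / 2))) {xc..b}"
  proof (rule fundamental_theorem_of_calculus_interior)
    show "continuous_on {xc..b} (\<lambda>x. - L x / 2)"
      using xc by (intro continuous_intros continuous_on_subset[OF L_continuous]) auto
    fix x assume x: "x \<in> {xc<..<b}"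
    then have x': "-1 < x" "x < b" using xc by auto
    have "((\<lambda>x. - L x / 2) has_real_derivative - (- 2 * u x / (u x + v x)) / 2) (at x)"
      by (intro DERIV_cdivide DERIV_minus) (use L_deriv[of x] at[OF x'] x' in auto)
    moreover have "- (- 2 * u x / (u x + v x)) / 2 = 1 - qc q0 x"
      using half_frac[of "u x" "v x"] x' uv_pos[of x] by (simp add: qc_def)
    ultimately show "((\<lambda>x. - L x / 2) has_vector_derivative 1 - qc q0 x) (at x)"
      by (simp add: has_real_derivative_iff_has_vector_derivative)
  qed (use xc in auto)
  have 2: "(qc q0 has_integral (R xu / 2 - R (-1) / 2)) {-1..xu}"
  proof (rule fundamental_theorem_of_calculus_interior)
    show "continuous_on {-1..xu} (\<lambda>x. R x / 2)"
      using xu by (intro continuous_intros continuous_on_subset[OF R_continuous]) auto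
    fix x assume x: "x \<in> {-1<..<xu}"
    then have x': "-1 < x" "x < b" using xu by auto
    have "((\<lambda>x. R x / 2) has_real_derivative (2 * v x / (u x + v x)) / 2) (at x)"
      by (intro DERIV_cdivide) (use R_deriv[of x] at[OF x'] x' in auto)
    moreover have "(2 * s / (r + s)) / 2 = s / (r + s)" for r s :: real by (simp add: divide_simps)
    then have "(2 * v x / (u x + v x)) / 2 = qc q0 x" using x' unfolding qc_def by (simp only:) simp
    ultimately show "((\<lambda>x. R x / 2) has_vector_derivative qc q0 x) (at x)"
      by (simp add: has_real_derivative_iff_has_vector_derivative)
  qed (use xu in auto)
  have "((\<lambda>x. (if x \<in> {xc..b} then 1 - qc q0 x else 0) + (if x \<in> {-1..xu} then qc q0 x else 0)) has_integral
     (- L b / 2 - (- L xc / 2)) + (R xu / 2 - R (-1) / 2)) {-1..b}"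
    by (intro has_integral_add; subst has_integral_restrict; use xc xu 1 2 in auto)
  moreover have "(- L b / 2 - (- L xc / 2)) + (R xu / 2 - R (-1) / 2) = (L xc - db) / 2 + (R xu - es) / 2"
    by (simp add: L_b L_m1 field_simps)
  ultimately have 3: "((\<lambda>x. (if x \<in> {xc..b} then 1 - qc q0 x else 0) + (if x \<in> {-1..xu} then qc q0 x else 0)) has_integral
     (L xc - db) / 2 + (R xu - es) / 2) {-1..b}" by simp
  show ?thesis
  proof (rule has_integral_spike_finite[OF _ _ 3, of "{-1, b, xc, xu}"])
    fix x assume "x \<in> {-1..b} - {-1, b, xc, xu}"
    then have x: "x \<in> {-1<..<b}" "x \<noteq> xc" "x \<noteq> xu" by auto
    then show "(1 - qc q0 x) * indicator {..c} (Dc x) + qc q0 x * indicator {..c} (Uc x)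
      = (if x \<in> {xc..b} then 1 - qc q0 x else 0) + (if x \<in> {-1..xu} then qc q0 x else 0)"
      using c1[OF x(1,2)] c2[OF x(1,3)] by (auto simp: Dc_def Uc_def)
  qed simp
qed

text \<open>Here the weights are \<open>(1 - dl') / 2\<close> and \<open>(1 + dl') / 2\<close>, as
  \<open>dl' = (k - dl) / (k + dl)\<close>.\<close>

lemma right_integral:
  assumes xm: "xm \<in> {b..1}" and xn: "xn \<in> {b..1}"
    and c1: "\<And>x. x \<in> {b<..<1} \<Longrightarrow> x \<noteq> xm \<Longrightarrow> x - k \<le> c \<longleftrightarrow> x \<le> xm"
    and c2: "\<And>x. x \<in> {b<..<1} \<Longrightarrow> x \<noteq> xn \<Longrightarrow> x + dl x \<le> c \<longleftrightarrow> x \<le> xn"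
  shows "((\<lambda>x. (1 - qc q0 x) * indicator {..c} (Dc x) + qc q0 x * indicator {..c} (Uc x)) has_integral
     (xm - dl xm - (b - db)) / 2 + (xn + dl xn - (b + db)) / 2) {b..1}"
proof -
  have 1: "((\<lambda>x. 1 - qc q0 x) has_integral ((xm - dl xm) / 2 - (b - dl b) / 2)) {b..xm}"
  proof (rule fundamental_theorem_of_calculus_interior)
    show "continuous_on {b..xm} (\<lambda>x. (x - dl x) / 2)"
      using xm by (intro continuous_intros continuous_on_subset[OF dl_cont]) auto
    fix x assume x: "x \<in> {b<..<xm}"
    then have x': "b < x" "x < 1" using xm by auto
    have "((\<lambda>x. (x - dl x) / 2) has_real_derivative (1 - (k - dl x) / (k + dl x)) / 2) (at x)"
      by (intro DERIV_cdivide DERIV_diff DERIV_ident dl_deriv x')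
    moreover have "(1 - (k - dl x) / (k + dl x)) / 2 = 1 - qc q0 x"
      using x' dl_pos[of x] by (simp add: qc_def divide_simps)
    ultimately show "((\<lambda>x. (x - dl x) / 2) has_vector_derivative 1 - qc q0 x) (at x)"
      by (simp add: has_real_derivative_iff_has_vector_derivative)
  qed (use xm in auto)
  have 2: "(qc q0 has_integral ((xn + dl xn) / 2 - (b + dl b) / 2)) {b..xn}"
  proof (rule fundamental_theorem_of_calculus_interior)
    show "continuous_on {b..xn} (\<lambda>x. (x + dl x) / 2)"
      using xn by (intro continuous_intros continuous_on_subset[OF dl_cont]) auto
    fix x assume x: "x \<in> {b<..<xn}"
    then have x': "b < x" "x < 1" using xn by auto
    have "((\<lambda>x. (x + dl x) / 2) has_real_derivative (1 + (k - dl x) / (k + dl x)) / 2) (at x)"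
      by (intro DERIV_cdivide DERIV_add DERIV_ident dl_deriv x')
    moreover have "(1 + (k - dl x) / (k + dl x)) / 2 = qc q0 x"
      using x' dl_pos[of x] by (simp add: qc_def divide_simps)
    ultimately show "((\<lambda>x. (x + dl x) / 2) has_vector_derivative qc q0 x) (at x)"
      by (simp add: has_real_derivative_iff_has_vector_derivative)
  qed (use xn in auto)
  have "((\<lambda>x. (if x \<in> {b..xm} then 1 - qc q0 x else 0) + (if x \<in> {b..xn} then qc q0 x else 0)) has_integral
     ((xm - dl xm) / 2 - (b - dl b) / 2) + ((xn + dl xn) / 2 - (b + dl b) / 2)) {b..1}"
    by (intro has_integral_add; subst has_integral_restrict; use xm xn 1 2 in auto)
  moreover have "((xm - dl xm) / 2 - (b - dl b) / 2) + ((xn + dl xn) / 2 - (b + dl b) / 2)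
    = (xm - dl xm - (b - db)) / 2 + (xn + dl xn - (b + db)) / 2"
    by (simp add: dl_b field_simps)
  ultimately have 3: "((\<lambda>x. (if x \<in> {b..xm} then 1 - qc q0 x else 0) + (if x \<in> {b..xn} then qc q0 x else 0)) has_integral
     (xm - dl xm - (b - db)) / 2 + (xn + dl xn - (b + db)) / 2) {b..1}" by simp
  show ?thesis
  proof (rule has_integral_spike_finite[OF _ _ 3, of "{b, 1, xm, xn}"])
    fix x assume "x \<in> {b..1} - {b, 1, xm, xn}"
    then have x: "x \<in> {b<..<1}" "x \<noteq> xm" "x \<noteq> xn" by auto
    then show "(1 - qc q0 x) * indicator {..c} (Dc x) + qc q0 x * indicator {..c} (Uc x)
      = (if x \<in> {b..xm} then 1 - qc q0 x else 0) + (if x \<in> {b..xn} then qc q0 x else 0)"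
      using c1[OF x(1,2)] c2[OF x(1,3)] by (auto simp: Dc_def Uc_def)
  qed simp
qed

text \<open>Bookkeeping in units of 1/4: \<open>nu\<close> below \<open>c\<close> has mass
  \<open>c + 2\<close>, made of the free mass \<open>e - db\<close> and the share
  \<open>xm - dl xm - (b - db)\<close> taken by the lower graph over \<open>[b, xm]\<close>.\<close>

lemma mass_match:
  assumes c: "c \<in> {-2..2}" and e: "db \<le> e" "Y e = c"
  defines "xm \<equiv> min (c + k) 1"
  shows "xm \<in> {b..1}" "e + xm - dl xm - b = c + 2"
proof -
  show "xm \<in> {b..1}" using c b1 by (auto simp: xm_def)
  show "e + xm - dl xm - b = c + 2"
  proof (cases "c + k \<le> 1")
    case True
    have "e \<le> 1" using e True by (auto simp: yc_def split: if_splits)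
    then have "z1 k e = c + k" using e by (simp add: yc_def y1_def)
    then have "dl xm = e" using dl_z1[of e] e \<open>e \<le> 1\<close> True by (simp add: xm_def)
    then show ?thesis using True by (simp add: xm_def)
  next
    case False
    have "e > 1"
    proof (rule ccontr)
      assume "\<not> e > 1"
      then have "Y e \<le> Y 1" using yc_le[OF k1, of e 1] e db0 by simp
      then show False using False e Y_ge1[of 1] by simp
    qed
    then show ?thesis using False e by (simp add: xm_def yc_def dl_1)
  qed
qed

text \<open>A free target is reached by the lower left graph up to \<open>-1\<close>, by the upper
  left graph up to \<open>U b\<close>, and by the upper right graph beyond. The lower right graph
  enters through \<open>mass_match\<close> in the first two cases and lies entirely below
  \<open>c\<close> in the third.\<close>

lemma cdf_c:
  assumes c: "c \<in> {-2..2}"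
  shows "((\<lambda>x. (1 - qc q0 x) * indicator {..c} (Dc x) + qc q0 x * indicator {..c} (Uc x)) has_integral (c + 2) / 2) {-1..1}"
    (is "(?f has_integral _) _")
proof -
  have comb: "(?f has_integral (c + 2) / 2) {-1..1}"
    if "(?f has_integral i) {-1..b}" "(?f has_integral j) {b..1}" "i + j = (c + 2) / 2" for i j
    using has_integral_combine[OF _ _ that(1,2)] that(3) b1 by simp
  have Ub: "U b > -1" "U b > 1 - k" using U_b db0 k1 Rb1 by auto
  have Umid: "x + dl x > U b" if "x \<in> {b<..<1}" for x
    using dl_less[of b x] dl_b U_b that b1 by auto
  have n: "x + dl x \<le> c \<longleftrightarrow> x \<le> b" if "x \<in> {b<..<1}" "c \<le> U b" for x using Umid[OF that(1)] that by auto
  consider "c \<le> -1" | "-1 < c" "c \<le> U b" | "U b < c" by linarith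
  then show ?thesis
  proof cases
    case 1
    have "\<exists>xc\<ge>-1. xc \<le> b \<and> D xc = c"
      by (rule IVT2') (use DU_m1 D_b 1 c b1 D_continuous in auto)
    then obtain xc where xc: "xc \<in> {-1..b}" "D xc = c" by auto
    have m: "min (c + k) 1 \<in> {b..1}" "L xc + min (c + k) 1 - dl (min (c + k) 1) - b = c + 2"
      using mass_match[OF c, of "L xc"] xc L_eq[of xc] by (auto simp: D_def)
    show ?thesis
    proof (rule comb)
      show "(?f has_integral (L xc - db) / 2 + (R (-1) - es) / 2) {-1..b}"
      proof (rule left_integral[OF xc(1)])
        show "D x \<le> c \<longleftrightarrow> xc \<le> x" if "x \<in> {-1<..<b}" "x \<noteq> xc" for x
          using D_dec[of xc x] D_dec[of x xc] xc that by (cases x xc rule: linorder_cases) auto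
        show "U x \<le> c \<longleftrightarrow> x \<le> -1" if "x \<in> {-1<..<b}" for x using U_inc[of "-1" x] DU_m1 that 1 by auto
      qed (use b1 in auto)
      show "(?f has_integral (min (c + k) 1 - dl (min (c + k) 1) - (b - db)) / 2 + (b + dl b - (b + db)) / 2) {b..1}"
        by (rule right_integral[OF m(1)]) (use b1 n 1 Ub in auto)
      show "(L xc - db) / 2 + (R (-1) - es) / 2 + ((min (c + k) 1 - dl (min (c + k) 1) - (b - db)) / 2 + (b + dl b - (b + db)) / 2) = (c + 2) / 2"
        using m(2) by (simp add: dl_b L_m1 field_simps)
    qed
  next
    case 2
    have "\<exists>xu\<ge>-1. xu \<le> b \<and> U xu = c"
      by (rule IVT') (use DU_m1 2 c b1 U_continuous in auto)
    then obtain xu where xu: "xu \<in> {-1..b}" "U xu = c" by auto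
    have m: "min (c + k) 1 \<in> {b..1}" "R xu + min (c + k) 1 - dl (min (c + k) 1) - b = c + 2"
      using mass_match[OF c, of "R xu"] xu L_eq[of xu] LR[of xu] by (auto simp: U_def)
    show ?thesis
    proof (rule comb)
      show "(?f has_integral (L (-1) - db) / 2 + (R xu - es) / 2) {-1..b}"
      proof (rule left_integral[OF _ xu(1)])
        show "U x \<le> c \<longleftrightarrow> x \<le> xu" if "x \<in> {-1<..<b}" "x \<noteq> xu" for x
          using U_inc[of xu x] U_inc[of x xu] xu that by (cases x xu rule: linorder_cases) auto
        show "D x \<le> c \<longleftrightarrow> -1 \<le> x" if "x \<in> {-1<..<b}" for x using D_le[of x] that 2 by auto
      qed (use b1 in auto)
      show "(?f has_integral (min (c + k) 1 - dl (min (c + k) 1) - (b - db)) / 2 + (b + dl b - (b + db)) / 2) {b..1}"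
        by (rule right_integral[OF m(1)]) (use b1 n 2 Ub in auto)
      show "(L (-1) - db) / 2 + (R xu - es) / 2 + ((min (c + k) 1 - dl (min (c + k) 1) - (b - db)) / 2 + (b + dl b - (b + db)) / 2) = (c + 2) / 2"
        using m(2) by (simp add: dl_b L_m1 field_simps)
    qed
  next
    case 3
    have "\<exists>xn\<ge>b. xn \<le> 1 \<and> xn + dl xn = c"
      by (rule IVT') (use U_b dl_b dl_1 3 c b1 in \<open>auto intro!: continuous_intros dl_cont\<close>)
    then obtain xn where xn: "xn \<in> {b..1}" "xn + dl xn = c" by auto
    show ?thesis
    proof (rule comb)
      show "(?f has_integral (L (-1) - db) / 2 + (R b - es) / 2) {-1..b}"
      proof (rule left_integral)
        show "U x \<le> c \<longleftrightarrow> x \<le> b" if "x \<in> {-1<..<b}" for x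
          using U_inc[of x b] that 3 by auto
        show "D x \<le> c \<longleftrightarrow> -1 \<le> x" if "x \<in> {-1<..<b}" for x using D_le[of x] that 3 Ub by auto
      qed (use b1 in auto)
      show "(?f has_integral (1 - dl 1 - (b - db)) / 2 + (xn + dl xn - (b + db)) / 2) {b..1}"
      proof (rule right_integral[OF _ xn(1)])
        show "x + dl x \<le> c \<longleftrightarrow> x \<le> xn" if "x \<in> {b<..<1}" "x \<noteq> xn" for x
          using dl_less[of xn x] dl_less[of x xn] xn that by (cases x xn rule: linorder_cases) auto
      qed (use b1 3 Ub in auto)
      show "(L (-1) - db) / 2 + (R b - es) / 2 + ((1 - dl 1 - (b - db)) / 2 + (xn + dl xn - (b + db)) / 2) = (c + 2) / 2"
        using xn R_b by (simp add: dl_1 L_m1 field_simps)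
    qed
  qed
qed

lemma Y_z1: "e \<le> 1 \<Longrightarrow> Y e = z1 k e - k" by (simp add: yc_def y1_def)

lemma z_deriv: "e \<in> {db..1} \<Longrightarrow> (z1 k has_real_derivative (k + e) / (k - e)) (at e within S)"
  by (rule has_field_derivative_at_within[OF DERIV_z1[OF k1]]) (use k1 in auto)

text \<open>The derivative is taken within \<open>{db..1}\<close> because \<open>yc\<close> has a
  kink at \<open>1\<close>.\<close>

lemma Y_deriv:
  assumes e: "e \<in> {db..1}" shows "(Y has_real_derivative (k + e) / (k - e)) (at e within {db..1})"
proof -
  have "((\<lambda>e. z1 k e - k) has_real_derivative (k + e) / (k - e) - 0) (at e within {db..1})"
    by (intro DERIV_diff z_deriv e DERIV_const)
  then show ?thesis
    by (rule has_field_derivative_transform_within[OF _ zero_less_one e, THEN DERIV_cong]) (auto simp: Y_z1)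
qed

lemma coupling_c:
  assumes q0: "0 \<le> q0" "q0 \<le> 1"
  shows "tg Dc Uc (qc q0) \<in> couplings k" "two_graph Dc Uc (qc q0) (tg Dc Uc (qc q0))"
    "AE p in tg Dc Uc (qc q0). fst p \<in> {-1..1} \<and> (snd p = Dc (fst p) \<or> snd p = Uc (fst p))"
proof -
  note [measurable] = Dc_borel Uc_borel qc_borel[of q0]
  have cdf: "(LINT x:{-1..1}|lborel. (1 - qc q0 x) * indicator {..c} (Dc x) + qc q0 x * indicator {..c} (Uc x)) = (c + 2) / 2"
    if c: "c \<in> {-2..2}" for c
  proof -
    have "set_integrable lborel {-1..1} (\<lambda>x. (1 - qc q0 x) * indicator {..c} (Dc x) + qc q0 x * indicator {..c} (Uc x))"
      unfolding set_integrable_def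
    proof (rule integrableI_bounded_set_indicator[where B = 2])
      show "AE x in lborel. x \<in> {- 1..1} \<longrightarrow> norm ((1 - qc q0 x) * indicator {..c} (Dc x) + qc q0 x * indicator {..c} (Uc x)) \<le> 2"
      proof (rule AE_I2)
        fix x show "x \<in> {- 1..1} \<longrightarrow> norm ((1 - qc q0 x) * indicator {..c} (Dc x) + qc q0 x * indicator {..c} (Uc x)) \<le> 2"
          using qc_bounds[OF q0, of x] by (auto simp: indicator_def)
      qed
    qed auto
    from set_borel_integral_eq_integral(2)[OF this] show ?thesis
      using integral_unique[OF cdf_c[OF c, of q0]] by simp
  qed
  show "tg Dc Uc (qc q0) \<in> couplings k" "two_graph Dc Uc (qc q0) (tg Dc Uc (qc q0))"
    "AE p in tg Dc Uc (qc q0). fst p \<in> {-1..1} \<and> (snd p = Dc (fst p) \<or> snd p = Uc (fst p))"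
    by (rule tg_coupling[OF Dc_borel Uc_borel qc_borel qc_bounds[OF q0] mean_c constraint_c cdf]; simp)+
qed

end

section \<open>Dual potentials of the left part for one hinge\<close>

lemma deriv_mono:
  fixes f :: "real \<Rightarrow> real"
  assumes "a \<le> b" "continuous_on {a..b} f"
    and "\<And>x. a < x \<Longrightarrow> x < b \<Longrightarrow> (f has_real_derivative f' x) (at x)"
    and "\<And>x. a < x \<Longrightarrow> x < b \<Longrightarrow> f' x \<ge> 0"
  shows "f a \<le> f b"
proof (cases "a = b")
  case False
  then have "a < b" using assms(1) by simp
  then obtain l z where z: "a < z" "z < b" "DERIV f z :> l" and eq: "f b - f a = (b - a) * l"
    using MVT[of a b f] assms(2,3) real_differentiable_def by blast
  have "l = f' z" using DERIV_unique[OF z(3) assms(3)[OF z(1,2)]] .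
  then have "(b - a) * l \<ge> 0" using assms(4)[OF z(1,2)] \<open>a < b\<close> by simp
  then show ?thesis using eq by simp
qed simp

lemma deriv_within_mono:
  fixes f :: "real \<Rightarrow> real"
  assumes "a \<le> b" "{a..b} \<subseteq> S"
    and d: "\<And>x. a \<le> x \<Longrightarrow> x \<le> b \<Longrightarrow> (f has_real_derivative f' x) (at x within S)"
    and p: "\<And>x. a < x \<Longrightarrow> x < b \<Longrightarrow> f' x \<ge> 0"
  shows "f a \<le> f b"
proof (rule deriv_mono[OF assms(1)])
  have d': "(f has_real_derivative f' x) (at x within {a..b})" if "a \<le> x" "x \<le> b" for x
    using DERIV_subset[OF d[OF that] assms(2)] .
  show "continuous_on {a..b} f" using d' by (intro DERIV_continuous_on) auto
  show "(f has_real_derivative f' x) (at x)" if "a < x" "x < b" for x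
    using d'[of x] that at_within_interior[of x "{a..b}"] by auto
qed (rule p)

locale hinge_dual = curtain +
  fixes s :: real
  assumes s0: "s \<noteq> 0"
begin

definition hp where "hp t = max (t - s) 0"

lemma hp_cont [continuous_intros]: "continuous_on S f \<Longrightarrow> continuous_on S (\<lambda>x. hp (f x))"
  unfolding hp_def by (intro continuous_intros)

lemma hp_nonneg: "0 \<le> hp t" and hp_mono: "t \<le> t' \<Longrightarrow> hp t \<le> hp t'"
  and hp_le: "t \<le> s \<Longrightarrow> hp t = 0" and hp_ge: "s \<le> t \<Longrightarrow> hp t = t - s" and hp_lower: "t - s \<le> hp t"
  by (auto simp: hp_def)

lemma hp_lip: "t \<le> t' \<Longrightarrow> hp t' - hp t \<le> t' - t"
  by (auto simp: hp_def)

lemma hinge_taylor: "0 \<le> hinge s t' - hinge s t - hp t * (t' - t)" "hinge s t' - hinge s t - hp t * (t' - t) \<le> (t' - t)\<^sup>2 / 2"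
proof -
  have "0 \<le> hinge s t' - hinge s t - hp t * (t' - t) \<and> hinge s t' - hinge s t - hp t * (t' - t) \<le> (t' - t)\<^sup>2 / 2"
  proof (cases "t \<le> s")
    case True
    then have h: "hinge s t = 0" "hp t = 0" by (auto simp: hinge_def hp_def)
    have "(max (t' - s) 0)\<^sup>2 \<le> \<bar>t' - t\<bar>\<^sup>2" using True by (intro power_mono) auto
    then show ?thesis unfolding h by (simp add: hinge_def)
  next
    case False
    then have h: "hinge s t = (t - s)\<^sup>2 / 2" "hp t = t - s" by (auto simp: hinge_def hp_def)
    show ?thesis
    proof (cases "t' \<le> s")
      case True
      then have h': "hinge s t' = 0" by (simp add: hinge_def)
      have e: "0 - (t - s)\<^sup>2 / 2 - (t - s) * (t' - t) = (t' - t)\<^sup>2 / 2 - (t' - s)\<^sup>2 / 2"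
        by (simp add: power2_eq_square field_simps)
      have "(s - t')\<^sup>2 \<le> (t - t')\<^sup>2" using True False by (intro power_mono) auto
      then show ?thesis unfolding h h' e by (simp add: power2_commute)
    next
      case b: False
      then have h': "hinge s t' = (t' - s)\<^sup>2 / 2" by (simp add: hinge_def)
      have e: "(t' - s)\<^sup>2 / 2 - (t - s)\<^sup>2 / 2 - (t - s) * (t' - t) = (t' - t)\<^sup>2 / 2"
        by (simp add: power2_eq_square field_simps)
      show ?thesis unfolding h h' e by simp
    qed
  qed
  then show "0 \<le> hinge s t' - hinge s t - hp t * (t' - t)" "hinge s t' - hinge s t - hp t * (t' - t) \<le> (t' - t)\<^sup>2 / 2"
    by auto
qed

lemma hp_convex: "a \<le> c \<Longrightarrow> c \<le> d \<Longrightarrow> (d - a) * hp c \<le> (d - c) * hp a + (c - a) * hp d"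
proof -
  assume a: "a \<le> c" "c \<le> d"
  have "(d - c) * (a - s) + (c - a) * (d - s) = (d - a) * (c - s)" by (simp add: algebra_simps)
  moreover have "(d - c) * (a - s) \<le> (d - c) * hp a" "(c - a) * (d - s) \<le> (c - a) * hp d"
    using a by (auto intro!: mult_left_mono hp_lower)
  moreover have "0 \<le> (d - c) * hp a" "0 \<le> (c - a) * hp d" using a hp_nonneg by auto
  ultimately show ?thesis by (cases "c \<le> s") (auto simp: hp_le hp_ge)
qed

text \<open>The chord of \<open>hp\<close> over \<open>[- v x, u x]\<close> is
  \<open>t \<mapsto> m0 x + \<beta> x * t\<close>. At \<open>-1\<close> it shrinks to the tangent at
  \<open>0\<close>, which exists because \<open>s \<noteq> 0\<close>.\<close>

definition \<beta> where "\<beta> x = (if x = -1 then (if s < 0 then 1 else 0) else (hp (u x) - hp (- v x)) / (u x + v x))"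
definition m0 where "m0 x = (if x = -1 then hp 0 else (v x * hp (u x) + u x * hp (- v x)) / (u x + v x))"

text \<open>The two implications keep the kink \<open>s\<close> out of the open interval from
  \<open>- v x\<close> to \<open>u x\<close>, on which \<open>hp\<close> is then affine and equal to
  its chord. Close to \<open>-1\<close> this always holds, which gives continuity of
  \<open>\<beta>\<close> and \<open>m0\<close> there.\<close>

lemma near_m1:
  assumes "-1 < x" "x \<le> b" "-s < v x \<longrightarrow> s > 0" "s < u x \<longrightarrow> s < 0"
  shows "\<beta> x = \<beta> (-1)" "m0 x = m0 (-1)"
proof -
  have p: "u x > 0" "v x > 0" "u x + v x \<noteq> 0" using uv_pos[of x] assms(1,2) by auto
  show "\<beta> x = \<beta> (-1)" "m0 x = m0 (-1)"
  proof (atomize (full), cases "s < 0")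
    case True
    then have "v x \<le> - s" using assms(3) by auto
    then have h: "hp (u x) = u x - s" "hp (- v x) = - v x - s" using True p by (auto simp: hp_ge)
    have "v x * (u x - s) + u x * (- v x - s) = (- s) * (u x + v x)" by (simp add: algebra_simps)
    then show "\<beta> x = \<beta> (-1) \<and> m0 x = m0 (-1)" using True p assms(1)
      unfolding \<beta>_def m0_def h by (simp add: hp_ge)
  next
    case False
    then have "u x \<le> s" "s > 0" using assms(4) s0 by auto
    then have h: "hp (u x) = 0" "hp (- v x) = 0" using p by (auto simp: hp_le)
    then show "\<beta> x = \<beta> (-1) \<and> m0 x = m0 (-1)" using \<open>s > 0\<close> assms(1)
      unfolding \<beta>_def m0_def h by (simp add: hp_le)
  qed
qed

lemma \<beta>_m0_cont: "continuous_on {-1..b} \<beta>" "continuous_on {-1..b} m0"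
proof -
  have ev: "\<exists>d>0. \<forall>x\<in>{-1..b}. dist x (-1) < d \<longrightarrow> \<beta> x = \<beta> (-1) \<and> m0 x = m0 (-1)"
  proof -
    have cu: "continuous_on {-1..b} u" "continuous_on {-1..b} v"
      by (intro continuous_intros U_continuous D_continuous)+
    have "\<bar>s\<bar> > 0" using s0 by simp
    then obtain d1 where d1: "d1 > 0" "\<And>x. x \<in> {-1..b} \<Longrightarrow> dist x (-1) < d1 \<Longrightarrow> dist (u x) (u (-1)) < \<bar>s\<bar>"
      using cu(1) b1 unfolding continuous_on_iff by (meson atLeastAtMost_iff less_imp_le order_refl)
    from \<open>\<bar>s\<bar> > 0\<close> obtain d2 where d2: "d2 > 0" "\<And>x. x \<in> {-1..b} \<Longrightarrow> dist x (-1) < d2 \<Longrightarrow> dist (v x) (v (-1)) < \<bar>s\<bar>"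
      using cu(2) b1 unfolding continuous_on_iff by (meson atLeastAtMost_iff less_imp_le order_refl)
    have "\<beta> x = \<beta> (-1) \<and> m0 x = m0 (-1)" if x: "x \<in> {-1..b}" "dist x (-1) < min d1 d2" for x
    proof (cases "x = -1")
      case False
      have "\<bar>u x\<bar> < \<bar>s\<bar>" "\<bar>v x\<bar> < \<bar>s\<bar>"
        using d1(2)[OF x(1)] d2(2)[OF x(1)] x(2) DU_m1 by (auto simp: dist_real_def)
      then have "-s < v x \<longrightarrow> s > 0" "s < u x \<longrightarrow> s < 0" using s0 by linarith+
      then show ?thesis using near_m1[of x] x False by auto
    qed simp
    moreover have "min d1 d2 > 0" using d1(1) d2(1) by simp
    ultimately show ?thesis by blast
  qed
  have cont: "continuous_on {-1..b} f"
    if f: "\<exists>d>0. \<forall>x\<in>{-1..b}. dist x (-1) < d \<longrightarrow> f x = f (-1)" and c: "continuous_on {-1<..b} f" for f :: "real \<Rightarrow> real"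
    unfolding continuous_on_eq_continuous_within
  proof
    fix x assume x: "x \<in> {-1..b}"
    show "continuous (at x within {-1..b}) f"
    proof (cases "x = -1")
      case True
      obtain d where d: "d > 0" "\<forall>x\<in>{-1..b}. dist x (-1) < d \<longrightarrow> f x = f (-1)" using f by blast
      show ?thesis unfolding True continuous_within_eps_delta
      proof (intro allI impI)
        fix e :: real assume e: "e > 0"
        have "dist (f y) (f (-1)) < e" if "y \<in> {-1..b}" "dist y (-1) < d" for y
        proof -
          have "f y = f (-1)" using d(2) that by blast
          then show ?thesis using e by (simp only: dist_self)
        qed
        then show "\<exists>d>0. \<forall>x'\<in>{-1..b}. dist x' (-1) < d \<longrightarrow> dist (f x') (f (-1)) < e" using d(1) by blast
      qed
    next
      case False
      then have "continuous (at x within {-1<..b}) f" using c x by (auto simp: continuous_on_eq_continuous_within)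
      moreover have "at x within {-1<..b} = at x within {-1..b}"
        by (rule at_within_nhd[of _ "{-1<..}"]) (use x False in auto)
      ultimately show ?thesis by simp
    qed
  qed
  have c1: "continuous_on {-1<..b} (\<lambda>x. (hp (u x) - hp (- v x)) / (u x + v x))"
    "continuous_on {-1<..b} (\<lambda>x. (v x * hp (u x) + u x * hp (- v x)) / (u x + v x))"
    by (intro continuous_intros continuous_on_subset[OF U_continuous] continuous_on_subset[OF D_continuous];
        use uv_pos in force)+
  show "continuous_on {-1..b} \<beta>"
  proof (rule cont)
    show "continuous_on {-1<..b} \<beta>"
      by (rule continuous_on_eq[OF c1(1)]) (auto simp: \<beta>_def)
  qed (use ev in blast)
  show "continuous_on {-1..b} m0"
  proof (rule cont)
    show "continuous_on {-1<..b} m0"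
      by (rule continuous_on_eq[OF c1(2)]) (auto simp: m0_def)
  qed (use ev in blast)
qed

lemma \<beta>_bounds:
  assumes "-1 \<le> x" "x \<le> b" shows "0 \<le> \<beta> x" "\<beta> x \<le> 1"
proof -
  have "0 \<le> \<beta> x \<and> \<beta> x \<le> 1"
  proof (cases "x = -1")
    case False
    then have p: "u x > 0" "v x > 0" using uv_pos[of x] assms by auto
    have "hp (- v x) \<le> hp (u x)" "hp (u x) - hp (- v x) \<le> u x - - v x"
      using hp_mono[of "- v x" "u x"] hp_lip[of "- v x" "u x"] p by simp_all
    then show ?thesis using False p by (simp add: \<beta>_def divide_simps)
  qed (simp add: \<beta>_def)
  then show "0 \<le> \<beta> x" "\<beta> x \<le> 1" by auto
qed

definition Bl where "Bl x = integral {-1..x} \<beta>"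

lemma Bl_deriv: "x \<in> {-1..b} \<Longrightarrow> (Bl has_real_derivative \<beta> x) (at x within {-1..b})"
  unfolding Bl_def by (rule integral_has_real_derivative[OF \<beta>_m0_cont(1)])

lemma Bl_cont: "continuous_on {-1..b} Bl"
  using Bl_deriv by (rule DERIV_continuous_on)

lemma Bl_m1: "Bl (-1) = 0" by (simp add: Bl_def)

lemma Bl_mono: "-1 \<le> x \<Longrightarrow> x \<le> x' \<Longrightarrow> x' \<le> b \<Longrightarrow> Bl x \<le> Bl x'"
  by (rule deriv_within_mono[where S = "{-1..b}" and f' = \<beta>]) (use Bl_deriv \<beta>_bounds in auto)

lemma Bl_lip: assumes "-1 \<le> x" "x \<le> x'" "x' \<le> b" shows "x - Bl x \<le> x' - Bl x'"
  by (rule deriv_within_mono[where S = "{-1..b}" and f = "\<lambda>x. x - Bl x" and f' = "\<lambda>x. 1 - \<beta> x"])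
     (use assms \<beta>_bounds in \<open>auto intro!: DERIV_diff Bl_deriv\<close>)

lemma Bl_bounds: "-1 \<le> x \<Longrightarrow> x \<le> b \<Longrightarrow> 0 \<le> Bl x" "-1 \<le> x \<Longrightarrow> x \<le> b \<Longrightarrow> Bl x \<le> x + 1"
  using Bl_mono[of "-1" x] Bl_lip[of "-1" x] Bl_m1 by auto

text \<open>Chosen so that the derivative of \<open>cl\<close> in the source is chord minus
  \<open>hp\<close>; its sign tells whether \<open>y\<close> lies in
  \<open>[D x, U x]\<close>.\<close>

definition \<phi>l where "\<phi>l x = - integral {-1..x} (\<lambda>t. Bl t + m0 t)"

lemma \<phi>l_deriv: "x \<in> {-1..b} \<Longrightarrow> (\<phi>l has_real_derivative - (Bl x + m0 x)) (at x within {-1..b})"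
  unfolding \<phi>l_def
  by (intro DERIV_minus integral_has_real_derivative continuous_intros Bl_cont \<beta>_m0_cont)

text \<open>The largest value at \<open>y\<close> that the dual inequality with source
  \<open>x\<close> permits; \<open>Bl\<close> is minus the multiplier.\<close>

definition cl where "cl x y = hinge s (y - x) - \<phi>l x + Bl x * (y - x)"

lemma hinge_chain: "((\<lambda>x. hinge s (y - x)) has_real_derivative - hp (y - x)) (at x within S)"
proof -
  have "((\<lambda>x. hinge s (y - x)) has_real_derivative hp (y - x) * (0 - 1)) (at x within S)"
    by (rule DERIV_chain2[where f = "hinge s" and g = "\<lambda>x. y - x"])
       (auto intro!: derivative_eq_intros hinge_deriv simp: hp_def)
  then show ?thesis by simp
qed

lemma cl_deriv:
  assumes x: "x \<in> {-1..b}"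
  shows "((\<lambda>x. cl x y) has_real_derivative m0 x + \<beta> x * (y - x) - hp (y - x)) (at x within {-1..b})"
proof -
  have "((\<lambda>x. cl x y) has_real_derivative - hp (y - x) - (- (Bl x + m0 x)) + (\<beta> x * (y - x) + (0 - 1) * Bl x)) (at x within {-1..b})"
    unfolding cl_def
    by (intro DERIV_add DERIV_diff DERIV_mult hinge_chain \<phi>l_deriv Bl_deriv x DERIV_const DERIV_ident)
  moreover have "- hp (y - x) - (- (Bl x + m0 x)) + (\<beta> x * (y - x) + (0 - 1) * Bl x) = m0 x + \<beta> x * (y - x) - hp (y - x)"
    by simp
  ultimately show ?thesis by (simp only:)
qed

lemma chord_eq:
  assumes "-1 < x" "x \<le> b"
  shows "(u x + v x) * (m0 x + \<beta> x * t) = (v x + t) * hp (u x) + (u x - t) * hp (- v x)"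
proof -
  have ne: "u x + v x \<noteq> 0" using uv_pos[OF assms] by simp
  define W where "W = u x + v x"
  have "W * (m0 x + \<beta> x * t) = (v x * hp (u x) + u x * hp (- v x)) + (hp (u x) - hp (- v x)) * t"
  proof -
    have "W * (X / W + Z / W * t) = X + Z * t" for X Z using ne by (simp add: W_def[symmetric] distrib_left)
    then show ?thesis using assms unfolding m0_def \<beta>_def W_def[symmetric] by simp
  qed
  then show ?thesis unfolding W_def by (simp add: algebra_simps)
qed

lemma chord_inside:
  assumes x: "-1 < x" "x \<le> b" and t: "- v x \<le> t" "t \<le> u x"
  shows "hp t \<le> m0 x + \<beta> x * t"
proof -
  have p: "u x + v x > 0" using uv_pos[OF x] by simp
  have "(u x + v x) * hp t \<le> (u x + v x) * (m0 x + \<beta> x * t)"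
    using hp_convex[OF t] unfolding chord_eq[OF x] by (simp add: algebra_simps)
  then show ?thesis using p by simp
qed

lemma chord_outside:
  assumes x: "-1 < x" "x \<le> b" and t: "t \<le> - v x \<or> u x \<le> t"
  shows "m0 x + \<beta> x * t \<le> hp t"
proof -
  have p: "u x > 0" "v x > 0" using uv_pos[OF x] by auto
  have "(u x + v x) * (m0 x + \<beta> x * t) \<le> (u x + v x) * hp t"
    using t
  proof
    assume "t \<le> - v x"
    from hp_convex[OF this, of "u x"] p show ?thesis unfolding chord_eq[OF x] by (simp add: algebra_simps)
  next
    assume "u x \<le> t"
    from hp_convex[OF _ this, of "- v x"] p show ?thesis unfolding chord_eq[OF x] by (simp add: algebra_simps)
  qed
  then show ?thesis using p by (simp add: mult_le_cancel_left)
qed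

lemma cl_decreasing:
  assumes "-1 \<le> x" "x \<le> x'" "x' \<le> b" and o: "\<And>z. x < z \<Longrightarrow> z < x' \<Longrightarrow> y \<le> D z \<or> U z \<le> y"
  shows "cl x' y \<le> cl x y"
proof -
  have "- cl x y \<le> - cl x' y"
  proof (rule deriv_within_mono[where S = "{-1..b}" and f = "\<lambda>x. - cl x y" and f' = "\<lambda>x. - (m0 x + \<beta> x * (y - x) - hp (y - x))"])
    show "0 \<le> - (m0 z + \<beta> z * (y - z) - hp (y - z))" if "x < z" "z < x'" for z
      using chord_outside[of z "y - z"] o[OF that] that assms by force
    show "((\<lambda>x. - cl x y) has_real_derivative - (m0 z + \<beta> z * (y - z) - hp (y - z))) (at z within {-1..b})"
      if "x \<le> z" "z \<le> x'" for z
      by (rule DERIV_minus[OF cl_deriv]) (use that assms in auto)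
  qed (use assms in auto)
  then show ?thesis by simp
qed

lemma cl_increasing:
  assumes "-1 \<le> x" "x \<le> x'" "x' \<le> b" and o: "\<And>z. x < z \<Longrightarrow> z < x' \<Longrightarrow> D z \<le> y \<and> y \<le> U z"
  shows "cl x y \<le> cl x' y"
proof (rule deriv_within_mono[where S = "{-1..b}" and f = "\<lambda>x. cl x y" and f' = "\<lambda>x. m0 x + \<beta> x * (y - x) - hp (y - x)"])
  show "0 \<le> m0 z + \<beta> z * (y - z) - hp (y - z)" if "x < z" "z < x'" for z
    using chord_inside[of z "y - z"] o[OF that] that assms by force
qed (use assms in \<open>auto intro!: cl_deriv\<close>)

text \<open>The left source of a target \<open>y \<le> U b\<close>; both branches give
  \<open>-1\<close> at \<open>y = -1\<close>.\<close>

definition \<tau> where "\<tau> y = (if y \<le> -1 then the_inv_into {-1..b} D y else the_inv_into {-1..b} U y)"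

lemma D_inj: "inj_on D {-1..b}" and U_inj: "inj_on U {-1..b}"
  by (rule inj_onI, metis D_dec atLeastAtMost_iff less_irrefl linorder_neqE_linordered_idom,
      rule inj_onI, metis U_inc atLeastAtMost_iff less_irrefl linorder_neqE_linordered_idom)

lemma D_image: "D ` {-1..b} = {-2..-1}"
proof
  show "D ` {-1..b} \<subseteq> {-2..-1}" using D_le D_ge by auto
  show "{-2..-1} \<subseteq> D ` {-1..b}"
  proof
    fix y assume "y \<in> {-2..(-1::real)}"
    then have "\<exists>x\<ge>-1. x \<le> b \<and> D x = y" using DU_m1 D_b b1 by (intro IVT2' D_continuous) auto
    then show "y \<in> D ` {-1..b}" by auto
  qed
qed

lemma U_ge_m1: "-1 \<le> x \<Longrightarrow> x \<le> b \<Longrightarrow> -1 \<le> U x" "-1 \<le> x \<Longrightarrow> x \<le> b \<Longrightarrow> U x \<le> U b"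
  using U_inc[of "-1" x] DU_m1 U_inc[of x b] by (cases "x = -1"; cases "x = b"; force)+

lemma U_image: "U ` {-1..b} = {-1..U b}"
proof
  show "U ` {-1..b} \<subseteq> {-1..U b}" using U_ge_m1 by auto
  show "{-1..U b} \<subseteq> U ` {-1..b}"
  proof
    fix y assume "y \<in> {-1..U b}"
    then have "\<exists>x\<ge>-1. x \<le> b \<and> U x = y" using DU_m1 b1 by (intro IVT' U_continuous) auto
    then show "y \<in> U ` {-1..b}" by auto
  qed
qed

lemma \<tau>_D: "t \<in> {-1..b} \<Longrightarrow> \<tau> (D t) = t"
  using the_inv_into_f_f[OF D_inj, of t] D_le[of t] by (simp add: \<tau>_def)

lemma \<tau>_U: "t \<in> {-1..b} \<Longrightarrow> \<tau> (U t) = t"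
proof (cases "t = -1")
  case True
  then show ?thesis using \<tau>_D[of "-1"] b1 by (simp add: DU_m1)
next
  case False
  assume t: "t \<in> {-1..b}"
  then have "U t > -1" using U_inc[of "-1" t] DU_m1 False by auto
  then show ?thesis using the_inv_into_f_f[OF U_inj t] by (simp add: \<tau>_def)
qed

lemma \<tau>_cases:
  assumes "y \<in> {-2..U b}"
  obtains (D) "y \<le> -1" "\<tau> y \<in> {-1..b}" "y = D (\<tau> y)" | (U) "-1 \<le> y" "\<tau> y \<in> {-1..b}" "y = U (\<tau> y)"
proof (cases "y \<le> -1")
  case True
  then obtain t where "t \<in> {-1..b}" "y = D t" using D_image assms by (metis atLeastAtMost_iff imageE)
  then show ?thesis using D True \<tau>_D by auto
next
  case False
  then obtain t where "t \<in> {-1..b}" "y = U t" using U_image assms by (metis atLeastAtMost_iff imageE less_eq_real_def not_le)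
  then show ?thesis using U False \<tau>_U by auto
qed

lemma \<tau>_range: "y \<in> {-2..U b} \<Longrightarrow> \<tau> y \<in> {-1..b}"
  by (erule \<tau>_cases)

lemma Ub_gt: "U b > -1" "U b > 1 - k" using U_b db0 k1 Rb1 by auto

lemma \<tau>_cont: "continuous_on {-2..U b} \<tau>"
proof -
  have "continuous_on ({-2..-1} \<union> {-1..U b}) \<tau>"
    unfolding \<tau>_def
  proof (rule continuous_on_cases)
    show "continuous_on {-2..-1} (the_inv_into {-1..b} D)"
      using continuous_on_inv_into[OF D_continuous _ D_inj] D_image by simp
    show "continuous_on {-1..U b} (the_inv_into {-1..b} U)"
      using continuous_on_inv_into[OF U_continuous _ U_inj] U_image by simp
    have "the_inv_into {-1..b} D (-1) = the_inv_into {-1..b} U (-1)"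
      using the_inv_into_f_f[OF D_inj, of "-1"] the_inv_into_f_f[OF U_inj, of "-1"] DU_m1 b1 by simp
    then show "\<forall>x. x \<in> {-2..-1} \<and> \<not> x \<le> -1 \<or> x \<in> {-1..U b} \<and> x \<le> -1 \<longrightarrow> the_inv_into {-1..b} D x = the_inv_into {-1..b} U x"
      by (metis antisym atLeastAtMost_iff)
  qed auto
  moreover have "{-2..-1} \<union> {-1..U b} = {-2..U b}" using Ub_gt by auto
  ultimately show ?thesis by simp
qed

definition p where "p y = hp (y - \<tau> y) + Bl (\<tau> y)"
definition \<psi>l where "\<psi>l y = cl (\<tau> y) y"

lemma p_cont: "continuous_on {-2..U b} p"
  unfolding p_def
  by (intro continuous_intros \<tau>_cont continuous_on_compose2[OF Bl_cont \<tau>_cont]) (use \<tau>_range in auto)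

text \<open>Nestedness of the intervals \<open>[D x, U x]\<close>: for a fixed target \<open>y\<close> the potential \<open>cl x y\<close> decreases in \<open>x\<close>
  until the source of \<open>y\<close> is reached and increases afterwards.\<close>

lemma \<psi>l_le:
  assumes y: "y \<in> {-2..U b}" and x: "x \<in> {-1..b}"
  shows "\<psi>l y \<le> cl x y"
proof -
  have t: "\<tau> y \<in> {-1..b}" using \<tau>_range[OF y] .
  show ?thesis
  proof (cases "x \<le> \<tau> y")
    case True
    show ?thesis unfolding \<psi>l_def
    proof (rule cl_decreasing)
      fix z assume z: "x < z" "z < \<tau> y"
      from y show "y \<le> D z \<or> U z \<le> y"
        by (cases rule: \<tau>_cases) (use z t x D_dec[of z "\<tau> y"] U_inc[of z "\<tau> y"] in auto)
    qed (use True t x in auto)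
  next
    case False
    show ?thesis unfolding \<psi>l_def
    proof (rule cl_increasing)
      fix z assume z: "\<tau> y < z" "z < x"
      from y show "D z \<le> y \<and> y \<le> U z"
        by (cases rule: \<tau>_cases)
           (use z t x D_dec[of "\<tau> y" z] U_inc[of "\<tau> y" z] D_le[of z] U_ge_m1[of z] in force)+
    qed (use False t x in auto)
  qed
qed

lemma cl_ge_b:
  assumes y: "y \<ge> U b" and x: "x \<in> {-1..b}"
  shows "cl b y \<le> cl x y"
proof (rule cl_decreasing)
  fix z assume "x < z" "z < b"
  then show "y \<le> D z \<or> U z \<le> y" using U_inc[of z b] x y by auto
qed (use x in auto)

lemma cl_taylor:
  "0 \<le> cl x y' - cl x y - (hp (y - x) + Bl x) * (y' - y)"
  "cl x y' - cl x y - (hp (y - x) + Bl x) * (y' - y) \<le> (y' - y)\<^sup>2 / 2"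
  using hinge_taylor[of "y' - x" "y - x"] by (simp_all add: cl_def algebra_simps)

text \<open>Envelope argument: \<open>\<psi>l\<close> is a minimum over sources, so the sources of
  \<open>y\<close> and of \<open>z\<close> bound the increment from both sides, and continuity of
  \<open>p\<close> closes the gap.\<close>

lemma \<psi>l_deriv:
  assumes y: "y \<in> {-2..U b}"
  shows "(\<psi>l has_real_derivative p y) (at y within {-2..U b})"
  unfolding has_field_derivative_iff
proof (rule LIM_zero_cancel, rule Lim_null_comparison)
  let ?F = "at y within {-2..U b}"
  show "\<forall>\<^sub>F z in ?F. norm ((\<psi>l z - \<psi>l y) / (z - y) - p y) \<le> \<bar>z - y\<bar> + \<bar>p z - p y\<bar>"
  proof -
    have "norm ((\<psi>l z - \<psi>l y) / (z - y) - p y) \<le> \<bar>z - y\<bar> + \<bar>p z - p y\<bar>"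
      if z: "z \<in> {-2..U b}" "z \<noteq> y" for z
    proof -
      have "\<psi>l z \<le> cl (\<tau> y) z" by (rule \<psi>l_le[OF z(1) \<tau>_range[OF y]])
      then have a: "\<psi>l z - \<psi>l y - p y * (z - y) \<le> (z - y)\<^sup>2 / 2"
        using cl_taylor(2)[of "\<tau> y" z y] by (simp add: \<psi>l_def p_def)
      have "\<psi>l y \<le> cl (\<tau> z) y" by (rule \<psi>l_le[OF y \<tau>_range[OF z(1)]])
      then have c: "\<psi>l y - \<psi>l z - p z * (y - z) \<le> (y - z)\<^sup>2 / 2"
        using cl_taylor(2)[of "\<tau> z" y z] by (simp add: \<psi>l_def p_def)
      have "p y * (z - y) - p z * (z - y) \<le> \<bar>p z - p y\<bar> * \<bar>z - y\<bar>"
      proof -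
        have "(p y - p z) * (z - y) \<le> \<bar>p y - p z\<bar> * \<bar>z - y\<bar>"
          using abs_ge_self[of "(p y - p z) * (z - y)"] by (simp only: abs_mult)
        then show ?thesis by (simp only: left_diff_distrib abs_minus_commute)
      qed
      then have "\<bar>\<psi>l z - \<psi>l y - p y * (z - y)\<bar> \<le> (z - y)\<^sup>2 + \<bar>p z - p y\<bar> * \<bar>z - y\<bar>"
      proof -
        have e: "p z * (y - z) = - (p z * (z - y))" "(y - z)\<^sup>2 = (z - y)\<^sup>2"
          by (simp_all add: algebra_simps power2_commute)
        have "0 \<le> (z - y)\<^sup>2" "0 \<le> \<bar>p z - p y\<bar> * \<bar>z - y\<bar>" by simp_all
        then show ?thesis using a c \<open>p y * (z - y) - p z * (z - y) \<le> \<bar>p z - p y\<bar> * \<bar>z - y\<bar>\<close>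
          unfolding e abs_le_iff by linarith
      qed
      also have "\<dots> = (\<bar>z - y\<bar> + \<bar>p z - p y\<bar>) * \<bar>z - y\<bar>"
        by (simp add: power2_eq_square algebra_simps flip: abs_mult)
      finally have "\<bar>\<psi>l z - \<psi>l y - p y * (z - y)\<bar> / \<bar>z - y\<bar> \<le> \<bar>z - y\<bar> + \<bar>p z - p y\<bar>"
        using z(2) by (simp add: divide_simps)
      moreover have "(\<psi>l z - \<psi>l y) / (z - y) - p y = (\<psi>l z - \<psi>l y - p y * (z - y)) / (z - y)"
        using z(2) by (simp add: diff_divide_distrib)
      ultimately show ?thesis by (simp add: abs_divide)
    qed
    then show ?thesis by (auto simp: eventually_at_filter)
  qed
  have "(p \<longlongrightarrow> p y) ?F" using p_cont y by (simp add: continuous_on)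
  then have "((\<lambda>z. \<bar>z - y\<bar> + \<bar>p z - p y\<bar>) \<longlongrightarrow> \<bar>y - y\<bar> + \<bar>p y - p y\<bar>) ?F"
    by (intro tendsto_intros)
  then show "((\<lambda>z. \<bar>z - y\<bar> + \<bar>p z - p y\<bar>) \<longlongrightarrow> 0) ?F" by simp
qed

end

section \<open>Dual potentials of the right part\<close>

context hinge_dual
begin

lemma Y_range: "e \<in> {db..1} \<Longrightarrow> Y e \<in> {-2..1 - k}" "e \<in> {db..1} \<Longrightarrow> Y e \<in> {-2..U b}"
proof -
  show 1: "Y e \<in> {-2..1 - k}" if "e \<in> {db..1}" for e
    using yc_le[OF k1, of db e] yc_le[OF k1, of e 1] that db0 Ydb Y_ge1[of 1] unfolding atLeastAtMost_iff by linarith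
  show "e \<in> {db..1} \<Longrightarrow> Y e \<in> {-2..U b}" using 1[of e] Ub_gt(2) unfolding atLeastAtMost_iff by linarith
qed

definition pe where "pe e = p (Y e)"

lemma p_nonneg: "y \<in> {-2..U b} \<Longrightarrow> 0 \<le> p y"
  using Bl_bounds(1)[of "\<tau> y"] \<tau>_range[of y] hp_nonneg[of "y - \<tau> y"] by (simp add: p_def)

lemma pe_nonneg: "e \<in> {db..1} \<Longrightarrow> 0 \<le> pe e"
  using p_nonneg Y_range by (simp add: pe_def)

lemma pe_cont: "continuous_on {db..1} pe"
  unfolding pe_def by (rule continuous_on_compose2[OF p_cont continuous_yc[OF k1]]) (use Y_range in auto)

lemma source_le:
  assumes "e \<in> {db..1}" shows "Y e - \<tau> (Y e) \<le> e"
  using yc_le_diff[OF k1, of e] \<tau>_range[OF Y_range(2)[OF assms]] assms db0 k1 by auto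

lemma pe_le:
  assumes e: "e \<in> {db..1}" shows "pe e - Bl b \<le> hp e"
  using hp_mono[OF source_le[OF e]] Bl_mono[of "\<tau> (Y e)" b] \<tau>_range[OF Y_range(2)[OF e]]
  by (simp add: pe_def p_def)

lemma y_minus_p:
  assumes y: "y \<in> {-2..U b}" shows "y - p y \<le> b + s - Bl b"
  using hp_lower[of "y - \<tau> y"] Bl_lip[of "\<tau> y" b] \<tau>_range[OF y] by (simp add: p_def)

text \<open>A free target with coordinate \<open>e \<le> s\<close> is reached by a displacement at
  most \<open>s\<close>, and every later left source has
  \<open>u x \<le> L x \<le> e \<le> s\<close>; so the hinge is inactive and \<open>\<beta>\<close>
  vanishes from that source up to \<open>b\<close>.\<close>

lemma pe_const:
  assumes e: "e \<in> {db..1}" and es: "e \<le> s" shows "pe e = Bl b"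
proof -
  define t where "t = \<tau> (Y e)"
  have t: "t \<in> {-1..b}" unfolding t_def by (rule \<tau>_range[OF Y_range(2)[OF e]])
  have Lt: "L t \<le> e"
  proof -
    have Ye: "Y e = D t \<or> Y e = U t" unfolding t_def by (rule \<tau>_cases[OF Y_range(2)[OF e]]) auto
    have inj: "e = e'" if "Y e = Y e'" "0 \<le> e'" for e'
      using yc_less[OF k1, of e e'] yc_less[OF k1, of e' e] that e db0 by (cases e e' rule: linorder_cases) auto
    have "e = L t \<or> e = R t"
      using Ye inj[of "L t"] inj[of "R t"] L_eq[of t] LR[of t] t db0 by (auto simp: D_def U_def)
    then show ?thesis using LR[of t] t by auto
  qed
  have \<beta>0: "\<beta> x = 0" if x: "t < x" "x < b" for x
  proof -
    have "u x \<le> L x" using u_le[of x] x t by auto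
    also have "L x \<le> L t" using L_dec[of t x] x t by auto
    finally have "u x \<le> s" using Lt es by simp
    moreover have "- v x \<le> s" using uv_pos[of x] x t es e db0 by auto
    ultimately show ?thesis using x t es e db0 by (auto simp: \<beta>_def hp_le)
  qed
  have "Bl b \<le> Bl t"
  proof -
    have "- Bl t \<le> - Bl b"
      by (rule deriv_within_mono[where S = "{-1..b}" and f = "\<lambda>x. - Bl x" and f' = "\<lambda>x. - \<beta> x"])
         (use t \<beta>0 in \<open>auto intro!: DERIV_minus Bl_deriv\<close>)
    then show ?thesis by simp
  qed
  then have "Bl t = Bl b" using Bl_mono[of t b] t by auto
  moreover have "hp (Y e - t) = 0" using source_le[OF e] es by (auto simp: t_def hp_le)
  ultimately show ?thesis by (simp add: pe_def p_def t_def)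
qed

definition J where "J d = integral {db..d} (\<lambda>e. hp e - pe e)"
text \<open>Minus the multiplier at the source \<open>z1 k d\<close>. It solves
  \<open>(k - d) * B' = hp d - pe d + B\<close> with initial value \<open>Bl b\<close>: the
  potential is tangent along the upper graph, while along the lower graph, which is the boundary of
  the constraint, only its value is matched.\<close>

definition Bt where "Bt d = ((k - db) * Bl b + J d) / (k - d)"

lemma J_deriv: "d \<in> {db..1} \<Longrightarrow> (J has_real_derivative hp d - pe d) (at d within {db..1})"
  unfolding J_def by (intro integral_has_real_derivative continuous_intros pe_cont)

lemma kd: "d \<in> {db..1} \<Longrightarrow> k - d > 0" "d \<in> {db..1} \<Longrightarrow> k + d > 0" using k1 db0 by auto

lemma Bt_db: "Bt db = Bl b"
  using db1 k1 by (simp add: Bt_def J_def)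

lemma Bt_eq: "d \<in> {db..1} \<Longrightarrow> (k - d) * Bt d = (k - db) * Bl b + J d"
  using kd[of d] by (simp add: Bt_def)

lemma Bt_deriv:
  assumes d: "d \<in> {db..1}"
  shows "(Bt has_real_derivative (hp d - pe d + Bt d) / (k - d)) (at d within {db..1})"
proof -
  have "(Bt has_real_derivative ((0 + (hp d - pe d)) * (k - d) - ((k - db) * Bl b + J d) * (0 - 1)) / ((k - d) * (k - d))) (at d within {db..1})"
    unfolding Bt_def
    by (intro DERIV_divide DERIV_add DERIV_diff DERIV_const DERIV_ident J_deriv d) (use kd[OF d] in auto)
  moreover have "((0 + (hp d - pe d)) * (k - d) - ((k - db) * Bl b + J d) * (0 - 1)) / ((k - d) * (k - d)) = (hp d - pe d + Bt d) / (k - d)"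
    using kd[OF d] Bt_eq[OF d, symmetric] by (simp add: divide_simps) (simp add: algebra_simps)
  ultimately show ?thesis by simp
qed

lemma Bt_cont: "continuous_on {db..1} Bt"
  using Bt_deriv by (rule DERIV_continuous_on)

lemma Bt_diff_deriv:
  "d \<in> {db..1} \<Longrightarrow> ((\<lambda>d. (k - d) * (Bt d - Bl b)) has_real_derivative hp d - pe d + Bl b) (at d within {db..1})"
proof -
  assume d: "d \<in> {db..1}"
  have "((\<lambda>d. (k - db) * Bl b + J d - (k - d) * Bl b) has_real_derivative 0 + (hp d - pe d) - (0 - 1) * Bl b) (at d within {db..1})"
    by (intro DERIV_add DERIV_diff DERIV_const DERIV_ident J_deriv d DERIV_cmult_right)
  then have "((\<lambda>d. (k - db) * Bl b + J d - (k - d) * Bl b) has_real_derivative hp d - pe d + Bl b) (at d within {db..1})"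
    by simp
  then show ?thesis
    by (rule has_field_derivative_transform_within[OF _ zero_less_one d]) (simp only: right_diff_distrib Bt_eq)
qed

lemma Bt_ge: assumes d: "d \<in> {db..1}" shows "Bl b \<le> Bt d"
proof -
  have "(k - db) * (Bt db - Bl b) \<le> (k - d) * (Bt d - Bl b)"
  proof (rule deriv_within_mono[where S = "{db..1}" and f = "\<lambda>d. (k - d) * (Bt d - Bl b)" and f' = "\<lambda>d. hp d - pe d + Bl b"])
    show "0 \<le> hp x - pe x + Bl b" if "db < x" "x < d" for x using pe_le[of x] that d by auto
    show "((\<lambda>d. (k - d) * (Bt d - Bl b)) has_real_derivative hp x - pe x + Bl b) (at x within {db..1})"
      if "db \<le> x" "x \<le> d" for x by (rule Bt_diff_deriv) (use that d in auto)
  qed (use d in auto)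
  then show ?thesis using kd[OF d] by (simp add: Bt_db zero_le_mult_iff)
qed

lemma Bt_mono: assumes "d \<in> {db..1}" "d' \<in> {db..1}" "d \<le> d'" shows "Bt d \<le> Bt d'"
proof (rule deriv_within_mono[where f = Bt and S = "{db..1}" and f' = "\<lambda>d. (hp d - pe d + Bt d) / (k - d)"])
  fix x assume "d < x" "x < d'"
  then have x: "x \<in> {db..1}" using assms by auto
  show "0 \<le> (hp x - pe x + Bt x) / (k - x)"
    using pe_le[OF x] Bt_ge[OF x] kd[OF x] by (intro divide_nonneg_pos) auto
qed (use assms in \<open>auto intro!: Bt_deriv\<close>)

lemma Bt_const: assumes d: "d \<in> {db..1}" "d \<le> s" shows "Bt d = Bl b"
proof -
  have "- ((k - db) * (Bt db - Bl b)) \<le> - ((k - d) * (Bt d - Bl b))"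
  proof (rule deriv_within_mono[where S = "{db..1}" and f = "\<lambda>d. - ((k - d) * (Bt d - Bl b))" and f' = "\<lambda>d. - (hp d - pe d + Bl b)"])
    show "((\<lambda>d. - ((k - d) * (Bt d - Bl b))) has_real_derivative - (hp x - pe x + Bl b)) (at x within {db..1})"
      if "db \<le> x" "x \<le> d" for x by (intro DERIV_minus Bt_diff_deriv) (use that d in auto)
    show "0 \<le> - (hp x - pe x + Bl b)" if "db < x" "x < d" for x
      using pe_const[of x] hp_le[of x] that d by auto
  qed (use d in auto)
  then have "(k - d) * (Bt d - Bl b) \<le> 0" by (simp add: Bt_db)
  then have "Bt d - Bl b \<le> 0" using kd(1)[OF d(1)] by (simp add: mult_le_0_iff)
  then show ?thesis using Bt_ge[OF d(1)] by simp
qed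

text \<open>With \<open>C = b + s - Bl b - Y + pe \<ge> 0\<close> the left-hand side times \<open>k - d\<close> equals
  \<open>(k - d) * C\<close> plus the integral of \<open>C - max (s - e) 0 \<ge> 0\<close>.\<close>

lemma slope_le_1: assumes d: "d \<in> {db..1}" shows "0 \<le> k + s + pe d - Bt d"
proof -
  define g where "g = (\<lambda>d. (k - d) * (2 + Bl b + Y d) - (k - db) * Bl b - J d)"
  have gd: "(g has_real_derivative k + x - 2 - Bl b - Y x - hp x + pe x) (at x within {db..1})" if x: "x \<in> {db..1}" for x
  proof -
    have "(g has_real_derivative ((0 - 1) * (2 + Bl b + Y x) + (0 + (k + x) / (k - x)) * (k - x)) - 0 - (hp x - pe x)) (at x within {db..1})"
      unfolding g_def by (intro DERIV_diff DERIV_mult DERIV_add DERIV_const DERIV_ident J_deriv Y_deriv x)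
    moreover have "((0 - 1) * (2 + Bl b + Y x) + (0 + (k + x) / (k - x)) * (k - x)) - 0 - (hp x - pe x) = k + x - 2 - Bl b - Y x - hp x + pe x"
      using kd(1)[OF x] by simp
    ultimately show ?thesis by (rule DERIV_cong)
  qed
  have C: "0 \<le> b + s - Bl b - Y x + pe x" if "x \<in> {db..1}" for x
    using y_minus_p[OF Y_range(2)[OF that]] by (simp add: pe_def)
  have "g db \<le> g d"
  proof (rule deriv_within_mono[where f = g and S = "{db..1}" and f' = "\<lambda>x. k + x - 2 - Bl b - Y x - hp x + pe x"])
    fix x assume "db < x" "x < d"
    then have x: "x \<in> {db..1}" using d by auto
    show "0 \<le> k + x - 2 - Bl b - Y x - hp x + pe x"
    proof (cases "x \<le> s")
      case True
      have "Bl b \<le> k - 1" using Bl_bounds(2)[of b] b1 by simp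
      then show ?thesis using True pe_nonneg[OF x] yc_le_diff[OF k1, of x] x db0 k1 by (simp add: hp_le)
    next
      case False
      then show ?thesis using C[OF x] by (simp add: hp_ge)
    qed
  qed (use d gd in auto)
  moreover have "g db = 0" using Ydb by (simp add: g_def J_def)
  ultimately have "0 \<le> g d" by simp
  moreover have "(k - d) * (k + s + pe d - Bt d) = g d + (k - d) * (b + s - Bl b - Y d + pe d)"
    using Bt_eq[OF d] by (simp add: g_def algebra_simps)
  moreover have "0 \<le> (k - d) * (b + s - Bl b - Y d + pe d)" using C[OF d] kd(1)[OF d] by simp
  ultimately have "0 \<le> (k - d) * (k + s + pe d - Bt d)" by simp
  then show ?thesis using kd(1)[OF d] by (simp add: zero_le_mult_iff)
qed

text \<open>\<open>Bt\<close> grows at most as fast as the source, as \<open>Bl_lip\<close> says on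
  the left part. It is constant for \<open>d \<le> s\<close>; above the kink the numerator is
  controlled by \<open>slope_le_1\<close>.\<close>

lemma zB_mono: assumes "d \<in> {db..1}" "d' \<in> {db..1}" "d \<le> d'" shows "z1 k d - Bt d \<le> z1 k d' - Bt d'"
proof (rule deriv_within_mono[where S = "{db..1}" and f = "\<lambda>d. z1 k d - Bt d"
      and f' = "\<lambda>d. (k + d) / (k - d) - (hp d - pe d + Bt d) / (k - d)"])
  fix x assume "d < x" "x < d'"
  then have x: "x \<in> {db..1}" using assms by auto
  have "0 \<le> (k + x) - (hp x - pe x + Bt x)"
    using slope_le_1[OF x] pe_const[OF x] Bt_const[OF x] kd(2)[OF x]
    by (cases "x \<le> s") (auto simp: hp_le hp_ge)
  then show "0 \<le> (k + x) / (k - x) - (hp x - pe x + Bt x) / (k - x)"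
    using kd(1)[OF x] by (simp add: divide_simps)
qed (use assms in \<open>auto intro!: DERIV_diff z_deriv Bt_deriv\<close>)

text \<open>Fixed by contact with \<open>\<psi>l\<close> at the lower target
  \<open>Y d\<close>.\<close>

definition \<phi>t where "\<phi>t d = hinge s (- k) - \<psi>l (Y d) - k * Bt d"
definition ct where "ct d y = hinge s (y - z1 k d) - \<phi>t d + Bt d * (y - z1 k d)"
definition Ut where "Ut e = z1 k e + e"
definition \<psi>t where "\<psi>t e = ct e (Ut e)"

lemma ct_D: "d \<in> {db..1} \<Longrightarrow> ct d (Y d) = \<psi>l (Y d)"
proof -
  assume "d \<in> {db..1}"
  then have e: "Y d - z1 k d = - k" using Y_z1[of d] by simp
  show ?thesis unfolding ct_def \<phi>t_def e by simp
qed

lemma \<psi>l_D: "t \<in> {-1..b} \<Longrightarrow> \<psi>l (D t) = cl t (D t)" and \<psi>l_U: "t \<in> {-1..b} \<Longrightarrow> \<psi>l (U t) = cl t (U t)"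
  by (simp_all add: \<psi>l_def \<tau>_D \<tau>_U)

lemma \<phi>t_db: "\<phi>t db = \<phi>l b"
  using \<psi>l_D[of b] b1 by (simp add: \<phi>t_def Bt_db Ydb D_b cl_def)

lemma ct_db: "ct db y = cl b y"
  unfolding ct_def cl_def \<phi>t_db Bt_db zdb by simp

lemma \<psi>t_eq: "e \<in> {db..1} \<Longrightarrow> \<psi>t e = hinge s e - hinge s (- k) + \<psi>l (Y e) + (k + e) * Bt e"
  by (simp add: \<psi>t_def ct_def \<phi>t_def Ut_def algebra_simps)

lemma \<psi>lY_deriv:
  assumes e: "e \<in> {db..1}"
  shows "((\<lambda>e. \<psi>l (Y e)) has_real_derivative pe e * ((k + e) / (k - e))) (at e within {db..1})"
proof -
  have "Y ` {db..1} \<subseteq> {-2..U b}" using Y_range(2) by auto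
  then have "(\<psi>l has_real_derivative p (Y e)) (at (Y e) within Y ` {db..1})"
    using DERIV_subset[OF \<psi>l_deriv[OF Y_range(2)[OF e]]] by blast
  from DERIV_image_chain[OF this Y_deriv[OF e]] show ?thesis by (simp add: o_def pe_def)
qed

text \<open>The equation for \<open>Bt\<close> is exactly what makes the target slope equal to
  \<open>hp e + Bt e\<close>, the slope of \<open>ct e\<close> at its upper target.\<close>

lemma \<psi>t_deriv:
  assumes e: "e \<in> {db..1}"
  shows "(\<psi>t has_real_derivative (hp e + Bt e) * (1 + (k + e) / (k - e))) (at e within {db..1})"
proof -
  let ?w = "(k + e) / (k - e)"
  have "((\<lambda>e. hinge s e - hinge s (- k) + \<psi>l (Y e) + (k + e) * Bt e) has_real_derivative
    hp e - 0 + pe e * ?w + ((0 + 1) * Bt e + (hp e - pe e + Bt e) / (k - e) * (k + e))) (at e within {db..1})"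
    by (intro DERIV_add DERIV_diff DERIV_mult DERIV_const DERIV_ident \<psi>lY_deriv Bt_deriv e)
       (unfold hp_def, rule hinge_deriv)
  moreover have "hp e - 0 + pe e * ?w + ((0 + 1) * Bt e + (hp e - pe e + Bt e) / (k - e) * (k + e)) = (hp e + Bt e) * (1 + ?w)"
    by (simp add: algebra_simps add_divide_distrib diff_divide_distrib)
  ultimately have "((\<lambda>e. hinge s e - hinge s (- k) + \<psi>l (Y e) + (k + e) * Bt e) has_real_derivative (hp e + Bt e) * (1 + ?w)) (at e within {db..1})"
    by simp
  then show ?thesis
    by (rule has_field_derivative_transform_within[OF _ zero_less_one e]) (simp add: \<psi>t_eq)
qed

lemma ct_y_deriv: "(ct d has_real_derivative hp (y - z1 k d) + Bt d) (at y within S)"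
proof -
  have "((\<lambda>y. hinge s (y - z1 k d)) has_real_derivative hp (y - z1 k d) * (1 - 0)) (at y within S)"
    by (rule DERIV_chain2[where f = "hinge s" and g = "\<lambda>y. y - z1 k d"])
       (auto intro!: derivative_eq_intros hinge_deriv simp: hp_def)
  then have "(ct d has_real_derivative hp (y - z1 k d) * (1 - 0) - 0 + (1 - 0) * Bt d) (at y within S)"
    unfolding ct_def mult.commute[of "Bt d"]
    by (intro DERIV_add DERIV_diff DERIV_const DERIV_cmult_right DERIV_ident)
  then show ?thesis by simp
qed

text \<open>The slope, in the target, of the dual slack of source \<open>z1 k d\<close> at the upper
  target \<open>Ut e\<close>.\<close>

definition r where "r d e = hp (Ut e - z1 k d) - hp e - Bt e + Bt d"

lemma top_deriv:
  assumes e: "e \<in> {db..1}"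
  shows "((\<lambda>e. ct d (Ut e) - \<psi>t e) has_real_derivative r d e * (1 + (k + e) / (k - e))) (at e within {db..1})"
proof -
  have U: "(Ut has_real_derivative (k + e) / (k - e) + 1) (at e within {db..1})"
    unfolding Ut_def by (intro DERIV_add DERIV_ident z_deriv e)
  have "((\<lambda>e. ct d (Ut e)) has_real_derivative (hp (Ut e - z1 k d) + Bt d) * ((k + e) / (k - e) + 1)) (at e within {db..1})"
    using DERIV_image_chain[OF ct_y_deriv[of d "Ut e" "Ut ` {db..1}"] U] by (simp add: o_def)
  from DERIV_diff[OF this \<psi>t_deriv[OF e]] show ?thesis by (simp add: r_def algebra_simps)
qed

lemma z_mono: "d \<in> {db..1} \<Longrightarrow> e \<in> {db..1} \<Longrightarrow> d \<le> e \<Longrightarrow> z1 k d \<le> z1 k e"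
  using z1_slope[OF k1, of d e] db0 k1 by auto

lemma w_pos: "e \<in> {db..1} \<Longrightarrow> 0 \<le> 1 + (k + e) / (k - e)"
  using kd[of e] by simp

lemma r_right:
  assumes d: "d \<in> {db..1}" and e: "e \<in> {db..1}" "d \<le> e" shows "0 \<le> r d e"
proof (cases "e \<le> s")
  case True
  then show ?thesis using Bt_const[OF d] Bt_const[OF e(1)] e hp_nonneg by (simp add: r_def hp_le)
next
  case False
  have "Ut e - z1 k d \<ge> s" using z_mono[OF d e] False by (simp add: Ut_def)
  then show ?thesis using zB_mono[OF d e] False by (simp add: r_def hp_ge Ut_def)
qed

lemma top_right:
  assumes d: "d \<in> {db..1}" and e: "e \<in> {db..1}" "d \<le> e" shows "\<psi>t e \<le> ct d (Ut e)"
proof -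
  have "ct d (Ut d) - \<psi>t d \<le> ct d (Ut e) - \<psi>t e"
    by (rule deriv_within_mono[OF e(2), where S = "{db..1}" and f' = "\<lambda>e. r d e * (1 + (k + e) / (k - e))"])
       (use d e in \<open>auto intro!: top_deriv mult_nonneg_nonneg r_right w_pos\<close>)
  then show ?thesis by (simp add: \<psi>t_def)
qed

text \<open>On \<open>[db, d]\<close> the derivative \<open>r\<close> is antitone until \<open>Ut e = z1 k d + s\<close> and nonpositive afterwards.\<close>

lemma r_persist:
  assumes d: "d \<in> {db..1}" and e: "e \<in> {db..1}" "e \<le> e'" "e' \<le> d" and r: "r d e \<le> 0" shows "r d e' \<le> 0"
proof (cases "Ut e' - z1 k d \<le> s")
  case True
  have e': "e' \<in> {db..1}" using e d by auto
  have "hp e \<le> hp e'" "Bt e \<le> Bt e'" using e Bt_mono[OF e(1) e'] by (auto intro: hp_mono)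
  moreover have "hp (Ut e - z1 k d) \<ge> 0" by (rule hp_nonneg)
  ultimately show ?thesis using r True by (simp add: r_def hp_le)
next
  case False
  have e': "e' \<in> {db..1}" using e d by auto
  have "s \<le> e'" using False z_mono[OF e' d e(3)] by (simp add: Ut_def)
  then show ?thesis using False zB_mono[OF e' d e(3)] by (simp add: r_def hp_ge Ut_def)
qed

lemma top_left:
  assumes d: "d \<in> {db..1}" and e: "e \<in> {db..1}" "e \<le> d" and r: "r d e \<le> 0"
  shows "\<psi>t e \<le> ct d (Ut e)"
proof -
  have "- (ct d (Ut e) - \<psi>t e) \<le> - (ct d (Ut d) - \<psi>t d)"
  proof (rule deriv_within_mono[OF e(2), where S = "{db..1}" and f = "\<lambda>e. - (ct d (Ut e) - \<psi>t e)" and f' = "\<lambda>e. - (r d e * (1 + (k + e) / (k - e)))"])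
    fix x assume x: "e < x" "x < d"
    then have "r d x \<le> 0" using r_persist[OF d e(1) _ _ r, of x] by simp
    then show "0 \<le> - (r d x * (1 + (k + x) / (k - x)))"
      using w_pos[of x] x d e by (simp add: mult_nonpos_nonneg)
  next
    show "((\<lambda>e. - (ct d (Ut e) - \<psi>t e)) has_real_derivative - (r d x * (1 + (k + x) / (k - x)))) (at x within {db..1})"
      if "e \<le> x" "x \<le> d" for x by (rule DERIV_minus[OF top_deriv]) (use that e d in auto)
  qed (use d e in auto)
  then show ?thesis by (simp add: \<psi>t_def)
qed

text \<open>If \<open>r d e\<close> is positive, \<open>r_persist\<close> makes the slope
  nonnegative on all of \<open>[db, e]\<close>, and nonnegativity is carried up from the junction.
  Otherwise the slack decreases towards its contact at \<open>d\<close>.\<close>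

lemma top_from_junction:
  assumes d: "d \<in> {db..1}" and e: "e \<in> {db..1}" "e \<le> d" and U: "\<psi>t db \<le> ct d (Ut db)"
  shows "\<psi>t e \<le> ct d (Ut e)"
proof (cases "r d e \<le> 0")
  case True then show ?thesis by (rule top_left[OF d e])
next
  case False
  have "ct d (Ut db) - \<psi>t db \<le> ct d (Ut e) - \<psi>t e"
  proof (rule deriv_within_mono[where S = "{db..1}" and f = "\<lambda>e. ct d (Ut e) - \<psi>t e" and f' = "\<lambda>e. r d e * (1 + (k + e) / (k - e))"])
    fix x assume x: "db < x" "x < e"
    then have "0 \<le> r d x" using r_persist[OF d _ _ e(2), of x] False e by force
    then show "0 \<le> r d x * (1 + (k + x) / (k - x))" using w_pos[of x] x e by simp
  qed (use e in \<open>auto intro!: top_deriv\<close>)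
  then show ?thesis using U by simp
qed

lemma Ut_db: "Ut db = U b" using zdb U_b by (simp add: Ut_def)

lemma \<psi>t_db: "\<psi>t db = \<psi>l (U b)"
  using \<psi>l_U[of b] b1 by (simp add: \<psi>t_def Ut_db ct_db)

end

section \<open>Explicit estimates for small \<open>k - 1\<close>\<close>

lemma deriv_nonneg_mono:
  fixes f :: "real \<Rightarrow> real"
  assumes "a \<le> b" and d: "\<And>x. a \<le> x \<Longrightarrow> x \<le> b \<Longrightarrow> (f has_real_derivative f' x) (at x)"
    and "\<And>x. a \<le> x \<Longrightarrow> x \<le> b \<Longrightarrow> f' x \<ge> 0"
  shows "f a \<le> f b"
  by (rule DERIV_nonneg_imp_nondecreasing[OF assms(1)]) (use assms in blast)

lemma deriv_nonpos_antimono: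
  fixes f :: "real \<Rightarrow> real"
  assumes "a \<le> b" and d: "\<And>x. a \<le> x \<Longrightarrow> x \<le> b \<Longrightarrow> (f has_real_derivative f' x) (at x)"
    and "\<And>x. a \<le> x \<Longrightarrow> x \<le> b \<Longrightarrow> f' x \<le> 0"
  shows "f b \<le> f a"
  by (rule DERIV_nonpos_imp_nonincreasing[OF assms(1)]) (use assms in blast)

lemma ln2_le: "ln (2::real) \<le> 6932 / 10000"
proof -
  have "summable (\<lambda>n. (6932 / 10000 :: real) ^ n /\<^sub>R fact n)" by (rule summable_exp_generic)
  then have "(\<Sum>n<8. (6932 / 10000 :: real) ^ n /\<^sub>R fact n) \<le> exp (6932 / 10000)"
    unfolding exp_def by (intro sum_le_suminf) (auto simp: fact_reduce)
  moreover have "(2::real) \<le> (\<Sum>n<8. (6932 / 10000 :: real) ^ n /\<^sub>R fact n)"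
    by (simp add: eval_nat_numeral lessThan_Suc)
  ultimately have "ln 2 \<le> ln (exp (6932 / 10000 :: real))" by (subst ln_le_cancel_iff) auto
  then show ?thesis by simp
qed

lemma ln_add_one_le_cubic:
  fixes t :: real
  assumes "-1 < t" shows "ln (1 + t) \<le> t - t\<^sup>2 / 2 + t ^ 3 / 3"
proof -
  let ?f = "\<lambda>t::real. t - t\<^sup>2 / 2 + t ^ 3 / 3 - ln (1 + t)"
  have d: "(?f has_real_derivative x ^ 3 / (1 + x)) (at x)" if "-1 < x" for x
    using that by (auto intro!: derivative_eq_intros simp: field_simps eval_nat_numeral)
  show ?thesis
  proof (cases "0 \<le> t")
    case True
    have "?f 0 \<le> ?f t"
      by (rule deriv_nonneg_mono[where f' = "\<lambda>x. x ^ 3 / (1 + x)"]) (use True in \<open>auto intro!: d\<close>)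
    then show ?thesis by simp
  next
    case False
    have "?f 0 \<le> ?f t"
    proof (rule deriv_nonpos_antimono[where f = ?f and f' = "\<lambda>x. x ^ 3 / (1 + x)"])
      fix x assume x: "t \<le> x" "x \<le> 0"
      show "(?f has_real_derivative x ^ 3 / (1 + x)) (at x)"
        by (rule d) (use x assms in auto)
      show "x ^ 3 / (1 + x) \<le> 0" using x assms by (simp add: divide_nonpos_pos power_less_zero_eq)
    qed (use False assms in auto)
    then show ?thesis by simp
  qed
qed

text \<open>Expansion about \<open>2\<close>, the middle of the range from 8/5 to 12/5 in which it
  is used.\<close>

lemma ln_le_cubic:
  fixes E :: real
  assumes "0 < E"
  shows "ln E \<le> 6932 / 10000 + (E - 2) / 2 - (E - 2)\<^sup>2 / 8 + (E - 2) ^ 3 / 24"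
proof -
  have "ln E = ln 2 + ln (1 + (E - 2) / 2)" using assms by (subst ln_mult_pos[symmetric]) (auto simp: field_simps)
  also have "\<dots> \<le> 6932 / 10000 + ((E - 2) / 2 - ((E - 2) / 2)\<^sup>2 / 2 + ((E - 2) / 2) ^ 3 / 3)"
    using assms by (intro add_mono ln2_le ln_add_one_le_cubic) auto
  finally show ?thesis by (simp add: power_divide field_simps)
qed

text \<open>In the locale \<open>critical\<close> below, \<open>\<epsilon> * h1 \<epsilon> E\<close>
  is \<open>4 * u\<^sup>2 - (2 - \<epsilon> - \<epsilon> * E)\<^sup>2\<close> after elimination of
  \<open>X\<close>.\<close>

definition h1 :: "real \<Rightarrow> real \<Rightarrow> real" where
  "h1 \<epsilon> E = 8 * (1 + \<epsilon>) * E * ln E - \<epsilon> * E\<^sup>2 - (12 + 2 * \<epsilon>) * E + 12 + 3 * \<epsilon>"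

text \<open>\<open>h1 \<epsilon> x / x\<close> vanishes at \<open>1\<close>, and its derivative has
  the sign of a function increasing up to \<open>4\<close>, so it first falls and then rises.
  Negative at \<open>E0\<close>, it cannot be positive between \<open>1\<close> and
  \<open>E0\<close>.\<close>

lemma h1_less:
  assumes \<epsilon>: "0 < \<epsilon>" "\<epsilon> < 1" and E: "1 < E" "0 < h1 \<epsilon> E" and E0: "0 < E0" "E0 < 4" "h1 \<epsilon> E0 < 0"
  shows "E0 < E"
proof (rule ccontr)
  assume "\<not> E0 < E"
  then have le: "E \<le> E0" by simp
  let ?f = "\<lambda>x. 8 * (1 + \<epsilon>) * ln x - \<epsilon> * x - (12 + 2 * \<epsilon>) + (12 + 3 * \<epsilon>) / x"
  let ?g = "\<lambda>x. 8 * (1 + \<epsilon>) * x - \<epsilon> * x\<^sup>2 - (12 + 3 * \<epsilon>)"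
  have f: "x * ?f x = h1 \<epsilon> x" if "0 < x" for x using that by (simp add: h1_def field_simps power2_eq_square)
  have d: "(?f has_real_derivative ?g x / x\<^sup>2) (at x)" if "0 < x" for x
    using that by (auto intro!: derivative_eq_intros simp: field_simps power2_eq_square)
  have g: "?g x \<le> ?g x'" if "x \<le> x'" "x' \<le> 4" for x x'
  proof -
    have "\<epsilon> * (x + x') \<le> \<epsilon> * 8" using that \<epsilon> by (intro mult_left_mono) auto
    then have "0 \<le> (x' - x) * (8 * (1 + \<epsilon>) - \<epsilon> * (x + x'))" using that by (intro mult_nonneg_nonneg) (auto simp: field_simps)
    also have "\<dots> = ?g x' - ?g x" by (simp add: algebra_simps power2_eq_square)
    finally show ?thesis by simp
  qed
  have "?f 1 = 0" by simp
  show False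
  proof (cases "?g E \<le> 0")
    case True
    have "?f E \<le> ?f 1"
    proof (rule deriv_nonpos_antimono[where f = ?f and f' = "\<lambda>x. ?g x / x\<^sup>2"])
      fix x assume x: "1 \<le> x" "x \<le> E"
      show "(?f has_real_derivative ?g x / x\<^sup>2) (at x)" by (rule d) (use x in auto)
      have "?g x \<le> 0" using g[of x E] x le E0 True by linarith
      then show "?g x / x\<^sup>2 \<le> 0" by (simp add: divide_nonpos_nonneg)
    qed (use E in auto)
    then have "?f E \<le> 0" by simp
    then have "E * ?f E \<le> 0" using E by (intro mult_nonneg_nonpos) auto
    then show False using f[of E] E by simp
  next
    case False
    have "?f E \<le> ?f E0"
    proof (rule deriv_nonneg_mono[where f = ?f and f' = "\<lambda>x. ?g x / x\<^sup>2"])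
      fix x assume x: "E \<le> x" "x \<le> E0"
      show "(?f has_real_derivative ?g x / x\<^sup>2) (at x)" by (rule d) (use x E in auto)
      have "?g x \<ge> 0" using g[of E x] x le E0 False by linarith
      then show "?g x / x\<^sup>2 \<ge> 0" by simp
    qed (use E le in auto)
    moreover have "?f E0 < 0"
    proof (rule ccontr)
      assume "\<not> ?f E0 < 0"
      then have "0 \<le> E0 * ?f E0" using E0 by (intro mult_nonneg_nonneg) auto
      then show False using f[of E0] E0 by simp
    qed
    moreover have "?f E > 0" by (rule zero_less_mult_pos[of E]) (use f[of E] E in simp_all)
    ultimately show False by linarith
  qed
qed

text \<open>The right-hand side is what eliminating \<open>\<epsilon>\<close> in \<open>E_gt\<close>
  asks for. The difference vanishes at \<open>1\<close>, falls and then rises, so only the end 8/5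
  has to be checked.\<close>

lemma ln_le_rational:
  fixes E :: real
  assumes "1 < E" "E \<le> 8/5"
  shows "ln E \<le> (E - 1) * (E + 15) / (E + 3)\<^sup>2"
proof -
  let ?f = "\<lambda>x::real. ln x - (x - 1) * (x + 15) / (x + 3)\<^sup>2"
  let ?g = "\<lambda>x::real. (x - 1) * (x\<^sup>2 + 18 * x - 27)"
  have d: "(?f has_real_derivative ?g x / (x * (x + 3) ^ 3)) (at x)" if "0 < x" for x
  proof -
    have "(?f has_real_derivative inverse x - ((1 * (x + 15) + (x - 1) * 1) * (x + 3)\<^sup>2 - (x - 1) * (x + 15) * (2 * (x + 3)))
        / ((x + 3)\<^sup>2 * (x + 3)\<^sup>2)) (at x)"
      by (intro DERIV_diff DERIV_ln DERIV_divide DERIV_mult' DERIV_cong[OF DERIV_power])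
        (use that in \<open>auto intro!: derivative_eq_intros\<close>)
    moreover have "(1 * (x + 15) + (x - 1) * 1) * (x + 3)\<^sup>2 - (x - 1) * (x + 15) * (2 * (x + 3)) = (x + 3) * (72 - 8 * x)"
      by (simp add: algebra_simps power2_eq_square)
    moreover have "(x + 3)\<^sup>2 * (x + 3)\<^sup>2 = (x + 3) * (x + 3) ^ 3" by (simp add: eval_nat_numeral)
    moreover have "(x + 3) * (72 - 8 * x) / ((x + 3) * (x + 3) ^ 3) = (72 - 8 * x) / (x + 3) ^ 3" using that by simp
    moreover have "inverse x - (72 - 8 * x) / (x + 3) ^ 3 = (1 * (x + 3) ^ 3 - (72 - 8 * x) * x) / (x * (x + 3) ^ 3)"
      unfolding inverse_eq_divide by (rule diff_frac_eq) (use that in auto)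
    moreover have "1 * (x + 3) ^ 3 - (72 - 8 * x) * x = ?g x" by (simp add: algebra_simps eval_nat_numeral)
    ultimately show ?thesis by (simp only:)
  qed
  show ?thesis
  proof (cases "E\<^sup>2 + 18 * E - 27 \<le> 0")
    case True
    have "?f E \<le> ?f 1"
    proof (rule deriv_nonpos_antimono[where f = ?f and f' = "\<lambda>x. ?g x / (x * (x + 3) ^ 3)"])
      fix x assume x: "1 \<le> x" "x \<le> E"
      show "(?f has_real_derivative ?g x / (x * (x + 3) ^ 3)) (at x)" by (rule d) (use x in auto)
      have "x\<^sup>2 \<le> E\<^sup>2" using x by (intro power_mono) auto
      then have "x\<^sup>2 + 18 * x - 27 \<le> 0" using True x by linarith
      then have "?g x \<le> 0" using x by (intro mult_nonneg_nonpos) auto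
      then show "?g x / (x * (x + 3) ^ 3) \<le> 0" using x by (simp add: divide_nonpos_nonneg)
    qed (use assms in auto)
    then show ?thesis by simp
  next
    case False
    have "?f E \<le> ?f (8/5)"
    proof (rule deriv_nonneg_mono[where f = ?f and f' = "\<lambda>x. ?g x / (x * (x + 3) ^ 3)"])
      fix x assume x: "E \<le> x" "x \<le> 8/5"
      show "(?f has_real_derivative ?g x / (x * (x + 3) ^ 3)) (at x)" by (rule d) (use x assms in auto)
      have "E\<^sup>2 \<le> x\<^sup>2" using x assms by (intro power_mono) auto
      then have "x\<^sup>2 + 18 * x - 27 \<ge> 0" using False x by linarith
      then have "?g x \<ge> 0" using x assms by (intro mult_nonneg_nonneg) auto
      then show "?g x / (x * (x + 3) ^ 3) \<ge> 0" using x assms by simp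
    qed (use assms in auto)
    moreover have "?f (8/5) \<le> 0" using ln_le_cubic[of "8/5"] by (simp add: power2_eq_square power3_eq_cube)
    ultimately show ?thesis by simp
  qed
qed


text \<open>The conditions \<open>N \<le> \<epsilon> * P\<close> to which the estimate \<open>C1\<close> reduces are linear in \<open>\<epsilon>\<close>. Eliminating
\<open>\<epsilon>\<close> by \<open>h1 \<epsilon> E > 0\<close> and \<open>ln E\<close> by its cubic bound leaves the following inequalities in one variable.\<close>

lemma C1_poly_1:
  fixes E :: real
  assumes E: "8/5 \<le> E" "E \<le> 19/10"
  defines "N \<equiv> 12 - 4 * E - 8 * E * (11/61)" and "P \<equiv> 6 * E + E\<^sup>2 - 3 + 4 * E * (11/61) * (2 - E)"
  shows "8 * E * (N + P) * (6932 / 10000 + (E - 2) / 2 - (E - 2)\<^sup>2 / 8 + (E - 2) ^ 3 / 24) \<le> (12 * E - 12) * P + (E\<^sup>2 + 2 * E - 3) * N" (is "8 * E * _ * ?c \<le> _")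
proof -
  define y where "y = E - 8/5"
  have y: "E = 8/5 + y" "0 \<le> y" "y \<le> 3/10" using E by (auto simp: y_def)
  have N: "N = (1004/305) + (-332/61) * y" unfolding N_def y by (simp add: field_simps power2_eq_square)
  have P: "P = (14673/1525) + (2542/305) * y + (17/61) * y ^ 2" unfolding P_def y by (simp add: field_simps power2_eq_square power3_eq_cube)
  have NP: "N + P = (19693/1525) + (882/305) * y + (17/61) * y ^ 2" unfolding N P by (simp add: field_simps)
  have c: "?c = (3529/7500) + (31/50) * y + (-7/40) * y ^ 2 + (1/24) * y ^ 3" unfolding y by (simp add: field_simps power2_eq_square power3_eq_cube)
  have "(12 * E - 12) * P + (E\<^sup>2 + 2 * E - 3) * N - 8 * E * (N + P) * ?c = (8374448/14296875) + (25893718/2859375) * y + (3643936/571875) * y ^ 2 + (-232541/114375) * y ^ 3 + (-2339/915) * y ^ 4 + (-661/915) * y ^ 5 + (-17/183) * y ^ 6"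
    unfolding c NP unfolding N P y by (simp add: field_simps eval_nat_numeral)
  \<comment> \<open>With the powers of \<open>y\<close> as separate unknowns the claim becomes
    linear; this chain and the square at 3/10 below are its certificate.\<close>
  moreover have "y ^ (j + 1) \<le> 3/10 * y ^ j" for j using mult_right_mono[OF y(3), of "y ^ j"] y(2) by simp
  from this[of 0] this[of 1] this[of 2] this[of 3] this[of 4] this[of 5] this[of 6]
  have "y\<^sup>2 \<le> 3/10 * y" "y ^ 3 \<le> 3/10 * y\<^sup>2" "y ^ 4 \<le> 3/10 * y ^ 3" "y ^ 5 \<le> 3/10 * y ^ 4" "y ^ 6 \<le> 3/10 * y ^ 5" "y ^ 7 \<le> 3/10 * y ^ 6"
    by (simp_all add: numeral_2_eq_2[symmetric])
  moreover have "0 \<le> y * (y - 3 / 10)\<^sup>2" using y by simp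
  then have "0 \<le> y ^ 3 - 6 / 10 * y\<^sup>2 + 9 / 100 * y" by (simp add: algebra_simps power2_eq_square power3_eq_cube)
  moreover have "0 \<le> y ^ 6" using y by simp
  ultimately show ?thesis using y(2,3) by linarith
qed

lemma C1_poly_2:
  fixes E :: real
  assumes E: "8/5 \<le> E" "E \<le> 19/10"
  defines "N \<equiv> (2 * (61/50) - E) * (12 - 4 * E)" and "P \<equiv> 2 * E * (E - 61/50)\<^sup>2 + (2 * (61/50) - E) * (10 * E + E\<^sup>2 - 3)"
  shows "8 * E * (N + P) * (6932 / 10000 + (E - 2) / 2 - (E - 2)\<^sup>2 / 8 + (E - 2) ^ 3 / 24) \<le> (12 * E - 12) * P + (E\<^sup>2 + 2 * E - 3) * N" (is "8 * E * _ * ?c \<le> _")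
proof -
  define y where "y = E - 8/5"
  have y: "E = 8/5 + y" "0 \<le> y" "y \<le> 3/10" using E by (auto simp: y_def)
  have N: "N = (588/125) + (-224/25) * y + (4) * y ^ 2" unfolding N_def y by (simp add: field_simps power2_eq_square)
  have P: "P = (42289/3125) + (-2189/1250) * y + (-191/25) * y ^ 2 + (1) * y ^ 3" unfolding P_def y by (simp add: field_simps power2_eq_square power3_eq_cube)
  have NP: "N + P = (56989/3125) + (-13389/1250) * y + (-91/25) * y ^ 2 + (1) * y ^ 3" unfolding N P by (simp add: field_simps)
  have c: "?c = (3529/7500) + (31/50) * y + (-7/40) * y ^ 2 + (1/24) * y ^ 3" unfolding y by (simp add: field_simps power2_eq_square power3_eq_cube)
  have "(12 * E - 12) * P + (E\<^sup>2 + 2 * E - 3) * N - 8 * E * (N + P) * ?c = (17043104/29296875) + (3822316/5859375) * y + (-10812469/1171875) * y ^ 2 + (415573/46875) * y ^ 3 + (-871/750) * y ^ 4 + (-8641/3750) * y ^ 5 + (52/25) * y ^ 6 + (-1/3) * y ^ 7"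
    unfolding c NP unfolding N P y by (simp add: field_simps eval_nat_numeral)
  moreover have "y ^ (j + 1) \<le> 3/10 * y ^ j" for j using mult_right_mono[OF y(3), of "y ^ j"] y(2) by simp
  from this[of 0] this[of 1] this[of 2] this[of 3] this[of 4] this[of 5] this[of 6]
  have "y\<^sup>2 \<le> 3/10 * y" "y ^ 3 \<le> 3/10 * y\<^sup>2" "y ^ 4 \<le> 3/10 * y ^ 3" "y ^ 5 \<le> 3/10 * y ^ 4" "y ^ 6 \<le> 3/10 * y ^ 5" "y ^ 7 \<le> 3/10 * y ^ 6"
    by (simp_all add: numeral_2_eq_2[symmetric])
  moreover have "0 \<le> y * (y - 3 / 10)\<^sup>2" using y by simp
  then have "0 \<le> y ^ 3 - 6 / 10 * y\<^sup>2 + 9 / 100 * y" by (simp add: algebra_simps power2_eq_square power3_eq_cube)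
  moreover have "0 \<le> y ^ 7" using y by simp
  ultimately show ?thesis using y(2,3) by linarith
qed

lemma C1_poly_3:
  fixes E :: real
  assumes E: "19/10 \<le> E" "E \<le> 12/5"
  defines "N \<equiv> 12 - 4 * E - 8 * E * (4/29)" and "P \<equiv> 6 * E + E\<^sup>2 - 3 + 4 * E * (4/29) * (2 - E)"
  shows "8 * E * (N + P) * (6932 / 10000 + (E - 2) / 2 - (E - 2)\<^sup>2 / 8 + (E - 2) ^ 3 / 24) \<le> (12 * E - 12) * P + (E\<^sup>2 + 2 * E - 3) * N" (is "8 * E * _ * ?c \<le> _")
proof -
  define y where "y = E - 19/10"
  have y: "E = 19/10 + y" "0 \<le> y" "y \<le> 1/2" using E by (auto simp: y_def)
  have N: "N = (334/145) + (-148/29) * y" unfolding N_def y by (simp add: field_simps power2_eq_square)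
  have P: "P = (35133/2900) + (1277/145) * y + (13/29) * y ^ 2" unfolding P_def y by (simp add: field_simps power2_eq_square power3_eq_cube)
  have NP: "N + P = (41813/2900) + (537/145) * y + (13/29) * y ^ 2" unfolding N P by (simp add: field_simps)
  have c: "?c = (77029/120000) + (421/800) * y + (-11/80) * y ^ 2 + (1/24) * y ^ 3" unfolding y by (simp add: field_simps power2_eq_square power3_eq_cube)
  have "(12 * E - 12) * P + (E\<^sup>2 + 2 * E - 3) * N - 8 * E * (N + P) * ?c = (138822037/435000000) + (2189309/375000) * y + (-1544539/4350000) * y ^ 2 + (-366199/54375) * y ^ 3 + (-7009/1740) * y ^ 4 + (-446/435) * y ^ 5 + (-13/87) * y ^ 6"
    unfolding c NP unfolding N P y by (simp add: field_simps eval_nat_numeral)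
  moreover have "y ^ (j + 1) \<le> 1/2 * y ^ j" for j using mult_right_mono[OF y(3), of "y ^ j"] y(2) by simp
  from this[of 0] this[of 1] this[of 2] this[of 3] this[of 4] this[of 5] this[of 6]
  have "y\<^sup>2 \<le> 1/2 * y" "y ^ 3 \<le> 1/2 * y\<^sup>2" "y ^ 4 \<le> 1/2 * y ^ 3" "y ^ 5 \<le> 1/2 * y ^ 4" "y ^ 6 \<le> 1/2 * y ^ 5" "y ^ 7 \<le> 1/2 * y ^ 6"
    by (simp_all add: numeral_2_eq_2[symmetric])
  moreover have "0 \<le> y * (y - 3 / 10)\<^sup>2" using y by simp
  then have "0 \<le> y ^ 3 - 6 / 10 * y\<^sup>2 + 9 / 100 * y" by (simp add: algebra_simps power2_eq_square power3_eq_cube)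
  moreover have "0 \<le> y ^ 6" using y by simp
  ultimately show ?thesis using y(2,3) by linarith
qed

lemma C1_poly_4:
  fixes E :: real
  assumes E: "19/10 \<le> E" "E \<le> 12/5"
  defines "N \<equiv> (2 * (29/25) - E) * (12 - 4 * E)" and "P \<equiv> 2 * E * (E - 29/25)\<^sup>2 + (2 * (29/25) - E) * (10 * E + E\<^sup>2 - 3)"
  shows "8 * E * (N + P) * (6932 / 10000 + (E - 2) / 2 - (E - 2)\<^sup>2 / 8 + (E - 2) ^ 3 / 24) \<le> (12 * E - 12) * P + (E\<^sup>2 + 2 * E - 3) * N" (is "8 * E * _ * ?c \<le> _")
proof -
  define y where "y = E - 19/10"
  have y: "E = 19/10 + y" "0 \<le> y" "y \<le> 1/2" using E by (auto simp: y_def)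
  have N: "N = (231/125) + (-152/25) * y + (4) * y ^ 2" unfolding N_def y by (simp add: field_simps power2_eq_square)
  have P: "P = (257927/25000) + (-17737/2500) * y + (-331/50) * y ^ 2 + (1) * y ^ 3" unfolding P_def y by (simp add: field_simps power2_eq_square power3_eq_cube)
  have NP: "N + P = (304127/25000) + (-32937/2500) * y + (-131/50) * y ^ 2 + (1) * y ^ 3" unfolding N P by (simp add: field_simps)
  have c: "?c = (77029/120000) + (421/800) * y + (-11/80) * y ^ 2 + (1/24) * y ^ 3" unfolding y by (simp add: field_simps power2_eq_square power3_eq_cube)
  have "(12 * E - 12) * P + (E\<^sup>2 + 2 * E - 3) * N - 8 * E * (N + P) * ?c = (3297665023/3750000000) + (-54777491/375000000) * y + (15192163/37500000) * y ^ 2 + (5056789/750000) * y ^ 3 + (-26747/15000) * y ^ 4 + (7867/7500) * y ^ 5 + (67/50) * y ^ 6 + (-1/3) * y ^ 7"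
    unfolding c NP unfolding N P y by (simp add: field_simps eval_nat_numeral)
  moreover have "y ^ (j + 1) \<le> 1/2 * y ^ j" for j using mult_right_mono[OF y(3), of "y ^ j"] y(2) by simp
  from this[of 0] this[of 1] this[of 2] this[of 3] this[of 4] this[of 5] this[of 6]
  have "y\<^sup>2 \<le> 1/2 * y" "y ^ 3 \<le> 1/2 * y\<^sup>2" "y ^ 4 \<le> 1/2 * y ^ 3" "y ^ 5 \<le> 1/2 * y ^ 4" "y ^ 6 \<le> 1/2 * y ^ 5" "y ^ 7 \<le> 1/2 * y ^ 6"
    by (simp_all add: numeral_2_eq_2[symmetric])
  moreover have "0 \<le> y * (y - 3 / 10)\<^sup>2" using y by simp
  then have "0 \<le> y ^ 3 - 6 / 10 * y\<^sup>2 + 9 / 100 * y" by (simp add: algebra_simps power2_eq_square power3_eq_cube)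
  moreover have "0 \<le> y ^ 7" using y by simp
  ultimately show ?thesis using y(2,3) by linarith
qed

text \<open>The configuration that monotonicity does not exclude: a point \<open>t\<close> of the middle part with \<open>v t < s < u t\<close>,
where \<open>\<epsilon> = k - 1\<close>, \<open>E = (k - L t) / (k - 1)\<close> and \<open>X = u t - v t\<close>.\<close>

locale critical =
  fixes \<epsilon> E X u :: real
  assumes \<epsilon>: "0 < \<epsilon>" "\<epsilon> < 1" and E1: "1 < E" and X: "X = 4 - 2 * (1 + \<epsilon>) * (1 + ln E)" and X0: "0 < X"
    and g2: "\<epsilon> * E < 2 - \<epsilon>" and u_sq: "u\<^sup>2 = (1 + \<epsilon>)\<^sup>2 - 2 * (1 + \<epsilon>) * (\<epsilon> * E) - \<epsilon> * E * X"
    and u3: "2 - \<epsilon> - \<epsilon> * E < 2 * u"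
begin

abbreviation "k \<equiv> 1 + \<epsilon>"
abbreviation "g \<equiv> \<epsilon> * E"

text \<open>Squaring \<open>u3\<close> and inserting \<open>u_sq\<close> leaves a difference with
  the common factor \<open>\<epsilon>\<close>.\<close>

lemma X_less: "4 * E * X < 12 + 3 * \<epsilon> - E * (4 + 10 * \<epsilon> + \<epsilon> * E)"
proof -
  have "(2 - \<epsilon> - g)\<^sup>2 < (2 * u)\<^sup>2" using u3 g2 by (intro power_strict_mono) auto
  then have "0 < 4 * (k\<^sup>2 - 2 * k * g - g * X) - (2 - \<epsilon> - g)\<^sup>2" using u_sq by (simp add: power_mult_distrib)
  also have "\<dots> = \<epsilon> * (12 + 3 * \<epsilon> - E * (4 + 10 * \<epsilon> + \<epsilon> * E) - 4 * E * X)"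
    by (simp add: algebra_simps power2_eq_square)
  finally show ?thesis using \<epsilon>(1) by (simp add: zero_less_mult_iff)
qed

lemma h1_pos: "0 < h1 \<epsilon> E"
proof -
  have "h1 \<epsilon> E = 12 + 3 * \<epsilon> - E * (4 + 10 * \<epsilon> + \<epsilon> * E) - 4 * E * X"
    unfolding h1_def X by (simp add: algebra_simps power2_eq_square)
  then show ?thesis using X_less by simp
qed

lemma h1_split: "h1 \<epsilon> E = 8 * E * ln E - 12 * E + 12 + \<epsilon> * (8 * E * ln E - E\<^sup>2 - 2 * E + 3)"
  by (simp add: h1_def algebra_simps)

lemma \<epsilon>_less: "\<epsilon> * (10 * E + E\<^sup>2 - 3) < 12 - 4 * E - 4 * E * X"
  using X_less by (simp add: algebra_simps power2_eq_square)

lemma E_less: "E < 3"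
proof -
  have "0 \<le> \<epsilon> * (10 * E + E\<^sup>2 - 3)" using \<epsilon> E1 zero_le_power2[of E] by (intro mult_nonneg_nonneg) linarith+
  moreover have "0 < 4 * E * X" using E1 X0 by simp
  ultimately show ?thesis using \<epsilon>_less by linarith
qed

text \<open>This is the coefficient of \<open>\<epsilon>\<close> in \<open>h1\<close>; its sign
  turns \<open>h1_pos\<close> into a lower bound for \<open>\<epsilon>\<close>. It follows from
  \<open>ln E \<ge> 1 - 1 / E\<close> and \<open>(E - 1) * (5 - E) > 0\<close>.\<close>

lemma coeff_pos: "0 < 8 * E * ln E - E\<^sup>2 - 2 * E + 3"
proof -
  have "- ln E \<le> 1 / E - 1" using ln_le_minus_one[of "1 / E"] E1 by (simp add: ln_div)
  then have "E * (1 - 1 / E) \<le> E * ln E" using E1 by (intro mult_left_mono) auto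
  then have "E - 1 \<le> E * ln E" using E1 by (simp add: algebra_simps)
  moreover have "0 < (E - 1) * (5 - E)" using E1 E_less by simp
  then have "0 < 6 * E - E\<^sup>2 - 5" by (simp add: algebra_simps power2_eq_square)
  ultimately show ?thesis by linarith
qed

text \<open>The lower bound on \<open>\<epsilon>\<close> from \<open>h1_pos\<close> meets the upper
  bound \<open>\<epsilon>_less\<close>. Eliminating \<open>\<epsilon>\<close> leaves a lower bound
  on \<open>ln E\<close> that \<open>ln_le_rational\<close> refutes up to 8/5.\<close>

lemma E_gt: "8 / 5 < E"
proof (rule ccontr)
  assume "\<not> 8 / 5 < E"
  then have l: "ln E * (E + 3)\<^sup>2 \<le> (E - 1) * (E + 15)"
    using ln_le_rational[of E] E1 by (simp add: pos_le_divide_eq)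
  let ?a = "8 * E * ln E - 12 * E + 12" and ?c = "8 * E * ln E - E\<^sup>2 - 2 * E + 3" and ?P = "10 * E + E\<^sup>2 - 3"
  have EX: "0 < 4 * E * X" using E1 X0 by simp
  have P: "0 < ?P" using E1 zero_le_power2[of E] by linarith
  have "0 < ?P * (?a + \<epsilon> * ?c)" using P h1_pos h1_split by simp
  also have "\<dots> = ?P * ?a + ?c * (\<epsilon> * ?P)" by (simp add: algebra_simps)
  also have "\<dots> \<le> ?P * ?a + ?c * (12 - 4 * E)"
    using \<epsilon>_less coeff_pos EX by (intro add_mono mult_left_mono order_refl) linarith+
  also have "\<dots> = 8 * E * (ln E * (E + 3)\<^sup>2 - (E - 1) * (E + 15))"
    by (simp add: algebra_simps power2_eq_square)
  also have "\<dots> \<le> 0" using l E1 by (intro mult_nonneg_nonpos) auto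
  finally show False by simp
qed

text \<open>By \<open>h1_pos\<close>, \<open>\<epsilon>\<close> times the positive coefficient of
  \<open>coeff_pos\<close> exceeds \<open>12 * E - 12 - 8 * E * ln E\<close>; the hypothesis
  compares \<open>N\<close> and \<open>P\<close> with this, \<open>ln E\<close> being replaced by
  its cubic bound.\<close>

lemma \<epsilon>_lower:
  assumes P: "0 \<le> P" "0 \<le> N + P"
    and le: "8 * E * (N + P) * (6932 / 10000 + (E - 2) / 2 - (E - 2)\<^sup>2 / 8 + (E - 2) ^ 3 / 24) \<le> (12 * E - 12) * P + (E\<^sup>2 + 2 * E - 3) * N"
  shows "N \<le> \<epsilon> * P"
proof -
  let ?c = "8 * E * ln E - E\<^sup>2 - 2 * E + 3"
  have "8 * E * (N + P) * ln E \<le> 8 * E * (N + P) * (6932 / 10000 + (E - 2) / 2 - (E - 2)\<^sup>2 / 8 + (E - 2) ^ 3 / 24)"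
    using P E1 ln_le_cubic[of E] by (intro mult_left_mono) auto
  with le have "N * ?c \<le> P * (12 * E - 12 - 8 * E * ln E)" by (simp add: algebra_simps)
  also have "\<dots> \<le> P * (\<epsilon> * ?c)" using h1_pos h1_split P by (intro mult_left_mono) auto
  finally have "N * ?c \<le> (\<epsilon> * P) * ?c" by (simp add: algebra_simps)
  then show ?thesis using coeff_pos by (simp add: mult_le_cancel_right)
qed

lemma k2g: "0 < 2 * k - g" using g2 \<epsilon> by auto

text \<open>Hypothesis \<open>c\<close> and \<open>X_less\<close> give
  \<open>\<epsilon> + X \<le> \<kappa> * (2 * k - g)\<close>, which turns the quadratic inequality
  for \<open>w\<close> into \<open>w - \<epsilon> \<le> \<kappa> * w\<close>. In the application
  \<open>w = k - d1\<close>, where \<open>d1\<close> is the coordinate at which \<open>u\<close>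
  crosses \<open>s\<close>.\<close>

lemma weight_bound:
  assumes c: "12 - 4 * E - 8 * E * \<kappa> \<le> \<epsilon> * (6 * E + E\<^sup>2 - 3 + 4 * E * \<kappa> * (2 - E))" and \<kappa>: "0 \<le> \<kappa>" "\<kappa> < 1"
    and w: "0 \<le> w" "w \<le> g" "(w - \<epsilon>) * (2 * k - w) \<le> w * (\<epsilon> + X)"
  shows "w \<le> 1 / (1 - \<kappa>) * \<epsilon>"
proof -
  have "4 * E * (\<epsilon> + X) \<le> 4 * E * (\<kappa> * (2 * k - g))"
    using c X_less by (simp add: algebra_simps power2_eq_square)
  then have k': "\<epsilon> + X \<le> \<kappa> * (2 * k - g)" using E1 by simp
  have "w - \<epsilon> \<le> \<kappa> * w"
  proof (cases "w \<le> \<epsilon>")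
    case True then show ?thesis using \<kappa> w(1) by (smt (verit) mult_nonneg_nonneg)
  next
    case False
    have "(w - \<epsilon>) * (2 * k - g) \<le> (w - \<epsilon>) * (2 * k - w)" using False w(2) by (intro mult_left_mono) auto
    also have "\<dots> \<le> w * (\<kappa> * (2 * k - g))" using w(3) mult_left_mono[OF k' w(1)] by linarith
    finally show ?thesis using k2g by (metis (no_types, lifting) mult.assoc mult.commute mult_le_cancel_right_pos)
  qed
  then show ?thesis using \<kappa> by (simp add: field_simps)
qed

text \<open>If \<open>2 * w \<le> g\<close>, the left-hand side is nonpositive. Otherwise both sides
  move unfavourably as \<open>w\<close> grows, so \<open>w\<close> is replaced by
  \<open>c * \<epsilon>\<close>; then \<open>q < X\<close> is bounded by
  \<open>\<epsilon>_less\<close>.\<close>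

lemma C1_aux:
  assumes c: "0 < c" "c \<le> E" and w: "0 \<le> w" "w \<le> c * \<epsilon>" "w \<le> g" and q: "0 < q" "q < X"
    and le: "E < 2 * c \<Longrightarrow> (2 * c - E) * (12 - 4 * E) \<le> \<epsilon> * (2 * E * (E - c)\<^sup>2 + (2 * c - E) * (10 * E + E\<^sup>2 - 3))"
  shows "(2 * w - g) * q < (g - w)\<^sup>2 / 2"
proof (cases "2 * w \<le> g")
  case True
  have "w < g"
  proof (rule ccontr)
    assume "\<not> w < g" then have "g \<le> 0" using True by simp
    then show False using \<epsilon> E1 by (simp add: mult_le_0_iff)
  qed
  then have "0 < (g - w)\<^sup>2 / 2" by simp
  moreover have "(2 * w - g) * q \<le> 0" using True q by (intro mult_nonpos_nonneg) auto
  ultimately show ?thesis by linarith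
next
  case False
  have wE: "2 * w - g \<le> \<epsilon> * (2 * c - E)" using w(2) by (simp add: algebra_simps)
  with False have "0 < \<epsilon> * (2 * c - E)" by linarith
  then have c2: "0 < 2 * c - E" using \<epsilon>(1) by (simp add: zero_less_mult_iff)
  have "4 * E * ((2 * c - E) * X) = (2 * c - E) * (4 * E * X)" by simp
  also have "\<dots> \<le> (2 * c - E) * (12 - 4 * E - \<epsilon> * (10 * E + E\<^sup>2 - 3))" using \<epsilon>_less c2 by (intro mult_left_mono) auto
  also have "\<dots> \<le> \<epsilon> * (2 * E * (E - c)\<^sup>2)" using le c2 by (simp add: algebra_simps)
  also have "\<dots> = 4 * E * (\<epsilon> * (E - c)\<^sup>2 / 2)" by simp
  finally have m: "(2 * c - E) * X \<le> \<epsilon> * (E - c)\<^sup>2 / 2" using E1 by (subst (asm) mult_le_cancel_left_pos) auto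
  have "(2 * w - g) * q < (2 * w - g) * X" using False q by (intro mult_strict_left_mono) auto
  also have "\<dots> \<le> \<epsilon> * (2 * c - E) * X" using wE X0 by (intro mult_right_mono) auto
  also have "\<dots> \<le> \<epsilon> * (\<epsilon> * (E - c)\<^sup>2 / 2)" using mult_left_mono[OF m, of \<epsilon>] \<epsilon>(1) by (simp add: mult.assoc)
  also have "\<dots> = (\<epsilon> * (E - c))\<^sup>2 / 2" by (simp add: power_mult_distrib power2_eq_square)
  also have "\<dots> \<le> (g - w)\<^sup>2 / 2"
  proof (intro divide_right_mono power_mono)
    show "\<epsilon> * (E - c) \<le> g - w" using w(2) by (simp add: algebra_simps)
    show "0 \<le> \<epsilon> * (E - c)" using c \<epsilon> by simp
  qed simp
  finally show ?thesis .
qed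

text \<open>In \<open>bad_point\<close> this contradicts the growth of the multiplier when
  \<open>u\<close> exceeds \<open>s\<close> too early. The bounds 61/50, 29/25 and 6/5 on
  \<open>w / \<epsilon>\<close> are \<open>1 / (1 - \<kappa>)\<close> for 11/61, 4/29 and
  1/6.\<close>

lemma C1:
  assumes w: "0 \<le> w" "w \<le> g" "(w - \<epsilon>) * (2 * k - w) \<le> w * (\<epsilon> + X)" and q: "0 < q" "q < X"
  shows "(2 * w - g) * q < (g - w)\<^sup>2 / 2"
proof -
  note w3 = w(3)
  have E2: "0 < E\<^sup>2" using E1 by simp
  have Q: "3 \<le> 6 * E + E\<^sup>2" "3 \<le> 10 * E + E\<^sup>2" using E1 E2 by linarith+
  consider "E \<le> 19/10" | "19/10 \<le> E" "E \<le> 12/5" | "12/5 \<le> E" by linarith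
  then show ?thesis
  proof cases
    case 1
    have 8: "8/5 \<le> E" using E_gt by simp
    have "0 \<le> 2 - E" using 1 by simp
    then have P1: "0 \<le> 6 * E + E\<^sup>2 - 3 + 4 * E * (11 / 61) * (2 - E)"
      using E1 Q by (intro add_nonneg_nonneg mult_nonneg_nonneg) auto
    have NP1: "0 \<le> 12 - 4 * E - 8 * E * (11 / 61) + (6 * E + E\<^sup>2 - 3 + 4 * E * (11 / 61) * (2 - E))"
    proof -
      have "0 \<le> 9 + 2 * E + 17 / 61 * E\<^sup>2" using E1 by simp
      then show ?thesis by (simp add: field_simps power2_eq_square)
    qed
    have "12 - 4 * E - 8 * E * (11 / 61) \<le> \<epsilon> * (6 * E + E\<^sup>2 - 3 + 4 * E * (11 / 61) * (2 - E))"
      by (rule \<epsilon>_lower[OF P1 NP1 C1_poly_1[OF 8 1]])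
    then have wc: "w \<le> 61 / 50 * \<epsilon>" using weight_bound[of "11 / 61" w] w w3 by simp
    show ?thesis
    proof (rule C1_aux[where c = "61 / 50"])
      have N: "0 \<le> (2 * (61 / 50) - E) * (12 - 4 * E)" using 1 by (intro mult_nonneg_nonneg) auto
      have P: "0 \<le> 2 * E * (E - 61 / 50)\<^sup>2 + (2 * (61 / 50) - E) * (10 * E + E\<^sup>2 - 3)"
        using 1 E1 Q by (intro add_nonneg_nonneg mult_nonneg_nonneg) auto
      show "(2 * (61 / 50) - E) * (12 - 4 * E) \<le> \<epsilon> * (2 * E * (E - 61 / 50)\<^sup>2 + (2 * (61 / 50) - E) * (10 * E + E\<^sup>2 - 3))"
        by (rule \<epsilon>_lower[OF P add_nonneg_nonneg[OF N P] C1_poly_2[OF 8 1]])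
    qed (use 8 w wc q in auto)
  next
    case 2
    have "4 * E * (4 / 29) * (E - 2) \<le> 4 * E * (4 / 29) * 1" using 2 by (intro mult_left_mono) auto
    moreover have "4 * E * (4 / 29) * (2 - E) = - (4 * E * (4 / 29) * (E - 2))" by (simp add: field_simps)
    ultimately have P1: "0 \<le> 6 * E + E\<^sup>2 - 3 + 4 * E * (4 / 29) * (2 - E)" using 2 E2 by linarith
    have NP1: "0 \<le> 12 - 4 * E - 8 * E * (4 / 29) + (6 * E + E\<^sup>2 - 3 + 4 * E * (4 / 29) * (2 - E))"
    proof -
      have "0 \<le> 9 + 2 * E + 13 / 29 * E\<^sup>2" using E1 by simp
      then show ?thesis by (simp add: field_simps power2_eq_square)
    qed
    have "12 - 4 * E - 8 * E * (4 / 29) \<le> \<epsilon> * (6 * E + E\<^sup>2 - 3 + 4 * E * (4 / 29) * (2 - E))"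
      by (rule \<epsilon>_lower[OF P1 NP1 C1_poly_3[OF 2]])
    then have wc: "w \<le> 29 / 25 * \<epsilon>" using weight_bound[of "4 / 29" w] w w3 by simp
    show ?thesis
    proof (rule C1_aux[where c = "29 / 25"])
      assume E: "E < 2 * (29 / 25)"
      have N: "0 \<le> (2 * (29 / 25) - E) * (12 - 4 * E)" using E by (intro mult_nonneg_nonneg) auto
      have P: "0 \<le> 2 * E * (E - 29 / 25)\<^sup>2 + (2 * (29 / 25) - E) * (10 * E + E\<^sup>2 - 3)"
        using E E1 Q by (intro add_nonneg_nonneg mult_nonneg_nonneg) auto
      show "(2 * (29 / 25) - E) * (12 - 4 * E) \<le> \<epsilon> * (2 * E * (E - 29 / 25)\<^sup>2 + (2 * (29 / 25) - E) * (10 * E + E\<^sup>2 - 3))"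
        by (rule \<epsilon>_lower[OF P add_nonneg_nonneg[OF N P] C1_poly_4[OF 2]])
    qed (use 2 w wc q in auto)
  next
    case 3
    have "4 * E * (1 / 6) * (E - 2) \<le> 4 * E * (1 / 6) * 1" using E_less 3 by (intro mult_left_mono) auto
    moreover have "4 * E * (1 / 6) * (2 - E) = - (4 * E * (1 / 6) * (E - 2))" by (simp add: field_simps)
    ultimately have "0 \<le> 6 * E + E\<^sup>2 - 3 + 4 * E * (1 / 6) * (2 - E)" using 3 E2 by linarith
    then have "0 \<le> \<epsilon> * (6 * E + E\<^sup>2 - 3 + 4 * E * (1 / 6) * (2 - E))" using \<epsilon>(1) by simp
    then have wc: "w \<le> 6 / 5 * \<epsilon>" using weight_bound[of "1 / 6" w] w w3 3 by simp
    \<comment> \<open>As \<open>12/5 \<le> E\<close>, the side condition of \<open>C1_aux\<close> is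
      vacuous for this constant.\<close>
    show ?thesis by (rule C1_aux[where c = "6 / 5"]) (use 3 w wc q in auto)
  qed
qed

text \<open>One row of the numerical table, for \<open>\<epsilon>\<close> in \<open>[a, d]\<close>.
  The sign of \<open>h1\<close> at \<open>E0\<close> gives \<open>E0 \<le> E\<close>; then
  \<open>X_less\<close> gives \<open>X \<le> X0\<close>, positivity of \<open>X\<close> gives
  \<open>g \<le> G\<close>, and the hypothesis on \<open>t\<close> gives \<open>t \<le> T\<close>.
  All terms of the claim are monotone in these quantities, so \<open>fin\<close> suffices.\<close>

lemma C2_on:
  fixes a d E0 X0 G T :: real
  assumes range: "0 \<le> a" "a \<le> \<epsilon>" "\<epsilon> \<le> d" and E0: "8/5 \<le> E0" "E0 < 4"
    and h: "E0 = 8/5 \<or> (let l = 6932 / 10000 + (E0 - 2) / 2 - (E0 - 2)\<^sup>2 / 8 + (E0 - 2) ^ 3 / 24 in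
        8 * (1 + a) * E0 * l - a * E0\<^sup>2 - (12 + 2 * a) * E0 + 12 + 3 * a < 0 \<and>
        8 * (1 + d) * E0 * l - d * E0\<^sup>2 - (12 + 2 * d) * E0 + 12 + 3 * d < 0)"
    and X0: "(12 + 3 * a) / (4 * E0) - 1 - 5 / 2 * a - a * E0 / 4 \<le> X0"
    and G: "0 \<le> G" "G \<le> 6/5" "G < 1 + a" "d * (12 - 10 * G + 3 * d) \<le> 4 * G + G\<^sup>2"
    and T: "0 \<le> T" "T \<le> 1/2" "(1 - 2 * T) * X0 \<le> T * (a * E0)\<^sup>2 / 2 + a * E0 * T\<^sup>2 / 2"
    and fin: "27728/10000 * (1 + d) * T + 3/4 * G\<^sup>2 * T / (1 + a - G) + 3/2 * X0 \<le> 2 - d - G"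
    and q: "0 < q" "q < X" and t: "0 \<le> t" "t \<le> 1/2" "t * l + g * t\<^sup>2 / 2 \<le> (1 - 2 * t) * q" and l: "g\<^sup>2 \<le> 2 * l"
  shows "27728/10000 * k * t + 3/4 * g\<^sup>2 * t / (k - g) + 3/2 * X \<le> 2 - \<epsilon> - g"
proof -
  have "E0 \<le> E"
  proof (cases "E0 = 8/5")
    case True then show ?thesis using E_gt by simp
  next
    case False
    define l where "l = 6932 / 10000 + (E0 - 2) / 2 - (E0 - 2)\<^sup>2 / 8 + (E0 - 2) ^ 3 / 24"
    define c where "c = 8 * E0 * l - E0\<^sup>2 - 2 * E0 + 3"
    have h': "8 * E0 * l - 12 * E0 + 12 + a * c < 0" "8 * E0 * l - 12 * E0 + 12 + d * c < 0"
    proof -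
      have "8 * (1 + a) * E0 * l - a * E0\<^sup>2 - (12 + 2 * a) * E0 + 12 + 3 * a < 0"
          "8 * (1 + d) * E0 * l - d * E0\<^sup>2 - (12 + 2 * d) * E0 + 12 + 3 * d < 0"
        using h False unfolding Let_def l_def by blast+
      then show "8 * E0 * l - 12 * E0 + 12 + a * c < 0" "8 * E0 * l - 12 * E0 + 12 + d * c < 0"
        unfolding c_def by (simp_all add: algebra_simps)
    qed
    \<comment> \<open>For fixed \<open>E0\<close> the expression is affine in
      \<open>\<epsilon>\<close>, so negativity at both ends of \<open>[a, d]\<close> is
      enough.\<close>
    have "8 * E0 * l - 12 * E0 + 12 + \<epsilon> * c < 0"
    proof (cases "0 \<le> c")
      case True
      then have "\<epsilon> * c \<le> d * c" using range by (intro mult_right_mono)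
      then show ?thesis using h' by linarith
    next
      case False
      then have "\<epsilon> * c \<le> a * c" using range by (intro mult_right_mono_neg) auto
      then show ?thesis using h' by linarith
    qed
    moreover have "8 * k * E0 * ln E0 \<le> 8 * k * E0 * l"
      unfolding l_def using E0 \<epsilon> ln_le_cubic[of E0] by (intro mult_left_mono) auto
    ultimately have "h1 \<epsilon> E0 < 0" unfolding h1_def c_def by (simp add: algebra_simps)
    then show ?thesis using h1_less[OF \<epsilon> E1 h1_pos _ E0(2)] E0 by simp
  qed
  have E0E: "12 / (4 * E) \<le> 12 / (4 * E0)" "3 / (4 * E) \<le> 3 / (4 * E0)" "3 / (4 * E0) \<le> 3 / 6"
    using \<open>E0 \<le> E\<close> E0 by (auto intro!: divide_left_mono)
  have "X \<le> X0"
  proof -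
    have "X \<le> (12 + 3 * \<epsilon> - E * (4 + 10 * \<epsilon> + \<epsilon> * E)) / (4 * E)" using X_less E1 by (simp add: field_simps)
    also have "\<dots> = 12 / (4 * E) + \<epsilon> * (3 / (4 * E)) - 1 - 5/2 * \<epsilon> - \<epsilon> * E / 4" using E1 by (simp add: field_simps)
    also have "\<dots> \<le> 12 / (4 * E0) + \<epsilon> * (3 / (4 * E0)) - 1 - 5/2 * \<epsilon> - \<epsilon> * E0 / 4"
      using E0E \<open>E0 \<le> E\<close> \<epsilon> by (intro diff_mono add_mono mult_left_mono divide_right_mono order_refl) auto
    also have "\<dots> = 12 / (4 * E0) - 1 - \<epsilon> * (5/2 + E0 / 4 - 3 / (4 * E0))" by (simp add: algebra_simps)
    also have "\<dots> \<le> 12 / (4 * E0) - 1 - a * (5/2 + E0 / 4 - 3 / (4 * E0))"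
    proof (intro diff_mono mult_right_mono order_refl)
      show "0 \<le> 5/2 + E0 / 4 - 3 / (4 * E0)" using E0E(3) E0 by linarith
    qed (use range in auto)
    also have "\<dots> = (12 + 3 * a) / (4 * E0) - 1 - 5 / 2 * a - a * E0 / 4" by (simp add: algebra_simps add_divide_distrib)
    finally show ?thesis using X0 by linarith
  qed
  have "g \<le> G"
  proof (rule ccontr)
    assume n: "\<not> g \<le> G"
    have "0 < 12 * \<epsilon> + 3 * \<epsilon>\<^sup>2 - g * (4 + 10 * \<epsilon> + g)"
    proof -
      have "0 < 4 * E * X" using E1 q by simp
      then have "0 < \<epsilon> * (12 + 3 * \<epsilon> - E * (4 + 10 * \<epsilon> + \<epsilon> * E))" using X_less \<epsilon> by simp
      then show ?thesis by (simp add: algebra_simps power2_eq_square)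
    qed
    moreover have "G * (4 + 10 * \<epsilon> + G) \<le> g * (4 + 10 * \<epsilon> + g)" using n G \<epsilon> by (intro mult_mono) auto
    moreover have "\<epsilon> * (12 - 10 * G + 3 * \<epsilon>) \<le> d * (12 - 10 * G + 3 * d)" using range \<epsilon> G by (intro mult_mono) auto
    ultimately show False using G(4) by (simp add: algebra_simps power2_eq_square)
  qed
  have gm: "a * E0 \<le> g" using range E0 \<open>E0 \<le> E\<close> by (intro mult_mono) auto
  have gm0: "0 \<le> a * E0" using range E0 by simp
  have "t \<le> T"
  proof (rule ccontr)
    assume n: "\<not> t \<le> T"
    have X00: "0 < X0" using \<open>X \<le> X0\<close> q by simp
    have "t * ((a * E0)\<^sup>2 / 2) + a * E0 * t\<^sup>2 / 2 \<le> t * l + g * t\<^sup>2 / 2"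
    proof (intro add_mono mult_left_mono divide_right_mono mult_right_mono)
      have "(a * E0)\<^sup>2 \<le> g\<^sup>2" using gm gm0 by (intro power_mono)
      then show "(a * E0)\<^sup>2 / 2 \<le> l" using l by simp
    qed (use gm t in auto)
    also have "\<dots> \<le> (1 - 2 * t) * q" by (rule t(3))
    also have "\<dots> \<le> (1 - 2 * t) * X0" using t q \<open>X \<le> X0\<close> by (intro mult_left_mono) auto
    also have "\<dots> < (1 - 2 * T) * X0" using n X00 by (intro mult_strict_right_mono) auto
    also have "\<dots> \<le> T * (a * E0)\<^sup>2 / 2 + a * E0 * T\<^sup>2 / 2" by (rule T(3))
    also have "\<dots> \<le> t * ((a * E0)\<^sup>2 / 2) + a * E0 * t\<^sup>2 / 2"
    proof (intro add_mono divide_right_mono mult_left_mono)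
      have "T * ((a * E0)\<^sup>2 / 2) \<le> t * ((a * E0)\<^sup>2 / 2)" using n by (intro mult_right_mono) auto
      then show "T * (a * E0)\<^sup>2 / 2 \<le> t * ((a * E0)\<^sup>2 / 2)" by simp
      show "T\<^sup>2 \<le> t\<^sup>2" using n T by (intro power_mono) auto
    qed (use gm0 in auto)
    finally show False by simp
  qed
  have "27728/10000 * k * t \<le> 27728/10000 * (1 + d) * T" using range \<open>t \<le> T\<close> t \<epsilon> by (intro mult_mono) auto
  moreover have "3/4 * g\<^sup>2 * t / (k - g) \<le> 3/4 * G\<^sup>2 * T / (1 + a - G)"
    using \<open>g \<le> G\<close> \<open>t \<le> T\<close> t G range \<epsilon> E1 by (intro frac_le mult_mono mult_nonneg_nonneg power_mono) auto
  moreover have "3/2 * X \<le> 3/2 * X0" using \<open>X \<le> X0\<close> by simp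
  ultimately show ?thesis using fin \<open>g \<le> G\<close> range by linarith
qed

text \<open>The origin of the threshold 1.36: for \<open>E > 8/5\<close> the left-hand side of
  \<open>\<epsilon>_less\<close> is at least \<open>389/25 * \<epsilon>\<close> and its right-hand
  side is below 28/5.\<close>

lemma \<epsilon>_le: "\<epsilon> \<le> 36/100"
proof (rule ccontr)
  assume n: "\<not> \<epsilon> \<le> 36/100"
  have "E\<^sup>2 \<ge> (8/5)\<^sup>2" using E_gt by (intro power_mono) auto
  then have "389/25 \<le> 10 * E + E\<^sup>2 - 3" using E_gt by (simp add: power2_eq_square)
  then have "36/100 * (389/25) \<le> \<epsilon> * (10 * E + E\<^sup>2 - 3)" using n by (intro mult_mono) auto
  moreover have "0 < 4 * E * X" using E1 X0 by simp
  ultimately show False using \<epsilon>_less E_gt by simp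
qed

text \<open>In each row the constants bound \<open>E\<close> from below and \<open>X\<close>, \<open>g\<close>, \<open>t\<close> from above for \<open>\<epsilon>\<close> in the given interval.\<close>

lemma C2_numeric:
  assumes q: "0 < q" "q < X" and t: "0 \<le> t" "t \<le> 1/2" "t * l + g * t\<^sup>2 / 2 \<le> (1 - 2 * t) * q" and l: "g\<^sup>2 \<le> 2 * l"
  shows "27728/10000 * k * t + 3/4 * g\<^sup>2 * t / (k - g) + 3/2 * X \<le> 2 - \<epsilon> - g"
proof -
  have s1: ?thesis if d: "\<epsilon> \<le> 29/1000"
  proof (cases "0/1000 \<le> \<epsilon>")
    case True show ?thesis
      by (rule C2_on[of "0/1000" "29/1000" "2308/1000" "300/1000" "81/1000" "500/1000", OF _ True d _ _ _ _ _ _ _ _ _ _ _ _ q t l])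
        (simp_all add: Let_def power2_eq_square power3_eq_cube)
  qed (use \<epsilon>(1) in simp)
  have s2: ?thesis if d: "\<epsilon> \<le> 51/1000"
  proof (cases "29/1000 \<le> \<epsilon>")
    case True show ?thesis
      by (rule C2_on[of "29/1000" "51/1000" "2244/1000" "258/1000" "134/1000" "484/1000", OF _ True d _ _ _ _ _ _ _ _ _ _ _ _ q t l])
        (simp_all add: Let_def power2_eq_square power3_eq_cube)
  qed (use s1 in simp)
  have s3: ?thesis if d: "\<epsilon> \<le> 70/1000"
  proof (cases "51/1000 \<le> \<epsilon>")
    case True show ?thesis
      by (rule C2_on[of "51/1000" "70/1000" "2192/1000" "231/1000" "176/1000" "468/1000", OF _ True d _ _ _ _ _ _ _ _ _ _ _ _ q t l])
        (simp_all add: Let_def power2_eq_square power3_eq_cube)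
  qed (use s2 in simp)
  have s4: ?thesis if d: "\<epsilon> \<le> 88/1000"
  proof (cases "70/1000 \<le> \<epsilon>")
    case True show ?thesis
      by (rule C2_on[of "70/1000" "88/1000" "2146/1000" "210/1000" "212/1000" "452/1000", OF _ True d _ _ _ _ _ _ _ _ _ _ _ _ q t l])
        (simp_all add: Let_def power2_eq_square power3_eq_cube)
  qed (use s3 in simp)
  have s5: ?thesis if d: "\<epsilon> \<le> 104/1000"
  proof (cases "88/1000 \<le> \<epsilon>")
    case True show ?thesis
      by (rule C2_on[of "88/1000" "104/1000" "2106/1000" "190/1000" "243/1000" "435/1000", OF _ True d _ _ _ _ _ _ _ _ _ _ _ _ q t l])
        (simp_all add: Let_def power2_eq_square power3_eq_cube)
  qed (use s4 in simp)
  have s6: ?thesis if d: "\<epsilon> \<le> 121/1000"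
  proof (cases "104/1000 \<le> \<epsilon>")
    case True show ?thesis
      by (rule C2_on[of "104/1000" "121/1000" "2064/1000" "178/1000" "273/1000" "420/1000", OF _ True d _ _ _ _ _ _ _ _ _ _ _ _ q t l])
        (simp_all add: Let_def power2_eq_square power3_eq_cube)
  qed (use s5 in simp)
  have s7: ?thesis if d: "\<epsilon> \<le> 138/1000"
  proof (cases "121/1000 \<le> \<epsilon>")
    case True show ?thesis
      by (rule C2_on[of "121/1000" "138/1000" "2024/1000" "164/1000" "302/1000" "403/1000", OF _ True d _ _ _ _ _ _ _ _ _ _ _ _ q t l])
        (simp_all add: Let_def power2_eq_square power3_eq_cube)
  qed (use s6 in simp)
  have s8: ?thesis if d: "\<epsilon> \<le> 156/1000"
  proof (cases "138/1000 \<le> \<epsilon>")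
    case True show ?thesis
      by (rule C2_on[of "138/1000" "156/1000" "1982/1000" "153/1000" "331/1000" "387/1000", OF _ True d _ _ _ _ _ _ _ _ _ _ _ _ q t l])
        (simp_all add: Let_def power2_eq_square power3_eq_cube)
  qed (use s7 in simp)
  have s9: ?thesis if d: "\<epsilon> \<le> 175/1000"
  proof (cases "156/1000 \<le> \<epsilon>")
    case True show ?thesis
      by (rule C2_on[of "156/1000" "175/1000" "1940/1000" "142/1000" "359/1000" "369/1000", OF _ True d _ _ _ _ _ _ _ _ _ _ _ _ q t l])
        (simp_all add: Let_def power2_eq_square power3_eq_cube)
  qed (use s8 in simp)
  have s10: ?thesis if d: "\<epsilon> \<le> 195/1000"
  proof (cases "175/1000 \<le> \<epsilon>")
    case True show ?thesis
      by (rule C2_on[of "175/1000" "195/1000" "1898/1000" "130/1000" "388/1000" "349/1000", OF _ True d _ _ _ _ _ _ _ _ _ _ _ _ q t l])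
        (simp_all add: Let_def power2_eq_square power3_eq_cube)
  qed (use s9 in simp)
  have s11: ?thesis if d: "\<epsilon> \<le> 217/1000"
  proof (cases "195/1000 \<le> \<epsilon>")
    case True show ?thesis
      by (rule C2_on[of "195/1000" "217/1000" "1852/1000" "122/1000" "417/1000" "331/1000", OF _ True d _ _ _ _ _ _ _ _ _ _ _ _ q t l])
        (simp_all add: Let_def power2_eq_square power3_eq_cube)
  qed (use s10 in simp)
  have s12: ?thesis if d: "\<epsilon> \<le> 242/1000"
  proof (cases "217/1000 \<le> \<epsilon>")
    case True show ?thesis
      by (rule C2_on[of "217/1000" "242/1000" "1804/1000" "113/1000" "449/1000" "311/1000", OF _ True d _ _ _ _ _ _ _ _ _ _ _ _ q t l])
        (simp_all add: Let_def power2_eq_square power3_eq_cube)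
  qed (use s11 in simp)
  have s13: ?thesis if d: "\<epsilon> \<le> 269/1000"
  proof (cases "242/1000 \<le> \<epsilon>")
    case True show ?thesis
      by (rule C2_on[of "242/1000" "269/1000" "1754/1000" "103/1000" "481/1000" "289/1000", OF _ True d _ _ _ _ _ _ _ _ _ _ _ _ q t l])
        (simp_all add: Let_def power2_eq_square power3_eq_cube)
  qed (use s12 in simp)
  have s14: ?thesis if d: "\<epsilon> \<le> 299/1000"
  proof (cases "269/1000 \<le> \<epsilon>")
    case True show ?thesis
      by (rule C2_on[of "269/1000" "299/1000" "1702/1000" "95/1000" "514/1000" "267/1000", OF _ True d _ _ _ _ _ _ _ _ _ _ _ _ q t l])
        (simp_all add: Let_def power2_eq_square power3_eq_cube)
  qed (use s13 in simp)
  have s15: ?thesis if d: "\<epsilon> \<le> 331/1000"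
  proof (cases "299/1000 \<le> \<epsilon>")
    case True show ?thesis
      by (rule C2_on[of "299/1000" "331/1000" "1648/1000" "86/1000" "548/1000" "244/1000", OF _ True d _ _ _ _ _ _ _ _ _ _ _ _ q t l])
        (simp_all add: Let_def power2_eq_square power3_eq_cube)
  qed (use s14 in simp)
  have s16: ?thesis if d: "\<epsilon> \<le> 360/1000"
  proof (cases "331/1000 \<le> \<epsilon>")
    case True show ?thesis
      by (rule C2_on[of "331/1000" "360/1000" "1600/1000" "71/1000" "576/1000" "212/1000", OF _ True d _ _ _ _ _ _ _ _ _ _ _ _ q t l])
        (simp_all add: Let_def power2_eq_square power3_eq_cube)
  qed (use s15 in simp)
  show ?thesis by (rule s16) (use \<epsilon>_le in simp)
qed

end

text \<open>The chord of the concave logarithm between 1/2 and 1; the constant is twice the bound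
  for \<open>ln 2\<close>.\<close>

lemma ln_half_bound:
  fixes t :: real
  assumes "0 \<le> t" "t \<le> 1/2"
  shows "- ln (1 - t) \<le> 13864/10000 * t"
proof -
  have "(1 - 2 * t) * ln 1 + 2 * t * ln (1/2) \<le> ln ((1 - 2 * t) *\<^sub>R 1 + (2 * t) *\<^sub>R (1/2))"
    using concave_onD[OF ln_concave, of "2 * t" 1 "1/2"] assms by simp
  then have "- ln (1 - t) \<le> 2 * t * ln 2" by (simp add: ln_div)
  also have "\<dots> \<le> 2 * t * (6932 / 10000)" using assms ln2_le by (intro mult_left_mono) auto
  finally show ?thesis by simp
qed

text \<open>With \<open>f = g * t\<close> the logarithm becomes \<open>- ln (1 - t)\<close>, and the
  sign of the last hypothesis gives \<open>t \<le> 1/2\<close>. In \<open>C2_numeric\<close> the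
  factor 3/4 stems from \<open>2 * f \<le> g\<close>, the factor 3/2 from \<open>q < X\<close>
  together with \<open>- X\<close> on the right; \<open>u3\<close> bounds
  \<open>2 * u\<close>.\<close>

lemma (in critical) C2:
  assumes q: "0 < q" "q < X" and f: "0 \<le> f" and l: "u \<le> k - g" and c: "f * (k - g - u) + f\<^sup>2 / 2 \<le> (g - 2 * f) * q"
  shows "2 * k * ln (g / (g - f)) - f + q / 2 + (2 * k - g + f) * f / (2 * (k - g)) \<le> 2 * u - X"
proof -
  have g: "0 < g" using \<epsilon> E1 by simp
  have u0: "0 < u" using u3 g2 by linarith
  define L where "L = k - g"
  have L: "0 < L" "L \<le> 1" using l u0 E1 \<epsilon> by (auto simp: L_def)
  define t where "t = f / g"
  have ft: "f = g * t" using \<epsilon> E1 by (simp add: t_def)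
  have "0 \<le> f * (k - g - u) + f\<^sup>2 / 2" using f l by simp
  with c have "0 \<le> (g - 2 * f) * q" by simp
  then have "2 * f \<le> g" using q by (simp add: zero_le_mult_iff)
  then have t: "0 \<le> t" "t \<le> 1/2" using g f by (auto simp: t_def field_simps)
  have "g * (t * (k - g - u) + g * t\<^sup>2 / 2) \<le> g * ((1 - 2 * t) * q)"
    using c unfolding ft by (simp add: algebra_simps power2_eq_square)
  then have c': "t * (k - g - u) + g * t\<^sup>2 / 2 \<le> (1 - 2 * t) * q" using g by (subst (asm) mult_le_cancel_left_pos) auto
  have "(k - g - u) * (L + u) = g\<^sup>2 + g * X" using u_sq unfolding L_def by (simp add: algebra_simps power2_eq_square)
  moreover have "(k - g - u) * (L + u) \<le> (k - g - u) * 2" using l L u0 by (intro mult_left_mono) (auto simp: L_def)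
  ultimately have l2: "g\<^sup>2 \<le> 2 * (k - g - u)" using g X0 by (smt (verit) mult_pos_pos)
  have num: "27728/10000 * k * t + 3/4 * g\<^sup>2 * t / (k - g) + 3/2 * X \<le> 2 - \<epsilon> - g"
    by (rule C2_numeric[OF q t c' l2])
  have "g / (g - f) = 1 / (1 - t)"
  proof -
    have "g - f = g * (1 - t)" by (simp add: ft algebra_simps)
    then show ?thesis using \<epsilon> E1 by simp
  qed
  then have "ln (g / (g - f)) = - ln (1 - t)" using t by (simp add: ln_div)
  then have "2 * k * ln (g / (g - f)) \<le> 2 * k * (13864/10000 * t)" using ln_half_bound[OF t] \<epsilon> by (intro mult_left_mono) auto
  moreover have "(2 * k - g + f) * f / (2 * (k - g)) - f \<le> 3/4 * g\<^sup>2 * t / (k - g)"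
  proof -
    have "(2 * k - g + f) * f / (2 * L) - f = (f * (g + f) / 2) / L" using L by (simp add: L_def field_simps)
    also have "\<dots> \<le> (3/4 * g\<^sup>2 * t) / L"
    proof (rule divide_right_mono)
      have "f * (g + f) \<le> f * (3/2 * g)" using f \<open>2 * f \<le> g\<close> by (intro mult_left_mono) linarith+
      then show "f * (g + f) / 2 \<le> 3/4 * g\<^sup>2 * t" unfolding ft by (simp add: power2_eq_square algebra_simps)
    qed (use L in simp)
    finally show ?thesis by (simp add: L_def)
  qed
  ultimately show ?thesis using num q u3 by linarith
qed

section \<open>Shape of the graphs and the exceptional configuration\<close>

context curtain
begin

text \<open>When the filled interval straddles coordinate \<open>1\<close>, \<open>R x\<close>
  enters through the linear branch of \<open>yc\<close>, and the moment equation can be solved for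
  \<open>u x\<close> in terms of \<open>L x\<close>. This is the origin of
  \<open>WW1\<close>.\<close>

lemma mid:
  assumes x: "-1 \<le> x" "x \<le> b" and LR: "L x \<le> 1" "1 \<le> R x"
  shows "(u x)\<^sup>2 = k\<^sup>2 - 4 * (k - L x) + 2 * k * (k - L x) * ln ((k - L x) / (k - 1))"
    and "v x - u x = 2 * k * (1 + ln ((k - L x) / (k - 1))) - 4"
proof -
  define l where "l = L x"
  define w where "w = ln ((k - l) / (k - 1))"
  have lk: "l < k" using LR k1 by (simp add: l_def)
  have w: "ln ((k - 1) / (k - l)) = - w" using lk k1 by (simp add: w_def ln_div)
  have ux: "u x = l - (b - x)" using u_eq[OF LR(2)] by (simp add: l_def)
  define m where "m = u x"
  have x': "x = m - l + b" using ux unfolding m_def by linarith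
  have R: "R x - k = 2 * m - l + b"
  proof -
    have "R x - k = x + m" using Y_ge1[OF LR(2)] by (simp add: U_def m_def)
    also have "x + m = 2 * m - l + b" using x' by linarith
    finally show ?thesis .
  qed
  have "A1 k 1 + ((R x - k)\<^sup>2 - (1 - k)\<^sup>2) / 2 - A1 k l = x\<^sup>2 - 1"
  proof -
    have "A (R x) = A1 k 1 + ((R x - k)\<^sup>2 - (1 - k)\<^sup>2) / 2"
    proof (cases "R x \<le> 1")
      case True
      then have "R x = 1" using LR(2) by simp
      then show ?thesis by (simp only: ac_def) simp
    qed (simp add: ac_def)
    moreover have "A (L x) = A1 k l" using LR(1) by (simp add: ac_def l_def)
    ultimately show ?thesis using AR[OF x] by simp
  qed
  then have "A1 k 1 - A1 k l = (m - l + b)\<^sup>2 - 1 - ((2 * m - l + b)\<^sup>2 - (1 - k)\<^sup>2) / 2"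
    unfolding R using x' by simp
  then show "(u x)\<^sup>2 = k\<^sup>2 - 4 * (k - L x) + 2 * k * (k - L x) * ln ((k - L x) / (k - 1))"
    unfolding A1_diff[OF lk] w unfolding l_def[symmetric] m_def[symmetric] w_def[symmetric]
    by (simp add: field_simps power2_eq_square)
  have "v x = x - (z1 k l - k)" using LR by (simp add: D_def yc_def y1_def l_def)
  then show "v x - u x = 2 * k * (1 + ln ((k - L x) / (k - 1))) - 4"
    unfolding ux z1_def w l_def[symmetric] w_def[symmetric] by (simp add: algebra_simps)
qed

lemma es_le_R: "-1 \<le> x \<Longrightarrow> x \<le> b \<Longrightarrow> es \<le> R x"
  using R_inc[of "-1" x] L_m1 by (cases "x = -1") auto

lemma Y_slope:
  assumes "e \<in> {db..1}" "e' \<in> {db..1}" "e \<le> e'"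
  shows "(k + e) / (k - e) * (e' - e) \<le> Y e' - Y e" "Y e' - Y e \<le> (k + e') / (k - e') * (e' - e)"
proof -
  have m: "(k + x) / (k - x) \<le> (k + x') / (k - x')" if "x \<in> {db..1}" "x' \<in> {db..1}" "x \<le> x'" for x x'
    using that k1 db0 by (intro frac_le) auto
  have "Y e - (k + e) / (k - e) * e \<le> Y e' - (k + e) / (k - e) * e'"
    by (rule deriv_within_mono[where S = "{db..1}" and f = "\<lambda>x. Y x - (k + e) / (k - e) * x" and f' = "\<lambda>x. (k + x) / (k - x) - (k + e) / (k - e)"])
      (use assms m in \<open>auto intro!: DERIV_diff Y_deriv DERIV_cmult_Id simp del: times_divide_eq_left times_divide_eq_right\<close>)
  then show "(k + e) / (k - e) * (e' - e) \<le> Y e' - Y e" by (simp only: right_diff_distrib)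
  have "(k + e') / (k - e') * e - Y e \<le> (k + e') / (k - e') * e' - Y e'"
    by (rule deriv_within_mono[where S = "{db..1}" and f = "\<lambda>x. (k + e') / (k - e') * x - Y x" and f' = "\<lambda>x. (k + e') / (k - e') - (k + x) / (k - x)"])
      (use assms m in \<open>auto intro!: DERIV_diff Y_deriv DERIV_cmult_Id simp del: times_divide_eq_left times_divide_eq_right\<close>)
  then show "Y e' - Y e \<le> (k + e') / (k - e') * (e' - e)" by (simp only: right_diff_distrib)
qed

text \<open>With \<open>c\<close> the slope of \<open>yc\<close> at \<open>R z\<close>, the claim
  \<open>U' \<ge> 1\<close> amounts to \<open>u z + v z \<le> 2 * c * v z\<close>. Convexity gives
  \<open>U z + 1 \<le> c * (R z - es) \<le> 2 * c * (z + 1)\<close>, and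
  \<open>z + 1 \<le> v z\<close>.\<close>

lemma u_mono:
  assumes x: "-1 \<le> x" "x \<le> x'" "x' \<le> b" and R: "R x' \<le> 1"
  shows "u x \<le> u x'"
proof (cases "x = -1")
  case True
  then show ?thesis using U_ge[of x'] x DU_m1 by simp
next
  case False
  have Rr: "R z \<in> {db..1}" "es \<le> R z" if "-1 \<le> z" "z \<le> x'" for z
    using R_inc[of z x'] es_le_R[of z] es that x R by (cases "z = x'"; force)+
  have UR: "Y \<circ> R = U" by (simp add: U_def fun_eq_iff)
  have es1: "es \<in> {db..1}" using Rr(2)[of x'] R es x by auto
  show ?thesis
  proof (rule deriv_within_mono[where S = "{x..x'}" and f = u and f' = "\<lambda>z. (k + R z) / (k - R z) * (2 * v z / (u z + v z)) - 1"])
    fix z assume z: "x \<le> z" "z \<le> x'"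
    have "(R has_real_derivative 2 * v z / (u z + v z)) (at z within {x..x'})"
      by (rule has_field_derivative_subset[OF R_deriv]) (use x z False in auto)
    moreover have "(Y has_real_derivative (k + R z) / (k - R z)) (at (R z) within R ` {x..x'})"
      by (rule has_field_derivative_subset[OF Y_deriv]) (use Rr x z in auto)
    ultimately have "((Y \<circ> R) has_real_derivative (k + R z) / (k - R z) * (2 * v z / (u z + v z))) (at z within {x..x'})"
      by (intro DERIV_image_chain)
    then have "(U has_real_derivative (k + R z) / (k - R z) * (2 * v z / (u z + v z))) (at z within {x..x'})"
      unfolding UR .
    then show "(u has_real_derivative (k + R z) / (k - R z) * (2 * v z / (u z + v z)) - 1) (at z within {x..x'})"
      by (intro DERIV_diff DERIV_ident)
  next
    fix z assume z: "x < z" "z < x'"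
    define c where "c = (k + R z) / (k - R z)"
    have zz: "-1 < z" "z \<le> b" using x z by auto
    have c1: "1 \<le> c" using Rr[of z] z x k1 db0 by (auto simp: c_def field_simps)
    have "U z + 1 \<le> c * (R z - es)" using Y_slope(2)[OF es1 Rr(1)[of z] Rr(2)[of z]] z x es by (simp add: U_def c_def)
    also have "\<dots> \<le> c * (2 * (z + 1))" using c1 L_le_es[of z] zz by (intro mult_left_mono) (auto simp: R_def)
    finally have "u z \<le> (2 * c - 1) * (z + 1)" by (simp add: algebra_simps)
    also have "\<dots> \<le> (2 * c - 1) * v z" using c1 D_le[of z] zz by (intro mult_left_mono) auto
    finally have "u z + v z \<le> c * (2 * v z)" by (simp add: algebra_simps)
    then show "0 \<le> (k + R z) / (k - R z) * (2 * v z / (u z + v z)) - 1"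
      unfolding c_def[symmetric] using uv_pos[OF zz] by (simp add: field_simps)
  qed (use x in auto)
qed

end

context hinge_dual
begin

lemma hp_neg: "0 < s \<Longrightarrow> -1 \<le> x \<Longrightarrow> x \<le> b \<Longrightarrow> hp (- v x) = 0"
  using D_le[of x] by (intro hp_le) auto

text \<open>Up to \<open>es\<close> a free target belongs to the lower graph, where a positive
  \<open>s\<close> keeps the hinge inactive, so only \<open>Bl\<close> remains in
  \<open>pe\<close>.\<close>

lemma pe_source:
  assumes s: "0 < s" and e: "e \<in> {db..1}" "e \<le> es"
  obtains x where "x \<in> {-1..b}" "L x = e" "pe e = Bl x"
proof -
  have y: "Y e \<in> {-2..U b}" using Y_range(2) e(1) .
  have y1: "Y e \<le> -1" using yc_le[of k e es] e k1 db0 es by auto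
  have x: "\<tau> (Y e) \<in> {-1..b}" using \<tau>_range[OF y] .
  have D: "Y e = D (\<tau> (Y e))"
  proof (cases rule: \<tau>_cases[OF y])
    case 2
    then have "Y e = -1" using y1 by simp
    then show ?thesis using \<tau>_U[of "-1"] DU_m1 b1 by simp
  qed
  have "L (\<tau> (Y e)) = e"
    using D yc_less[of k e "L (\<tau> (Y e))"] yc_less[of k "L (\<tau> (Y e))" e] L_eq(1)[of "\<tau> (Y e)"] x e(1) k1 db0
    unfolding D_def by (cases "L (\<tau> (Y e))" e rule: linorder_cases) auto
  moreover have "pe e = Bl (\<tau> (Y e))"
    unfolding pe_def p_def using hp_neg[OF s, of "\<tau> (Y e)"] x D by simp
  ultimately show ?thesis using that x by blast
qed

lemma pe_source':
  assumes e: "e \<in> {db..1}" "es \<le> e"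
  obtains x where "x \<in> {-1..b}" "R x = e" "pe e = hp (u x) + Bl x"
proof -
  have y: "Y e \<in> {-2..U b}" using Y_range(2) e(1) .
  have y1: "-1 \<le> Y e" using yc_le[of k es e] e k1 db0 es by auto
  have x: "\<tau> (Y e) \<in> {-1..b}" using \<tau>_range[OF y] .
  have D: "Y e = U (\<tau> (Y e))"
  proof (cases rule: \<tau>_cases[OF y])
    case 1
    then have "Y e = -1" using y1 by simp
    then show ?thesis using \<tau>_D[of "-1"] DU_m1 b1 by simp
  qed
  have "R (\<tau> (Y e)) = e"
    using D yc_less[of k e "R (\<tau> (Y e))"] yc_less[of k "R (\<tau> (Y e))" e] es_le_R[of "\<tau> (Y e)"] es x e(1) k1 db0
    unfolding U_def by (cases "R (\<tau> (Y e))" e rule: linorder_cases) auto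
  moreover have "pe e = hp (u (\<tau> (Y e))) + Bl (\<tau> (Y e))"
    unfolding pe_def p_def using D by simp
  ultimately show ?thesis using that x by blast
qed

text \<open>Comparison of derivatives: \<open>\<beta> = hp u / (u + v)\<close> and
  \<open>- L' = 2 * u / (u + v)\<close>, while \<open>hp u \<le> (e - s) / e * u\<close> for
  \<open>0 \<le> u \<le> e\<close>.\<close>

lemma Bl_L:
  assumes s: "0 < s" and x: "-1 \<le> x" "x \<le> x'" "x' \<le> b" and e: "L x \<le> e" "s \<le> e" "0 < e"
  shows "Bl x' - Bl x \<le> (e - s) / (2 * e) * (L x - L x')"
proof -
  define c where "c = (e - s) / (2 * e)"
  have c: "0 \<le> c" "2 * c * e = e - s" using e by (auto simp: c_def)
  have "c * - L x - Bl x \<le> c * - L x' - Bl x'"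
  proof (rule deriv_mono[where f = "\<lambda>z. c * - L z - Bl z" and f' = "\<lambda>z. c * - (- 2 * u z / (u z + v z)) - \<beta> z"])
    show "continuous_on {x..x'} (\<lambda>z. c * - L z - Bl z)"
      by (intro continuous_intros continuous_on_subset[OF L_continuous] continuous_on_subset[OF Bl_cont]) (use x in auto)
    fix z assume z: "x < z" "z < x'"
    have at: "at z within {-1..b} = at z" by (rule at_within_Icc_at) (use x z in auto)
    show "((\<lambda>z. c * - L z - Bl z) has_real_derivative c * - (- 2 * u z / (u z + v z)) - \<beta> z) (at z)"
      using L_deriv[of z] Bl_deriv[of z] x z unfolding at by (intro DERIV_diff DERIV_cmult DERIV_minus) auto
    have zz: "-1 < z" "z \<le> b" using x z by auto
    have "u z \<le> e" using u_le[of z] L_dec[of x z] zz x z e by auto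
    have "hp (u z) \<le> 2 * c * u z"
    proof (cases "u z \<le> s")
      case True then show ?thesis using hp_le c uv_pos[OF zz] by simp
    next
      case False
      have "s * u z \<le> s * e" using \<open>u z \<le> e\<close> s by (intro mult_left_mono) auto
      then have "(u z - s) * e \<le> (e - s) * u z" by (simp add: algebra_simps)
      also have "\<dots> = (2 * c * u z) * e" unfolding c(2)[symmetric] by (simp only: mult_ac)
      finally have "u z - s \<le> 2 * c * u z" using e(3) by (subst (asm) mult_le_cancel_right_pos) auto
      then show ?thesis using False hp_ge by simp
    qed
    moreover have "\<beta> z = hp (u z) / (u z + v z)" using zz hp_neg[OF s, of z] by (simp add: \<beta>_def)
    ultimately have "\<beta> z \<le> (2 * c * u z) / (u z + v z)"
      using uv_pos[OF zz] by (simp only:) (intro divide_right_mono, auto)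
    also have "2 * c * a / w = c * - (- 2 * a / w)" for a w :: real by simp
    finally show "0 \<le> c * - (- 2 * u z / (u z + v z)) - \<beta> z" by simp
  qed (use x in auto)
  then show ?thesis unfolding c_def[symmetric] by (simp add: algebra_simps)
qed

lemma Bt_shift_deriv:
  assumes d: "d \<in> {db..1}"
  shows "((\<lambda>d. (k - d) * (Bt d - c)) has_real_derivative hp d - pe d + c) (at d within {db..1})"
proof -
  have "((\<lambda>d. (k - d) * (Bt d - c)) has_real_derivative (0 - 1) * (Bt d - c) + ((hp d - pe d + Bt d) / (k - d) - 0) * (k - d)) (at d within {db..1})"
    by (intro DERIV_mult DERIV_diff DERIV_const DERIV_ident Bt_deriv d)
  moreover have "(0 - 1) * (Bt d - c) + ((hp d - pe d + Bt d) / (k - d) - 0) * (k - d) = hp d - pe d + c"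
    using kd(1)[OF d] by simp
  ultimately show ?thesis by (simp only:)
qed

text \<open>Both claims integrate the equation for \<open>(k - e) * (Bt e - Bl t)\<close> from
  \<open>L t\<close> to \<open>d\<close>. Its right-hand side is at least \<open>e - s\<close>
  because \<open>pe e \<le> Bl t\<close>; and by \<open>Bl_L\<close> the deficit
  \<open>Bl t - pe e\<close> is at most \<open>\<kappa> * hp e\<close>, hence controlled by the same
  integral.\<close>

lemma W_bound:
  assumes s: "0 < s" and t: "t \<in> {-1..b}" and st: "s < L t" and d: "d \<in> {db..1}" "L t \<le> d"
    and pe: "\<And>e. L t \<le> e \<Longrightarrow> e \<le> d \<Longrightarrow> pe e \<le> Bl t"
  shows "(d - L t) * (L t - s) + (d - L t)\<^sup>2 / 2 \<le> (k - d) * (Bt d - Bl t)"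
    and "Bl t * (Y d - Y (L t)) - (\<psi>l (Y d) - \<psi>l (Y (L t))) \<le> (k + d) * (d - L t) / (2 * L t) * (Bt d - Bl t)"
proof -
  have l: "L t \<in> {db..1}" "0 < L t" using L_eq(1)[of t] t d db0 by auto
  have st0: "0 \<le> (k - L t) * (Bt (L t) - Bl t)"
    using Bt_ge[OF l(1)] Bl_mono[of t b] t kd(1)[OF l(1)] by (intro mult_nonneg_nonneg) auto
  have "(k - L t) * (Bt (L t) - Bl t) - (L t - s)\<^sup>2 / 2 \<le> (k - d) * (Bt d - Bl t) - (d - s)\<^sup>2 / 2"
  proof (rule deriv_within_mono[where S = "{db..1}" and f = "\<lambda>e. (k - e) * (Bt e - Bl t) - (e - s)\<^sup>2 / 2" and f' = "\<lambda>e. hp e - pe e + Bl t - (e - s)"])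
    fix e assume e: "L t \<le> e" "e \<le> d"
    have "((\<lambda>e. (e - s)\<^sup>2 / 2) has_real_derivative (e - s)) (at e within {db..1})"
      by (auto intro!: derivative_eq_intros)
    then show "((\<lambda>e. (k - e) * (Bt e - Bl t) - (e - s)\<^sup>2 / 2) has_real_derivative hp e - pe e + Bl t - (e - s)) (at e within {db..1})"
      by (intro DERIV_diff Bt_shift_deriv) (use e l d in auto)
  next
    fix e assume e: "L t < e" "e < d"
    show "0 \<le> hp e - pe e + Bl t - (e - s)" using pe[of e] e hp_lower[of e] by simp
  qed (use l d in auto)
  moreover have "(d - s)\<^sup>2 = (d - L t)\<^sup>2 + 2 * ((d - L t) * (L t - s)) + (L t - s)\<^sup>2"
    by (simp add: power2_eq_square algebra_simps)
  ultimately show "(d - L t) * (L t - s) + (d - L t)\<^sup>2 / 2 \<le> (k - d) * (Bt d - Bl t)"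
    using st0 by linarith
  \<comment> \<open>A majorant of \<open>(e - L t) / (2 * e)\<close> for
    \<open>L t \<le> e \<le> d\<close>.\<close>
  define \<kappa> where "\<kappa> = (d - L t) / (2 * L t)"
  define M where "M = (k + d) / (k - d)"
  have \<kappa>: "0 \<le> \<kappa>" using d l by (simp add: \<kappa>_def)
  have M: "(k + e) / (k - e) \<le> M" "0 \<le> (k + e) / (k - e)" if "e \<in> {db..1}" "e \<le> d" for e
    using that d k1 db0 by (auto simp: M_def intro!: frac_le divide_nonneg_nonneg)
  have key: "Bl t - pe e \<le> \<kappa> * hp e" if e: "L t \<le> e" "e \<le> d" for e
  proof -
    have e1: "e \<in> {db..1}" "0 < e" "s \<le> e" using e l d st by auto
    have "Bl t - pe e \<le> (e - s) / (2 * e) * (e - L t)"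
    proof (cases "e \<le> es")
      case True
      obtain x where x: "x \<in> {-1..b}" "L x = e" "pe e = Bl x" using pe_source[OF s e1(1) True] .
      have "x \<le> t" using L_dec[of t x] x t e by (cases "x \<le> t") auto
      then show ?thesis using Bl_L[OF s, of x t e] x t e1 by auto
    next
      case False
      have "Bl t \<le> (e - s) / (2 * e) * (es - L t)" using Bl_L[OF s, of "-1" t e] Bl_m1 L_m1 t e1 False by auto
      also have "\<dots> \<le> (e - s) / (2 * e) * (e - L t)" using False e1 by (intro mult_left_mono) auto
      finally show ?thesis using pe_nonneg[OF e1(1)] by simp
    qed
    also have "\<dots> = (e - s) * ((e - L t) / (2 * e))" by simp
    also have "\<dots> \<le> (e - s) * \<kappa>"
      unfolding \<kappa>_def using e e1 l by (intro mult_left_mono frac_le) auto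
    also have "\<dots> = \<kappa> * hp e" using hp_ge e1 by simp
    finally show ?thesis .
  qed
  have "M * \<kappa> * ((k - L t) * (Bt (L t) - Bl t)) - (Bl t * Y (L t) - \<psi>l (Y (L t))) \<le> M * \<kappa> * ((k - d) * (Bt d - Bl t)) - (Bl t * Y d - \<psi>l (Y d))"
  proof (rule deriv_within_mono[where S = "{db..1}" and f = "\<lambda>e. M * \<kappa> * ((k - e) * (Bt e - Bl t)) - (Bl t * Y e - \<psi>l (Y e))"
        and f' = "\<lambda>e. M * \<kappa> * (hp e - pe e + Bl t) - (Bl t * ((k + e) / (k - e)) - pe e * ((k + e) / (k - e)))"])
    fix e assume e: "L t \<le> e" "e \<le> d"
    show "((\<lambda>e. M * \<kappa> * ((k - e) * (Bt e - Bl t)) - (Bl t * Y e - \<psi>l (Y e))) has_real_derivative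
      M * \<kappa> * (hp e - pe e + Bl t) - (Bl t * ((k + e) / (k - e)) - pe e * ((k + e) / (k - e)))) (at e within {db..1})"
      by (intro DERIV_diff DERIV_cmult Bt_shift_deriv \<psi>lY_deriv Y_deriv) (use e l d in auto)
  next
    fix e assume e: "L t < e" "e < d"
    have e1: "e \<in> {db..1}" "e \<le> d" using e l d by auto
    have M0: "0 \<le> M" using M[OF e1] by simp
    have a: "0 \<le> Bl t - pe e" "Bl t - pe e \<le> \<kappa> * hp e" using pe[of e] key[of e] e by auto
    have "(Bl t - pe e) * ((k + e) / (k - e)) \<le> (\<kappa> * hp e) * M" using a M[OF e1] by (intro mult_mono) auto
    moreover have "0 \<le> M * \<kappa> * (Bl t - pe e)" using M0 \<kappa> a by simp
    ultimately show "0 \<le> M * \<kappa> * (hp e - pe e + Bl t) - (Bl t * ((k + e) / (k - e)) - pe e * ((k + e) / (k - e)))"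
      by (simp only: left_diff_distrib right_diff_distrib distrib_left) (simp add: mult_ac)
  qed (use l d in auto)
  moreover have "0 \<le> M * \<kappa> * ((k - L t) * (Bt (L t) - Bl t))" using M[OF d(1)] \<kappa> st0 by simp
  moreover have "M * \<kappa> * ((k - d) * (Bt d - Bl t)) = (k + d) * (d - L t) / (2 * L t) * (Bt d - Bl t)"
    using kd(1)[OF d(1)] by (simp add: M_def \<kappa>_def)
  ultimately show "Bl t * (Y d - Y (L t)) - (\<psi>l (Y d) - \<psi>l (Y (L t))) \<le> (k + d) * (d - L t) / (2 * L t) * (Bt d - Bl t)"
    by (simp add: right_diff_distrib)
qed

text \<open>The configuration left open by \<open>p_past\<close> and \<open>p_future\<close>. The
  slack at \<open>U t\<close> is estimated directly: the hinge term of the right source is dropped,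
  and contact of \<open>t\<close> with its own two targets reduces the claim to
  \<open>key\<close>.\<close>

lemma bad_point:
  assumes t: "t \<in> {-1..b}" "1 < R t" and s: "v t < s" "s < u t" and d: "d \<in> {db..1}"
    and B: "Bt d = Bl t + (u t - s)"
  shows "\<psi>l (U t) \<le> ct d (U t)"
proof -
  define l q B0 where "l = L t" and "q = u t - s" and "B0 = Bl t"
  have v0: "0 \<le> v t" using D_le[of t] t by auto
  have s1: "0 < s" and q0: "0 < q" using s v0 by (auto simp: q_def)
  have t1: "-1 < t" using s DU_m1 t by (cases "t = -1") auto
  have l0: "db \<le> l" "0 < l" using L_eq(1)[of t] t db0 by (auto simp: l_def)
  have ul: "u t = l - (b - t)" using u_eq t by (simp add: l_def)
  have Yl: "Y l = D t" by (simp add: D_def l_def)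
  have hk: "hinge s (- k) = 0" using s1 k1 by (simp add: hinge_def)
  have "ct d (U t) = hinge s (U t - z1 k d) + \<psi>l (Y d) + Bt d * (U t - Y d)"
  proof -
    have "z1 k d = Y d + k" using Y_z1[of d] d by simp
    then show ?thesis by (simp add: ct_def \<phi>t_def hk algebra_simps)
  qed
  moreover have "0 \<le> hinge s (U t - z1 k d)" by (simp add: hinge_def)
  ultimately have ct: "\<psi>l (Y d) + (B0 + q) * (U t - Y d) \<le> ct d (U t)" by (simp add: B B0_def q_def)
  have "\<psi>l (U t) = q\<^sup>2 / 2 - \<phi>l t + B0 * u t" using \<psi>l_U[OF t(1)] s by (simp add: cl_def hinge_def q_def B0_def)
  moreover have "\<psi>l (D t) = - \<phi>l t - B0 * v t"
    using \<psi>l_D[OF t(1)] s1 v0 by (simp add: cl_def hinge_def B0_def algebra_simps)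
  ultimately have psi: "\<psi>l (U t) = \<psi>l (D t) + q\<^sup>2 / 2 + B0 * (u t + v t)" by (simp add: algebra_simps)
  have key: "q\<^sup>2 / 2 + B0 * (Y d - D t) - (\<psi>l (Y d) - \<psi>l (D t)) \<le> q * (u t + v t - (Y d - D t))"
  proof (cases "d < l")
    case True
    have le: "Y d \<le> D t" unfolding Yl[symmetric] using yc_le[of k d l] True d k1 db0 by auto
    have Y: "Y d \<in> {-2..U b}" "D t \<le> -1" using Y_range(2)[OF d] D_le t by auto
    \<comment> \<open>Targets between \<open>Y d\<close> and \<open>D t\<close> are at most
      \<open>-1\<close>, so no left source reaches them with an active hinge, and
      \<open>p \<le> Bl b\<close>.\<close>
    have "Bl b * Y d - \<psi>l (Y d) \<le> Bl b * D t - \<psi>l (D t)"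
    proof (rule deriv_within_mono[where S = "{-2..U b}" and f = "\<lambda>y. Bl b * y - \<psi>l y" and f' = "\<lambda>y. Bl b - p y"])
      fix y assume y: "Y d \<le> y" "y \<le> D t"
      show "((\<lambda>y. Bl b * y - \<psi>l y) has_real_derivative Bl b - p y) (at y within {-2..U b})"
        by (intro DERIV_diff DERIV_cmult_Id \<psi>l_deriv) (use y Y Ub_gt in auto)
    next
      fix y assume y: "Y d < y" "y < D t"
      have "\<tau> y \<in> {-1..b}" by (rule \<tau>_range) (use y Y Ub_gt in auto)
      then show "0 \<le> Bl b - p y" using hp_le[of "y - \<tau> y"] y Y s1 Bl_mono[of "\<tau> y" b] by (auto simp: p_def)
    qed (use Y le Ub_gt in auto)
    then have "\<psi>l (D t) - \<psi>l (Y d) \<le> Bl b * (D t - Y d)" by (simp add: algebra_simps)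
    also have "\<dots> \<le> (B0 + q) * (D t - Y d)" using Bt_ge[OF d] B le by (intro mult_right_mono) (auto simp: B0_def q_def)
    finally have 1: "\<psi>l (D t) - \<psi>l (Y d) \<le> B0 * (D t - Y d) + q * (D t - Y d)" by (simp add: algebra_simps)
    have "q * q \<le> q * (2 * (u t + v t))" using q0 s1 v0 by (intro mult_left_mono) (auto simp: q_def)
    then have "q * q \<le> 2 * (q * (u t + v t))" by (simp only: mult.left_commute)
    then have "q\<^sup>2 / 2 \<le> q * (u t + v t)" unfolding power2_eq_square by linarith
    with 1 show ?thesis by (simp add: algebra_simps)
  next
    case False
    then have ld: "l \<le> d" "l \<le> 1" using d by auto
    define g where "g = k - l"
    define w where "w = ln (g / (k - 1))"
    have g: "k - 1 \<le> g" "0 < g" using ld k1 by (auto simp: g_def)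
    have u2: "(u t)\<^sup>2 = k\<^sup>2 - 4 * g + 2 * k * g * w" and vu: "v t - u t = 2 * k * (1 + w) - 4"
      using mid[of t] t ld unfolding l_def[symmetric] g_def[symmetric] w_def[symmetric] by auto
    have w0: "0 \<le> w" using g k1 by (simp add: w_def)
    have kw: "k * (1 + w) < 2" using vu s by (simp add: algebra_simps)
    moreover have "k * 1 \<le> k * (1 + w)" using w0 k1 by (intro mult_left_mono) auto
    ultimately have k2: "k < 2" by simp
    have l1: "l < 1"
    proof (rule ccontr)
      assume "\<not> l < 1"
      then have "l = 1" using ld by simp
      then have "w = 0" "g = k - 1" using k1 by (simp_all add: w_def g_def)
      then have "(u t)\<^sup>2 = (2 - k)\<^sup>2" using u2 by (simp add: power2_eq_square algebra_simps)
      moreover have "0 \<le> u t" using U_ge t by simp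
      ultimately have "u t = 2 - k" by (rule power2_eq_imp_eq) (use k2 in simp)
      then show False using ul \<open>l = 1\<close> t1 by simp
    qed
    have g2: "g < 3 - k"
    proof -
      have "- w \<le> (k - 1) / g - 1" using ln_le_minus_one[of "(k - 1) / g"] g k1 by (simp add: w_def ln_div)
      then have "g * (2 - (k - 1) / g) \<le> g * (1 + w)" using g by (intro mult_left_mono) auto
      moreover have "g * (2 - (k - 1) / g) = 2 * g - (k - 1)" using g by (simp add: field_simps)
      ultimately have "2 * g - (k - 1) \<le> g * (1 + w)" by simp
      then have "k * (2 * g - (k - 1)) \<le> k * (g * (1 + w))" using k1 by (intro mult_left_mono) auto
      also have "\<dots> = g * (k * (1 + w))" by simp
      also have "\<dots> < g * 2" using kw g by (intro mult_strict_left_mono) auto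
      finally have "(k - 1) * (2 * g) < (k - 1) * k" by (simp add: algebra_simps)
      then have "2 * g < k" using k1 by simp
      then show ?thesis using k2 by simp
    qed
    have Ut: "1 - k < U t" using Y_ge1[of "R t"] t by (simp add: U_def)
    have cr: "critical (k - 1) (g / (k - 1)) (u t - v t) (u t)"
    proof
      show "1 < g / (k - 1)" using l1 k1 by (simp add: g_def)
      show "u t - v t = 4 - 2 * (1 + (k - 1)) * (1 + ln (g / (k - 1)))" using vu by (simp add: w_def)
      show "(k - 1) * (g / (k - 1)) < 2 - (k - 1)" using g2 k1 by simp
      have uv: "u t - v t = 4 - 2 * k * (1 + w)" using vu by simp
      have kg: "(k - 1) * (g / (k - 1)) = g" using k1 by simp
      then show "(u t)\<^sup>2 = (1 + (k - 1))\<^sup>2 - 2 * (1 + (k - 1)) * ((k - 1) * (g / (k - 1))) - (k - 1) * (g / (k - 1)) * (u t - v t)"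
        unfolding kg uv using u2 by (simp add: algebra_simps)
      show "2 - (k - 1) - (k - 1) * (g / (k - 1)) < 2 * u t" using Ut ul k1 by (simp add: g_def)
    qed (use k1 k2 s in auto)
    have kg: "(k - 1) * (g / (k - 1)) = g" using k1 by simp
    have q: "q < u t - v t" using s by (simp add: q_def)
    have lu: "0 \<le> l - u t" using ul t by simp
    have sl: "s < L t" using s lu by (simp add: l_def)
    \<comment> \<open>Either \<open>u\<close> stays at most \<open>s\<close> for the sources up to
      \<open>t\<close> whose upper coordinate is at most \<open>d\<close>, and then
      \<open>pe \<le> Bl t\<close> up to \<open>d\<close>; or \<open>u\<close> crosses
      \<open>s\<close> at some \<open>x1\<close>, and the same bound up to \<open>R x1 < d\<close>
      is already contradictory.\<close>
    show ?thesis
    proof (cases "\<forall>x. -1 \<le> x \<and> x \<le> t \<and> R x \<le> d \<longrightarrow> u x \<le> s")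
      case True
      have pe: "pe e \<le> Bl t" if e: "L t \<le> e" "e \<le> d" for e
      proof (cases "e \<le> es")
        case True
        obtain x where x: "x \<in> {-1..b}" "L x = e" "pe e = Bl x" using pe_source[OF s1 _ True] e d l0 l_def by auto
        have "x \<le> t" using L_dec[of t x] x t e by (cases "x \<le> t") auto
        then show ?thesis using Bl_mono x t by auto
      next
        case False
        obtain x where x: "x \<in> {-1..b}" "R x = e" "pe e = hp (u x) + Bl x" using pe_source'[of e] False e d l0 l_def by auto
        have "x \<le> t" using R_inc[of t x] x t e d by (cases "x \<le> t") auto
        then show ?thesis using True x t Bl_mono[of x t] hp_le[of "u x"] e by auto
      qed
      define f where "f = d - l"
      note W = W_bound[OF s1 t(1) sl d _ pe, unfolded l_def[symmetric] B0_def[symmetric] f_def[symmetric], OF ld(1)]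
      have Bq: "Bt d - B0 = q" using B by (simp add: B0_def q_def)
      have C2: "2 * k * ln (g / (g - f)) - f + q / 2 + (2 * k - g + f) * f / (2 * (k - g)) \<le> 2 * u t - (u t - v t)"
      proof -
        have "f * (k - g - u t) + f\<^sup>2 / 2 \<le> (g - 2 * f) * q"
          using W(1) unfolding Bq by (simp add: q_def g_def f_def algebra_simps)
        then show ?thesis using critical.C2[OF cr q0 q, of f] ld lu unfolding kg by (simp add: f_def g_def)
      qed
      have "Y d - Y l = 2 * k * (ln ((k - 1) / (k - d)) - ln ((k - 1) / (k - l))) - f"
        using Y_z1[of d] Y_z1[of l] ld d by (simp add: z1_def f_def algebra_simps)
      also have "ln ((k - 1) / (k - d)) - ln ((k - 1) / (k - l)) = ln (g / (g - f))"
        using k1 d ld by (simp add: ln_div g_def f_def)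
      finally have "q * (Y d - D t + q / 2 + (k + d) * f / (2 * l)) \<le> q * (u t + v t)"
        using C2 q0 Yl by (intro mult_left_mono) (auto simp: g_def f_def)
      moreover have "B0 * (Y d - D t) - (\<psi>l (Y d) - \<psi>l (D t)) \<le> q * ((k + d) * f / (2 * l))"
        using W(2) unfolding Bq Yl by (simp add: mult_ac)
      ultimately show ?thesis by (simp only: distrib_left right_diff_distrib) (simp add: power2_eq_square)
    next
      case False
      then obtain x' where x': "-1 \<le> x'" "x' \<le> t" "R x' \<le> d" "s < u x'" by force
      have "\<exists>x1\<ge>-1. x1 \<le> x' \<and> u x1 = s"
        by (rule IVT') (use x' t s1 DU_m1 in \<open>auto intro!: continuous_intros continuous_on_subset[OF U_continuous]\<close>)
      then obtain x1 where x1: "-1 \<le> x1" "x1 \<le> x'" "u x1 = s" by blast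
      have "x1 \<noteq> x'" using x1(3) x'(4) by auto
      then have "x1 < x'" using x1 by simp
      then have "R x1 < R x'" using R_inc x1 x' t by auto
      define d1 where "d1 = R x1"
      have d1: "d1 \<in> {db..1}" "L t \<le> d1" "d1 \<le> d" "d1 \<le> 1"
        using \<open>R x1 < R x'\<close> x' d es_le_R[of x1] es x1 t L_le_es[of t] by (auto simp: d1_def)
      have pe: "pe e \<le> Bl t" if e: "L t \<le> e" "e \<le> d1" for e
      proof (cases "e \<le> es")
        case True
        obtain x where x: "x \<in> {-1..b}" "L x = e" "pe e = Bl x" using pe_source[OF s1 _ True] e d1 l0 l_def by auto
        have "x \<le> t" using L_dec[of t x] x t e by (cases "x \<le> t") auto
        then show ?thesis using Bl_mono x t by auto
      next
        case False
        obtain x where x: "x \<in> {-1..b}" "R x = e" "pe e = hp (u x) + Bl x" using pe_source'[of e] False e d1 l0 l_def by auto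
        have "x \<le> x1" using R_inc[of x1 x] x x1 e d1_def by (cases "x \<le> x1") auto
        moreover have "u x \<le> s" using u_mono[of x x1] x x1 x' t \<open>x \<le> x1\<close> d1 d1_def by auto
        ultimately show ?thesis using x t x1 x' Bl_mono[of x t] hp_le[of "u x"] by auto
      qed
      define f where "f = d1 - l"
      have "f * (l - s) + f\<^sup>2 / 2 \<le> (k - d1) * (Bt d1 - B0)"
        using W_bound(1)[OF s1 t(1) sl d1(1,2) pe] by (simp add: f_def l_def B0_def)
      also have "\<dots> \<le> (k - d1) * q"
        using Bt_mono[OF d1(1) d d1(3)] B kd(1)[OF d1(1)] by (intro mult_left_mono) (auto simp: B0_def q_def)
      finally have c: "f * (l - s) + f\<^sup>2 / 2 \<le> (g - f) * q" by (simp add: g_def f_def)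
      have f0: "0 \<le> f" using d1 by (simp add: f_def l_def)
      have "f * q \<le> f * (l - s)" using f0 lu by (intro mult_left_mono) (auto simp: q_def)
      with c have "f\<^sup>2 / 2 \<le> (g - 2 * f) * q" by (simp add: algebra_simps)
      \<comment> \<open>Convexity of \<open>Y\<close> between \<open>d1\<close> and \<open>1\<close>
        supplies the weight condition of \<open>C1\<close> for \<open>w = k - d1\<close>.\<close>
      moreover have "(2 * (k - d1) - g) * q < (g - (k - d1))\<^sup>2 / 2"
      proof -
        have "(k + d1) / (k - d1) * (1 - d1) \<le> 1 - k - U x1"
          using Y_slope(1)[of d1 1] d1 Y_ge1[of 1] db1 by (simp add: U_def d1_def)
        also have "\<dots> \<le> k - 1 + (u t - v t)" using Ut t x1 q by (simp add: q_def)
        finally have "(1 - d1) * (k + d1) \<le> (k - d1) * (k - 1 + (u t - v t))"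
          using kd(1)[OF d1(1)] by (simp add: pos_divide_le_eq mult_ac)
        then have "(k - d1 - (k - 1)) * (2 * (1 + (k - 1)) - (k - d1)) \<le> (k - d1) * (k - 1 + (u t - v t))" by simp
        then show ?thesis
          using critical.C1[OF cr, of "k - d1" q] kd(1)[OF d1(1)] d1(2) q q0 unfolding kg by (simp add: g_def l_def)
      qed
      moreover have "2 * (k - d1) - g = g - 2 * f" "g - (k - d1) = f" by (simp_all add: g_def f_def)
      ultimately have False by (simp only:)
      then show ?thesis ..
    qed
  qed
  have "\<psi>l (U t) \<le> \<psi>l (Y d) + (B0 + q) * (U t - Y d)"
  proof -
    have "U t - Y d = u t + v t - (Y d - D t)" by simp
    then show ?thesis using key unfolding psi by (simp add: distrib_right right_diff_distrib)
  qed
  with ct show ?thesis by simp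
qed

end

section \<open>Dual inequality between right sources and left targets\<close>

context hinge_dual
begin

text \<open>Beyond coordinate \<open>1\<close>, \<open>u' = (v - u) / (u + v)\<close>. Adding
  \<open>\<beta>\<close> gives the numerator \<open>v - u + hp u - hp (- v)\<close>, nonnegative
  because \<open>hp u \<ge> u - s\<close> and \<open>hp (- v) \<le> v - s\<close>.\<close>

lemma uB_mono:
  assumes t: "t \<in> {-1..b}" "1 < R t" "s \<le> v t" and t': "t \<le> t'" "t' \<le> b"
  shows "u t + Bl t \<le> u t' + Bl t'"
proof -
  have R1: "1 \<le> R z" if "t \<le> z" "z \<le> b" for z
    using R_inc[of t z] that t by (cases "z = t") auto
  have t1: "-1 < t \<or> t = -1" using t by auto
  have "L t - b + t + Bl t \<le> L t' - b + t' + Bl t'"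
  proof (rule deriv_mono[where f = "\<lambda>z. L z - b + z + Bl z" and f' = "\<lambda>z. - 2 * u z / (u z + v z) - 0 + 1 + \<beta> z"])
    show "continuous_on {t..t'} (\<lambda>z. L z - b + z + Bl z)"
      by (intro continuous_intros continuous_on_subset[OF L_continuous] continuous_on_subset[OF Bl_cont]) (use t t' in auto)
    fix z assume z: "t < z" "z < t'"
    have zz: "-1 < z" "z \<le> b" using z t t' by auto
    have at: "at z within {-1..b} = at z" by (rule at_within_Icc_at) (use t t' z in auto)
    show "((\<lambda>z. L z - b + z + Bl z) has_real_derivative - 2 * u z / (u z + v z) - 0 + 1 + \<beta> z) (at z)"
      using L_deriv[OF zz] Bl_deriv[of z] zz unfolding at by (intro DERIV_add DERIV_diff DERIV_const DERIV_ident) auto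
    have vz: "s \<le> v z" using D_dec[of t z] t t' z by auto
    have "0 \<le> v z" using uv_pos[OF zz] by simp
    then have "hp (- v z) \<le> v z - s" unfolding hp_def using vz by simp
    then have "0 \<le> v z - u z + (hp (u z) - hp (- v z))" using hp_lower[of "u z"] by simp
    then have "0 \<le> (v z - u z + (hp (u z) - hp (- v z))) / (u z + v z)" using uv_pos[OF zz] by (intro divide_nonneg_nonneg) auto
    also have "\<dots> = - 2 * u z / (u z + v z) - 0 + 1 + \<beta> z"
    proof -
      have "(- 2 * a / n - 0 + 1 + c / n) * n = - 2 * a + n + c" if "n \<noteq> 0" for a c n :: real
        using that by (simp add: distrib_right left_diff_distrib)
      from this[of "a + w" for a w] have "w - a + c = (- 2 * a / (a + w) - 0 + 1 + c / (a + w)) * (a + w)" if "0 < a" "0 < w" for a w c :: real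
        using that by simp
      then have "(w - a + c) / (a + w) = - 2 * a / (a + w) - 0 + 1 + c / (a + w)" if "0 < a" "0 < w" for a w c :: real
        using that by (intro nonzero_divide_eq_eq[THEN iffD2]) auto
      from this[OF uv_pos[OF zz]] show ?thesis using zz by (simp add: \<beta>_def)
    qed
    finally show "0 \<le> - 2 * u z / (u z + v z) - 0 + 1 + \<beta> z" .
  qed (use t' in auto)
  then show ?thesis using u_eq[OF R1[of t]] u_eq[OF R1[of t']] t t' by simp
qed

lemma p_D: "t \<in> {-1..b} \<Longrightarrow> p (D t) = hp (- v t) + Bl t" and p_U: "t \<in> {-1..b} \<Longrightarrow> p (U t) = hp (u t) + Bl t"
  by (simp_all add: p_def \<tau>_D \<tau>_U)

text \<open>On the upper graph with \<open>R \<le> 1\<close> both \<open>u\<close> and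
  \<open>Bl\<close> increase. On the lower graph either the hinge is inactive and
  \<open>p \<le> Bl b \<le> Bt d\<close>, or it is linear and the comparison rests on
  \<open>Bl_lip\<close> or, when \<open>yy\<close> is an upper target, on signs.\<close>

lemma p_past:
  assumes d: "d \<in> {db..1}" and y: "y \<in> {-2..U b}" "y \<le> yy" and yy: "yy \<in> {-2..U b}" and B: "p yy = Bt d"
    and c: "(\<exists>t\<in>{-1..b}. yy = D t \<and> yy \<le> -1) \<or> (\<exists>t\<in>{-1..b}. yy = U t \<and> R t \<le> 1)"
  shows "p y \<le> p yy"
proof -
  have pD: ?thesis if t': "t' \<in> {-1..b}" "y = D t'" for t'
  proof (cases "- v t' \<le> s")
    case True
    then show ?thesis using t' p_D[of t'] hp_le Bl_mono[of t' b] Bt_ge[OF d] B by auto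
  next
    case False
    have py: "p y = D t' - t' - s + Bl t'" using t' p_D[of t'] hp_ge[of "- v t'"] False by simp
    from c show ?thesis
    proof
      assume "\<exists>t\<in>{-1..b}. yy = D t \<and> yy \<le> -1"
      then obtain t where t: "t \<in> {-1..b}" "yy = D t" by blast
      have "t \<le> t'" using D_dec[of t' t] t t' y by (cases "t \<le> t'") auto
      then have "t - Bl t \<le> t' - Bl t'" using Bl_lip[of t t'] t t' by auto
      moreover have "D t - t - s + Bl t \<le> p yy" using p_D[OF t(1)] hp_lower[of "- v t"] t by simp
      ultimately show ?thesis using py t t' y by simp
    next
      assume "\<exists>t\<in>{-1..b}. yy = U t \<and> R t \<le> 1"
      then obtain t where t: "t \<in> {-1..b}" "yy = U t" by blast
      have "p y \<le> - s" using py D_le[of t'] Bl_bounds(2)[of t'] t' by auto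
      also have "\<dots> \<le> p yy" using p_U[OF t(1)] hp_lower[of "u t"] U_ge[of t] Bl_bounds(1)[of t] t by auto
      finally show ?thesis .
    qed
  qed
  show ?thesis
  proof (cases rule: \<tau>_cases[OF y(1)])
    case 1 then show ?thesis using pD[of "\<tau> y"] by simp
  next
    case 2
    from c show ?thesis
    proof
      assume "\<exists>t\<in>{-1..b}. yy = D t \<and> yy \<le> -1"
      then have "y = -1" using 2 y by auto
      then show ?thesis using pD[of "-1"] DU_m1 b1 by auto
    next
      assume "\<exists>t\<in>{-1..b}. yy = U t \<and> R t \<le> 1"
      then obtain t where t: "t \<in> {-1..b}" "yy = U t" "R t \<le> 1" by blast
      have "\<tau> y \<le> t" using U_inc[of t "\<tau> y"] t 2 y by (cases "\<tau> y \<le> t") auto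
      then have "hp (u (\<tau> y)) \<le> hp (u t)" "Bl (\<tau> y) \<le> Bl t"
        using u_mono[of "\<tau> y" t] Bl_mono[of "\<tau> y" t] t 2 by (auto intro!: hp_mono)
      moreover have "p y = hp (u (\<tau> y)) + Bl (\<tau> y)" using p_U[of "\<tau> y"] 2 by simp
      moreover have "p yy = hp (u t) + Bl t" using p_U[of t] t by simp
      ultimately show ?thesis by simp
    qed
  qed
qed

lemma p_future:
  assumes t: "t \<in> {-1..b}" "1 < R t" "u t \<le> s \<or> s \<le> v t" and y: "y \<in> {-2..U b}" "U t \<le> y"
  shows "p (U t) \<le> p y"
proof -
  have "-1 \<le> U t" using U_ge[of t] t by auto
  then have y1: "-1 \<le> y" using y by simp
  have Uy: "y = U (\<tau> y)" "\<tau> y \<in> {-1..b}"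
  proof -
    show "\<tau> y \<in> {-1..b}" by (rule \<tau>_range[OF y(1)])
    show "y = U (\<tau> y)"
    proof (cases rule: \<tau>_cases[OF y(1)])
      case 1
      then have "y = -1" using y1 by simp
      then show ?thesis using \<tau>_D[of "-1"] DU_m1 b1 by simp
    qed
  qed
  have tt: "t \<le> \<tau> y" using U_inc[of "\<tau> y" t] t Uy y by (cases "t \<le> \<tau> y") auto
  have py: "p y = hp (u (\<tau> y)) + Bl (\<tau> y)" using p_U[OF Uy(2)] Uy(1) by simp
  have B: "Bl t \<le> Bl (\<tau> y)" using Bl_mono[of t "\<tau> y"] tt t Uy by auto
  show ?thesis
  proof (cases "u t \<le> s")
    case True
    then show ?thesis using p_U[OF t(1)] hp_le py B hp_nonneg[of "u (\<tau> y)"] by simp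
  next
    case False
    then have "u t + Bl t \<le> u (\<tau> y) + Bl (\<tau> y)" using t(3) uB_mono[OF t(1,2) _ tt] Uy by auto
    then show ?thesis using p_U[OF t(1)] False hp_ge[of "u t"] py hp_lower[of "u (\<tau> y)"] by simp
  qed
qed

text \<open>For \<open>d \<le> s\<close> the multiplier is still \<open>Bl b\<close>, and
  \<open>\<psi>l\<close> has slope \<open>Bl b\<close> on \<open>[-2, Y d]\<close>. Hence
  \<open>ct d\<close> dominates \<open>cl b\<close>, which dominates \<open>\<psi>l\<close>.\<close>

lemma main_low:
  assumes d: "d \<in> {db..1}" "d \<le> s" and y: "y \<in> {Y d..U b}"
  shows "\<psi>l y \<le> ct d y"
proof -
  have s1: "0 < s" using d db0 by auto
  have hk: "hinge s (- k) = 0" using s1 k1 by (simp add: hinge_def)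
  have z: "z1 k d = Y d + k" using Y_z1[of d] d by simp
  have B: "Bt d = Bl b" by (rule Bt_const[OF d])
  have c1: "\<psi>l (Y d) + Bl b * (y - Y d) \<le> ct d y"
  proof -
    have "ct d y = hinge s (y - z1 k d) + \<psi>l (Y d) + Bl b * (y - Y d)"
      unfolding B[symmetric] by (simp add: ct_def \<phi>t_def hk z algebra_simps)
    then show ?thesis by (simp add: hinge_def)
  qed
  have "\<psi>l (Y db) - Bl b * Y db \<le> \<psi>l (Y d) - Bl b * Y d"
  proof (rule deriv_within_mono[where S = "{db..1}" and f = "\<lambda>e. \<psi>l (Y e) - Bl b * Y e" and f' = "\<lambda>e. pe e * ((k + e) / (k - e)) - Bl b * ((k + e) / (k - e))"])
    fix e assume "db \<le> e" "e \<le> d"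
    then show "((\<lambda>e. \<psi>l (Y e) - Bl b * Y e) has_real_derivative pe e * ((k + e) / (k - e)) - Bl b * ((k + e) / (k - e))) (at e within {db..1})"
      by (intro DERIV_diff DERIV_cmult \<psi>lY_deriv Y_deriv) (use d in auto)
  next
    fix e assume "db < e" "e < d"
    then show "0 \<le> pe e * ((k + e) / (k - e)) - Bl b * ((k + e) / (k - e))" using pe_const[of e] d by simp
  qed (use d in auto)
  then have "\<psi>l (-2) + Bl b * (Y d + 2) \<le> \<psi>l (Y d)" by (simp add: Ydb algebra_simps)
  moreover have "cl b y = \<psi>l (-2) + Bl b * (y + 2)"
  proof -
    have "y - b \<le> s" using y U_b d by auto
    then have "hinge s (y - b) = 0" by (simp add: hinge_def)
    moreover have "hinge s (- 2 - b) = 0" using s1 b1 by (simp add: hinge_def)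
    moreover have "\<psi>l (-2) = cl b (-2)" using \<psi>l_D[of b] D_b b1 by simp
    ultimately show ?thesis by (simp add: cl_def algebra_simps)
  qed
  moreover have "\<psi>l y \<le> cl b y" by (rule \<psi>l_le) (use y Y_range(2)[OF d(1)] b1 in auto)
  ultimately show ?thesis using c1 by (simp add: algebra_simps)
qed

lemma G_deriv:
  "y \<in> {-2..U b} \<Longrightarrow> ((\<lambda>y. ct d y - \<psi>l y) has_real_derivative hp (y - z1 k d) + Bt d - p y) (at y within {-2..U b})"
  by (intro DERIV_diff ct_y_deriv \<psi>l_deriv)

text \<open>With the hinge of the right source active, the slack has slope
  \<open>y - z1 k d - s + Bt d - p y\<close>, nonpositive by \<open>y_minus_p\<close> and
  \<open>zB_mono\<close>; it decreases to \<open>U b\<close>, where \<open>top_left\<close>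
  applies.\<close>

lemma main_top:
  assumes d: "d \<in> {db..1}" and y: "y \<in> {Y d..U b}" "z1 k d + s \<le> y"
  shows "\<psi>l y \<le> ct d y"
proof -
  have z: "b - Bl b \<le> z1 k d - Bt d" using zB_mono[of db d] d db1 zdb Bt_db by simp
  have "r d db \<le> 0" using y hp_ge[of "U b - z1 k d"] hp_lower[of db] z U_b Bt_db by (simp add: r_def Ut_db)
  then have top: "\<psi>l (U b) \<le> ct d (U b)" using top_left[OF d, of db] d db1 by (simp add: Ut_db \<psi>t_db)
  have Yd: "-2 \<le> Y d" using Y_range(2)[OF d] by simp
  have "\<psi>l y - ct d y \<le> \<psi>l (U b) - ct d (U b)"
  proof (rule deriv_within_mono[where S = "{-2..U b}" and f = "\<lambda>y. \<psi>l y - ct d y" and f' = "\<lambda>y. p y - (hp (y - z1 k d) + Bt d)"])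
    fix x assume x: "y \<le> x" "x \<le> U b"
    show "((\<lambda>y. \<psi>l y - ct d y) has_real_derivative p x - (hp (x - z1 k d) + Bt d)) (at x within {-2..U b})"
      by (intro DERIV_diff ct_y_deriv \<psi>l_deriv) (use x y Yd in auto)
  next
    fix x assume x: "y < x" "x < U b"
    have "x - p x \<le> b + s - Bl b" by (rule y_minus_p) (use x y Yd in auto)
    then show "0 \<le> p x - (hp (x - z1 k d) + Bt d)" using hp_ge[of "x - z1 k d"] x y z by simp
  qed (use y Yd in auto)
  then show ?thesis using top by simp
qed

text \<open>Up to \<open>e1\<close> the hinge of the right source is inactive, so the slack has
  slope \<open>Bt d - p y\<close> and an interior minimum \<open>m\<close> satisfies
  \<open>p m = Bt d\<close>. The order of \<open>p\<close> on one side of \<open>m\<close> then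
  refutes a negative value there.\<close>

lemma main_min:
  assumes d: "d \<in> {db..1}" "s < d" and e1: "e1 = min (z1 k d + s) (U b)" and y: "y \<in> {Y d..e1}"
  shows "\<psi>l y \<le> ct d y"
proof (rule ccontr)
  assume neg: "\<not> \<psi>l y \<le> ct d y"
  let ?G = "\<lambda>y. ct d y - \<psi>l y"
  have Yd: "-2 \<le> Y d" "Y d \<le> U b" using Y_range(2)[OF d(1)] by auto
  have sub: "{Y d..e1} \<subseteq> {-2..U b}" using Yd by (auto simp: e1)
  have "continuous_on {-2..U b} ?G"
    using G_deriv by (intro DERIV_continuous_on) auto
  then have "continuous_on {Y d..e1} ?G" by (rule continuous_on_subset[OF _ sub])
  then obtain m where m: "m \<in> {Y d..e1}" "\<forall>x\<in>{Y d..e1}. ?G m \<le> ?G x"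
    using continuous_attains_inf[of "{Y d..e1}" ?G] y by auto
  have Gm: "?G m < 0" using m(2) y neg by force
  have G': "(?G has_real_derivative Bt d - p x) (at x within {-2..U b})" if "x \<in> {Y d..e1}" for x
    using G_deriv[of x d] hp_le[of "x - z1 k d"] that sub by (auto simp: e1)
  have m2: "m \<in> {-2..U b}" using m sub by auto
  have mY: "Y d < m" using m Gm ct_D[OF d(1)] by (cases "m = Y d") auto
  have low: "Bt d \<le> p m"
  proof (rule ccontr)
    assume "\<not> Bt d \<le> p m"
    then obtain r where r: "0 < r" "\<forall>h>0. m - h \<in> {-2..U b} \<longrightarrow> h < r \<longrightarrow> ?G (m - h) < ?G m"
      using has_real_derivative_pos_inc_left[OF G'[OF m(1)]] by auto
    define h where "h = min (r / 2) (m - Y d)"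
    have "0 < h" "h < r" "m - h \<in> {Y d..e1}" using r mY m by (auto simp: h_def min_def)
    then show False using r(2) m(2) sub by force
  qed
  \<comment> \<open>With the hinge of the source inactive at \<open>U b\<close>, the condition on
    \<open>p\<close> is exactly \<open>r d db \<le> 0\<close>, as \<open>top_left\<close>
    requires.\<close>
  have Ub: "\<psi>l (U b) \<le> ct d (U b)" if "U b \<le> z1 k d + s" "Bt d \<le> p (U b)"
  proof -
    have "p (U b) = hp db + Bl b" using p_U[of b] b1 U_b by simp
    then have "r d db \<le> 0" using that hp_le[of "U b - z1 k d"] Bt_db by (simp add: r_def Ut_db)
    then show ?thesis using top_left[OF d(1), of db] d db1 by (simp add: Ut_db \<psi>t_db)
  qed
  have end1: "0 \<le> ?G e1" if "Bt d \<le> p e1"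
  proof (cases "z1 k d + s \<le> U b")
    case True
    then show ?thesis using main_top[OF d(1), of e1] y by (auto simp: e1)
  next
    case False
    then show ?thesis using Ub that by (simp add: e1)
  qed
  have me: "m < e1" using m end1 low Gm by (cases "m = e1") auto
  have "p m \<le> Bt d"
  proof (rule ccontr)
    assume "\<not> p m \<le> Bt d"
    then obtain r where r: "0 < r" "\<forall>h>0. m + h \<in> {-2..U b} \<longrightarrow> h < r \<longrightarrow> ?G m > ?G (m + h)"
      using has_real_derivative_neg_dec_right[OF G'[OF m(1)]] by auto
    define h where "h = min (r / 2) (e1 - m)"
    have "0 < h" "h < r" "m + h \<in> {Y d..e1}" using r me m by (auto simp: h_def min_def)
    then show False using r(2) m(2) sub by force
  qed
  with low have pm: "p m = Bt d" by simp
  have past: False if "\<And>x. x \<in> {Y d..m} \<Longrightarrow> p x \<le> p m"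
  proof -
    have "?G (Y d) \<le> ?G m"
    proof (rule deriv_within_mono[where S = "{-2..U b}" and f = ?G and f' = "\<lambda>x. Bt d - p x"])
      fix x assume "Y d \<le> x" "x \<le> m"
      then show "(?G has_real_derivative Bt d - p x) (at x within {-2..U b})" by (intro G') (use m in auto)
    qed (use mY m2 Yd that pm in auto)
    then show False using Gm ct_D[OF d(1)] by simp
  qed
  have future: False if f: "\<And>x. x \<in> {m..e1} \<Longrightarrow> p m \<le> p x"
  proof -
    have "- ?G m \<le> - ?G e1"
    proof (rule deriv_within_mono[where S = "{-2..U b}" and f = "\<lambda>x. - ?G x" and f' = "\<lambda>x. - (Bt d - p x)"])
      fix x assume "m \<le> x" "x \<le> e1"
      then show "((\<lambda>x. - ?G x) has_real_derivative - (Bt d - p x)) (at x within {-2..U b})" by (intro DERIV_minus G') (use mY in auto)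
    qed (use me m2 sub f pm in \<open>auto simp: e1\<close>)
    moreover have "0 \<le> ?G e1" using end1 f[of e1] pm me by simp
    ultimately show False using Gm by simp
  qed
  have pst: False if "(\<exists>t\<in>{-1..b}. m = D t \<and> m \<le> -1) \<or> (\<exists>t\<in>{-1..b}. m = U t \<and> R t \<le> 1)"
    by (rule past, rule p_past[OF d(1) _ _ m2 pm that]) (use m2 Yd in auto)
  show False
  proof (cases rule: \<tau>_cases[OF m2])
    case 1 then show False using pst by blast
  next
    case 2
    show False
    proof (cases "R (\<tau> m) \<le> 1")
      case True then show False using pst 2 by blast
    next
      case False
      show False
      proof (cases "u (\<tau> m) \<le> s \<or> s \<le> v (\<tau> m)")
        case True
        show False
          by (rule future, subst 2(3), rule p_future[OF 2(2) _ True]) (use False 2(3) m2 e1 in auto)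
      next
        case F: False
        have "p m = Bl (\<tau> m) + (u (\<tau> m) - s)" using p_U[OF 2(2)] 2(3) F hp_ge[of "u (\<tau> m)"] by simp
        then have "\<psi>l (U (\<tau> m)) \<le> ct d (U (\<tau> m))" using bad_point[OF 2(2) _ _ _ d(1)] False F pm by simp
        then show False using Gm 2(3) by simp
      qed
    qed
  qed
qed

lemma main_ineq:
  assumes d: "d \<in> {db..1}" and y: "y \<in> {Y d..U b}"
  shows "\<psi>l y \<le> ct d y"
proof -
  consider "d \<le> s" | "z1 k d + s \<le> y" | "s < d" "y \<in> {Y d..min (z1 k d + s) (U b)}" using y by force
  then show ?thesis
  proof cases
    case 1 then show ?thesis using main_low d y by blast
  next
    case 2 then show ?thesis using main_top d y by blast
  next
    case 3 then show ?thesis using main_min[OF d _ refl] by blast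
  qed
qed

section \<open>Global potentials and optimality for a hinge\<close>

lemma piecewise_bounded:
  fixes f g :: "real \<Rightarrow> real"
  assumes "continuous_on {a1..a2} f" "continuous_on {a3..a4} g"
  defines "h \<equiv> \<lambda>x. if x \<in> {a1..a2} then f x else if x \<in> {a3..a4} then g x else 0"
  shows "h \<in> borel_measurable borel" "\<exists>C. \<forall>x. \<bar>h x\<bar> \<le> C"
proof -
  show "h \<in> borel_measurable borel"
    unfolding h_def by (intro borel_measurable_if_continuous_on assms) auto
  have bd: "\<exists>C. \<forall>x\<in>{c..e}. \<bar>q x\<bar> \<le> C" if "continuous_on {c..e} q" for c e and q :: "real \<Rightarrow> real"
    using compact_imp_bounded[OF compact_continuous_image[OF that compact_Icc]] by (auto simp: bounded_iff)
  obtain C1 C2 where "\<forall>x\<in>{a1..a2}. \<bar>f x\<bar> \<le> C1" "\<forall>x\<in>{a3..a4}. \<bar>g x\<bar> \<le> C2" using bd[OF assms(1)] bd[OF assms(2)] by blast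
  then have "\<forall>x. \<bar>h x\<bar> \<le> max (max C1 C2) 0" by (auto simp: h_def max_def) force+
  then show "\<exists>C. \<forall>x. \<bar>h x\<bar> \<le> C" ..
qed

lemma Ut_less: "e \<in> {db..1} \<Longrightarrow> e' \<in> {db..1} \<Longrightarrow> e < e' \<Longrightarrow> Ut e < Ut e'"
  using z_mono[of e e'] by (simp add: Ut_def)

lemma Ut_inj: "inj_on Ut {db..1}"
  by (rule inj_onI) (use Ut_less in \<open>metis less_irrefl linorder_neqE_linordered_idom\<close>)

lemma Ut_cont: "continuous_on {db..1} Ut"
  unfolding Ut_def by (intro continuous_intros z1_cont)

lemma Ut_image: "Ut ` {db..1} = {U b..2}"
proof
  have U1: "Ut 1 = 2" using z1_1[OF k1] by (simp add: Ut_def)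
  have le: "Ut e \<le> Ut e'" if "e \<in> {db..1}" "e' \<in> {db..1}" "e \<le> e'" for e e'
    using Ut_less[of e e'] that by (cases "e = e'") auto
  show "Ut ` {db..1} \<subseteq> {U b..2}" using le[of db] le[of _ 1] U1 Ut_db db1 by auto
  show "{U b..2} \<subseteq> Ut ` {db..1}"
  proof
    fix y assume "y \<in> {U b..2}"
    then have "\<exists>e\<ge>db. e \<le> 1 \<and> Ut e = y" using U1 Ut_db db1 Ut_cont by (intro IVT') auto
    then show "y \<in> Ut ` {db..1}" by auto
  qed
qed

text \<open>Sources split at \<open>b\<close>, targets at \<open>U b\<close>. Low targets are
  handled by \<open>\<psi>l_le\<close> and \<open>main_ineq\<close>; high targets by
  \<open>cl_ge_b\<close> with \<open>top_right\<close> for left sources, and by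
  \<open>top_right\<close> or \<open>top_from_junction\<close> for right ones. Outside the supports
  the potentials are set to \<open>0\<close>, which keeps them bounded and measurable.\<close>

theorem hinge_optimal:
  assumes q0: "0 \<le> q0" "q0 \<le> 1" and pi: "\<pi> \<in> couplings k"
  shows "cost (hinge s) (tg Dc Uc (qc q0)) \<le> cost (hinge s) \<pi>"
proof -
  define iU where "iU = the_inv_into {db..1} Ut"
  have iU: "iU (Ut e) = e" if "e \<in> {db..1}" for e using the_inv_into_f_f[OF Ut_inj that] by (simp add: iU_def)
  have iU_cont: "continuous_on {U b..2} iU"
    using continuous_on_inv_into[OF Ut_cont _ Ut_inj] Ut_image by (simp add: iU_def)
  have iU_im: "iU ` {U b..2} \<subseteq> {db..1}" using iU unfolding Ut_image[symmetric] by auto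
  have dl_im: "dl ` {b..1} \<subseteq> {db..1}" using dl by auto
  define pg where "pg x = (if x \<in> {-1..b} then \<phi>l x else if x \<in> {b..1} then \<phi>t (dl x) else 0)" for x
  define tt where "tt x = (if x \<in> {-1..b} then - Bl x else if x \<in> {b..1} then - Bt (dl x) else 0)" for x
  define sg where "sg y = (if y \<in> {-2..U b} then \<psi>l y else if y \<in> {U b..2} then \<psi>t (iU y) else 0)" for y
  have Btdl: "continuous_on {b..1} (\<lambda>x. Bt (dl x))" by (rule continuous_on_compose2[OF Bt_cont dl_cont dl_im])
  have psY: "continuous_on {db..1} (\<lambda>e. \<psi>l (Y e))" by (intro DERIV_continuous_on) (rule \<psi>lY_deriv)
  have pst: "continuous_on {db..1} \<psi>t" by (intro DERIV_continuous_on) (rule \<psi>t_deriv)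
  have c: "continuous_on {-1..b} \<phi>l" "continuous_on {b..1} (\<lambda>x. \<phi>t (dl x))" "continuous_on {-1..b} (\<lambda>x. - Bl x)"
    "continuous_on {b..1} (\<lambda>x. - Bt (dl x))" "continuous_on {-2..U b} \<psi>l" "continuous_on {U b..2} (\<lambda>y. \<psi>t (iU y))"
  proof -
    show "continuous_on {-1..b} \<phi>l" by (intro DERIV_continuous_on) (rule \<phi>l_deriv)
    show "continuous_on {b..1} (\<lambda>x. \<phi>t (dl x))"
      unfolding \<phi>t_def by (intro continuous_intros Btdl continuous_on_compose2[OF psY dl_cont dl_im])
    show "continuous_on {-1..b} (\<lambda>x. - Bl x)" by (intro continuous_intros Bl_cont)
    show "continuous_on {b..1} (\<lambda>x. - Bt (dl x))" by (intro continuous_intros Btdl)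
    show "continuous_on {-2..U b} \<psi>l" by (intro DERIV_continuous_on) (rule \<psi>l_deriv)
    show "continuous_on {U b..2} (\<lambda>y. \<psi>t (iU y))" by (rule continuous_on_compose2[OF pst iU_cont iU_im])
  qed
  have meas: "pg \<in> borel_measurable borel" "sg \<in> borel_measurable borel" "tt \<in> borel_measurable borel"
    unfolding pg_def sg_def tt_def by (rule piecewise_bounded(1); rule c)+
  obtain C1 C2 C3 where "\<forall>x. \<bar>pg x\<bar> \<le> C1" "\<forall>x. \<bar>sg x\<bar> \<le> C2" "\<forall>x. \<bar>tt x\<bar> \<le> C3"
    using piecewise_bounded(2)[OF c(1,2)] piecewise_bounded(2)[OF c(5,6)] piecewise_bounded(2)[OF c(3,4)]
    unfolding pg_def sg_def tt_def by blast
  then have bd: "\<bar>pg x\<bar> \<le> max C1 (max C2 C3)" "\<bar>sg x\<bar> \<le> max C1 (max C2 C3)" "\<bar>tt x\<bar> \<le> max C1 (max C2 C3)" for x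
    by (simp_all add: le_max_iff_disj)
  have left: "pg x + sg y + tt x * (y - x) \<le> hinge s (y - x) \<longleftrightarrow> sg y \<le> cl x y"
    "pg x + sg y + tt x * (y - x) = hinge s (y - x) \<longleftrightarrow> sg y = cl x y" if "x \<in> {-1..b}" for x y
    using that by (auto simp: pg_def tt_def cl_def)
  have right: "pg x + sg y + tt x * (y - x) \<le> hinge s (y - x) \<longleftrightarrow> sg y \<le> ct (dl x) y"
    "pg x + sg y + tt x * (y - x) = hinge s (y - x) \<longleftrightarrow> sg y = ct (dl x) y" if "x \<in> {b<..1}" for x y
    using that dl(2)[of x] by (auto simp: pg_def tt_def ct_def)
  show ?thesis
  proof (rule weak_duality[OF pi coupling_c(1)[OF q0] hinge_continuous meas bd])
    fix x y :: real assume x: "x \<in> {-1..1}" and y: "y \<in> {-2..2}" "y \<ge> x - k"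
    show "pg x + sg y + tt x * (y - x) \<le> hinge s (y - x)"
    proof (cases "y \<le> U b")
      case yU: True
      then have sg: "sg y = \<psi>l y" using y by (simp add: sg_def)
      show ?thesis
      proof (cases "x \<le> b")
        case True
        then show ?thesis using left(1)[of x y] x \<psi>l_le[of y x] y yU sg by simp
      next
        case False
        then have dx: "dl x \<in> {db..1}" "z1 k (dl x) = x" using dl[of x] x by auto
        then have "Y (dl x) = x - k" using Y_z1[of "dl x"] by simp
        then show ?thesis using right(1)[of x y] x False main_ineq[OF dx(1), of y] y yU sg by simp
      qed
    next
      case yU: False
      then have "y \<in> Ut ` {db..1}" using y unfolding Ut_image by simp
      then obtain e where e: "e \<in> {db..1}" "y = Ut e" by blast
      have sg: "sg y = \<psi>t e" using yU y e iU by (simp add: sg_def)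
      show ?thesis
      proof (cases "x \<le> b")
        case True
        have "\<psi>t e \<le> cl b y" using top_right[of db e] e db1 by (simp add: ct_db)
        then show ?thesis using left(1)[of x y] x True cl_ge_b[of y x] yU sg by simp
      next
        case False
        then have dx: "dl x \<in> {db..1}" using dl[of x] x by auto
        have "\<psi>t db \<le> ct (dl x) (Ut db)" unfolding Ut_db \<psi>t_db using main_ineq[OF dx, of "U b"] Y_range(2)[OF dx] by simp
        then have "\<psi>t e \<le> ct (dl x) (Ut e)" using top_right[OF dx e(1)] top_from_junction[OF dx e(1)] by linarith
        then show ?thesis using right(1)[of x y] x False sg e by simp
      qed
    qed
  next
    show "AE p in tg Dc Uc (qc q0). pg (fst p) + sg (snd p) + tt (fst p) * (snd p - fst p) = hinge s (snd p - fst p)"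
      using coupling_c(3)[OF q0]
    proof eventually_elim
      case (elim p)
      define x where "x = fst p"
      have x: "x \<in> {-1..1}" using elim by (simp add: x_def)
      have yv: "snd p = Dc x \<or> snd p = Uc x" using elim by (simp add: x_def)
      show ?case unfolding x_def[symmetric]
      proof (cases "x \<le> b")
        case True
        then have xb: "x \<in> {-1..b}" using x by simp
        have "sg (D x) = cl x (D x)" using \<psi>l_D[OF xb] D_ge[of x] D_le[of x] xb Ub_gt by (simp add: sg_def)
        moreover have "sg (U x) = cl x (U x)" using \<psi>l_U[OF xb] U_ge_m1[of x] xb by (simp add: sg_def)
        ultimately show "pg x + sg (snd p) + tt x * (snd p - x) = hinge s (snd p - x)"
          using yv unfolding left(2)[OF xb] Dc_le[OF xb] Uc_le[OF xb] by (elim disjE) (simp_all only:)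
      next
        case False
        then have xb: "x \<in> {b<..1}" "x \<in> {b..1}" using x by auto
        note dx = dl[OF xb(2)]
        have Yd: "Y (dl x) = x - k" using Y_z1[of "dl x"] dx by simp
        have "sg (x - k) = ct (dl x) (x - k)" using ct_D[OF dx(1)] Y_range(2)[OF dx(1)] Yd by (simp add: sg_def)
        moreover have "sg (x + dl x) = ct (dl x) (x + dl x)"
        proof -
          have "db < dl x" using dl_less[of b x] dl_b xb b1 by auto
          then have "U b < Ut (dl x)" using Ut_less[of db "dl x"] dx Ut_db db1 by simp
          moreover have "Ut (dl x) \<in> {U b..2}" using dx unfolding Ut_image[symmetric] by blast
          ultimately have "sg (Ut (dl x)) = \<psi>t (dl x)" using iU[OF dx(1)] by (simp add: sg_def)
          then show ?thesis using dx by (simp add: \<psi>t_def Ut_def)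
        qed
        ultimately show "pg x + sg (snd p) + tt x * (snd p - x) = hinge s (snd p - x)"
          using yv unfolding right(2)[OF xb(1)] Dc_ge[OF xb(2)] Uc_ge[OF xb(2)] by (elim disjE) (simp_all only:)
      qed
    qed
  qed
qed

end

theorem (in curtain) V_curtain:
  assumes "0 \<le> q0" "q0 \<le> 1" "C1_convex_derivative h"
  shows "V k h = ereal (cost h (tg Dc Uc (qc q0)))"
proof (rule V_eq[OF coupling_c(1)[OF assms(1,2)] _ assms(3)])
  fix s \<pi> assume "s \<noteq> (0::real)" "\<pi> \<in> couplings k"
  then interpret hinge_dual k db s by unfold_locales
  show "cost (hinge s) (tg Dc Uc (qc q0)) \<le> cost (hinge s) \<pi>"
    by (rule hinge_optimal) fact+
qed

section \<open>Scalar equations and the explicit constructions\<close>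

text \<open>The cubic bound for the logarithm gives \<open>z1 k 0 < - 1 / k\<close>, and
  \<open>- 1 / k \<le> k - 2\<close> is \<open>(k - 1)\<^sup>2 \<ge> 0\<close>.\<close>

lemma delta_b_less:
  assumes "1 < k" shows "z1 k 0 < k - 2"
proof -
  have "ln ((k - 1) / k) = ln (1 + - (1 / k))" using assms by (simp add: field_simps)
  also have "\<dots> \<le> - (1 / k) - (- (1 / k))\<^sup>2 / 2 + (- (1 / k)) ^ 3 / 3"
    using assms by (intro ln_add_one_le_cubic) simp
  also have "\<dots> < - (1 / k) - (1 / k)\<^sup>2 / 2" using assms by (simp add: power3_eq_cube)
  finally have "2 * k * ln ((k - 1) / k) < 2 * k * (- (1 / k) - (1 / k)\<^sup>2 / 2)" using assms by (intro mult_strict_left_mono) auto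
  also have "\<dots> = - 2 - 1 / k" using assms by (simp add: field_simps power2_eq_square)
  finally have 1: "z1 k 0 < - 1 / k" by (simp add: z1_def)
  have "0 \<le> (k - 1)\<^sup>2 / k" using assms by simp
  also have "\<dots> = k - 2 + 1 / k" using assms by (simp add: field_simps power2_eq_square)
  finally show ?thesis using 1 by simp
qed

lemma z1_continuous: "1 < k \<Longrightarrow> continuous_on {0..1} (z1 k)"
  by (rule DERIV_continuous_on[where D = "\<lambda>e. (k + e) / (k - e)"], rule has_field_derivative_at_within[OF DERIV_z1]) auto

lemma delta_b_ex1:
  assumes k: "1 < k" "k < 3" shows "\<exists>!\<delta>. is_delta_b k \<delta>"
proof -
  have "\<exists>x\<ge>0. x \<le> 1 \<and> z1 k x = k - 2"
    using delta_b_less[OF k(1)] z1_1[OF k(1)] k by (intro IVT' z1_continuous) auto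
  then obtain x where x: "0 \<le> x" "x \<le> 1" "z1 k x = k - 2" by blast
  have "x \<noteq> 0" "x \<noteq> 1" using x delta_b_less[OF k(1)] z1_1[OF k(1)] k by auto
  then have "is_delta_b k x" using x by (auto simp: is_delta_b_def)
  moreover have "y = x" if "is_delta_b k y" for y
    using that x z1_slope_strict[OF k(1), of x y] z1_slope_strict[OF k(1), of y x] k
    by (cases x y rule: linorder_cases) (auto simp: is_delta_b_def)
  ultimately show ?thesis by blast
qed

lemma delta_b:
  assumes "1 < k" "k < 3" shows "is_delta_b k (delta_b k)"
  unfolding delta_b_def by (rule theI'[OF delta_b_ex1[OF assms]])

lemma curtain_delta_b:
  assumes k: "1 < k" "k < 3" shows "curtain k (delta_b k)"
proof
  note d = delta_b[OF k, unfolded is_delta_b_def]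
  show "1 < k" "k \<le> 3" "0 < delta_b k" "delta_b k \<le> 1" "z1 k (delta_b k) = k - 2" using k d by auto
  show "1 < delta_b k + 2 * (k - 1)"
  proof (rule ccontr)
    assume "\<not> 1 < delta_b k + 2 * (k - 1)"
    then have le: "delta_b k \<le> 3 - 2 * k" by simp
    \<comment> \<open>At \<open>3 - 2 * k\<close> the logarithm equals
      \<open>- ln 3 \<le> -1\<close>, so \<open>z1\<close> is at most \<open>-1\<close> there, which
      is below \<open>k - 2\<close>.\<close>
    have "z1 k (delta_b k) \<le> z1 k (3 - 2 * k)"
      using z1_slope[OF k(1), of "delta_b k" "3 - 2 * k"] d le k by auto
    also have "\<dots> = 2 * k - 1 + 2 * k * ln ((k - 1) / (3 * (k - 1)))" by (simp add: z1_def)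
    also have "(k - 1) / (3 * (k - 1)) = 1 / 3" using k by simp
    also have "ln (1 / 3 :: real) = - ln 3" by (simp add: ln_div)
    also have "2 * k - 1 + 2 * k * - ln 3 \<le> 2 * k - 1 + 2 * k * - 1"
    proof -
      have "1 \<le> ln (3::real)" using exp_le by (subst ln_ge_iff) auto
      then show ?thesis using k by (intro add_left_mono mult_left_mono) auto
    qed
    finally show False using d k by simp
  qed
qed

context curtain
begin

lemma L_surj:
  assumes "\<delta> \<in> {db..es}" obtains x where "x \<in> {-1..b}" "L x = \<delta>"
proof -
  have "\<exists>x\<ge>-1. x \<le> b \<and> L x = \<delta>"
    using assms L_m1 L_b b1 L_continuous by (intro IVT2') auto
  then show ?thesis using that by auto
qed

text \<open>Where the filled interval straddles coordinate \<open>1\<close>, the parameter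
  \<open>\<delta>\<close> of Construction I is \<open>L x\<close>.\<close>

lemma late:
  assumes x: "x \<in> {-1..b}" "L x \<le> 1" "1 \<le> R x"
  shows "WW1 k (L x) = (u x)\<^sup>2" "W1 k (L x) = u x" "xpar1 k (L x) = x" "D x = z1 k (L x) - k" "U x = b - L x + 2 * u x"
proof -
  have "(u x)\<^sup>2 = k\<^sup>2 - 4 * (k - L x) + 2 * k * (k - L x) * ln ((k - L x) / (k - 1))"
    using mid(1)[of x] x by auto
  then show W: "WW1 k (L x) = (u x)\<^sup>2" by (simp add: WW1_def Let_def power2_eq_square algebra_simps)
  then show W1: "W1 k (L x) = u x" using U_ge[of x] x by (simp add: W1_def)
  have u: "u x = L x - (b - x)" by (rule u_eq) (use x in simp)
  then show "xpar1 k (L x) = x" unfolding xpar1_def W1 by linarith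
  show "D x = z1 k (L x) - k" using x by (simp add: D_def yc_def y1_def)
  obtain c where c: "u x = c" by blast
  then have "U x = x + c" "x = c - L x + b" using u by linarith+
  then show "U x = b - L x + 2 * u x" unfolding c by linarith
qed

text \<open>\<open>x0\<close> will be the left end of that stretch: the source with
  \<open>R x0 = 1\<close> in Construction I, with \<open>L x0 = 1\<close> in Construction
  II.\<close>

lemma xpar1_bij:
  assumes x0: "x0 \<in> {-1..b}" "1 \<le> R x0" "L x0 \<le> 1"
  shows "decreasing_bijection (xpar1 k) {db..L x0} {x0..b}"
    and "\<And>\<delta>. \<delta> \<in> {db..L x0} \<Longrightarrow> \<exists>x\<in>{x0..b}. L x = \<delta> \<and> L x \<le> 1 \<and> 1 \<le> R x \<and> xpar1 k \<delta> = x"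
proof -
  have ex: "\<exists>x\<in>{x0..b}. L x = \<delta> \<and> L x \<le> 1 \<and> 1 \<le> R x \<and> xpar1 k \<delta> = x" if d: "\<delta> \<in> {db..L x0}" for \<delta>
  proof -
    obtain x where x: "x \<in> {-1..b}" "L x = \<delta>" using L_surj[of \<delta>] d L_le_es[of x0] x0 by auto
    have "x0 \<le> x" using L_dec[of x x0] x x0 d by (cases "x0 \<le> x") auto
    moreover have "1 \<le> R x" using R_inc[of x0 x] \<open>x0 \<le> x\<close> x x0 by (cases "x = x0") auto
    ultimately show ?thesis using late(3)[of x] x d x0 by (intro bexI[of _ x]) auto
  qed
  then show "\<And>\<delta>. \<delta> \<in> {db..L x0} \<Longrightarrow> \<exists>x\<in>{x0..b}. L x = \<delta> \<and> L x \<le> 1 \<and> 1 \<le> R x \<and> xpar1 k \<delta> = x" .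
  have mono: "monotone_on {db..L x0} (<) (>) (xpar1 k)"
  proof (rule monotone_onI)
    fix a c assume a: "a \<in> {db..L x0}" "c \<in> {db..L x0}" "a < c"
    obtain x y where xy: "x \<in> {x0..b}" "L x = a" "xpar1 k a = x" "y \<in> {x0..b}" "L y = c" "xpar1 k c = y"
      using ex[OF a(1)] ex[OF a(2)] by blast
    show "xpar1 k c < xpar1 k a"
      using L_dec[of x y] xy a(3) x0 by (cases x y rule: linorder_cases) auto
  qed
  have bij: "bij_betw (xpar1 k) {db..L x0} {x0..b}"
  proof (rule bij_betw_byWitness[where f' = L])
    show "\<forall>a\<in>{db..L x0}. L (xpar1 k a) = a" using ex by blast
    have Lx: "L x \<in> {db..L x0}" "R x \<ge> 1" if "x \<in> {x0..b}" for x
      using that x0 L_dec[of x0 x] R_inc[of x0 x] L_eq(1)[of x] by (cases "x = x0"; auto)+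
    show "\<forall>x\<in>{x0..b}. xpar1 k (L x) = x" using late(3) Lx x0 by force
    show "xpar1 k ` {db..L x0} \<subseteq> {x0..b}" using ex by force
    show "L ` {x0..b} \<subseteq> {db..L x0}" using Lx by auto
  qed
  show "decreasing_bijection (xpar1 k) {db..L x0} {x0..b}" using mono bij by (simp add: decreasing_bijection_def)
qed

lemma z1_strict: "strict_mono_on {0..1} (z1 k)"
  by (rule strict_mono_onI) (use k1 in \<open>auto intro!: z1_slope_strict\<close>)

lemma z1_bij: "increasing_bijection (z1 k) {db..1} {b..1}"
  using z1_inj z1_image db0 monotone_on_subset[OF z1_strict, of "{db..1}"]
  by (auto simp: increasing_bijection_def bij_betw_def)

lemma Dc_anti: "monotone_on {-1..b} (<) (>) Dc"
  by (rule monotone_onI) (use D_dec Dc_le in auto)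

lemma Uc_mono: "strict_mono_on {-1..1} Uc"
proof (rule strict_mono_onI)
  fix x y :: real assume xy: "x \<in> {-1..1}" "y \<in> {-1..1}" "x < y"
  have l: "Uc x < Uc y" if "x \<in> {-1..b}" "y \<in> {-1..b}" "x < y" for x y
    using that U_inc by (simp add: Uc_le)
  have r: "Uc x < Uc y" if "x \<in> {b..1}" "y \<in> {b..1}" "x < y" for x y
    using that dl_less[of x y] by (simp add: Uc_ge)
  consider "y \<le> b" | "b \<le> x" | "x < b" "b < y" by linarith
  then show "Uc x < Uc y"
  proof cases
    case 1 then show ?thesis using l[of x y] xy by auto
  next
    case 2 then show ?thesis using r[of x y] xy by auto
  next
    case 3 then show ?thesis using l[of x b] r[of b y] xy b1 by auto
  qed
qed

lemma weights: "curtain_weights Dc Uc (qc (1/2))"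
proof -
  have "qc (1/2) (-1) = 1/2" using k1 by (simp add: qc_def)
  then show ?thesis by (simp add: curtain_weights_def qc_eq)
qed

text \<open>Beyond coordinate \<open>1\<close> the free part is \<open>nu\<close> itself. For
  \<open>k \<ge> 2\<close> the intervals start at \<open>es = k - 1 \<ge> 1\<close> and stay there
  up to \<open>x = 2 * k - 5\<close>, so the equations are those of the unconstrained
  problem.\<close>

lemma left_curtain:
  assumes k2: "2 \<le> k" and x: "x \<in> {-1..2 * k - 5}"
  shows "L x = k - (x + 3) / 2" "Dc x = D_lc x" "Uc x = U_lc x"
proof -
  have xb: "x \<in> {-1..b}" using x k3 by auto
  have es1: "es = k - 1"
    using yc_less[of k es "k - 1"] yc_less[of k "k - 1" es] Y_ge1[of "k - 1"] es k1 db0 k2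
    by (cases es "k - 1" rule: linorder_cases) auto
  show L: "L x = k - (x + 3) / 2"
  proof (cases "x = -1")
    case True then show ?thesis using L_m1 es1 by simp
  next
    case False
    have r: "k - (x + 3) / 2 + 2 * (x + 1) = k + (3 * x + 1) / 2" by (simp add: field_simps)
    have Ae: "A e = A1 k 1 + ((e - k)\<^sup>2 - (1 - k)\<^sup>2) / 2" if "1 \<le> e" for e using that by (cases "e = 1") (auto simp: ac_def)
    have sq: "(k + c - k)\<^sup>2 = c\<^sup>2" "(k - c - k)\<^sup>2 = c\<^sup>2" for c by (simp_all add: power2_eq_square)
    have ge: "1 \<le> k + (3 * x + 1) / 2" "1 \<le> k - (x + 3) / 2" using x k2 by (auto simp: field_simps)
    note Ae[OF ge(1), unfolded sq] Ae[OF ge(2), unfolded sq]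
    then have "F x (k - (x + 3) / 2) = ((3 * x + 1) / 2)\<^sup>2 / 2 - ((x + 3) / 2)\<^sup>2 / 2"
      unfolding F_def r by (simp only: diff_divide_distrib)
    also have "\<dots> = x\<^sup>2 - 1" by (simp add: power2_eq_square field_simps)
    finally have "F x (k - (x + 3) / 2) = x\<^sup>2 - 1" .
    moreover have "db \<le> k - (x + 3) / 2" using ge(2) db1 by linarith
    ultimately have "k - (x + 3) / 2 = L x" by (intro L_unique) (use False xb in auto)
    then show ?thesis by (rule sym)
  qed
  have "1 \<le> L x" "1 \<le> R x" using L x k2 by (auto simp: R_def field_simps)
  then have "D x = L x - k" "U x = R x - k" by (simp_all add: Y_ge1 D_def U_def)
  then have "D x = - x/2 - 3/2" "U x = 3*x/2 + 1/2" unfolding R_def L by (simp_all add: field_simps)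
  then show "Dc x = D_lc x" "Uc x = U_lc x" using xb by (simp_all add: Dc_le Uc_le D_lc_def U_lc_def)
qed

end

text \<open>As \<open>T1 k 1 = 0\<close> too, the mean value theorem yields two zeros of the
  derivative \<open>- y1 k e - (1 + e) / 2\<close>, which is strictly decreasing.\<close>

lemma T1_three_zeros:
  assumes k: "1 < k" and ab: "0 \<le> a" "a < c" "c < 1" and z: "T1 k a = 0" "T1 k c = 0"
  shows False
proof -
  have d: "(T1 k has_real_derivative - y1 k e - (1 + e) / 2) (at e)" if "e \<le> 1" for e
    unfolding T1_def using that k
    by (auto intro!: derivative_eq_intros DERIV_A1 simp: power2_eq_square field_simps)
  have "\<exists>s>a. s < c \<and> T1 k c - T1 k a = (c - a) * (- y1 k s - (1 + s) / 2)"
    by (rule MVT2) (use ab in \<open>auto intro: d\<close>)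
  then obtain s where s: "a < s" "s < c" "- y1 k s - (1 + s) / 2 = 0" using z ab by auto
  have "\<exists>s>c. s < 1 \<and> T1 k 1 - T1 k c = (1 - c) * (- y1 k s - (1 + s) / 2)"
    by (rule MVT2) (use ab in \<open>auto intro: d\<close>)
  then obtain r where r: "c < r" "r < 1" "- y1 k r - (1 + r) / 2 = 0" using z ab by (auto simp: T1_def)
  have "z1 k s < z1 k r" by (rule z1_slope_strict) (use k s r ab in auto)
  then show False using s r by (simp add: y1_def)
qed

lemma construction_I_facts:
  assumes k: "1 < k" "k < 2"
  shows "\<exists>!\<delta>. is_delta_0 k \<delta>" "construction_I k (curtain.Dc k (delta_b k)) (curtain.Uc k (delta_b k))"
    "\<forall>x\<in>{-1<..x_0 k}. \<exists>!p. is_LR k x (fst p) (snd p)" "well_posed_I k"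
proof -
  define db where "db = delta_b k"
  interpret curtain k db unfolding db_def by (rule curtain_delta_b) (use k in auto)
  have es1: "es < 1"
    using yc_le[of k 1 es] es k by (cases "es < 1") (auto simp: Y_ge1)
  \<comment> \<open>This is the source at which the filled interval reaches coordinate
    \<open>1\<close>. There \<open>R x0 = 1\<close> gives \<open>x0 = - (1 + d0) / 2\<close>, and
    the moment equation becomes \<open>T1 k d0 = 0\<close>.\<close>
  have "\<exists>x\<ge>-1. x \<le> b \<and> R x = 1" using R_continuous L_m1 R_b(2) es1 b1 by (intro IVT') auto
  then obtain x0 where x0: "-1 \<le> x0" "x0 \<le> b" "R x0 = 1" by blast
  have x01: "-1 < x0" "x0 < b" using x0 L_m1 R_b(2) es1 by (auto simp: order.strict_iff_order)
  define d0 where "d0 = L x0"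
  have d0: "db < d0" "d0 < 1" "x0 = - (1 + d0) / 2"
    using L_dec[of x0 b] x01 L_b LR(2)[of x0] x0 by (auto simp: d0_def R_def)
  have "A1 k 1 - A1 k d0 = x0\<^sup>2 - 1"
    using AR[of x0] x0 d0(2) by (simp add: ac_def d0_def[symmetric])
  moreover have "x0\<^sup>2 = (1 + d0)\<^sup>2 / 4" unfolding d0(3) by (simp add: power2_eq_square algebra_simps)
  ultimately have "T1 k d0 = 0" by (simp add: T1_def)
  then have id0: "is_delta_0 k d0" using d0 by (simp add: is_delta_0_def db_def)
  have uniq: "\<delta> = d0" if "is_delta_0 k \<delta>" for \<delta>
    using that id0 T1_three_zeros[OF k(1), of \<delta> d0] T1_three_zeros[OF k(1), of d0 \<delta>] db0
    unfolding is_delta_0_def db_def[symmetric] by (cases \<delta> d0 rule: linorder_cases) auto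
  show "\<exists>!\<delta>. is_delta_0 k \<delta>" using id0 uniq by blast
  have delta0: "delta_0 k = d0" unfolding delta_0_def using id0 uniq by (rule the_equality)
  have x_0: "x_0 k = x0" using d0 by (simp add: x_0_def delta0)
  have LRiff: "is_LR k x l r \<longleftrightarrow> l = L x \<and> r = R x" if x: "x \<in> {-1<..x0}" for x l r
  proof
    assume lr: "is_LR k x l r"
    then have "F x l = x\<^sup>2 - 1" unfolding F_def is_LR_def by (auto simp: ac_def algebra_simps)
    then have "l = L x" using L_unique[of x l] lr x x0 by (auto simp: is_LR_def db_def)
    then show "l = L x \<and> r = R x" using lr by (auto simp: is_LR_def R_def)
  next
    assume "l = L x \<and> r = R x"
    moreover have "R x \<le> 1" using R_inc[of x x0] x x0 by (cases "x = x0") auto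
    moreover have "L x < R x" "db \<le> L x" "A (R x) - A (L x) = x\<^sup>2 - 1" using LR(2) L_eq(1) AR x x0 by auto
    ultimately show "is_LR k x l r" by (auto simp: is_LR_def R_def ac_def db_def[symmetric])
  qed
  show "\<forall>x\<in>{-1<..x_0 k}. \<exists>!p. is_LR k x (fst p) (snd p)"
  proof
    fix x assume "x \<in> {-1<..x_0 k}"
    then show "\<exists>!p. is_LR k x (fst p) (snd p)" using LRiff[of x] by (intro ex1I[of _ "(L x, R x)"]) (auto simp: x_0 prod_eq_iff)
  qed
  note bij = xpar1_bij[of x0, folded d0_def]
  have xin: "x0 \<in> {-1..b}" "1 \<le> R x0" "d0 \<le> 1" using x0 d0(1,2) by auto
  show "construction_I k (curtain.Dc k (delta_b k)) (curtain.Uc k (delta_b k))"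
    unfolding construction_I_def db_def[symmetric] delta0 x_0
  proof (intro conjI ballI allI impI)
    show "Dc (-1) = -1" "Uc (-1) = -1" by (rule Dc_m1 Uc_m1)+
  next
    fix x l r assume x: "x \<in> {-1<..x0}" and lr: "is_LR k x l r"
    then have "l = L x \<and> r = R x" using LRiff[OF x] by blast
    moreover have "l \<le> 1" "r \<le> 1" using lr by (auto simp: is_LR_def)
    ultimately show "Dc x = y1 k l" "Uc x = y1 k r" using x x0 by (auto simp: Dc_le Uc_le D_def U_def yc_def)
  next
    fix \<delta> assume "\<delta> \<in> {db..d0}"
    then obtain x where x: "x \<in> {x0..b}" "L x = \<delta>" "L x \<le> 1" "1 \<le> R x" "xpar1 k \<delta> = x" using bij(2)[OF xin] by blast
    then have xb: "x \<in> {-1..b}" using x0 by auto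
    show "Dc (xpar1 k \<delta>) = z1 k \<delta> - k" "Uc (xpar1 k \<delta>) = k - 2 - \<delta> + 2 * W1 k \<delta>"
      using late(2,4,5)[OF xb x(3,4)] xb x by (simp_all add: Dc_le Uc_le)
  next
    fix \<delta> assume d: "\<delta> \<in> {db..1}"
    then have "z1 k \<delta> \<in> {b..1}" unfolding z1_image[symmetric] by blast
    then show "Dc (z1 k \<delta>) = z1 k \<delta> - k" "Uc (z1 k \<delta>) = z1 k \<delta> + \<delta>"
      using Dc_ge Uc_ge dl_z1[OF d] by simp_all
  qed
  show "well_posed_I k"
    unfolding well_posed_I_def db_def[symmetric] delta0 x_0
  proof (intro conjI ballI)
    fix \<delta> assume "\<delta> \<in> {db..d0}"
    then obtain x where x: "x \<in> {x0..b}" "L x = \<delta>" "L x \<le> 1" "1 \<le> R x" using bij(2)[OF xin] by blast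
    then show "0 < WW1 k \<delta>" using late(1)[of x] uv_pos(1)[of x] x01 x0 by auto
  qed (use z1_strict z1_1[OF k1] bij(1)[OF xin] z1_bij in auto)
qed

lemma construction_II_facts:
  assumes k: "2 \<le> k" "k < 3"
  shows "construction_II k (curtain.Dc k (delta_b k)) (curtain.Uc k (delta_b k))" "well_posed_II k"
proof -
  define db where "db = delta_b k"
  have k': "1 < k" using k by simp
  interpret curtain k db unfolding db_def by (rule curtain_delta_b) (use k in auto)
  have dbd: "is_delta_b k db" using delta_b[of k] k by (simp add: db_def)
  \<comment> \<open>\<open>\<eta>\<close> is the upper target
    \<open>z1 k \<delta> + \<delta>\<close> of the right part, and \<open>E2 k \<eta>\<close> is
    \<open>k - \<delta>\<close>. This change of parameter carries the curves of Construction I into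
    those of Construction II.\<close>
  define de where "de \<eta> = k - E2 k \<eta>" for \<eta>
  define ee where "ee \<delta> = z1 k \<delta> + \<delta>" for \<delta>
  have E0: "0 < E2 k \<eta>" for \<eta> using k by (simp add: E2_def)
  have ee_de: "ee (de \<eta>) = \<eta>" for \<eta>
  proof -
    have "(k - 1) / (k - de \<eta>) = exp (- ((2 - \<eta>) / (2 * k)))" using k by (simp add: de_def E2_def exp_minus field_simps)
    then have "ln ((k - 1) / (k - de \<eta>)) = - ((2 - \<eta>) / (2 * k))" by simp
    then show ?thesis using k by (simp add: ee_def z1_def)
  qed
  have de_ee: "de (ee \<delta>) = \<delta>" if "\<delta> \<le> 1" for \<delta>
  proof -
    have "(2 - ee \<delta>) / (2 * k) = - ln ((k - 1) / (k - \<delta>))" using k by (simp add: ee_def z1_def)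
    also have "\<dots> = ln ((k - \<delta>) / (k - 1))" using k that by (simp add: ln_div)
    finally have "exp ((2 - ee \<delta>) / (2 * k)) = (k - \<delta>) / (k - 1)" using k that by simp
    then show ?thesis using k by (simp add: de_def E2_def)
  qed
  have rho: "rho2 k \<eta> = z1 k (de \<eta>)" for \<eta> using ee_de[of \<eta>] by (simp add: rho2_def de_def ee_def)
  have de_mono: "de \<eta> < de \<eta>'" if "\<eta> < \<eta>'" for \<eta> \<eta>'
    using that k by (simp add: de_def E2_def divide_strict_right_mono)
  have de2: "de 2 = 1" by (simp add: de_def E2_def)
  define e0 where "e0 = b + db"
  have e0: "ee db = e0" "de e0 = db" "e0 < 2" "b < e0"
    using zdb de_ee[of db] db1 db0 dbd k by (auto simp: e0_def ee_def is_delta_b_def)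
  have eb: "is_eta_b k \<eta> \<longleftrightarrow> \<eta> = e0" for \<eta>
  proof
    assume h: "is_eta_b k \<eta>"
    then have z: "z1 k (de \<eta>) = b" and r: "b < \<eta>" "\<eta> < 2" by (auto simp: is_eta_b_def rho)
    have "de \<eta> < 1" using de_mono[OF r(2)] de2 by simp
    moreover have "0 < de \<eta>" using ee_de[of \<eta>] z r by (simp add: ee_def)
    ultimately have "is_delta_b k (de \<eta>)" using z by (simp add: is_delta_b_def)
    then have "de \<eta> = db" using dbd delta_b_ex1[OF k' k(2)] by blast
    then show "\<eta> = e0" using ee_de[of \<eta>] e0 by simp
  qed (use e0 zdb in \<open>simp add: is_eta_b_def rho\<close>)
  have etab: "eta_b k = e0" unfolding eta_b_def eb by simp
  have de_in: "de \<eta> \<in> {db..1}" if "\<eta> \<in> {e0..2}" for \<eta>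
    using de_mono[of e0 \<eta>] de_mono[of \<eta> 2] that e0 de2 by (cases "\<eta> = e0"; cases "\<eta> = 2") auto
  have bij_de: "bij_betw de {e0..2} {db..1}"
  proof (rule bij_betw_byWitness[where f' = ee])
    show "\<forall>a\<in>{e0..2}. ee (de a) = a" "\<forall>a\<in>{db..1}. de (ee a) = a" "de ` {e0..2} \<subseteq> {db..1}"
      using ee_de de_ee de_in by auto
    have z: "z1 k db \<le> z1 k x \<and> z1 k x \<le> z1 k 1" if "x \<in> {db..1}" for x
      using z1_slope[OF k1, of db x] z1_slope[OF k1, of x 1] that db0 k by auto
    show "ee ` {db..1} \<subseteq> {e0..2}" using z z1_1[OF k1] zdb by (auto simp: ee_def e0_def) force+
  qed
  define x0 where "x0 = 2 * k - 5"
  have x0b: "x0 \<in> {-1..b}" "x0 \<in> {-1..2 * k - 5}" using k by (auto simp: x0_def)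
  have L0: "L x0 = 1" using left_curtain(1)[OF k(1) x0b(2)] by (simp add: x0_def field_simps)
  have R0: "1 \<le> R x0" using L0 x0b by (simp add: R_def)
  note bij = xpar1_bij[OF x0b(1) R0, unfolded L0, OF order_refl]
  have sq: "k\<^sup>2 - (\<eta> + 2) * E2 k \<eta> = WW1 k (de \<eta>)" for \<eta>
  proof -
    have E: "E2 k \<eta> = k - de \<eta>" by (simp add: de_def)
    have "ln ((k - de \<eta>) / (k - 1)) = (2 - \<eta>) / (2 * k)" unfolding E[symmetric] using k by (simp add: E2_def)
    then have "2 * k * ln ((k - de \<eta>) / (k - 1)) = 2 - \<eta>" using k by simp
    moreover have "2 * k * ((k - de \<eta>) * w + de \<eta> - 1) = (k - de \<eta>) * (2 * k * w) + 2 * k * (de \<eta> - 1)" for w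
      by (simp add: algebra_simps)
    ultimately have "2 * k * ((k - de \<eta>) * ln ((k - de \<eta>) / (k - 1)) + de \<eta> - 1) = (k - de \<eta>) * (2 - \<eta>) + 2 * k * (de \<eta> - 1)"
      by (simp only:)
    then show ?thesis unfolding WW1_def Let_def E by (simp add: power2_eq_square algebra_simps)
  qed
  have xp: "xpar2 k \<eta> = xpar1 k (de \<eta>)" for \<eta>
    unfolding xpar2_def xpar1_def R2_def W1_def sq by (simp add: de_def)
  have R2W: "R2 k \<eta> = W1 k (de \<eta>)" for \<eta> by (simp add: R2_def W1_def sq)
  show "well_posed_II k"
    unfolding well_posed_II_def etab
  proof (intro conjI ballI)
    show "\<exists>!\<eta>. is_eta_b k \<eta>" by (simp add: eb)
    fix \<eta> assume "\<eta> \<in> {e0..2}"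
    then obtain x where x: "x \<in> {x0..b}" "L x = de \<eta>" "L x \<le> 1" "1 \<le> R x" using bij(2)[OF de_in] by blast
    then have "WW1 k (de \<eta>) = (u x)\<^sup>2" using late(1)[of x] x0b by auto
    then show "0 \<le> k\<^sup>2 - (\<eta> + 2) * E2 k \<eta>" by (simp add: sq)
  next
    have "monotone_on {e0..2} (<) (>) (\<lambda>\<eta>. xpar1 k (de \<eta>))"
    proof (rule monotone_onI)
      fix x y assume "x \<in> {e0..2}" "y \<in> {e0..2}" "x < y"
      then show "xpar1 k (de x) > xpar1 k (de y)"
        using bij(1) de_mono[of x y] de_in[of x] de_in[of y] unfolding decreasing_bijection_def monotone_on_def by blast
    qed
    moreover have "bij_betw (\<lambda>\<eta>. xpar1 k (de \<eta>)) {e0..2} {x0..b}"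
      using bij_betw_trans[OF bij_de, of "xpar1 k"] bij(1) by (simp add: decreasing_bijection_def o_def)
    ultimately show "decreasing_bijection (xpar2 k) {e0..2} {2 * k - 5..k - 2}"
      by (simp add: decreasing_bijection_def xp[abs_def] x0_def)
  next
    have "strict_mono_on {e0..2} (\<lambda>\<eta>. z1 k (de \<eta>))"
    proof (rule strict_mono_onI)
      fix x y assume "x \<in> {e0..2}" "y \<in> {e0..2}" "x < y"
      then show "z1 k (de x) < z1 k (de y)"
        using z1_slope_strict[OF k1, of "de x" "de y"] de_mono[of x y] de_in[of x] de_in[of y] db0 k by auto
    qed
    moreover have "bij_betw (\<lambda>\<eta>. z1 k (de \<eta>)) {e0..2} {b..1}"
      using bij_betw_trans[OF bij_de, of "z1 k"] z1_bij by (simp add: increasing_bijection_def o_def)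
    ultimately show "increasing_bijection (rho2 k) {e0..2} {k - 2..1}"
      by (simp add: increasing_bijection_def rho[abs_def])
  qed
  show "construction_II k (curtain.Dc k (delta_b k)) (curtain.Uc k (delta_b k))"
    unfolding construction_II_def etab db_def[symmetric]
  proof (intro conjI ballI)
    fix x assume "x \<in> {-1..2 * k - 5}"
    then show "Dc x = D_lc x" "Uc x = U_lc x" using left_curtain(2,3)[OF k(1)] by auto
  next
    fix \<eta> assume "\<eta> \<in> {e0..2}"
    then obtain x where x: "x \<in> {x0..b}" "L x = de \<eta>" "L x \<le> 1" "1 \<le> R x" "xpar1 k (de \<eta>) = x" using bij(2)[OF de_in] by blast
    then have xb: "x \<in> {-1..b}" using x0b by auto
    have E: "E2 k \<eta> = k - de \<eta>" by (simp add: de_def)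
    have "z1 k (de \<eta>) + de \<eta> = \<eta>" using ee_de[of \<eta>] by (simp add: ee_def)
    then show "Dc (xpar2 k \<eta>) = E2 k \<eta> + \<eta> - 2 * k" "Uc (xpar2 k \<eta>) = E2 k \<eta> - 2 + 2 * R2 k \<eta>"
      unfolding xp x(5) R2W E using late(2,4,5)[OF xb x(3,4)] xb x(2) by (simp_all add: Dc_le Uc_le)
  next
    fix \<eta> assume "\<eta> \<in> {e0..2}"
    note d = de_in[OF this]
    then have "z1 k (de \<eta>) \<in> {b..1}" unfolding z1_image[symmetric] by blast
    then show "Dc (rho2 k \<eta>) = rho2 k \<eta> - k" "Uc (rho2 k \<eta>) = \<eta>"
      unfolding rho using Dc_ge Uc_ge dl_z1[OF d] ee_de[of \<eta>] by (simp_all add: ee_def)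
  qed
qed

theorem theorem2p1:
  shows "(\<forall>k>0. couplings k \<noteq> {} \<longleftrightarrow> k \<ge> 1) \<and>
    (\<forall>k\<ge>1. \<exists>\<pi> D U q.
       \<pi> \<in> couplings k \<and> two_graph D U q \<pi> \<and>
       (\<forall>h. C1_convex_derivative h \<longrightarrow> V k h = ereal (cost h \<pi>)) \<and>
       (k = 1 \<longrightarrow>
          (\<forall>x\<in>{-1..1}. D x = x - 1 \<and> U x = x + 1 \<and> q x = 1/2) \<and>
          (\<forall>h. C1_convex_derivative h \<longrightarrow> V 1 h = ereal ((h (-1) + h 1) / 2))) \<and>
       (1 < k \<and> k < 2 \<longrightarrow>
          construction_I k D U \<and> curtain_weights D U q \<and>
          (\<exists>!\<delta>. is_delta_b k \<delta>) \<and>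
          (\<exists>!\<delta>. is_delta_0 k \<delta>) \<and>
          (\<forall>x\<in>{-1<..x_0 k}. \<exists>!p. is_LR k x (fst p) (snd p)) \<and>
          well_posed_I k) \<and>
       (2 \<le> k \<and> k < 3 \<longrightarrow>
          construction_II k D U \<and> curtain_weights D U q \<and>
          (\<forall>x\<in>{-1..2*k - 5}. D x = D_lc x \<and> U x = U_lc x) \<and>
          well_posed_II k) \<and>
       (k \<ge> 3 \<longrightarrow>
          (\<forall>x\<in>{-1..1}. D x = D_lc x \<and> U x = U_lc x \<and> q x = 3/4)) \<and>
       (1 < k \<and> k < 3 \<longrightarrow>
          monotone_on {-1..k - 2} (<) (>) D \<and>
          (\<forall>x\<in>{k - 2..1}. D x = x - k) \<and>
          strict_mono_on {-1..1} U))"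
    (is "?A \<and> (\<forall>k\<ge>1. \<exists>\<pi> D U q. ?P k \<pi> D U q)")
proof -
  have ?A
    using couplings_empty mono_couplings coupling_1(1) by (metis empty_iff not_le)
  moreover have "\<exists>\<pi> D U q. ?P k \<pi> D U q" if k1: "1 \<le> k" for k
  proof -
    consider "k = 1" | "1 < k" "k < 3" | "3 \<le> k" using k1 by linarith
    then show ?thesis
    proof cases
      case 1
      have *: "?P 1 (tg (\<lambda>x. x - 1) (\<lambda>x. x + 1) (\<lambda>_. 1/2)) (\<lambda>x. x - 1) (\<lambda>x. x + 1) (\<lambda>_. 1/2)"
        using coupling_1(1,2) V_1 by simp
      show ?thesis unfolding 1 
        by (rule exI[where x = "tg (\<lambda>x. x - 1) (\<lambda>x. x + 1) (\<lambda>_. 1/2)"], rule exI[where x = "\<lambda>x. x - 1"], rule exI[where x = "\<lambda>x. x + 1"], rule exI[where x = "\<lambda>_. 1/2"], rule *)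
    next
      case 2
      interpret curtain k "delta_b k" by (rule curtain_delta_b[OF 2])
      have "tg Dc Uc (qc (1/2)) \<in> couplings k" "two_graph Dc Uc (qc (1/2)) (tg Dc Uc (qc (1/2)))"
        "\<forall>h. C1_convex_derivative h \<longrightarrow> V k h = ereal (cost h (tg Dc Uc (qc (1/2))))"
        using coupling_c(1,2)[of "1/2"] V_curtain[of "1/2"] by simp_all
      moreover have "k \<noteq> 1" "\<not> 3 \<le> k" using 2 by auto
      moreover have "\<forall>x\<in>{k - 2..1}. Dc x = x - k" using Dc_ge by blast
      moreover have "\<forall>x\<in>{-1..2*k - 5}. Dc x = D_lc x \<and> Uc x = U_lc x" if "2 \<le> k" using left_curtain(2,3)[OF that] by blast
      ultimately have *: "?P k (tg Dc Uc (qc (1/2))) Dc Uc (qc (1/2))"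
        using weights delta_b_ex1[OF 2] construction_I_facts[OF 2(1)] construction_II_facts[OF _ 2(2)] Dc_anti Uc_mono by blast
      show ?thesis 
        by (rule exI[where x = "tg Dc Uc (qc (1/2))"], rule exI[where x = "Dc"], rule exI[where x = "Uc"], rule exI[where x = "qc (1/2)"], rule *)
    next
      case 3
      \<comment> \<open>With \<open>b = 1\<close> the right part is a single point and
        \<open>left_curtain\<close> covers all sources. The value 3/4 at \<open>-1\<close> continues
        the constant weight.\<close>
      interpret curtain 3 1 by unfold_locales (simp_all add: z1_1)
      have x: "Dc x = D_lc x" "Uc x = U_lc x" "qc (3/4) x = 3/4" if "x \<in> {-1..1}" for x
      proof -
        show l: "Dc x = D_lc x" "Uc x = U_lc x" using left_curtain(2,3)[of x] that by simp_all
        show "qc (3/4) x = 3/4"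
        proof (cases "x = -1")
          case False
          have "qc (3/4) x = (3 / 4 * (2 * x + 2)) / (2 * x + 2)"
            using qc_eq[of x "3/4"] False that unfolding l by (simp add: D_lc_def U_lc_def field_simps)
          also have "\<dots> = 3 / 4" using False that by (subst nonzero_mult_div_cancel_right) auto
          finally show ?thesis .
        qed (simp add: qc_def)
      qed
      have "V k h = V 3 h" for h using couplings_ge3[OF 3] by (simp add: V_def)
      then have *: "?P k (tg Dc Uc (qc (3/4))) Dc Uc (qc (3/4))"
        using coupling_c(1,2)[of "3/4"] V_curtain[of "3/4"] couplings_ge3[OF 3] x 3 by auto
      show ?thesis 
        by (rule exI[where x = "tg Dc Uc (qc (3/4))"], rule exI[where x = "Dc"], rule exI[where x = "Uc"], rule exI[where x = "qc (3/4)"], rule *)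
    qed
  qed
  ultimately show ?thesis by blast
qed

end
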